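(* Let $\mathcal{D}$ be a deformation space (or restricted deformation space) of $G$-trees which is irreducible or genuine abelian. The Gromov topology and the weak topology induce the same topology on any finite union of cones of $\mathcal{D}$ (respectively, on any finite union of simplices of $P\mathcal{D}$).
   Context: $G$ is a finitely generated group. A $G$-tree is a simplicial tree $T$ with an action of $G$ by simplicial automorphisms without inversions; it is always assumed minimal (no proper $G$-invariant subtree) and without redundant vertex (the only vertices of degree 2 allowed are those $v$ such that some element of $G$ fixes $v$ and exchanges the two adjacent edges). A metric $G$-tree is a $G$-tree with a positive length assigned to each edge, constant on $G$-orbits, so that $G$ acts isometrically. Metric $G$-trees are considered up to equivariant isometry. A subgroup of $G$ is elliptic in $T$ if it fixes a point of $T$. A deformation space $\mathcal{D}$ is the set of all metric $G$-trees having the same elliptic subgroups as a given one. If $\mathcal{A}$ is a family of subgroups of $G$ stable under conjugation and under passing to subgroups, the restricted deformation space $\mathcal{D}_{\mathcal{A}}$ is the set of trees in $\mathcal{D}$ with all edge stabilizers in $\mathcal{A}$. The space is irreducible if in its trees there are two hyperbolic (non-elliptic) elements with disjoint axes; it is genuine abelian if in its trees $G$ fixes an end and the tree is not a line. $P\mathcal{D}$ is the quotient of $\mathcal{D}$ by rescaling, with the quotient topologies. Cones and weak topology. The open cone of $T$ is the set of metric trees obtained by changing the edge lengths of $T$, keeping them positive; with $p$ orbits of edges it is parametrized by $(0,\infty)^p$. Allowing some (not all) lengths to be $0$ (collapsing edges) gives a set parametrized by $[0,\infty)^p\setminus\{0\}$, whose intersection with $\mathcal{D}$ is a closed cone of $\mathcal{D}$,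 topologized as a subset of $\mathbb{R}^p$. "Cone" means open or closed cone; simplices of $P\mathcal{D}$ are the projections of cones. A subset of $\mathcal{D}$ (resp. $P\mathcal{D}$) is closed in the weak topology if its intersection with every closed cone (resp. closed simplex) is closed in it. Gromov topology. A fundamental system of neighborhoods of $T$ is given by the sets $V_T(X,A,\varepsilon)$, with $X\subset T$ and $A\subset G$ finite and $\varepsilon>0$, where $T'\in V_T(X,A,\varepsilon)$ if and only if there is a map $x\mapsto\tilde x$ from $X$ to $T'$ with $|d(x,gy)-d(\tilde x,g\tilde y)|<\varepsilon$ for all $x,y\in X$, $g\in A$. *)

theory Defs
  imports
    "HOL-Analysis.Analysis"
    "HOL-Algebra.Group_Action"
    "HOL-Algebra.Generated_Groups"
begin

section \<open>Groups\<close>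

definition finitely_generated_group :: "('g, 'b) monoid_scheme \<Rightarrow> bool" where
  "finitely_generated_group G \<longleftrightarrow>
     group G \<and> (\<exists>S. finite S \<and> S \<subseteq> carrier G \<and> generate G S = carrier G)"

definition subgroup_family :: "('g, 'b) monoid_scheme \<Rightarrow> 'g set set \<Rightarrow> bool" where
  "subgroup_family G \<A> \<longleftrightarrow>
     (\<forall>H\<in>\<A>. subgroup H G) \<and>
     (\<forall>H\<in>\<A>. \<forall>g\<in>carrier G. (g <#\<^bsub>G\<^esub> H) #>\<^bsub>G\<^esub> inv\<^bsub>G\<^esub> g \<in> \<A>) \<and>
     (\<forall>H\<in>\<A>. \<forall>K. subgroup K G \<and> K \<subseteq> H \<longrightarrow> K \<in> \<A>)"


section \<open>Simplicial trees\<close>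

text \<open>A simplicial tree is a nonempty set of vertices together with a set of unordered pairs of
  distinct vertices, such that any two vertices are joined by a unique path without repetition.\<close>

definition is_path :: "'v set \<Rightarrow> 'v set set \<Rightarrow> 'v list \<Rightarrow> 'v \<Rightarrow> 'v \<Rightarrow> bool" where
  "is_path V E p u v \<longleftrightarrow>
     p \<noteq> [] \<and> hd p = u \<and> last p = v \<and> set p \<subseteq> V \<and> distinct p \<and> successively (\<lambda>a b. {a, b} \<in> E) p"

definition simplicial_tree :: "'v set \<Rightarrow> 'v set set \<Rightarrow> bool" where
  "simplicial_tree V E \<longleftrightarrow>
     V \<noteq> {} \<and> (\<forall>e\<in>E. \<exists>a\<in>V. \<exists>b\<in>V. a \<noteq> b \<and> e = {a, b}) \<and>
     (\<forall>u\<in>V. \<forall>v\<in>V. \<exists>!p. is_path V E p u v)"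


section \<open>\<open>G\<close>-trees and metric \<open>G\<close>-trees\<close>

record ('g, 'v) gtree =
  verts :: "'v set"
  edges :: "'v set set"
  act :: "'g \<Rightarrow> 'v \<Rightarrow> 'v"

record ('g, 'v) metric_gtree = "('g, 'v) gtree" +
  len :: "'v set \<Rightarrow> real"

text \<open>The last two conjuncts are minimality and the absence of redundant vertices.\<close>

definition is_gtree :: "('g, 'b) monoid_scheme \<Rightarrow> ('g, 'v, 'c) gtree_scheme \<Rightarrow> bool" where
  "is_gtree G T \<longleftrightarrow>
     simplicial_tree (verts T) (edges T) \<and>
     group_action G (verts T) (act T) \<and>
     (\<forall>g\<in>carrier G. \<forall>e\<in>edges T. act T g ` e \<in> edges T) \<and>
     (\<forall>g\<in>carrier G. \<forall>a b. {a, b} \<in> edges T \<longrightarrow> \<not> (act T g a = b \<and> act T g b = a)) \<and>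
     (\<forall>W F. W \<subseteq> verts T \<and> F \<subseteq> edges T \<and> simplicial_tree W F \<and>
        (\<forall>g\<in>carrier G. act T g ` W \<subseteq> W \<and> (\<forall>e\<in>F. act T g ` e \<in> F)) \<longrightarrow>
        W = verts T \<and> F = edges T) \<and>
     (\<forall>v\<in>verts T. \<forall>e f. e \<noteq> f \<and> {d \<in> edges T. v \<in> d} = {e, f} \<longrightarrow>
        (\<exists>g\<in>carrier G. act T g v = v \<and> act T g ` e = f \<and> act T g ` f = e))"

definition is_metric_gtree :: "('g, 'b) monoid_scheme \<Rightarrow> ('g, 'v) metric_gtree \<Rightarrow> bool" where
  "is_metric_gtree G T \<longleftrightarrow>
     is_gtree G T \<and> (\<forall>e\<in>edges T. 0 < len T e) \<and>
     (\<forall>g\<in>carrier G. \<forall>e\<in>edges T. len T (act T g ` e) = len T e)"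

abbreviation edge_act :: "('g, 'v, 'c) gtree_scheme \<Rightarrow> 'g \<Rightarrow> 'v set \<Rightarrow> 'v set" where
  "edge_act T \<equiv> \<lambda>g e. act T g ` e"

definition edge_orbits ::
  "('g, 'b) monoid_scheme \<Rightarrow> ('g, 'v, 'c) gtree_scheme \<Rightarrow> 'v set set set" where
  "edge_orbits G T = orbits G (edges T) (edge_act T)"


section \<open>Geometric realization\<close>

text \<open>A point of the geometric realization is given by its barycentric coordinates: its support is
  a vertex or an edge.\<close>

definition supp :: "('v \<Rightarrow> real) \<Rightarrow> 'v set" where
  "supp x = {v. x v \<noteq> 0}"

definition points :: "('g, 'v, 'c) gtree_scheme \<Rightarrow> ('v \<Rightarrow> real) set" where
  "points T = {x. (\<forall>v. 0 \<le> x v) \<and> ((\<exists>v\<in>verts T. supp x = {v}) \<or> supp x \<in> edges T) \<and>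
     sum x (supp x) = 1}"

definition point_act ::
  "('g, 'b) monoid_scheme \<Rightarrow> ('g, 'v, 'c) gtree_scheme \<Rightarrow> 'g \<Rightarrow> ('v \<Rightarrow> real) \<Rightarrow> 'v \<Rightarrow> real" where
  "point_act G T g x = (\<lambda>v. if v \<in> verts T then x (act T (inv\<^bsub>G\<^esub> g) v) else 0)"

definition path_length :: "('g, 'v) metric_gtree \<Rightarrow> 'v list \<Rightarrow> real" where
  "path_length T p = (\<Sum>(a, b) \<leftarrow> zip p (tl p). len T {a, b})"

definition vertex_dist :: "('g, 'v) metric_gtree \<Rightarrow> 'v \<Rightarrow> 'v \<Rightarrow> real" where
  "vertex_dist T u v = path_length T (THE p. is_path (verts T) (edges T) p u v)"

text \<open>The path metric. Two points in the same open edge (or at the same vertex) are compared by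
  their coordinates; otherwise a geodesic leaves the support of \<open>x\<close> through one of its vertices
  \<open>a\<close> and enters the support of \<open>y\<close> through one of its vertices \<open>b\<close>. The distance from \<open>x\<close> to a
  vertex \<open>a\<close> of its support is \<open>(1 - x a) * len T (supp x)\<close>; if \<open>supp x = {a}\<close>, this is \<open>0\<close>
  whatever the (meaningless) value \<open>len T {a}\<close>.\<close>

definition point_dist :: "('g, 'v) metric_gtree \<Rightarrow> ('v \<Rightarrow> real) \<Rightarrow> ('v \<Rightarrow> real) \<Rightarrow> real" where
  "point_dist T x y =
     (if supp x = supp y then len T (supp x) * ((\<Sum>v\<in>supp x. \<bar>x v - y v\<bar>) / 2)
      else Min {(1 - x a) * len T (supp x) + vertex_dist T a b + (1 - y b) * len T (supp y)
                | a b. a \<in> supp x \<and> b \<in> supp y})"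

definition equivariantly_isometric ::
  "('g, 'b) monoid_scheme \<Rightarrow> ('g, 'v) metric_gtree \<Rightarrow> ('g, 'v) metric_gtree \<Rightarrow> bool" where
  "equivariantly_isometric G T T' \<longleftrightarrow>
     (\<exists>f. bij_betw f (points T) (points T') \<and>
        (\<forall>x\<in>points T. \<forall>y\<in>points T. point_dist T' (f x) (f y) = point_dist T x y) \<and>
        (\<forall>g\<in>carrier G. \<forall>x\<in>points T. f (point_act G T g x) = point_act G T' g (f x)))"

definition isometry_class ::
  "('g, 'b) monoid_scheme \<Rightarrow> ('g, 'v) metric_gtree \<Rightarrow> ('g, 'v) metric_gtree set" where
  "isometry_class G T = {T'. is_metric_gtree G T' \<and> equivariantly_isometric G T T'}"


section \<open>Elliptic subgroups, axes and ends\<close>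

definition elliptic ::
  "('g, 'b) monoid_scheme \<Rightarrow> ('g, 'v, 'c) gtree_scheme \<Rightarrow> 'g set \<Rightarrow> bool" where
  "elliptic G T H \<longleftrightarrow> (\<exists>x\<in>points T. \<forall>h\<in>H. point_act G T h x = x)"

definition hyperbolic ::
  "('g, 'b) monoid_scheme \<Rightarrow> ('g, 'v, 'c) gtree_scheme \<Rightarrow> 'g \<Rightarrow> bool" where
  "hyperbolic G T g \<longleftrightarrow> g \<in> carrier G \<and> \<not> elliptic G T {g}"

text \<open>The axis of \<open>g\<close> is the isometrically embedded line on which \<open>g\<close> acts as a nontrivial
  translation.\<close>

definition is_axis ::
  "('g, 'b) monoid_scheme \<Rightarrow> ('g, 'v) metric_gtree \<Rightarrow> 'g \<Rightarrow> ('v \<Rightarrow> real) set \<Rightarrow> bool" where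
  "is_axis G T g L \<longleftrightarrow>
     (\<exists>(\<gamma> :: real \<Rightarrow> 'v \<Rightarrow> real) l. 0 < l \<and> range \<gamma> = L \<and> L \<subseteq> points T \<and>
        (\<forall>s t. point_dist T (\<gamma> s) (\<gamma> t) = \<bar>s - t\<bar>) \<and>
        (\<forall>t. point_act G T g (\<gamma> t) = \<gamma> (t + l)))"

definition irreducible_tree ::
  "('g, 'b) monoid_scheme \<Rightarrow> ('g, 'v) metric_gtree \<Rightarrow> bool" where
  "irreducible_tree G T \<longleftrightarrow>
     (\<exists>g h L M. hyperbolic G T g \<and> hyperbolic G T h \<and>
        is_axis G T g L \<and> is_axis G T h M \<and> L \<inter> M = {})"

text \<open>An end is represented by a simplicial ray; two rays represent the same end if they have a
  common subray.\<close>

definition is_ray :: "('g, 'v, 'c) gtree_scheme \<Rightarrow> (nat \<Rightarrow> 'v) \<Rightarrow> bool" where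
  "is_ray T r \<longleftrightarrow> inj r \<and> range r \<subseteq> verts T \<and> (\<forall>n. {r n, r (Suc n)} \<in> edges T)"

definition same_end :: "(nat \<Rightarrow> 'v) \<Rightarrow> (nat \<Rightarrow> 'v) \<Rightarrow> bool" where
  "same_end r s \<longleftrightarrow> (\<exists>m n. \<forall>k. r (m + k) = s (n + k))"

definition fixes_end :: "('g, 'b) monoid_scheme \<Rightarrow> ('g, 'v, 'c) gtree_scheme \<Rightarrow> bool" where
  "fixes_end G T \<longleftrightarrow> (\<exists>r. is_ray T r \<and> (\<forall>g\<in>carrier G. same_end (act T g \<circ> r) r))"

definition is_line :: "('g, 'v, 'c) gtree_scheme \<Rightarrow> bool" where
  "is_line T \<longleftrightarrow>
     (\<exists>f :: int \<Rightarrow> 'v. bij_betw f UNIV (verts T) \<and> edges T = {{f i, f (i + 1)} | i. True})"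

definition genuine_abelian_tree ::
  "('g, 'b) monoid_scheme \<Rightarrow> ('g, 'v, 'c) gtree_scheme \<Rightarrow> bool" where
  "genuine_abelian_tree G T \<longleftrightarrow> fixes_end G T \<and> \<not> is_line T"


section \<open>Deformation spaces\<close>

text \<open>The points of a deformation space are the equivariant isometry classes of metric \<open>G\<close>-trees.
  The vertices are taken in a fixed type \<open>'v\<close>. This loses nothing: a finitely generated group is
  countable and its minimal trees have countably many vertices, so any infinite type \<open>'v\<close> contains
  a copy of every tree, and \<open>'v\<close> is infinite as soon as some tree over it is irreducible or
  genuine abelian.\<close>

definition deformation_space ::
  "('g, 'b) monoid_scheme \<Rightarrow> ('g, 'v) metric_gtree \<Rightarrow> ('g, 'v) metric_gtree set set" where
  "deformation_space G T\<^sub>0 = isometry_class G `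
     {T. is_metric_gtree G T \<and> (\<forall>H. subgroup H G \<longrightarrow> elliptic G T H = elliptic G T\<^sub>0 H)}"

definition restricted_deformation_space ::
  "('g, 'b) monoid_scheme \<Rightarrow> ('g, 'v) metric_gtree \<Rightarrow> 'g set set \<Rightarrow>
     ('g, 'v) metric_gtree set set" where
  "restricted_deformation_space G T\<^sub>0 \<A> =
     {c \<in> deformation_space G T\<^sub>0. \<forall>T\<in>c. \<forall>e\<in>edges T. stabilizer G (edge_act T) e \<in> \<A>}"

definition irreducible_space ::
  "('g, 'b) monoid_scheme \<Rightarrow> ('g, 'v) metric_gtree set set \<Rightarrow> bool" where
  "irreducible_space G D \<longleftrightarrow> (\<forall>T\<in>\<Union>D. irreducible_tree G T)"

definition genuine_abelian_space ::
  "('g, 'b) monoid_scheme \<Rightarrow> ('g, 'v) metric_gtree set set \<Rightarrow> bool" where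
  "genuine_abelian_space G D \<longleftrightarrow> (\<forall>T\<in>\<Union>D. genuine_abelian_tree G T)"


section \<open>Cones\<close>

text \<open>With \<open>p\<close> orbits of edges, the functions on \<open>edge_orbits G T\<close> (extensional, as in \<^term>\<open>PiE\<close>)
  are the vectors of \<open>\<real>\<^sup>p\<close>, and \<^term>\<open>powertop_real (edge_orbits G T)\<close> is the topology of \<open>\<real>\<^sup>p\<close>.\<close>

definition edge_weight ::
  "('g, 'b) monoid_scheme \<Rightarrow> ('g, 'v, 'c) gtree_scheme \<Rightarrow> ('v set set \<Rightarrow> real) \<Rightarrow> 'v set \<Rightarrow> real" where
  "edge_weight G T w e = w (orbit G (edge_act T) e)"

definition open_cone ::
  "('g, 'b) monoid_scheme \<Rightarrow> ('g, 'v) metric_gtree \<Rightarrow> ('g, 'v) metric_gtree set set" where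
  "open_cone G T =
     (\<lambda>w. isometry_class G (T\<lparr>len := edge_weight G T w\<rparr>)) ` (edge_orbits G T \<rightarrow>\<^sub>E {0<..})"

text \<open>\<open>T'\<close> is obtained from \<open>T\<close> by giving the edges the lengths \<open>w\<close> and collapsing those of length
  \<open>0\<close>; the vertex map \<open>f\<close> is the collapse map.\<close>

definition collapses_to ::
  "('g, 'b) monoid_scheme \<Rightarrow> ('g, 'v) metric_gtree \<Rightarrow> ('v set set \<Rightarrow> real) \<Rightarrow>
     ('g, 'v) metric_gtree \<Rightarrow> bool" where
  "collapses_to G T w T' \<longleftrightarrow>
     (\<exists>f. f ` verts T = verts T' \<and>
        (\<forall>u\<in>verts T. \<forall>v\<in>verts T.
           f u = f v \<longleftrightarrow> (\<exists>p. is_path (verts T) {e \<in> edges T. edge_weight G T w e = 0} p u v)) \<and>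
        (\<forall>g\<in>carrier G. \<forall>v\<in>verts T. f (act T g v) = act T' g (f v)) \<and>
        edges T' = (`) f ` {e \<in> edges T. edge_weight G T w e \<noteq> 0} \<and>
        (\<forall>e\<in>edges T. edge_weight G T w e \<noteq> 0 \<longrightarrow> len T' (f ` e) = edge_weight G T w e))"

definition cone_point ::
  "('g, 'b) monoid_scheme \<Rightarrow> ('g, 'v) metric_gtree \<Rightarrow> ('v set set \<Rightarrow> real) \<Rightarrow>
     ('g, 'v) metric_gtree set" where
  "cone_point G T w =
     \<Union> (isometry_class G ` {T'. is_metric_gtree G T' \<and> collapses_to G T w T'})"

text \<open>Length vectors in \<open>[0,\<infinity>)\<^sup>p - {0}\<close> whose collapsed tree lies in \<open>D\<close>.\<close>

definition closed_cone_params ::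
  "('g, 'b) monoid_scheme \<Rightarrow> ('g, 'v) metric_gtree set set \<Rightarrow> ('g, 'v) metric_gtree \<Rightarrow>
     ('v set set \<Rightarrow> real) set" where
  "closed_cone_params G D T =
     {w \<in> edge_orbits G T \<rightarrow>\<^sub>E {0..}. (\<exists>c\<in>edge_orbits G T. w c \<noteq> 0) \<and> cone_point G T w \<in> D}"

definition closed_cone ::
  "('g, 'b) monoid_scheme \<Rightarrow> ('g, 'v) metric_gtree set set \<Rightarrow> ('g, 'v) metric_gtree \<Rightarrow>
     ('g, 'v) metric_gtree set set" where
  "closed_cone G D T = cone_point G T ` closed_cone_params G D T"

definition cones ::
  "('g, 'b) monoid_scheme \<Rightarrow> ('g, 'v) metric_gtree set set \<Rightarrow> ('g, 'v) metric_gtree set set set" where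
  "cones G D = open_cone G ` \<Union>D \<union> closed_cone G D ` \<Union>D"


section \<open>Topologies\<close>

definition quotient_topology :: "'a topology \<Rightarrow> ('a \<Rightarrow> 'b) \<Rightarrow> 'b topology" where
  "quotient_topology X f =
     topology (\<lambda>U. U \<subseteq> f ` topspace X \<and> openin X {x \<in> topspace X. f x \<in> U})"

lemma openin_quotient_topology:
  "openin (quotient_topology X f) U \<longleftrightarrow>
     U \<subseteq> f ` topspace X \<and> openin X {x \<in> topspace X. f x \<in> U}"
proof -
  have "istopology (\<lambda>U. U \<subseteq> f ` topspace X \<and> openin X {x \<in> topspace X. f x \<in> U})"
    unfolding istopology_def
  proof (intro conjI allI impI; (elim conjE)?)
    fix S T assume *: "S \<subseteq> f ` topspace X" "openin X {x \<in> topspace X. f x \<in> S}"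
      "openin X {x \<in> topspace X. f x \<in> T}"
    have eq: "{x \<in> topspace X. f x \<in> S \<inter> T} = {x \<in> topspace X. f x \<in> S} \<inter> {x \<in> topspace X. f x \<in> T}"
      by blast
    show "openin X {x \<in> topspace X. f x \<in> S \<inter> T}"
      unfolding eq using *(2,3) by (rule openin_Int)
    show "S \<inter> T \<subseteq> f ` topspace X" using *(1) by (rule le_infI1)
  next
    fix K assume *: "\<forall>S\<in>K. S \<subseteq> f ` topspace X \<and> openin X {x \<in> topspace X. f x \<in> S}"
    have eq: "{x \<in> topspace X. f x \<in> \<Union>K} = \<Union> ((\<lambda>S. {x \<in> topspace X. f x \<in> S}) ` K)" by blast
    show "openin X {x \<in> topspace X. f x \<in> \<Union>K}"
      unfolding eq by (rule openin_Union) (use * in blast)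
    show "\<Union>K \<subseteq> f ` topspace X" by (rule Union_least) (use * in blast)
  qed
  then show ?thesis unfolding quotient_topology_def by (simp only: topology_inverse')
qed

lemma topspace_quotient_topology: "topspace (quotient_topology X f) = f ` topspace X"
proof
  show "topspace (quotient_topology X f) \<subseteq> f ` topspace X"
    using openin_topspace[of "quotient_topology X f"] unfolding openin_quotient_topology by (rule conjunct1)
  have "{x \<in> topspace X. f x \<in> f ` topspace X} = topspace X" by blast
  then have "openin (quotient_topology X f) (f ` topspace X)"
    unfolding openin_quotient_topology by (simp only: openin_topspace simp_thms subset_refl)
  then show "f ` topspace X \<subseteq> topspace (quotient_topology X f)"
    by (rule openin_subset)
qed

lemma quotient_map_quotient_topology: "quotient_map X (quotient_topology X f) f"
  unfolding quotient_map_def topspace_quotient_topology openin_quotient_topology by blast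

text \<open>The topology of \<open>\<real>\<^sup>p\<close> transported to the closed cone by its parametrization.\<close>

definition closed_cone_topology ::
  "('g, 'b) monoid_scheme \<Rightarrow> ('g, 'v) metric_gtree set set \<Rightarrow> ('g, 'v) metric_gtree \<Rightarrow>
     ('g, 'v) metric_gtree set topology" where
  "closed_cone_topology G D T =
     quotient_topology (subtopology (powertop_real (edge_orbits G T)) (closed_cone_params G D T))
       (cone_point G T)"

definition weakly_closed ::
  "('g, 'b) monoid_scheme \<Rightarrow> ('g, 'v) metric_gtree set set \<Rightarrow> ('g, 'v) metric_gtree set set \<Rightarrow> bool" where
  "weakly_closed G D C \<longleftrightarrow>
     C \<subseteq> D \<and> (\<forall>T\<in>\<Union>D. closedin (closed_cone_topology G D T) (C \<inter> closed_cone G D T))"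

definition weak_topology ::
  "('g, 'b) monoid_scheme \<Rightarrow> ('g, 'v) metric_gtree set set \<Rightarrow> ('g, 'v) metric_gtree set topology" where
  "weak_topology G D = topology (\<lambda>U. U \<subseteq> D \<and> weakly_closed G D (D - U))"

definition gromov_nhd ::
  "('g, 'b) monoid_scheme \<Rightarrow> ('g, 'v) metric_gtree \<Rightarrow> ('v \<Rightarrow> real) set \<Rightarrow> 'g set \<Rightarrow> real \<Rightarrow>
     ('g, 'v) metric_gtree set" where
  "gromov_nhd G T X A \<epsilon> =
     {T'. \<exists>f. f ` X \<subseteq> points T' \<and>
        (\<forall>x\<in>X. \<forall>y\<in>X. \<forall>g\<in>A.
           \<bar>point_dist T x (point_act G T g y) - point_dist T' (f x) (point_act G T' g (f y))\<bar> < \<epsilon>)}"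

definition gromov_open ::
  "('g, 'b) monoid_scheme \<Rightarrow> ('g, 'v) metric_gtree set set \<Rightarrow> ('g, 'v) metric_gtree set set \<Rightarrow> bool" where
  "gromov_open G D U \<longleftrightarrow>
     U \<subseteq> D \<and>
     (\<forall>T\<in>\<Union>U. \<exists>X A \<epsilon>. finite X \<and> X \<subseteq> points T \<and> finite A \<and> A \<subseteq> carrier G \<and> 0 < \<epsilon> \<and>
        {c \<in> D. c \<inter> gromov_nhd G T X A \<epsilon> \<noteq> {}} \<subseteq> U)"

definition gromov_topology ::
  "('g, 'b) monoid_scheme \<Rightarrow> ('g, 'v) metric_gtree set set \<Rightarrow> ('g, 'v) metric_gtree set topology" where
  "gromov_topology G D = topology (gromov_open G D)"

lemma topspace_closed_cone_topology:
  "topspace (closed_cone_topology G D T) = closed_cone G D T"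
proof -
  let ?X = "subtopology (powertop_real (edge_orbits G T)) (closed_cone_params G D T)"
  have "topspace ?X = closed_cone_params G D T"
    unfolding topspace_subtopology topspace_product_topology closed_cone_params_def by force
  moreover have "cone_point G T ` topspace ?X = topspace (closed_cone_topology G D T)"
    unfolding closed_cone_topology_def
    by (rule topspace_quotient_topology[symmetric])
  ultimately show ?thesis by (simp only: closed_cone_def)
qed

lemma closed_cone_subset: "closed_cone G D T \<subseteq> D"
  unfolding closed_cone_def closed_cone_params_def by blast

lemma openin_weak_topology:
  "openin (weak_topology G D) U \<longleftrightarrow> U \<subseteq> D \<and> weakly_closed G D (D - U)"
proof -
  have "istopology (\<lambda>U. U \<subseteq> D \<and> weakly_closed G D (D - U))"
    unfolding istopology_def
  proof (intro conjI allI impI)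
    fix S T assume *: "S \<subseteq> D \<and> weakly_closed G D (D - S)" "T \<subseteq> D \<and> weakly_closed G D (D - T)"
    have **: "(D - S \<inter> T) \<inter> K = (D - S) \<inter> K \<union> (D - T) \<inter> K" for K by blast
    show "weakly_closed G D (D - S \<inter> T)"
      unfolding weakly_closed_def **
    proof (intro conjI ballI closedin_Un)
      fix R assume "R \<in> \<Union>D"
      then show "closedin (closed_cone_topology G D R) ((D - S) \<inter> closed_cone G D R)"
        "closedin (closed_cone_topology G D R) ((D - T) \<inter> closed_cone G D R)"
        using * unfolding weakly_closed_def by blast+
    qed blast
    show "S \<inter> T \<subseteq> D" using * by blast
  next
    fix K assume *: "\<forall>S\<in>K. S \<subseteq> D \<and> weakly_closed G D (D - S)"
    have "closedin (closed_cone_topology G D T) ((D - \<Union>K) \<inter> closed_cone G D T)"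
      if "T \<in> \<Union>D" for T
    proof -
      have cl: "closedin (closed_cone_topology G D T) (closed_cone G D T)"
        using closedin_topspace[of "closed_cone_topology G D T"]
        unfolding topspace_closed_cone_topology .
      let ?\<F> = "insert (closed_cone G D T) ((\<lambda>S. (D - S) \<inter> closed_cone G D T) ` K)"
      have "(D - \<Union>K) \<inter> closed_cone G D T = \<Inter> ?\<F>"
        using closed_cone_subset[of G D T] by blast
      moreover have "closedin (closed_cone_topology G D T) (\<Inter> ?\<F>)"
      proof (rule closedin_Inter)
        fix C assume "C \<in> ?\<F>"
        then consider "C = closed_cone G D T" | S where "S \<in> K" "C = (D - S) \<inter> closed_cone G D T"
          by blast
        then show "closedin (closed_cone_topology G D T) C"
          using cl * that unfolding weakly_closed_def by cases blast+
      qed simp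
      ultimately show ?thesis by simp
    qed
    then show "weakly_closed G D (D - \<Union>K)" unfolding weakly_closed_def by blast
    show "\<Union>K \<subseteq> D" using * by blast
  qed
  then show ?thesis unfolding weak_topology_def by (simp only: topology_inverse')
qed

lemma gromov_nhd_mono:
  "X \<subseteq> X' \<Longrightarrow> A \<subseteq> A' \<Longrightarrow> \<epsilon>' \<le> \<epsilon> \<Longrightarrow> gromov_nhd G T X' A' \<epsilon>' \<subseteq> gromov_nhd G T X A \<epsilon>"
proof
  assume sub: "X \<subseteq> X'" "A \<subseteq> A'" and le: "\<epsilon>' \<le> \<epsilon>"
  fix T' assume "T' \<in> gromov_nhd G T X' A' \<epsilon>'"
  then obtain f where f: "f ` X' \<subseteq> points T'" and
    d: "\<forall>x\<in>X'. \<forall>y\<in>X'. \<forall>g\<in>A'.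
      \<bar>point_dist T x (point_act G T g y) - point_dist T' (f x) (point_act G T' g (f y))\<bar> < \<epsilon>'"
    unfolding gromov_nhd_def by (elim CollectE exE conjE)
  show "T' \<in> gromov_nhd G T X A \<epsilon>"
    unfolding gromov_nhd_def
  proof (intro CollectI exI[of _ f] conjI ballI)
    show "f ` X \<subseteq> points T'" using image_mono[OF sub(1)] f by (rule subset_trans)
    fix x y g assume "x \<in> X" "y \<in> X" "g \<in> A"
    then have "x \<in> X'" "y \<in> X'" "g \<in> A'" using sub by (simp_all only: subsetD)
    from less_le_trans[OF d[rule_format, OF this] le]
    show "\<bar>point_dist T x (point_act G T g y) - point_dist T' (f x) (point_act G T' g (f y))\<bar> < \<epsilon>" .
  qed
qed

lemma openin_gromov_topology: "openin (gromov_topology G D) U \<longleftrightarrow> gromov_open G D U"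
proof -
  let ?P = "\<lambda>T S X A \<epsilon>. finite X \<and> X \<subseteq> points T \<and> finite A \<and> A \<subseteq> carrier G \<and> 0 < \<epsilon> \<and>
    {c \<in> D. c \<inter> gromov_nhd G T X A \<epsilon> \<noteq> {}} \<subseteq> S"
  have D: "S \<subseteq> D" "T \<in> \<Union>S \<Longrightarrow> \<exists>X A \<epsilon>. ?P T S X A \<epsilon>" if "gromov_open G D S" for S T
    using that unfolding gromov_open_def by (rule conjunct1, rule bspec[OF conjunct2])
  have I: "gromov_open G D S" if "S \<subseteq> D" "\<And>T. T \<in> \<Union>S \<Longrightarrow> \<exists>X A \<epsilon>. ?P T S X A \<epsilon>" for S
    unfolding gromov_open_def using that by (intro conjI ballI)
  have "istopology (gromov_open G D)"
    unfolding istopology_def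
  proof (intro conjI allI impI)
    fix S S' assume *: "gromov_open G D S" "gromov_open G D S'"
    show "gromov_open G D (S \<inter> S')"
    proof (rule I)
      show "S \<inter> S' \<subseteq> D" using D(1)[OF *(1)] by (rule le_infI1)
      fix T assume "T \<in> \<Union>(S \<inter> S')"
      then have T: "T \<in> \<Union>S" "T \<in> \<Union>S'" by blast+
      obtain X A \<epsilon> where 1: "?P T S X A \<epsilon>" using D(2)[OF *(1) T(1)] by (elim exE)
      obtain X' A' \<epsilon>' where 2: "?P T S' X' A' \<epsilon>'" using D(2)[OF *(2) T(2)] by (elim exE)
      let ?N = "gromov_nhd G T (X \<union> X') (A \<union> A') (min \<epsilon> \<epsilon>')"
      have N: "?N \<subseteq> gromov_nhd G T X A \<epsilon>" "?N \<subseteq> gromov_nhd G T X' A' \<epsilon>'"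
        by (rule gromov_nhd_mono; simp)+
      have mono: "{c \<in> D. c \<inter> M \<noteq> {}} \<subseteq> {c \<in> D. c \<inter> M' \<noteq> {}}" if "M \<subseteq> M'" for M M'
        using that by blast
      have
        fin: "finite X" "X \<subseteq> points T" "finite A" "A \<subseteq> carrier G" "0 < \<epsilon>"
          "finite X'" "X' \<subseteq> points T" "finite A'" "A' \<subseteq> carrier G" "0 < \<epsilon>'" and
        sub: "{c \<in> D. c \<inter> gromov_nhd G T X A \<epsilon> \<noteq> {}} \<subseteq> S"
          "{c \<in> D. c \<inter> gromov_nhd G T X' A' \<epsilon>' \<noteq> {}} \<subseteq> S'"
        by ((insert 1 2)[1], elim conjE, assumption)+
      have "{c \<in> D. c \<inter> ?N \<noteq> {}} \<subseteq> S \<inter> S'"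
        by (rule Int_greatest[OF subset_trans[OF mono[OF N(1)] sub(1)]
              subset_trans[OF mono[OF N(2)] sub(2)]])
      then have "?P T (S \<inter> S') (X \<union> X') (A \<union> A') (min \<epsilon> \<epsilon>')"
        using fin by (simp only: finite_Un Un_subset_iff min_less_iff_conj simp_thms)
      then show "\<exists>X A \<epsilon>. ?P T (S \<inter> S') X A \<epsilon>" by (intro exI)
    qed
  next
    fix K assume *: "\<forall>S\<in>K. gromov_open G D S"
    show "gromov_open G D (\<Union>K)"
    proof (rule I)
      show "\<Union>K \<subseteq> D" by (rule Union_least) (rule D(1)[OF bspec[OF *]])
      fix T assume "T \<in> \<Union>(\<Union>K)"
      then obtain S where S: "S \<in> K" "T \<in> \<Union>S" by blast
      obtain X A \<epsilon> where 1: "?P T S X A \<epsilon>" using D(2)[OF bspec[OF * S(1)] S(2)] by (elim exE)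
      have "?P T (\<Union>K) X A \<epsilon>"
        using 1 by (elim conjE) (intro conjI subset_trans[OF _ Union_upper[OF S(1)]])
      then show "\<exists>X A \<epsilon>. ?P T (\<Union>K) X A \<epsilon>" by (intro exI)
    qed
  qed
  then show ?thesis unfolding gromov_topology_def by (simp only: topology_inverse')
qed


section \<open>Projectivized deformation spaces\<close>

definition rescale :: "real \<Rightarrow> ('g, 'v) metric_gtree \<Rightarrow> ('g, 'v) metric_gtree" where
  "rescale t T = T\<lparr>len := \<lambda>e. t * len T e\<rparr>"

text \<open>The projection sends a point of \<open>D\<close> to its orbit under rescaling. Its image is the
  projectivized space, carrying the quotient topologies. A set is closed in the quotient of the weak
  topology if and only if its intersection with every closed simplex is closed, closed simplices
  being given the quotient topology from closed cones: both say that the preimage of the set in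
  every closed cone is closed.\<close>

definition projection :: "('g, 'v) metric_gtree set \<Rightarrow> ('g, 'v) metric_gtree set set" where
  "projection c = {rescale t ` c | t. 0 < t}"

definition simplices ::
  "('g, 'b) monoid_scheme \<Rightarrow> ('g, 'v) metric_gtree set set \<Rightarrow>
     ('g, 'v) metric_gtree set set set set" where
  "simplices G D = (`) projection ` cones G D"

definition projective_gromov_topology ::
  "('g, 'b) monoid_scheme \<Rightarrow> ('g, 'v) metric_gtree set set \<Rightarrow>
     ('g, 'v) metric_gtree set set topology" where
  "projective_gromov_topology G D = quotient_topology (gromov_topology G D) projection"

definition projective_weak_topology ::
  "('g, 'b) monoid_scheme \<Rightarrow> ('g, 'v) metric_gtree set set \<Rightarrow>
     ('g, 'v) metric_gtree set set topology" where
  "projective_weak_topology G D = quotient_topology (weak_topology G D) projection"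

end

theory Submission
  imports Defs
begin

text \<open>
  A point of a tree is determined by its coordinates at the edges, telling on which side of each edge it
  lies, and the distance of two points is the sum of the coordinate differences weighted by the edge
  lengths. For fixed points it is linear in the lengths, so the points of a closed cone depend
  continuously on their length vectors and Gromov open sets are weakly open.

  Conversely, let \<open>K\<close> be the closed cone of \<open>S\<close> and \<open>W\<close> a weakly
  closed set. It suffices that \<open>W \<inter> K\<close> is closed in the Gromov topology. Let
  \<open>T\<close> be in its closure. In the irreducible and in the genuine abelian case there are a
  hyperbolic element \<open>g\<close>, a vertex \<open>x\<close> of \<open>T\<close> on its axis and an
  \<open>h\<close> such that \<open>x\<close> is outside the characteristic set (axis or fixed point
  set) of \<open>h\<close>. Trees of \<open>W \<inter> K\<close> approximating \<open>T\<close> on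
  \<open>x\<close> provide length vectors on \<open>S\<close> and points \<open>p\<close> of
  \<open>S\<close> whose displacements by finitely many group elements approximate those of
  \<open>x\<close>. The length vectors are bounded. The displacements by powers of \<open>g\<close>
  force \<open>p\<close> to be near the axis of \<open>g\<close>, and those by powers of
  \<open>h\<close> confine it to a fixed finite part of that axis. A limit of these data is a length
  vector and a point with exactly the displacements of \<open>x\<close>, hence an equivariant surjection
  from \<open>S\<close> with the limit lengths onto \<open>T\<close>. As \<open>T\<close> has no
  redundant vertices, it maps vertices to vertices and is the collapse of the edges of limit length
  zero. So \<open>T\<close> belongs to \<open>K\<close>, and to \<open>W\<close> because
  \<open>W\<close> is weakly closed.

  For simplices, the cones are replaced by their saturations under rescaling, and a Gromov open set by
  its union of rescalings.
\<close>

section \<open>Tree-like pseudo-metrics\<close>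

text \<open>The obstacle is a lack of compactness: the trees need not be locally finite and edge
  lengths may tend to zero, so that points of \<open>S\<close> approximating \<open>x\<close> could
  escape. For this reason combinatorics and metric are kept apart. Betweenness, axes and projections
  in \<open>S\<close> are decided once and for all with every edge of length one; the actual lengths
  enter through a second pseudo-metric that is additive along the same segments. Hence the finite
  piece of the axis found in \<open>axis_trap\<close> depends on two real bounds but not on the
  lengths. One base point \<open>x\<close> is enough because a minimal tree is the hull of any
  vertex orbit, and the distances within that orbit determine the tree. Displacements of a point are
  used instead of translation lengths, since the latter do not determine a tree with a fixed end.
  The element \<open>h\<close> breaks the symmetry along the axis of \<open>g\<close>: displacements
  by powers of \<open>g\<close> alone cannot tell the points of the axis apart. That the limit of
  the length vectors stays in the closed cone takes no separate estimate: its collapse is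
  \<open>T\<close>, which lies in the space.\<close>

text \<open>Length vectors with zero entries give distances that do not separate points, hence
  pseudo-metrics. The assumption \<open>Y\<close> is the tree condition: a branch leaving the geodesic from
  \<open>x\<close> to \<open>z\<close> leaves it on one side of \<open>y\<close> only.\<close>

locale ptree =
  fixes M :: "'a set" and d :: "'a \<Rightarrow> 'a \<Rightarrow> real"
  assumes nonneg: "x \<in> M \<Longrightarrow> y \<in> M \<Longrightarrow> 0 \<le> d x y"
    and self: "x \<in> M \<Longrightarrow> d x x = 0"
    and sym: "x \<in> M \<Longrightarrow> y \<in> M \<Longrightarrow> d x y = d y x"
    and tri: "x \<in> M \<Longrightarrow> y \<in> M \<Longrightarrow> z \<in> M \<Longrightarrow> d x z \<le> d x y + d y z"
    and geod: "x \<in> M \<Longrightarrow> y \<in> M \<Longrightarrow> 0 \<le> t \<Longrightarrow> t \<le> d x y \<Longrightarrow>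
      \<exists>m\<in>M. d x m = t \<and> d m y = d x y - t"
    and Y: "x \<in> M \<Longrightarrow> y \<in> M \<Longrightarrow> z \<in> M \<Longrightarrow> u \<in> M \<Longrightarrow> d x y + d y z = d x z \<Longrightarrow>
      d x y + d y u = d x u \<or> d z y + d y u = d z u"
begin

definition bt :: "'a \<Rightarrow> 'a \<Rightarrow> 'a \<Rightarrow> bool" where
  "bt x y z \<longleftrightarrow> d x y + d y z = d x z"

lemma bt_sym: "x \<in> M \<Longrightarrow> y \<in> M \<Longrightarrow> z \<in> M \<Longrightarrow> bt x y z \<Longrightarrow> bt z y x"
  unfolding bt_def using sym by (metis add.commute)

lemma bt_triv: "x \<in> M \<Longrightarrow> y \<in> M \<Longrightarrow> bt x x y" "x \<in> M \<Longrightarrow> y \<in> M \<Longrightarrow> bt x y y"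
  unfolding bt_def using self by auto

lemma bt_Y: "x \<in> M \<Longrightarrow> y \<in> M \<Longrightarrow> z \<in> M \<Longrightarrow> u \<in> M \<Longrightarrow> bt x y z \<Longrightarrow> bt x y u \<or> bt z y u"
  unfolding bt_def by (rule Y)

lemma bt_trans:
  assumes "a \<in> M" "m \<in> M" "y \<in> M" "b \<in> M" "bt a m b" "bt a y m"
  shows "bt a y b" "bt y m b"
  using assms(5,6) tri[of a y b] tri[of y m b] tri[of a m b] assms(1-4) unfolding bt_def
  by linarith+

text \<open>Local geodesics are global. By \<open>bt_Y\<close> at \<open>c\<close>, either
  \<open>bt b c a\<close> or \<open>bt e c a\<close>; the first, together with
  \<open>bt a b c\<close>, would give \<open>d b c = 0\<close>. Positivity of the overlap has to be
  assumed, since distinct points of a pseudo-metric may have distance zero.\<close>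

lemma bt_local:
  assumes M: "a \<in> M" "b \<in> M" "c \<in> M" "e \<in> M" and bt: "bt a b c" "bt b c e" "d b c > 0"
  shows "bt a b e" "bt a c e"
proof -
  have "bt b c a \<or> bt e c a" by (rule bt_Y) (use assms in auto)
  then have "bt e c a"
    using bt sym[of b c] sym[of a b] sym[of a c] M unfolding bt_def by auto
  then show 1: "bt a c e" by (rule bt_sym[rotated -1]) (use M in auto)
  show "bt a b e" by (rule bt_trans(1)[OF _ _ _ _ 1 bt(1)]) (use M in auto)
qed

text \<open>By \<open>bt_Y\<close>, one of the two terms is exactly \<open>d y z\<close>, and the
  triangle inequality bounds both. So the distances from a point of a segment to all other points
  are determined by those from the ends; this is what later reconstructs a tree from an
  orbit.\<close>

lemma bt_max:
  assumes M: "a \<in> M" "b \<in> M" "y \<in> M" "z \<in> M" and bt: "bt a y b"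
  shows "d y z = max (d a z - d a y) (d b z - d b y)"
proof -
  have "bt a y z \<or> bt b y z" using assms by (intro bt_Y) auto
  then show ?thesis unfolding bt_def using tri[of a y z] tri[of b y z] M by auto
qed

lemma bt_unique:
  assumes M: "a \<in> M" "b \<in> M" "y \<in> M" "z \<in> M" and bt: "bt a y b" "bt a z b" and "d a y = d a z"
  shows "d y z = 0"
  using bt_max[OF M bt(1)] assms(5-) sym M unfolding bt_def by (smt (verit))

lemma bt_segment:
  assumes M: "a \<in> M" "b \<in> M" "x \<in> M" "y \<in> M" and bt: "bt a x b" "bt a y b" and le: "d a x \<le> d a y"
  shows "bt a x y" "bt x y b"
proof -
  have "d x y = max (d a y - d a x) (d b y - d b x)" using bt_max[OF M bt(1)] .
  then show 1: "bt a x y"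
    using bt le sym[of x b] sym[of y b] M unfolding bt_def by (smt (verit))
  show "bt x y b" by (rule bt_trans(2)[OF _ _ _ _ bt(2) 1]) (use M in auto)
qed

lemma median:
  assumes M: "p \<in> M" "a \<in> M" "b \<in> M"
  shows "\<exists>m\<in>M. bt p m a \<and> bt p m b \<and> bt a m b"
proof -
  \<comment> \<open>The Gromov product of \<open>p\<close> and \<open>b\<close> seen from
    \<open>a\<close>, that is, the distance from \<open>a\<close> to the branch point.\<close>
  define t where "t = (d a p + d a b - d p b) / 2"
  have "0 \<le> t" "t \<le> d a b"
    using tri[of p a b] tri[of a b p] sym[of p a] sym[of p b] M unfolding t_def by auto
  then obtain m where m: "m \<in> M" "d a m = t" "d m b = d a b - t" using geod M by blast
  have bt: "bt a m b" using m unfolding bt_def by simp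
  have "d m p = max (d a p - d a m) (d b p - d b m)" using bt_max[OF M(2,3) m(1) M(1) bt] .
  moreover have "d a p - d a m = d b p - d b m"
    using m sym[of b p] sym[of b m] M unfolding t_def by (auto simp: field_simps)
  ultimately have "d m p = d a p - d a m" "d m p = d b p - d b m" by auto
  then show ?thesis using m(1) bt sym M unfolding bt_def
    by (intro bexI[of _ m]) (smt (verit))+
qed

text \<open>A second pseudo-metric, additive along the segments of \<open>d\<close>. In the
  application \<open>d\<close> has unit edge lengths and \<open>e\<close> has the lengths
  \<open>w\<close>, possibly zero: positions are decided with \<open>d\<close>, which separates
  points, and displacements are measured with \<open>e\<close>.\<close>

definition compatible :: "('a \<Rightarrow> 'a \<Rightarrow> real) \<Rightarrow> bool" where
  "compatible e \<longleftrightarrow> (\<forall>x\<in>M. \<forall>y\<in>M. 0 \<le> e x y \<and> e x y = e y x) \<and>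
     (\<forall>x\<in>M. \<forall>y\<in>M. \<forall>z\<in>M. e x z \<le> e x y + e y z) \<and>
     (\<forall>x\<in>M. \<forall>y\<in>M. \<forall>z\<in>M. bt x y z \<longrightarrow> e x y + e y z = e x z)"

lemma compatible_self: "compatible d"
  unfolding compatible_def bt_def using nonneg sym tri by auto

end

section \<open>Isometries and their characteristic sets\<close>

locale ptree_isometry = ptree +
  fixes h h' :: "'a \<Rightarrow> 'a"
  assumes h_in: "x \<in> M \<Longrightarrow> h x \<in> M" and h'_in: "x \<in> M \<Longrightarrow> h' x \<in> M"
    and hh': "x \<in> M \<Longrightarrow> h (h' x) = x" and h'h: "x \<in> M \<Longrightarrow> h' (h x) = x"
    and h_iso: "x \<in> M \<Longrightarrow> y \<in> M \<Longrightarrow> d (h x) (h y) = d x y"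
begin

lemma h'_iso: "x \<in> M \<Longrightarrow> y \<in> M \<Longrightarrow> d (h' x) (h' y) = d x y"
  using h_iso[of "h' x" "h' y"] h'_in hh' by auto

lemma inverse_isometry: "ptree_isometry M d h' h"
  by unfold_locales (auto simp: h_in h'_in hh' h'h h'_iso)

lemma bt_h: "x \<in> M \<Longrightarrow> y \<in> M \<Longrightarrow> z \<in> M \<Longrightarrow> bt (h x) (h y) (h z) \<longleftrightarrow> bt x y z"
  unfolding bt_def using h_iso by auto

text \<open>The points of the characteristic set of \<open>h\<close>: its axis or its fixed point set.\<close>

definition ch :: "'a \<Rightarrow> bool" where
  "ch q \<longleftrightarrow> bt (h' q) q (h q)"

text \<open>Applying \<open>h\<close> turns \<open>h' q\<close>, \<open>q\<close>,
  \<open>h q\<close> into \<open>q\<close>, \<open>h q\<close>, \<open>h (h q)\<close>. In this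
  form, membership is visible from the displacements by \<open>h\<close> and its square, which
  Gromov neighborhoods control.\<close>

lemma ch_iff: "q \<in> M \<Longrightarrow> ch q \<longleftrightarrow> d q (h (h q)) = 2 * d q (h q)"
proof -
  assume q: "q \<in> M"
  have "d (h' q) (h q) = d q (h (h q))" using h_iso[of "h' q" "h q"] q h_in h'_in hh' by auto
  moreover have "d (h' q) q = d q (h q)" using h_iso[of "h' q" "q"] q h_in h'_in hh' by auto
  ultimately show ?thesis unfolding ch_def bt_def by auto
qed

text \<open>The point \<open>q\<close> lies on the way from \<open>r\<close> to the characteristic set of \<open>h\<close>.\<close>

definition good :: "'a \<Rightarrow> 'a \<Rightarrow> bool" where
  "good r q \<longleftrightarrow> bt r q (h q) \<and> bt r q (h' q)"

lemma not_ch_pos: "q \<in> M \<Longrightarrow> \<not> ch q \<Longrightarrow> d q (h q) > 0"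
proof (rule ccontr)
  assume q: "q \<in> M" "\<not> ch q" "\<not> d q (h q) > 0"
  then have 0: "d q (h q) = 0" using nonneg[of q "h q"] h_in by auto
  then have "d (h q) (h (h q)) = 0" using h_iso q h_in by auto
  then have "d q (h (h q)) = 0"
    using 0 tri[of q "h q" "h (h q)"] nonneg[of q "h (h q)"] q h_in by auto
  then show False using ch_iff q 0 by auto
qed

text \<open>The path through \<open>r\<close>, \<open>q\<close>, \<open>h q\<close>,
  \<open>h r\<close> does not backtrack: \<open>bt q (h q) (h r)\<close> is the image under
  \<open>h\<close> of \<open>bt r q (h' q)\<close>, read backwards. The overlap from
  \<open>q\<close> to \<open>h q\<close> has positive length because \<open>q\<close> is outside the
  characteristic set, so \<open>bt_local\<close> applies.\<close>

lemma good_chain: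
  assumes "q \<in> M" "r \<in> M" "\<not> ch q" "good r q"
  shows "bt r q (h r)" "bt r (h q) (h r)"
proof -
  have "bt (h r) (h q) (h (h' q))" using assms bt_h h'_in unfolding good_def by auto
  then have "bt (h r) (h q) q" using assms hh' by auto
  then have 1: "bt q (h q) (h r)" by (rule bt_sym[rotated 3]) (use assms h_in in auto)
  have 2: "bt r q (h q)" using assms unfolding good_def by auto
  show "bt r q (h r)" "bt r (h q) (h r)"
    using bt_local[OF _ _ _ _ 2 1 not_ch_pos] assms h_in by auto
qed

text \<open>The outer parts of the path through \<open>r\<close>, \<open>q\<close>,
  \<open>h q\<close>, \<open>h r\<close> have equal length because \<open>h\<close> preserves
  \<open>e\<close>. The pseudo-metric \<open>e\<close> is allowed to vanish where \<open>d\<close>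
  does not.\<close>

lemma good_displacement:
  assumes "q \<in> M" "r \<in> M" "\<not> ch q" "good r q" "compatible e"
    and inv: "\<And>x y. x \<in> M \<Longrightarrow> y \<in> M \<Longrightarrow> e (h x) (h y) = e x y"
  shows "e r (h r) = e q (h q) + 2 * e r q"
proof -
  have bt: "bt r q (h r)" "bt r (h q) (h r)" "bt r q (h q)"
    using good_chain[OF assms(1-4)] assms(4) unfolding good_def by auto
  have add: "\<And>x y z. x \<in> M \<Longrightarrow> y \<in> M \<Longrightarrow> z \<in> M \<Longrightarrow> bt x y z \<Longrightarrow> e x y + e y z = e x z"
    and s: "\<And>x y. x \<in> M \<Longrightarrow> y \<in> M \<Longrightarrow> e x y = e y x"
    using assms(5) unfolding compatible_def by auto
  have "e r (h q) + e (h q) (h r) = e r (h r)" "e r q + e q (h q) = e r (h q)"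
    using add[of r "h q" "h r"] add[of r q "h q"] bt assms(1,2) h_in by auto
  moreover have "e (h q) (h r) = e r q" using inv[of q r] s[of q r] assms(1,2) by auto
  ultimately show ?thesis by auto
qed

lemma ch_cong: "q \<in> M \<Longrightarrow> r \<in> M \<Longrightarrow> d q r = 0 \<Longrightarrow> ch q \<Longrightarrow> ch r"
proof -
  assume q: "q \<in> M" "r \<in> M" "d q r = 0" "ch q"
  have e: "d (h q) (h r) = 0" "d (h (h q)) (h (h r)) = 0" using q h_iso h_in by auto
  have "d r (h r) = d q (h q)"
    using q(1-3) e tri[of r q "h r"] tri[of q "h q" "h r"] tri[of q r "h q"] tri[of r "h r" "h q"]
      sym h_in by (smt (verit))
  moreover have "d r (h (h r)) = d q (h (h q))"
    using q(1-3) e tri[of r q "h (h r)"] tri[of q "h (h q)" "h (h r)"] tri[of q r "h (h q)"]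
      tri[of r "h (h r)" "h (h q)"] sym h_in by (smt (verit))
  ultimately show ?thesis using ch_iff q by auto
qed

text \<open>If \<open>r\<close> were in the characteristic set, \<open>h' r\<close> and
  \<open>h r\<close> would lie on opposite sides of \<open>r\<close>, whereas
  \<open>good_chain\<close> for \<open>h\<close> and for \<open>h'\<close> puts \<open>q\<close> on
  the way from \<open>r\<close> to both. Then \<open>r\<close> and \<open>q\<close> would have
  distance zero.\<close>

lemma good_not_ch:
  assumes "q \<in> M" "r \<in> M" "\<not> ch q" "good r q"
  shows "\<not> ch r"
proof
  assume ch: "ch r"
  interpret I: ptree_isometry M d h' h by (rule inverse_isometry)
  have nI: "\<not> I.ch q" using assms bt_sym h_in h'_in unfolding I.ch_def ch_def by blast
  have gI: "I.good r q" using assms unfolding I.good_def good_def by auto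
  have "bt r q (h r)" "bt r q (h' r)"
    using good_chain[OF assms] I.good_chain[OF assms(1,2) nI gI] by auto
  then have "d r q = 0"
    using ch tri[of "h' r" q "h r"] sym[of r "h' r"] sym[of q "h' r"] sym[of r q] nonneg[of r q]
      assms h_in h'_in
    unfolding ch_def bt_def by auto
  then show False using ch_cong[of r q] ch assms by auto
qed

text \<open>Outside the characteristic set, \<open>h q\<close> and \<open>h' q\<close> lie in the
  same branch at \<open>q\<close>. As \<open>q\<close> is between \<open>a\<close> and
  \<open>b\<close>, these cannot both lie in that branch.\<close>

lemma good_opposite:
  assumes M: "a \<in> M" "b \<in> M" "q \<in> M" and "bt a q b" "\<not> ch q"
  shows "good a q \<or> good b q"
proof (rule ccontr)
  assume not: "\<not> ?thesis"
  have hq: "h q \<in> M" "h' q \<in> M" using M h_in h'_in by auto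
  have n: "\<not> bt (h' q) q (h q)" "\<not> bt (h q) q (h' q)"
    using assms(5) bt_sym hq M unfolding ch_def by blast+
  have 1: "bt a q (h q) \<or> bt b q (h q)" "bt a q (h' q) \<or> bt b q (h' q)"
    using bt_Y assms(4) M hq by auto
  have 2: "bt x q (h' q)" if "x \<in> M" "bt x q (h q)" for x
    using bt_Y[of x q "h q" "h' q"] n that M hq by blast
  have 3: "bt x q (h q)" if "x \<in> M" "bt x q (h' q)" for x
    using bt_Y[of x q "h' q" "h q"] n that M hq by blast
  show False using not 1 2 3 M unfolding good_def by blast
qed

text \<open>A point \<open>r\<close> outside would lie on the way from \<open>a\<close> or from
  \<open>b\<close> to the characteristic set, and \<open>good_not_ch\<close> would put that end
  outside as well.\<close>

lemma ch_convex:
  assumes M: "a \<in> M" "b \<in> M" "r \<in> M" and "bt a r b" "ch a" "ch b"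
  shows "ch r"
  using good_opposite[OF M assms(4)] good_not_ch assms by blast

end

section \<open>Lines, their translations and projections to them\<close>

locale ptree_line = ptree +
  fixes q :: "int \<Rightarrow> 'a" and c :: real
  assumes q_in: "q i \<in> M" and q_bt0: "bt (q i) (q (i + 1)) (q (i + 2))"
    and q_step: "d (q i) (q (i + 1)) = c" and c_pos: "c > 0"
begin

lemma q_dist_nat: "d (q i) (q (i + int n)) = n * c \<and> bt (q i) (q (i + int n)) (q (i + int n + 1))"
proof (induction n)
  case 0
  then show ?case using self bt_triv q_in by auto
next
  case (Suc n)
  have "d (q i) (q (i + int n + 1)) = n * c + c"
    using Suc q_step[of "i + int n"] unfolding bt_def by auto
  moreover have "bt (q i) (q (i + int n + 1)) (q (i + int n + 2))"
    by (rule bt_local(2)[of "q i" "q (i + int n)"])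
       (use Suc q_in q_bt0 q_step[of "i + int n"] c_pos in auto)
  ultimately show ?case by (auto simp: algebra_simps)
qed

lemma q_dist: "i \<le> j \<Longrightarrow> d (q i) (q j) = (j - i) * c"
  using q_dist_nat[of i "nat (j - i)"] by auto

lemma q_bt: "i \<le> j \<Longrightarrow> j \<le> k \<Longrightarrow> bt (q i) (q j) (q k)"
  unfolding bt_def using q_dist[of i j] q_dist[of j k] q_dist[of i k] by (auto simp: algebra_simps)

lemma reverse_line: "ptree_line M d (\<lambda>i. q (- i)) c"
proof
  fix i
  show "bt (q (- i)) (q (- (i + 1))) (q (- (i + 2)))"
    using bt_sym[OF q_in q_in q_in q_bt0[of "- i - 2"]] by (auto simp: algebra_simps)
  show "d (q (- i)) (q (- (i + 1))) = c"
    using q_step[of "- i - 1"] sym q_in by auto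
qed (auto simp: q_in c_pos)

end

locale ptree_line_isometry = ptree_isometry M d h h' + ptree_line M d q c
  for M :: "'a set" and d h h' q c
begin

text \<open>If the ray, at some point outside the characteristic set, steps away from it, all later
  points recede. If this never happens, a ray that has reached the set cannot leave it, and a ray
  that never reaches it would approach it forever.\<close>

lemma ray_dichotomy:
  "\<exists>K. (\<forall>r\<in>M. \<forall>j\<ge>K. bt (q K) r (q j) \<longrightarrow> good r (q K) \<and> \<not> ch (q K)) \<or>
       (\<forall>r\<in>M. \<forall>j\<ge>K. bt (q K) r (q j) \<longrightarrow> ch r)"
proof (cases "\<exists>K. \<not> ch (q K) \<and> \<not> good (q (K - 1)) (q K)")
  case True
  then obtain K where K: "\<not> ch (q K)" "\<not> good (q (K - 1)) (q K)" by auto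
  have "good r (q K)" if r: "r \<in> M" "K \<le> j" "bt (q K) r (q j)" for r j
  proof -
    have "bt (q j) (q K) (q (K - 1))" by (rule bt_sym) (use q_bt[of "K - 1" K j] q_in r in auto)
    moreover have "bt (q j) r (q K)" by (rule bt_sym) (use q_in r in auto)
    ultimately have "bt r (q K) (q (K - 1))" by (rule bt_trans(2)[rotated 4]) (use r q_in in auto)
    then have "bt (q (K - 1)) (q K) r" by (rule bt_sym[rotated 3]) (use q_in r in auto)
    then show ?thesis using good_opposite[of "q (K - 1)" r "q K"] K q_in r by auto
  qed
  then show ?thesis using K by blast
next
  case False
  then have F: "ch (q K) \<or> good (q (K - 1)) (q K)" for K by auto
  show ?thesis
  proof (cases "\<exists>i. ch (q i)")
    case True
    then obtain i where i: "ch (q i)" by auto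
    have *: "ch (q j)" if "j \<ge> i" for j using that
    proof (induction rule: int_ge_induct)
      case (step j)
      then show ?case using F[of "j + 1"] good_not_ch[of "q (j + 1)" "q j"] q_in by auto
    qed (use i in auto)
    have "ch r" if "r \<in> M" "i \<le> j" "bt (q i) r (q j)" for r j
      using ch_convex[OF q_in q_in that(1,3)] i * that by auto
    then show ?thesis by blast
  next
    case False
    \<comment> \<open>Every step towards the set lowers the displacement by \<open>2 * c\<close>,
      which cannot go on without end.\<close>
    have "d (q 0) (h (q 0)) \<ge> 2 * n * c" for n :: nat
    proof -
      have "d (q 0) (h (q 0)) = d (q (int n)) (h (q (int n))) + 2 * n * c"
      proof (induction n)
        case (Suc n)
        have "good (q (int n)) (q (int n + 1))" using F[of "int n + 1"] False by auto
        from good_displacement[OF q_in q_in _ this compatible_self h_iso]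
        have "d (q (int n)) (h (q (int n))) = d (q (int n + 1)) (h (q (int n + 1))) + 2 * c"
          using False q_step by auto
        then show ?case using Suc by (auto simp: algebra_simps)
      qed auto
      then show ?thesis using nonneg[of "q (int n)" "h (q (int n))"] q_in h_in by auto
    qed
    note * = this
    obtain n :: nat where n: "d (q 0) (h (q 0)) < n * c"
      using reals_Archimedean3[OF c_pos] by auto
    have "n * c \<ge> 0" using c_pos by auto
    then have False using *[of n] n by linarith
    then show ?thesis ..
  qed
qed

text \<open>Here \<open>h\<close> translates the line; \<open>r\<close> is the projection of \<open>p\<close> to it.\<close>

lemma shift_projection_step:
  assumes shift: "\<And>i. h (q i) = q (i + k)" and k: "k \<ge> 1"
    and p: "p \<in> M" and r: "r \<in> M" "bt p r (q (- N))" "bt p r (q N)" "bt (q (- N)) r (q N)"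
    and far: "d r (q N) > 0" "d r (q (- N)) > 0" and N: "N \<ge> 0"
  shows "bt p r (h p)" "bt p (h r) (h p)" "bt p r (h r)" "d r (h r) = k * c" "bt (q (- N)) r (h r)"
proof -
  have far': "d (q (- N)) r > 0" using far sym r q_in by auto
  have hr: "h r \<in> M" "h p \<in> M" using h_in r p by auto
  have le: "- N \<le> N" using N by auto
  \<comment> \<open>Prolonging the segment by one shift beyond \<open>q N\<close> makes
    \<open>r\<close> and \<open>h r\<close> points of a single segment from \<open>q (- N)\<close>
    to \<open>?R\<close>, on which they are ordered by their distances from
    \<open>q (- N)\<close>.\<close>
  let ?R = "q (N + k)"
  have b1: "bt r (q N) ?R"
  proof -
    have "bt (q (-N)) (q N) ?R" "bt (q (- N)) r (q N)" using q_bt[of "- N" N "N + k"] r k le by auto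
    then show ?thesis by (rule bt_trans(2)[rotated 4]) (use q_in r in auto)
  qed
  have pR: "bt p r ?R" by (rule bt_local(1)[OF _ _ _ _ r(3) b1 far(1)]) (use p r q_in in auto)
  have lR: "bt (q (- N)) r ?R" by (rule bt_local(1)[OF _ _ _ _ r(4) b1 far(1)]) (use p r q_in in auto)
  have b2: "bt r (q (- N)) (q (- N - k))"
  proof -
    have "bt (q (- N - k)) (q (-N)) (q N)" using q_bt[of "- N - k" "- N" N] k le by auto
    then have "bt (q N) (q (-N)) (q (- N - k))" by (rule bt_sym[rotated 3]) (use q_in in auto)
    moreover have "bt (q N) r (q (- N))" by (rule bt_sym) (use q_in r in auto)
    ultimately show ?thesis by (rule bt_trans(2)[rotated 4]) (use q_in r in auto)
  qed
  have "bt p r (q (- N - k))" by (rule bt_local(1)[OF _ _ _ _ r(2) b2 far(2)]) (use p r q_in in auto)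
  then have "bt (h p) (h r) (h (q (- N - k)))" using bt_h p r q_in by auto
  then have hp: "bt (h p) (h r) (q (- N))" using shift by auto
  have "bt (h (q (- N))) (h r) (h (q N))" using r bt_h q_in by auto
  then have h1: "bt (q (- N + k)) (h r) ?R" using shift by auto
  have "bt (q (- N)) (q (- N + k)) ?R" using q_bt k le by auto
  then have l: "bt (q (- N)) (h r) ?R" "bt (q (- N)) (q (- N + k)) (h r)"
    using bt_trans[of "?R" "q (- N + k)" "h r" "q (- N)"] bt_sym[OF _ _ _ h1]
      bt_sym[of "q (- N)" "q (- N + k)" ?R] bt_sym[of ?R "h r" "q (- N)"]
      bt_sym[of "h r" "q (- N + k)" "q (- N)"] q_in hr by auto
  have "d (q (- N)) (h r) = d (q (- N)) (q (- N + k)) + d (q (- N + k)) (h r)"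
    using l(2) unfolding bt_def by auto
  also have "d (q (- N + k)) (h r) = d (q (- N)) r" using h_iso[of "q (- N)" r] shift q_in r by auto
  also have "d (q (- N)) (q (- N + k)) = k * c" using q_dist[of "- N" "- N + k"] k by auto
  finally have dd: "d (q (- N)) (h r) = k * c + d (q (- N)) r" .
  have kc: "k * c > 0" using k c_pos by auto
  have s: "bt (q (- N)) r (h r)" "bt r (h r) ?R"
    by (rule bt_segment[OF _ _ _ _ lR l(1)]; use q_in r hr dd kc in auto)+
  show "bt (q (- N)) r (h r)" by fact
  show dr: "d r (h r) = k * c" using s(1) dd unfolding bt_def by auto
  have "bt ?R r p" "bt ?R (h r) r" by (rule bt_sym; use pR s(2) p r hr q_in in auto)+
  from bt_trans(2)[OF _ _ _ _ this] have "bt (h r) r p" using p r hr q_in by auto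
  then show 1: "bt p r (h r)" by (rule bt_sym[rotated 3]) (use p r hr in auto)
  have "bt (q (- N)) (h r) (h p)" by (rule bt_sym) (use hp p r hr q_in in auto)
  from bt_trans(2)[OF _ _ _ _ this s(1)] have 2: "bt r (h r) (h p)" using q_in r hr by auto
  show "bt p r (h p)" "bt p (h r) (h p)"
    by (rule bt_local[OF _ _ _ _ 1 2]; use p r hr dr kc in auto)+
qed

text \<open>The median of \<open>p\<close> and of two points of the line that are farther from
  \<open>q 0\<close> than \<open>p\<close> is. The strict inequalities provide the overlaps of
  positive length that \<open>bt_local\<close> asks for.\<close>

lemma projection_exists:
  assumes p: "p \<in> M"
  obtains r N where "r \<in> M" "bt p r (q (- N))" "bt p r (q N)" "bt (q (- N)) r (q N)"
    "d r (q N) > 0" "d r (q (- N)) > 0" "N \<ge> 1"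
proof -
  obtain n :: nat where n: "d p (q 0) < n * c" using reals_Archimedean3[OF c_pos] by auto
  define N where "N = int n + 1"
  obtain r where r: "r \<in> M" "bt p r (q (- N))" "bt p r (q N)" "bt (q (- N)) r (q N)"
    using median[OF p q_in[of "- N"] q_in[of N]] by auto
  have Nc: "d (q 0) (q N) = N * c" "d (q (- N)) (q 0) = N * c" "bt (q (- N)) (q 0) (q N)"
    using q_dist[of 0 N] q_dist[of "- N" 0] q_bt[of "- N" 0 N] unfolding N_def by auto
  have "d r (q 0) = max (d (q (- N)) (q 0) - d (q (- N)) r) (d (q N) (q 0) - d (q N) r)"
    using bt_max[OF q_in q_in r(1) q_in r(4)] .
  moreover have "d p r + d r (q (- N)) = d p (q (- N))" "d p r + d r (q N) = d p (q N)"
    using r unfolding bt_def by auto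
  moreover have "d p (q N) \<ge> d (q 0) (q N) - d p (q 0)" "d p (q (- N)) \<ge> d (q (-N)) (q 0) - d p (q 0)"
    using tri[of "q 0" p "q N"] tri[of "q (-N)" p "q 0"] sym p q_in by (smt (verit))+
  moreover have "d (q (- N)) r + d r (q N) = d (q (- N)) (q N)" using r unfolding bt_def by auto
  moreover have "d (q (- N)) (q N) = 2 * (N * c)" using Nc unfolding bt_def by linarith
  moreover have "N * c > d p (q 0)" using n c_pos unfolding N_def by (auto simp: algebra_simps)
  moreover have "d p (q N) \<le> d p (q 0) + d (q 0) (q N)" "d p (q (- N)) \<le> d p (q 0) + d (q 0) (q (- N))"
    using tri p q_in by auto
  ultimately have "d r (q N) > 0" "d r (q (- N)) > 0"
    using Nc sym p q_in r nonneg[OF p r(1)] by (smt (verit))+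
  moreover have "1 \<le> N" unfolding N_def by auto
  ultimately show ?thesis using that[OF r] by blast
qed

end

section \<open>Geodesics in simplicial trees\<close>

fun path_edges :: "'v list \<Rightarrow> 'v set set" where
  "path_edges (x # y # p) = insert {x, y} (path_edges (y # p))"
| "path_edges _ = {}"

lemma path_edges_append:
  "path_edges (xs @ x # ys) = path_edges (xs @ [x]) \<union> path_edges (x # ys)"
proof (induction xs)
  case (Cons a xs)
  then show ?case by (cases xs) auto
qed auto

lemma path_edges_snoc: "xs \<noteq> [] \<Longrightarrow> path_edges (xs @ [x]) = insert {last xs, x} (path_edges xs)"
  by (induction xs rule: path_edges.induct) auto

lemma path_edges_subset: "e \<in> path_edges p \<Longrightarrow> e \<subseteq> set p"
  by (induction p rule: path_edges.induct) auto

lemma path_edges_in: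
  "successively (\<lambda>a b. {a, b} \<in> E) p \<longleftrightarrow> path_edges p \<subseteq> E"
  by (induction p rule: path_edges.induct) auto

lemma finite_path_edges: "finite (path_edges p)"
  by (induction p rule: path_edges.induct) auto

lemma is_path_iff:
  "is_path V E p u v \<longleftrightarrow>
     p \<noteq> [] \<and> hd p = u \<and> last p = v \<and> set p \<subseteq> V \<and> distinct p \<and> path_edges p \<subseteq> E"
  unfolding is_path_def path_edges_in by auto

locale simp_tree =
  fixes V :: "'v set" and E :: "'v set set"
  assumes tree: "simplicial_tree V E"
begin

definition tp :: "'v \<Rightarrow> 'v \<Rightarrow> 'v list" where
  "tp u v = (THE p. is_path V E p u v)"

definition geo :: "'v \<Rightarrow> 'v \<Rightarrow> 'v set set" where
  "geo u v = path_edges (tp u v)"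

lemma unique_path: "u \<in> V \<Longrightarrow> v \<in> V \<Longrightarrow> \<exists>!p. is_path V E p u v"
proof -
  have "\<forall>u\<in>V. \<forall>v\<in>V. \<exists>!p. is_path V E p u v"
    using tree unfolding simplicial_tree_def by (elim conjE)
  then show "u \<in> V \<Longrightarrow> v \<in> V \<Longrightarrow> \<exists>!p. is_path V E p u v" by (simp only: Ball_def)
qed

lemma tp_path: "u \<in> V \<Longrightarrow> v \<in> V \<Longrightarrow> is_path V E (tp u v) u v"
  unfolding tp_def by (rule theI'[OF unique_path])

lemma tp_eq: "is_path V E p u v \<Longrightarrow> tp u v = p"
proof -
  assume p: "is_path V E p u v"
  then have "u \<in> V" "v \<in> V" unfolding is_path_def by auto
  from unique_path[OF this] show ?thesis unfolding tp_def using p by (rule the1_equality)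
qed

lemma V_nonempty: "V \<noteq> {}" using tree unfolding simplicial_tree_def by auto

lemma edge_ends: "e \<in> E \<Longrightarrow> \<exists>a b. a \<in> V \<and> b \<in> V \<and> a \<noteq> b \<and> e = {a, b}"
proof -
  have "\<forall>e\<in>E. \<exists>a\<in>V. \<exists>b\<in>V. a \<noteq> b \<and> e = {a, b}"
    using tree unfolding simplicial_tree_def by (elim conjE)
  then show "e \<in> E \<Longrightarrow> \<exists>a b. a \<in> V \<and> b \<in> V \<and> a \<noteq> b \<and> e = {a, b}" by meson
qed

lemma edge_verts: "{a, b} \<in> E \<Longrightarrow> a \<in> V" "{a, b} \<in> E \<Longrightarrow> b \<in> V" "{a, b} \<in> E \<Longrightarrow> a \<noteq> b"
  using edge_ends[of "{a, b}"] by (auto simp: doubleton_eq_iff)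

lemma tp_props:
  assumes "u \<in> V" "v \<in> V"
  shows "tp u v \<noteq> []" "hd (tp u v) = u" "last (tp u v) = v" "set (tp u v) \<subseteq> V" "distinct (tp u v)"
    "geo u v \<subseteq> E"
  using tp_path[OF assms] unfolding is_path_iff geo_def by auto

lemma tp_self: "u \<in> V \<Longrightarrow> tp u u = [u]"
  by (rule tp_eq) (auto simp: is_path_iff)

lemma finite_geo: "finite (geo u v)" unfolding geo_def by (rule finite_path_edges)

lemma tp_step:
  assumes u: "u \<in> V" and vw: "{v, w} \<in> E"
  shows "tp u w = tp u v @ [w] \<and> w \<notin> set (tp u v) \<or> tp u v = tp u w @ [v] \<and> v \<notin> set (tp u w)"
proof (cases "w \<in> set (tp u v)")
  case False
  have "is_path V E (tp u v @ [w]) u w"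
    using tp_props[OF u edge_verts(1)[OF vw]] vw False edge_verts[OF vw]
    unfolding is_path_iff geo_def by (auto simp: path_edges_snoc)
  then show ?thesis using tp_eq False by auto
next
  case True
  then obtain xs ys where s: "tp u v = xs @ w # ys" by (metis split_list)
  note P = tp_props[OF u edge_verts(1)[OF vw]]
  have e: "path_edges (xs @ [w]) \<subseteq> E" "path_edges (w # ys) \<subseteq> E"
    using P(6) path_edges_append[of xs w ys] unfolding geo_def s by auto
  have "is_path V E (xs @ [w]) u w" using P e unfolding is_path_iff s by (cases xs) auto
  then have 1: "tp u w = xs @ [w]" by (rule tp_eq)
  have "is_path V E (w # ys) w v" using P e unfolding is_path_iff s by auto
  moreover have "is_path V E [w, v] w v" using vw edge_verts[OF vw]
    unfolding is_path_iff by (auto simp: insert_commute)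
  ultimately have "ys = [v]" using tp_eq by (metis list.inject)
  then show ?thesis using 1 s P(5) by auto
qed

lemma geo_self: "u \<in> V \<Longrightarrow> geo u u = {}"
  unfolding geo_def by (simp add: tp_self)

text \<open>Passing from \<open>v\<close> to its neighbor \<open>w\<close> either appends the edge
  to the path from \<open>u\<close> or removes it from the path, and so toggles exactly this
  edge.\<close>

lemma geo_step:
  assumes u: "u \<in> V" and vw: "{v, w} \<in> E"
  shows "e \<in> geo u w \<longleftrightarrow> (e \<in> geo u v) \<noteq> (e = {v, w})"
proof -
  note P = tp_props[OF u edge_verts(1)[OF vw]] tp_props[OF u edge_verts(2)[OF vw]]
  from tp_step[OF u vw] show ?thesis
  proof
    assume a: "tp u w = tp u v @ [w] \<and> w \<notin> set (tp u v)"
    then have "{v, w} \<notin> geo u v" using path_edges_subset unfolding geo_def by blast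
    then show ?thesis using a P unfolding geo_def by (auto simp: path_edges_snoc)
  next
    assume a: "tp u v = tp u w @ [v] \<and> v \<notin> set (tp u w)"
    then have "{v, w} \<notin> geo u w" using path_edges_subset unfolding geo_def by blast
    then show ?thesis using a P unfolding geo_def by (auto simp: path_edges_snoc insert_commute)
  qed
qed

lemma conn_induct:
  assumes "v \<in> V" "w \<in> V" "P v" and step: "\<And>m w. m \<in> V \<Longrightarrow> {m, w} \<in> E \<Longrightarrow> P m \<Longrightarrow> P w"
  shows "P w"
proof -
  have "is_path V E p v w \<Longrightarrow> P w" for p w
  proof (induction p arbitrary: w rule: rev_induct)
    case (snoc x p)
    show ?case
    proof (cases "p = []")
      case True
      then show ?thesis using snoc.prems assms unfolding is_path_iff by auto
    next
      case False
      then have "is_path V E p v (last p)" "{last p, w} \<in> E"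
        using snoc.prems unfolding is_path_iff by (auto simp: path_edges_snoc)
      then show ?thesis using snoc.IH step edge_verts by blast
    qed
  qed (auto simp: is_path_def)
  then show ?thesis using tp_path assms by blast
qed

text \<open>Removing \<open>e\<close> leaves two sides, and \<open>e\<close> lies on
  \<open>geo u w\<close> exactly when \<open>u\<close> and \<open>w\<close> are on different sides;
  among three vertices an even number of pairs is separated. This parity rule replaces most
  reasoning with paths.\<close>

lemma geo_cocycle:
  assumes "u \<in> V" "v \<in> V" "w \<in> V"
  shows "e \<in> geo u w \<longleftrightarrow> (e \<in> geo u v) \<noteq> (e \<in> geo v w)"
  by (rule conn_induct[OF assms(2,3)]) (use assms geo_self geo_step in auto)

lemma geo_sym: "u \<in> V \<Longrightarrow> v \<in> V \<Longrightarrow> geo u v = geo v u"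
  using geo_cocycle[of u v u] geo_self by auto

lemma geo_sub_Un: "u \<in> V \<Longrightarrow> v \<in> V \<Longrightarrow> w \<in> V \<Longrightarrow> geo u w \<subseteq> geo u v \<union> geo v w"
  using geo_cocycle by blast

lemma geo_edge: "{a, b} \<in> E \<Longrightarrow> geo a b = {{a, b}}"
  using geo_step[of a a b] geo_self edge_verts by auto

lemma geo_in_E: "u \<in> V \<Longrightarrow> v \<in> V \<Longrightarrow> e \<in> geo u v \<Longrightarrow> e \<in> E"
  using tp_props(6)[of u v] by auto

lemma geo_last:
  assumes "u \<in> V" "v \<in> V" "u \<noteq> v"
  shows "\<exists>m. {m, v} \<in> E \<and> {m, v} \<in> geo u v \<and> geo u m = geo u v - {{m, v}}"
proof -
  note P = tp_props[OF assms(1,2)]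
  obtain ys where ys: "tp u v = ys @ [v]" using P by (metis append_butlast_last_id)
  then have ne: "ys \<noteq> []" using P assms by auto
  have e: "{last ys, v} \<in> geo u v" unfolding geo_def ys using ne by (simp add: path_edges_snoc)
  then have E: "{last ys, v} \<in> E" using P by auto
  show ?thesis using geo_step[OF assms(1) E] e E by (intro exI[of _ "last ys"]) auto
qed

lemma geo_empty: "u \<in> V \<Longrightarrow> v \<in> V \<Longrightarrow> geo u v = {} \<longleftrightarrow> u = v"
  using geo_last[of u v] geo_self[of u] by auto

lemma geo_prefix:
  assumes "u \<in> V" "v \<in> V" "m \<in> set (tp u v)"
  shows "geo u m \<subseteq> geo u v"
proof -
  obtain xs ys where s: "tp u v = xs @ m # ys" using assms by (metis split_list)
  note P = tp_props[OF assms(1,2)]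
  have e: "path_edges (xs @ [m]) \<subseteq> geo u v"
    using path_edges_append[of xs m ys] unfolding geo_def s by auto
  then have "is_path V E (xs @ [m]) u m" using P unfolding is_path_iff s by (cases xs) auto
  then show ?thesis using tp_eq[of "xs @ [m]" u m] e unfolding geo_def by auto
qed

lemma geo_verts: "u \<in> V \<Longrightarrow> v \<in> V \<Longrightarrow> e \<in> geo u v \<Longrightarrow> e \<subseteq> set (tp u v)"
  unfolding geo_def by (rule path_edges_subset)

lemma geo_end_subset: "u \<in> V \<Longrightarrow> v \<in> V \<Longrightarrow> e \<in> geo u v \<Longrightarrow> a \<in> e \<Longrightarrow> geo u a \<subseteq> geo u v"
  using geo_prefix geo_verts by blast

lemma geo_prefix_card:
  assumes "u \<in> V" "v \<in> V" "i \<le> card (geo u v)"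
  shows "\<exists>m\<in>V. geo u m \<subseteq> geo u v \<and> card (geo u m) = i"
  using assms(2,3)
proof (induction "card (geo u v)" arbitrary: v)
  case 0
  then show ?case by auto
next
  case (Suc n)
  show ?case
  proof (cases "i = Suc n")
    case False
    have "u \<noteq> v" using Suc geo_self assms by auto
    then obtain m where m: "{m, v} \<in> E" "{m, v} \<in> geo u v" "geo u m = geo u v - {{m, v}}"
      using geo_last[OF assms(1) Suc(3)] by auto
    then have "n = card (geo u m)" using Suc(2) finite_geo by auto
    from Suc(1)[OF this] obtain k where "k \<in> V" "geo u k \<subseteq> geo u m" "card (geo u k) = i"
      using False Suc edge_verts(1)[OF m(1)] \<open>n = card (geo u m)\<close> by auto
    then show ?thesis using m by blast
  qed (use Suc in auto)
qed

text \<open>Two distinct edges cut the tree into three pieces, not four.\<close>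

lemma geo_nested:
  assumes V: "o' \<in> V" "z00 \<in> V" "z01 \<in> V" "z10 \<in> V" "z11 \<in> V" and "e \<noteq> k"
    and "e \<notin> geo o' z00" "k \<notin> geo o' z00" "e \<notin> geo o' z01" "k \<in> geo o' z01"
    "e \<in> geo o' z10" "k \<notin> geo o' z10" "e \<in> geo o' z11" "k \<in> geo o' z11"
  shows False
proof -
  have k1: "k \<in> geo z00 z01" "e \<notin> geo z00 z01" "k \<in> geo z10 z11" "e \<notin> geo z10 z11"
    using geo_cocycle[of z00 o' z01] geo_cocycle[of z10 o' z11] geo_sym[of z00 o'] geo_sym[of z10 o'] assms
    by auto
  \<comment> \<open>An end of \<open>k\<close> is reached both from \<open>z00\<close> and from
    \<open>z10\<close> without crossing \<open>e\<close>, although \<open>e\<close> separates these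
    two vertices.\<close>
  obtain s where s: "s \<in> k" "s \<in> V" using edge_ends[of k] geo_in_E k1 V by blast
  have "e \<notin> geo z00 s" "e \<notin> geo z10 s" using geo_end_subset k1 s V by blast+
  then have "e \<notin> geo o' s" "e \<in> geo o' s"
    using geo_cocycle[of o' z00 s] geo_cocycle[of o' z10 s] assms s by auto
  then show False by auto
qed

text \<open>Convexity connects \<open>W\<close> inside \<open>F\<close>; uniqueness of paths is
  inherited from the whole tree.\<close>

lemma subtree:
  assumes W: "W \<noteq> {}" "W \<subseteq> V" and F: "F \<subseteq> E" "\<And>e. e \<in> F \<Longrightarrow> e \<subseteq> W"
    and conv: "\<And>a b. a \<in> W \<Longrightarrow> b \<in> W \<Longrightarrow> geo a b \<subseteq> F"
  shows "simplicial_tree W F"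
  unfolding simplicial_tree_def
proof (intro conjI ballI)
  fix e assume "e \<in> F"
  then have "e \<in> E" using F(1) by auto
  from edge_ends[OF this] obtain a b where "a \<noteq> b" "e = {a, b}" by auto
  moreover have "e \<subseteq> W" using F(2) \<open>e \<in> F\<close> .
  ultimately show "\<exists>a\<in>W. \<exists>b\<in>W. a \<noteq> b \<and> e = {a, b}" by auto
next
  fix u v assume uv: "u \<in> W" "v \<in> W"
  then have V: "u \<in> V" "v \<in> V" using W by auto
  have sub: "is_path V E p u v" if "is_path W F p u v" for p
    using that W F unfolding is_path_iff by auto
  have "set (tp u v) \<subseteq> W"
  proof
    fix a assume a: "a \<in> set (tp u v)"
    show "a \<in> W"
    proof (cases "a = u")
      case False
      have aV: "a \<in> V" using a tp_props(4)[OF V] by auto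
      then obtain m where "{m, a} \<in> geo u a" using geo_last[of u a] V False by auto
      then have "{m, a} \<in> F" using geo_prefix[OF V a] conv uv by auto
      then show ?thesis using F by auto
    qed (use uv in auto)
  qed
  then have "is_path W F (tp u v) u v"
    using tp_props[OF V] conv[OF uv] unfolding is_path_iff geo_def by auto
  then show "\<exists>!p. is_path W F p u v" using sub tp_eq by metis
qed (use W in auto)

end

section \<open>Separation coordinates on the geometric realization\<close>

definition between :: "real \<Rightarrow> real \<Rightarrow> real \<Rightarrow> bool" where
  "between x y z \<longleftrightarrow> \<bar>x - y\<bar> + \<bar>y - z\<bar> = \<bar>x - z\<bar>"

lemma between_iff: "between x y z \<longleftrightarrow> x \<le> y \<and> y \<le> z \<or> z \<le> y \<and> y \<le> x"
  unfolding between_def by auto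

definition pt :: "'v \<Rightarrow> 'v \<Rightarrow> real" where
  "pt v = (\<lambda>u. if u = v then 1 else 0)"

definition mix :: "'v \<Rightarrow> 'v \<Rightarrow> real \<Rightarrow> 'v \<Rightarrow> real" where
  "mix a b s = (\<lambda>v. if v = a then 1 - s else if v = b then s else 0)"

lemma supp_pt [simp]: "supp (pt v) = {v}" unfolding supp_def pt_def by auto

lemma pt_same [simp]: "pt v v = 1" unfolding pt_def by auto

lemma mix_left [simp]: "mix a b s a = 1 - s" unfolding mix_def by auto

lemma mix_right [simp]: "a \<noteq> b \<Longrightarrow> mix a b s b = s" unfolding mix_def by auto

lemma supp_mix: "a \<noteq> b \<Longrightarrow> 0 < s \<Longrightarrow> s < 1 \<Longrightarrow> supp (mix a b s) = {a, b}"
  unfolding supp_def mix_def by auto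

lemma supp_mix_subset: "supp (mix a b s) \<subseteq> {a, b}"
  unfolding supp_def mix_def by (auto split: if_splits)

lemma mix_0: "mix a b 0 = pt a" unfolding mix_def pt_def by auto
lemma mix_1: "a \<noteq> b \<Longrightarrow> mix a b 1 = pt b" unfolding mix_def pt_def by auto
lemma mix_swap: "a \<noteq> b \<Longrightarrow> mix a b s = mix b a (1 - s)" unfolding mix_def by auto

lemma pt_eq [simp]: "pt u = pt v \<longleftrightarrow> u = v" unfolding pt_def by (metis zero_neq_one)

context simp_tree
begin

definition pts :: "('v \<Rightarrow> real) set" where
  "pts = {x. (\<forall>v. 0 \<le> x v) \<and> ((\<exists>v\<in>V. supp x = {v}) \<or> supp x \<in> E) \<and> sum x (supp x) = 1}"

lemma pt_in [simp]: "pt v \<in> pts \<longleftrightarrow> v \<in> V"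
proof -
  have "{v} \<notin> E" using edge_ends[of "{v}"] by auto
  moreover have "pt v v = 1" "0 \<le> pt v u" for u by (auto simp: pt_def)
  ultimately show ?thesis unfolding pts_def by auto
qed

lemma mix_in: "{a, b} \<in> E \<Longrightarrow> 0 \<le> s \<Longrightarrow> s \<le> 1 \<Longrightarrow> mix a b s \<in> pts"
proof -
  assume ab: "{a, b} \<in> E" "0 \<le> s" "s \<le> 1"
  consider "s = 0" | "s = 1" | "0 < s \<and> s < 1" using ab by linarith
  then show ?thesis
  proof cases
    case 3
    then show ?thesis using ab edge_verts[OF ab(1)] unfolding pts_def
      by (auto simp: supp_mix) (auto simp: mix_def)
  qed (use ab edge_verts[OF ab(1)] in \<open>auto simp: mix_0 mix_1\<close>)
qed

lemma pts_cases:
  assumes "x \<in> pts"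
  obtains (vertex) v where "v \<in> V" "x = pt v"
  | (edge) a b s where "{a, b} \<in> E" "0 < s" "s < 1" "x = mix a b s"
proof (cases "\<exists>v\<in>V. supp x = {v}")
  case True
  then obtain v where v: "v \<in> V" "supp x = {v}" by auto
  then have "x v = 1" "\<And>u. u \<noteq> v \<Longrightarrow> x u = 0" using assms unfolding pts_def supp_def by auto
  then have "x = pt v" unfolding pt_def by auto
  then show ?thesis using v vertex by auto
next
  case False
  then have s: "supp x \<in> E" using assms unfolding pts_def by auto
  then obtain a b where ab: "a \<noteq> b" "supp x = {a, b}" using edge_ends by blast
  then have "x a + x b = 1" "x a \<noteq> 0" "x b \<noteq> 0" "0 \<le> x a" "0 \<le> x b" "\<And>v. v \<noteq> a \<Longrightarrow> v \<noteq> b \<Longrightarrow> x v = 0"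
    using assms unfolding pts_def supp_def by auto
  then show ?thesis using edge[of a b "x b"] s ab unfolding mix_def by fastforce
qed

lemma supp_pts:
  assumes "x \<in> pts"
  shows "finite (supp x)" "supp x \<subseteq> V" "supp x \<noteq> {}" "sum x (supp x) = 1" "0 \<le> x v" "x v \<le> 1"
proof -
  show 1: "finite (supp x)" "supp x \<subseteq> V" "supp x \<noteq> {}" "sum x (supp x) = 1"
    using assms edge_ends unfolding pts_def by fastforce+
  show 0: "0 \<le> x v" using assms unfolding pts_def by auto
  show "x v \<le> 1"
  proof (cases "v \<in> supp x")
    case True
    then show ?thesis using member_le_sum[of v "supp x" x] 1 assms unfolding pts_def by auto
  qed (auto simp: supp_def)
qed

definition root :: 'v where "root = (SOME v. v \<in> V)"

lemma root_in [simp]: "root \<in> V" unfolding root_def using V_nonempty some_in_eq by blast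

text \<open>The coordinate of \<open>x\<close> at the edge \<open>e\<close>: \<open>0\<close> on the side of \<open>e\<close> that contains the root, \<open>1\<close> on
  the other side, and affine along \<open>e\<close>.\<close>

definition cc :: "'v set \<Rightarrow> ('v \<Rightarrow> real) \<Rightarrow> real" where
  "cc e x = (\<Sum>v\<in>supp x. x v * of_bool (e \<in> geo root v))"

lemma cc_superset: "finite F \<Longrightarrow> supp x \<subseteq> F \<Longrightarrow> cc e x = (\<Sum>v\<in>F. x v * of_bool (e \<in> geo root v))"
  unfolding cc_def by (rule sum.mono_neutral_left) (auto simp: supp_def)

lemma cc_pt [simp]: "cc e (pt v) = of_bool (e \<in> geo root v)"
  unfolding cc_def by simp

lemma cc_mix: "a \<noteq> b \<Longrightarrow> cc e (mix a b s) = (1 - s) * of_bool (e \<in> geo root a) + s * of_bool (e \<in> geo root b)"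
  using cc_superset[of "{a, b}" "mix a b s" e] supp_mix_subset[of a b s] by simp

lemma side_edge: "{a, b} \<in> E \<Longrightarrow> e \<in> geo root b \<longleftrightarrow> (e \<in> geo root a) \<noteq> (e = {a, b})"
  by (rule geo_step) auto

lemma cc_range: "x \<in> pts \<Longrightarrow> 0 \<le> cc e x" "x \<in> pts \<Longrightarrow> cc e x \<le> 1"
  by (erule pts_cases; auto simp: cc_mix edge_verts)+

lemma cc_frac:
  assumes "x \<in> pts" "cc e x \<noteq> 0" "cc e x \<noteq> 1"
  shows "supp x = e" "e \<in> E"
proof -
  have "supp x = e \<and> e \<in> E"
    using assms(1)
  proof (cases rule: pts_cases)
    case (edge a b s)
    note ab = edge_verts[OF edge(1)]
    have "e = {a, b}"
      using assms(2,3) side_edge[OF edge(1), of e] ab edge(4)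
      by (cases "e \<in> geo root a"; cases "e = {a, b}") (auto simp: cc_mix)
    then show ?thesis using edge ab supp_mix[of a b s] by auto
  qed (use assms in auto)
  then show "supp x = e" "e \<in> E" by auto
qed

lemma cc_frac_mix:
  assumes "{a, b} \<in> E" "0 < s" "s < 1"
  shows "0 < cc {a, b} (mix a b s)" "cc {a, b} (mix a b s) < 1"
  using assms side_edge[OF assms(1)] edge_verts[OF assms(1)] by (auto simp: cc_mix)

text \<open>Replaces a point by a vertex of its support lying on prescribed sides of two edges, so
  that \<open>geo_nested\<close> becomes applicable. A point has a fractional coordinate at one edge
  at most, so a single vertex serves both edges.\<close>

lemma cc_pick:
  assumes "x \<in> pts" "e \<noteq> k" "if \<alpha> then cc e x > 0 else cc e x < 1" "if \<beta> then cc k x > 0 else cc k x < 1"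
  shows "\<exists>v\<in>V. (e \<in> geo root v) = \<alpha> \<and> (k \<in> geo root v) = \<beta>"
  using assms(1)
proof (cases rule: pts_cases)
  case (vertex v)
  then show ?thesis using assms by (intro bexI[of _ v]) (auto split: if_splits)
next
  case (edge a b s)
  note ab = edge_verts[OF edge(1)]
  show ?thesis using assms(2-) ab side_edge[OF edge(1), of e] side_edge[OF edge(1), of k]
      edge(2,3) unfolding edge(4)
    by (cases "e \<in> geo root a"; cases "e \<in> geo root b"; cases "k \<in> geo root a"; cases "k \<in> geo root b")
       (auto simp: cc_mix split: if_splits)
qed

lemma mix_cases:
  assumes "y \<in> pts" "supp y = {a, b}" "a \<noteq> b"
  obtains s where "0 < s" "s < 1" "y = mix a b s"
  using assms(1)
proof (cases rule: pts_cases)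
  case (edge c e s)
  have ce: "c \<noteq> e" using edge_verts edge by auto
  then have "{c, e} = {a, b}" using assms(2) edge supp_mix[of c e s] by auto
  then have "c = a \<and> e = b \<or> c = b \<and> e = a" by (auto simp: doubleton_eq_iff)
  then show ?thesis using that[of s] that[of "1 - s"] edge mix_swap[OF ce, of s] by auto
qed (use assms in auto)

lemma cc_eq:
  assumes "x \<in> pts" "y \<in> pts" "\<And>e. e \<in> E \<Longrightarrow> cc e x = cc e y"
  shows "x = y"
proof -
  have *: "x = y" if x: "{a, b} \<in> E" "0 < s" "s < 1" "x = mix a b s" and y: "y \<in> pts"
    and eq: "\<And>e. e \<in> E \<Longrightarrow> cc e x = cc e y" for x y a b s
  proof -
    have "supp y = {a, b}" using cc_frac(1)[OF y, of "{a, b}"] cc_frac_mix[OF x(1-3)] eq[OF x(1)] x(4) by auto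
    then obtain s' where s': "0 < s'" "s' < 1" "y = mix a b s'" using mix_cases[OF y _ edge_verts(3)[OF x(1)]] by auto
    then have "s = s'" using eq[OF x(1)] x side_edge[OF x(1), of "{a, b}"] edge_verts[OF x(1)]
      by (auto simp: cc_mix split: if_splits)
    then show ?thesis using s' x by simp
  qed
  show ?thesis
    using assms(1)
  proof (cases rule: pts_cases)
    case (vertex u)
    note u = this
    show ?thesis
      using assms(2)
    proof (cases rule: pts_cases)
      case (vertex v)
      have "geo u v = {}"
        using geo_cocycle[of u root v] geo_sym[of u root] geo_in_E[of u v] assms(3) u vertex by fastforce
      then show ?thesis using geo_empty u vertex by auto
    next
      case (edge a b s)
      then show ?thesis using *[OF edge assms(1)] assms(3) by auto
    qed
  next
    case (edge a b s)
    then show ?thesis using *[OF edge assms(2)] assms(3) by auto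
  qed
qed

lemma cc_diff_subset:
  assumes "x \<in> pts" "y \<in> pts" "a \<in> supp x" "b \<in> supp y" "cc e x \<noteq> cc e y"
  shows "e = supp x \<or> e = supp y \<or> e \<in> geo a b"
proof -
  have *: "e = supp z \<or> cc e z = of_bool (e \<in> geo root c)" if "z \<in> pts" "c \<in> supp z" for z c
    using that(1)
  proof (cases rule: pts_cases)
    case (edge p q s)
    then show ?thesis using that side_edge[OF edge(1), of e] edge_verts[OF edge(1)]
      by (auto simp: cc_mix supp_mix)
  qed (use that in auto)
  have V: "a \<in> V" "b \<in> V" using assms supp_pts by auto
  show ?thesis using *[OF assms(1,3)] *[OF assms(2,4)] assms(5) geo_cocycle[of root a b] V by auto
qed

lemma cc_diff_finite: "x \<in> pts \<Longrightarrow> y \<in> pts \<Longrightarrow> finite {e\<in>E. cc e x \<noteq> cc e y}"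
proof -
  assume x: "x \<in> pts" "y \<in> pts"
  then obtain a b where ab: "a \<in> supp x" "b \<in> supp y" using supp_pts(3)[of x] supp_pts(3)[of y] by auto
  have "{e\<in>E. cc e x \<noteq> cc e y} \<subseteq> {supp x, supp y} \<union> geo a b" using cc_diff_subset[OF x ab] by auto
  then show ?thesis by (rule finite_subset) (simp add: finite_geo)
qed

text \<open>The path metric for the edge lengths \<open>w\<close>, in a form that is linear in \<open>w\<close> and makes sense when
  some lengths vanish.\<close>

definition dw :: "('v set \<Rightarrow> real) \<Rightarrow> ('v \<Rightarrow> real) \<Rightarrow> ('v \<Rightarrow> real) \<Rightarrow> real" where
  "dw w x y = (\<Sum>e\<in>{e\<in>E. cc e x \<noteq> cc e y}. w e * \<bar>cc e x - cc e y\<bar>)"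

lemma dw_superset:
  "finite F \<Longrightarrow> {e\<in>E. cc e x \<noteq> cc e y} \<subseteq> F \<Longrightarrow> F \<subseteq> E \<Longrightarrow> dw w x y = (\<Sum>e\<in>F. w e * \<bar>cc e x - cc e y\<bar>)"
  unfolding dw_def by (rule sum.mono_neutral_left) auto

text \<open>For finitely many points, one finite set of edges carries all differences of
  coordinates, whatever the lengths. Relations between distances can then be checked edge by
  edge.\<close>

lemma dw_common:
  assumes "finite X" "X \<subseteq> pts"
  obtains F where "finite F" "F \<subseteq> E"
    "\<And>w x y. x \<in> X \<Longrightarrow> y \<in> X \<Longrightarrow> dw w x y = (\<Sum>e\<in>F. w e * \<bar>cc e x - cc e y\<bar>)"
proof -
  let ?F = "\<Union>x\<in>X. \<Union>y\<in>X. {e\<in>E. cc e x \<noteq> cc e y}"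
  have "finite ?F" using assms cc_diff_finite by (intro finite_UN_I) auto
  moreover have "?F \<subseteq> E" by auto
  moreover have "dw w x y = (\<Sum>e\<in>?F. w e * \<bar>cc e x - cc e y\<bar>)" if "x \<in> X" "y \<in> X" for w x y
    by (rule dw_superset) (use that \<open>finite ?F\<close> in auto)
  ultimately show ?thesis by (rule that)
qed

lemma dw_nonneg: "(\<And>e. e \<in> E \<Longrightarrow> 0 \<le> w e) \<Longrightarrow> 0 \<le> dw w x y"
  unfolding dw_def by (rule sum_nonneg) auto

lemma dw_self [simp]: "dw w x x = 0" unfolding dw_def by auto

lemma dw_sym: "dw w x y = dw w y x"
  unfolding dw_def by (rule sum.cong) (auto simp: abs_minus_commute)

lemma dw_scale: "dw (\<lambda>e. t * w e) x y = t * dw w x y"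
  unfolding dw_def sum_distrib_left by (rule sum.cong) auto

lemma dw_tri:
  assumes w: "\<And>e. e \<in> E \<Longrightarrow> 0 \<le> w e" and "x \<in> pts" "y \<in> pts" "z \<in> pts"
  shows "dw w x z \<le> dw w x y + dw w y z"
proof -
  obtain F where F: "finite F" "F \<subseteq> E"
    "\<And>w' a b. a \<in> {x, y, z} \<Longrightarrow> b \<in> {x, y, z} \<Longrightarrow> dw w' a b = (\<Sum>e\<in>F. w' e * \<bar>cc e a - cc e b\<bar>)"
    using dw_common[of "{x, y, z}"] assms by auto
  have "w e * \<bar>cc e x - cc e z\<bar> \<le> w e * \<bar>cc e x - cc e y\<bar> + w e * \<bar>cc e y - cc e z\<bar>" if "e \<in> F" for e
    unfolding distrib_left[symmetric] by (rule mult_left_mono) (use w F that in auto)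
  then show ?thesis by (simp add: F(3) sum.distrib[symmetric] sum_mono)
qed

text \<open>Betweenness for \<open>dw w\<close>, as \<open>dw_additive_iff\<close> shows. The
  stronger \<open>B\<close> is betweenness for unit lengths and therefore holds for all nonnegative
  lengths.\<close>

definition cb :: "('v set \<Rightarrow> real) \<Rightarrow> ('v \<Rightarrow> real) \<Rightarrow> ('v \<Rightarrow> real) \<Rightarrow> ('v \<Rightarrow> real) \<Rightarrow> bool" where
  "cb w x y z \<longleftrightarrow> (\<forall>e\<in>E. w e \<noteq> 0 \<longrightarrow> between (cc e x) (cc e y) (cc e z))"

definition B :: "('v \<Rightarrow> real) \<Rightarrow> ('v \<Rightarrow> real) \<Rightarrow> ('v \<Rightarrow> real) \<Rightarrow> bool" where
  "B x y z \<longleftrightarrow> (\<forall>e\<in>E. between (cc e x) (cc e y) (cc e z))"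

lemma B_cb: "B x y z \<Longrightarrow> cb w x y z" unfolding B_def cb_def by auto

lemma B_one: "B x y z \<longleftrightarrow> cb (\<lambda>_. 1) x y z" unfolding B_def cb_def by auto

lemma B_triv: "B x x y" "B x y y" unfolding B_def between_def by auto

lemma B_sym: "B x y z \<Longrightarrow> B z y x" unfolding B_def between_iff by auto

lemma B_trans: "B a m b \<Longrightarrow> B a y m \<Longrightarrow> B a y b" unfolding B_def between_iff by fastforce

text \<open>The defect in the triangle inequality is a sum of nonnegative defects, one for each edge
  and weighted by its length.\<close>

lemma dw_additive_iff:
  assumes w: "\<And>e. e \<in> E \<Longrightarrow> 0 \<le> w e" and "x \<in> pts" "y \<in> pts" "z \<in> pts"
  shows "dw w x y + dw w y z = dw w x z \<longleftrightarrow> cb w x y z"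
proof -
  obtain F where F: "finite F" "F \<subseteq> E"
    "\<And>w' a b. a \<in> {x, y, z} \<Longrightarrow> b \<in> {x, y, z} \<Longrightarrow> dw w' a b = (\<Sum>e\<in>F. w' e * \<bar>cc e a - cc e b\<bar>)"
    using dw_common[of "{x, y, z}"] assms by auto
  define D where "D e = w e * (\<bar>cc e x - cc e y\<bar> + \<bar>cc e y - cc e z\<bar> - \<bar>cc e x - cc e z\<bar>)" for e
  have D: "0 \<le> D e" if "e \<in> E" for e unfolding D_def by (rule mult_nonneg_nonneg) (use w that in auto)
  have "dw w x y + dw w y z - dw w x z = sum D F"
    unfolding D_def by (simp add: F(3) sum.distrib sum_subtractf algebra_simps)
  then have "dw w x y + dw w y z = dw w x z \<longleftrightarrow> sum D F = 0" by auto
  also have "\<dots> \<longleftrightarrow> (\<forall>e\<in>F. D e = 0)" by (rule sum_nonneg_eq_0_iff) (use F D in auto)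
  also have "\<dots> \<longleftrightarrow> (\<forall>e\<in>E. D e = 0)"
  proof safe
    fix e assume e: "\<forall>e\<in>F. D e = 0" "e \<in> E"
    have "e \<notin> F \<Longrightarrow> cc e x = cc e y \<and> cc e y = cc e z"
    proof -
      assume "e \<notin> F"
      have "finite (insert e F)" "insert e F \<subseteq> E" using F e by auto
      have "cc e a = cc e b" if ab: "a \<in> {x, y, z}" "b \<in> {x, y, z}" for a b
      proof (rule ccontr)
        assume ne: "cc e a \<noteq> cc e b"
        \<comment> \<open>With weight one on \<open>e\<close> and zero elsewhere, the sum over
          \<open>F\<close> vanishes; so an edge outside \<open>F\<close> distinguishes no two of the
          three points.\<close>
        let ?w = "\<lambda>f. of_bool (f = e) :: real"
        have P: "a \<in> pts" "b \<in> pts" using ab assms by auto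
        have "dw ?w a b = (\<Sum>f\<in>{f\<in>E. cc f a \<noteq> cc f b}. of_bool (f = e) * \<bar>cc f a - cc f b\<bar>)"
          unfolding dw_def ..
        also have "\<dots> = (\<Sum>f\<in>{e}. of_bool (f = e) * \<bar>cc f a - cc f b\<bar>)"
          by (rule sum.mono_neutral_right) (use e ne cc_diff_finite[OF P] in auto)
        finally have "dw ?w a b > 0" using ne by auto
        moreover have "dw ?w a b = 0" using F(3)[OF ab, of ?w] \<open>e \<notin> F\<close> by (auto intro!: sum.neutral)
        ultimately show False by auto
      qed
      then show ?thesis by auto
    qed
    then show "D e = 0" using e unfolding D_def by auto
  qed (use F in auto)
  also have "\<dots> \<longleftrightarrow> cb w x y z" unfolding D_def cb_def between_def by auto
  finally show ?thesis .
qed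

text \<open>If \<open>e\<close> violates the first alternative and \<open>k\<close> the second, then
  \<open>x\<close>, \<open>y\<close>, \<open>z\<close>, \<open>u\<close> occupy all four
  combinations of sides of \<open>e\<close> and \<open>k\<close>, while two edges of a tree leave
  only three.\<close>

lemma cb_Y:
  assumes P: "x \<in> pts" "y \<in> pts" "z \<in> pts" "u \<in> pts" and cb: "cb w x y z"
  shows "cb w x y u \<or> cb w z y u"
proof (rule ccontr)
  assume "\<not> ?thesis"
  then obtain e k where e: "e \<in> E" "w e \<noteq> 0" "\<not> between (cc e x) (cc e y) (cc e u)"
    and k: "k \<in> E" "w k \<noteq> 0" "\<not> between (cc k z) (cc k y) (cc k u)" unfolding cb_def by auto
  have b: "between (cc e x) (cc e y) (cc e z)" "between (cc k x) (cc k y) (cc k z)"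
    using cb e k unfolding cb_def by auto
  have ek: "e \<noteq> k" using b e(3) k(3) unfolding between_iff by auto
  define \<alpha> where "\<alpha> \<longleftrightarrow> cc e y > cc e x"
  define \<beta> where "\<beta> \<longleftrightarrow> cc k y > cc k z"
  note pick = cc_pick[OF _ ek]
  have r: "0 \<le> cc f v \<and> cc f v \<le> 1" if "v \<in> {x, y, z, u}" for f v using that P cc_range by auto
  have v: "\<exists>v\<in>V. (e \<in> geo root v) = \<alpha> \<and> (k \<in> geo root v) = \<beta>"
    by (rule pick[OF P(2)])
       (use b e(3) k(3) r[of x e] r[of y e] r[of u e] r[of z k] r[of y k] r[of u k] in
         \<open>auto simp: \<alpha>_def \<beta>_def between_iff\<close>)
  have v2: "\<exists>v\<in>V. (e \<in> geo root v) = (\<not> \<alpha>) \<and> (k \<in> geo root v) = \<beta>"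
    by (rule pick[OF P(1)])
       (use b e(3) k(3) r[of x e] r[of y e] r[of u e] r[of z k] r[of y k] r[of u k] r[of x k] in
         \<open>auto simp: \<alpha>_def \<beta>_def between_iff\<close>)
  have v3: "\<exists>v\<in>V. (e \<in> geo root v) = \<alpha> \<and> (k \<in> geo root v) = (\<not> \<beta>)"
    by (rule pick[OF P(3)])
       (use b e(3) k(3) r[of x e] r[of y e] r[of u e] r[of z e] r[of z k] r[of y k] r[of u k] in
         \<open>auto simp: \<alpha>_def \<beta>_def between_iff\<close>)
  have v4: "\<exists>v\<in>V. (e \<in> geo root v) = (\<not> \<alpha>) \<and> (k \<in> geo root v) = (\<not> \<beta>)"
    by (rule pick[OF P(4)])
       (use b e(3) k(3) r[of x e] r[of y e] r[of u e] r[of z k] r[of y k] r[of u k] in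
         \<open>auto simp: \<alpha>_def \<beta>_def between_iff\<close>)
  have all: "\<exists>v\<in>V. (e \<in> geo root v) = a \<and> (k \<in> geo root v) = b" for a b
    using v v2 v3 v4 by (cases "a = \<alpha>"; cases "b = \<beta>") auto
  obtain z00 z01 z10 z11 where "z00 \<in> V" "z01 \<in> V" "z10 \<in> V" "z11 \<in> V"
    "e \<notin> geo root z00" "k \<notin> geo root z00" "e \<notin> geo root z01" "k \<in> geo root z01"
    "e \<in> geo root z10" "k \<notin> geo root z10" "e \<in> geo root z11" "k \<in> geo root z11"
    using all[of False False] all[of False True] all[of True False] all[of True True] by blast
  then show False using geo_nested[of root z00 z01 z10 z11 e k] ek by auto
qed

text \<open>If \<open>x\<close> is inside an edge, the coordinate of \<open>y\<close> at that edge
  is \<open>0\<close> or \<open>1\<close> and hence equal to that of one of its ends; at all other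
  edges \<open>x\<close> and both ends have the same coordinates.\<close>

lemma gate:
  assumes "x \<in> pts" "y \<in> pts" "supp x \<noteq> supp y"
  shows "\<exists>a\<in>supp x. B x (pt a) y"
  using assms(1)
proof (cases rule: pts_cases)
  case (vertex v)
  then show ?thesis using B_triv by auto
next
  case (edge a b s)
  note ab = edge_verts[OF edge(1)]
  have s: "supp x = {a, b}" using edge supp_mix[of a b s] ab by auto
  have "cc {a, b} y = 0 \<or> cc {a, b} y = 1" using cc_frac[OF assms(2), of "{a, b}"] s assms(3) by auto
  then obtain c where c: "c \<in> {a, b}" "cc {a, b} (pt c) = cc {a, b} y"
    using side_edge[OF edge(1), of "{a, b}"] that[of a] that[of b] by (cases "{a, b} \<in> geo root a") auto
  have "between (cc e x) (cc e (pt c)) (cc e y)" if "e \<in> E" for e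
  proof (cases "e = {a, b}")
    case True
    then show ?thesis using c unfolding between_def by auto
  next
    case False
    then have "cc e x = cc e (pt c)" using side_edge[OF edge(1), of e] ab c(1) edge(4) by (auto simp: cc_mix)
    then show ?thesis unfolding between_def by auto
  qed
  then show ?thesis using c s unfolding B_def by blast
qed

lemma B_geo: "u \<in> V \<Longrightarrow> v \<in> V \<Longrightarrow> m \<in> V \<Longrightarrow> B (pt u) (pt m) (pt v) \<longleftrightarrow> geo u m \<subseteq> geo u v"
proof -
  assume V: "u \<in> V" "v \<in> V" "m \<in> V"
  have "B (pt u) (pt m) (pt v) \<longleftrightarrow> (\<forall>e\<in>E. e \<in> geo u m \<longrightarrow> e \<in> geo u v)"
    unfolding B_def using geo_cocycle[of root u m] geo_cocycle[of root u v] V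
    by (intro ball_cong) (auto simp: between_def)
  then show ?thesis using geo_in_E[OF V(1,3)] by auto
qed

section \<open>Geodesics for edge lengths that may vanish\<close>

definition Geo :: "('v set \<Rightarrow> real) \<Rightarrow> ('v \<Rightarrow> real) \<Rightarrow> ('v \<Rightarrow> real) \<Rightarrow> bool" where
  "Geo w x y \<longleftrightarrow> (\<forall>t. 0 \<le> t \<and> t \<le> dw w x y \<longrightarrow> (\<exists>m\<in>pts. B x m y \<and> dw w x m = t))"

context
  fixes w :: "'v set \<Rightarrow> real" assumes w: "\<And>e. e \<in> E \<Longrightarrow> 0 \<le> w e"
begin

lemma dw_B: "x \<in> pts \<Longrightarrow> y \<in> pts \<Longrightarrow> z \<in> pts \<Longrightarrow> B x y z \<Longrightarrow> dw w x y + dw w y z = dw w x z"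
  using dw_additive_iff[of w x y z] w B_cb by auto

lemma Geo_concat:
  assumes P: "x \<in> pts" "y \<in> pts" "m \<in> pts" and B: "B x m y" and G: "Geo w x m" "Geo w m y"
  shows "Geo w x y"
  unfolding Geo_def
proof (intro allI impI)
  fix t assume t: "0 \<le> t \<and> t \<le> dw w x y"
  have a: "dw w x m + dw w m y = dw w x y" using dw_B[OF P(1,3,2) B] .
  show "\<exists>m\<in>pts. B x m y \<and> dw w x m = t"
  proof (cases "t \<le> dw w x m")
    case True
    then obtain z where "z \<in> pts" "B x z m" "dw w x z = t" using G(1) t unfolding Geo_def by auto
    then show ?thesis using B_trans[OF B] by auto
  next
    case False
    then have *: "0 \<le> t - dw w x m \<and> t - dw w x m \<le> dw w m y" using t a by auto
    obtain z where z: "z \<in> pts" "B m z y" "dw w m z = t - dw w x m"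
      using G(2)[unfolded Geo_def, rule_format, OF *] by auto
    have Bx: "B x z y" using B_trans[OF B_sym[OF B] B_sym[OF z(2)]] B_sym by auto
    have "B y m x" "B y z m" using B z B_sym by auto
    then have "B x m z" unfolding B_def between_iff by fastforce
    then have "dw w x z = t" using dw_B[of x m z] P z by auto
    then show ?thesis using Bx z by auto
  qed
qed

lemma Geo_sym: "x \<in> pts \<Longrightarrow> y \<in> pts \<Longrightarrow> Geo w x y \<Longrightarrow> Geo w y x"
  unfolding Geo_def
proof (intro allI impI)
  fix t assume *: "x \<in> pts" "y \<in> pts" "\<forall>t. 0 \<le> t \<and> t \<le> dw w x y \<longrightarrow> (\<exists>m\<in>pts. B x m y \<and> dw w x m = t)"
    and t: "0 \<le> t \<and> t \<le> dw w y x"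
  have "0 \<le> dw w x y - t \<and> dw w x y - t \<le> dw w x y" using t dw_sym[of w x y] by auto
  then obtain m where m: "m \<in> pts" "B x m y" "dw w x m = dw w x y - t" using * by blast
  then have "dw w y m = t" using dw_B[of x m y] dw_sym[of w y m] * by auto
  then show "\<exists>m\<in>pts. B y m x \<and> dw w y m = t" using m B_sym by auto
qed

lemma Geo_refl: "x \<in> pts \<Longrightarrow> Geo w x x"
  unfolding Geo_def using B_triv by (intro allI impI bexI[of _ x]) auto

lemma Geo_edge:
  assumes ab: "{a, b} \<in> E" "0 \<le> s" "s \<le> 1" "0 \<le> s'" "s' \<le> 1"
  shows "Geo w (mix a b s) (mix a b s')"
  unfolding Geo_def
proof (intro allI impI)
  let ?x = "mix a b s" and ?y = "mix a b s'"
  fix t assume t: "0 \<le> t \<and> t \<le> dw w ?x ?y"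
  \<comment> \<open>The fraction of the way to go. At distance zero the only case is
    \<open>t = 0\<close>, and the starting point will do.\<close>
  define r where "r = (if dw w ?x ?y = 0 then 0 else t / dw w ?x ?y)"
  have r: "0 \<le> r" "r \<le> 1" "r * dw w ?x ?y = t" using t unfolding r_def by auto
  define s2 where "s2 = s + r * (s' - s)"
  have "s2 = (1 - r) * s + r * s'" unfolding s2_def by algebra
  then have s2: "0 \<le> s2" "s2 \<le> 1"
    using ab r convex_bound_le[of s 1 s' "1 - r" r] by auto
  let ?m = "mix a b s2"
  note P = mix_in[OF ab(1,2,3)] mix_in[OF ab(1,4,5)] mix_in[OF ab(1) s2]
  have c: "cc e ?m - cc e ?x = r * (cc e ?y - cc e ?x)" for e
    using edge_verts[OF ab(1)] by (auto simp: cc_mix s2_def algebra_simps)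
  have B: "B ?x ?m ?y"
    unfolding B_def between_def
  proof
    fix e
    have "cc e ?m - cc e ?y = (1 - r) * (cc e ?x - cc e ?y)" using c[of e] by algebra
    then have "\<bar>cc e ?m - cc e ?y\<bar> = (1 - r) * \<bar>cc e ?x - cc e ?y\<bar>" using r by (simp add: abs_mult)
    moreover have "\<bar>cc e ?x - cc e ?m\<bar> = r * \<bar>cc e ?x - cc e ?y\<bar>"
      using c[of e] r by (metis abs_minus_commute abs_mult abs_of_nonneg)
    ultimately show "\<bar>cc e ?x - cc e ?m\<bar> + \<bar>cc e ?m - cc e ?y\<bar> = \<bar>cc e ?x - cc e ?y\<bar>" by algebra
  qed
  obtain F where F: "finite F" "F \<subseteq> E"
    "\<And>w' x y. x \<in> {?x, ?y, ?m} \<Longrightarrow> y \<in> {?x, ?y, ?m} \<Longrightarrow> dw w' x y = (\<Sum>e\<in>F. w' e * \<bar>cc e x - cc e y\<bar>)"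
    using dw_common[of "{?x, ?y, ?m}"] P by auto
  have "dw w ?x ?m = (\<Sum>e\<in>F. r * (w e * \<bar>cc e ?x - cc e ?y\<bar>))"
    unfolding F(3)[of ?x ?m, simplified]
  proof (rule sum.cong)
    fix e
    have "\<bar>cc e ?x - cc e ?m\<bar> = r * \<bar>cc e ?x - cc e ?y\<bar>"
      using c[of e] r by (metis abs_minus_commute abs_mult abs_of_nonneg)
    then show "w e * \<bar>cc e ?x - cc e ?m\<bar> = r * (w e * \<bar>cc e ?x - cc e ?y\<bar>)" by auto
  qed auto
  also have "\<dots> = r * dw w ?x ?y" using F(3)[of ?x ?y w] by (simp add: sum_distrib_left)
  finally show "\<exists>m\<in>pts. B ?x m ?y \<and> dw w ?x m = t" using r B P by auto
qed

lemma Geo_vertices: "u \<in> V \<Longrightarrow> v \<in> V \<Longrightarrow> Geo w (pt u) (pt v)"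
proof (induction "card (geo u v)" arbitrary: v rule: less_induct)
  case less
  show ?case
  proof (cases "u = v")
    case True
    then show ?thesis using Geo_refl less by auto
  next
    case False
    then obtain m where m: "{m, v} \<in> E" "{m, v} \<in> geo u v" "geo u m = geo u v - {{m, v}}"
      using geo_last less by blast
    then have "card (geo u m) < card (geo u v)" using finite_geo[of u v] by (metis card_Diff1_less)
    then have 1: "Geo w (pt u) (pt m)" using less edge_verts[OF m(1)] by auto
    have 2: "Geo w (pt m) (pt v)" using Geo_edge[OF m(1), of 0 1] edge_verts[OF m(1)] by (simp add: mix_0 mix_1)
    have "B (pt u) (pt m) (pt v)" using B_geo less edge_verts[OF m(1)] m by auto
    then show ?thesis using Geo_concat[OF _ _ _ _ 1 2] less edge_verts[OF m(1)] by auto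
  qed
qed

lemma Geo_supp: "x \<in> pts \<Longrightarrow> a \<in> supp x \<Longrightarrow> Geo w x (pt a)"
proof (erule pts_cases)
  fix p q s assume *: "a \<in> supp x" "{p, q} \<in> E" "0 < s" "s < 1" "x = mix p q s"
  then have "a = p \<or> a = q" using supp_mix_subset by fastforce
  then show ?thesis
    using Geo_edge[OF *(2), of s 0] Geo_edge[OF *(2), of s 1] * edge_verts[OF *(2)] by (auto simp: mix_0 mix_1)
qed (auto intro: Geo_refl)

lemma Geo_pts:
  assumes P: "x \<in> pts" "y \<in> pts"
  shows "Geo w x y"
proof (cases "supp x = supp y")
  case True
  show ?thesis
    using P(1)
  proof (cases rule: pts_cases)
    case (vertex v)
    have "v \<in> supp y" using True vertex by auto
    then have "Geo w y (pt v)" using Geo_supp P(2) by blast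
    then show ?thesis using Geo_sym[OF P(2), of x] P(1) vertex by auto
  next
    case (edge a b s)
    note ab = edge_verts[OF edge(1)]
    have s: "supp y = {a, b}" using True supp_mix[of a b s] edge ab by auto
    obtain s' where "0 < s'" "s' < 1" "y = mix a b s'" using mix_cases[OF P(2) s ab(3)] .
    then show ?thesis using Geo_edge[OF edge(1), of s s'] edge by auto
  qed
next
  case False
  then obtain a where a: "a \<in> supp x" "B x (pt a) y" using gate P by blast
  have aV: "a \<in> V" using a supp_pts P by auto
  have "Geo w (pt a) y"
  proof (cases "supp y = {a}")
    case True
    then have "Geo w y (pt a)" using Geo_supp[of y a] P by auto
    then show ?thesis using Geo_sym[OF P(2), of "pt a"] aV by simp
  next
    case False
    then obtain b where b: "b \<in> supp y" "B y (pt b) (pt a)" using gate[of y "pt a"] P aV by auto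
    have "b \<in> V" using b supp_pts P by auto
    moreover have "Geo w (pt b) y" using Geo_sym[OF P(2) _ Geo_supp[OF P(2) b(1)]] calculation by simp
    ultimately show ?thesis
      using Geo_concat[of "pt a" y "pt b", OF _ P(2) _ B_sym[OF b(2)]] Geo_vertices[OF aV] aV by simp
  qed
  then show ?thesis using Geo_concat[OF P _ a(2)] Geo_supp a aV P by auto
qed

lemma ptree_pts: "ptree pts (dw w)"
proof
  fix x y :: "'v \<Rightarrow> real" and t assume P: "x \<in> pts" "y \<in> pts" and t: "0 \<le> t" "t \<le> dw w x y"
  then obtain m where "m \<in> pts" "B x m y" "dw w x m = t" using Geo_pts[OF P] unfolding Geo_def by blast
  then show "\<exists>m\<in>pts. dw w x m = t \<and> dw w m y = dw w x y - t" using dw_B[of x m y] P by auto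
next
  fix x y z u :: "'v \<Rightarrow> real" assume "x \<in> pts" "y \<in> pts" "z \<in> pts" "u \<in> pts" "dw w x y + dw w y z = dw w x z"
  then show "dw w x y + dw w y u = dw w x u \<or> dw w z y + dw w y u = dw w z u"
    using cb_Y[of x y z u w] by (simp add: dw_additive_iff w)
qed (use dw_nonneg dw_sym dw_tri w in auto)

lemma bt_cb: "x \<in> pts \<Longrightarrow> y \<in> pts \<Longrightarrow> z \<in> pts \<Longrightarrow> ptree.bt (dw w) x y z \<longleftrightarrow> cb w x y z"
  using dw_additive_iff[OF w] by (simp add: ptree.bt_def[OF ptree_pts])

end

end

section \<open>The metric of the realization\<close>

lemma points_pts: "points T = simp_tree.pts (verts T) (edges T)" if "simplicial_tree (verts T) (edges T)"
proof -
  interpret simp_tree "verts T" "edges T" by unfold_locales (rule that)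
  show ?thesis unfolding points_def pts_def ..
qed

lemma path_length_sum: "distinct p \<Longrightarrow> path_length T p = (\<Sum>e\<in>path_edges p. len T e)"
  unfolding path_length_def
proof (induction p rule: path_edges.induct)
  case (1 x y p)
  then have "{x, y} \<notin> path_edges (y # p)" using path_edges_subset[of "{x, y}" "y # p"] by auto
  then show ?case using 1 by (simp add: sum.insert[OF finite_path_edges])
qed auto

context simp_tree
begin

lemma dw_pt: "u \<in> V \<Longrightarrow> v \<in> V \<Longrightarrow> dw w (pt u) (pt v) = (\<Sum>e\<in>geo u v. w e)"
proof -
  assume V: "u \<in> V" "v \<in> V"
  have "{e \<in> E. cc e (pt u) \<noteq> cc e (pt v)} = geo u v"
    using geo_cocycle[of u root v] geo_sym[of u root] geo_in_E[OF V] V by auto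
  then show ?thesis unfolding dw_def
    by (intro sum.cong) (use geo_cocycle[of u root v] geo_sym[of u root] V in auto)
qed

lemma dw_edge: "{a, b} \<in> E \<Longrightarrow> dw w (pt a) (pt b) = w {a, b}"
  using dw_pt[of a b w] geo_edge[of a b] edge_verts[of a b] by auto

lemma dw_mix:
  assumes ab: "{a, b} \<in> E" "0 \<le> s" "s \<le> 1" "0 \<le> s'" "s' \<le> 1"
  shows "dw w (mix a b s) (mix a b s') = w {a, b} * \<bar>s - s'\<bar>"
proof -
  have c: "cc e (mix a b s) - cc e (mix a b s') =
      (s - s') * (of_bool (e \<in> geo root b) - of_bool (e \<in> geo root a))" for e
    using edge_verts[OF ab(1)] by (auto simp: cc_mix algebra_simps)
  have "dw w (mix a b s) (mix a b s') = (\<Sum>e\<in>{{a, b}}. w e * \<bar>cc e (mix a b s) - cc e (mix a b s')\<bar>)"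
  proof (rule dw_superset)
    have "cc e (mix a b s) = cc e (mix a b s')" if "e \<noteq> {a, b}" for e
      using c[of e] side_edge[OF ab(1), of e] that by auto
    then show "{e \<in> E. cc e (mix a b s) \<noteq> cc e (mix a b s')} \<subseteq> {{a, b}}" by blast
  qed (use ab in auto)
  also have "\<dots> = w {a, b} * \<bar>s - s'\<bar>" using side_edge[OF ab(1), of "{a, b}"] c[of "{a, b}"] by (auto simp: abs_mult)
  finally show ?thesis .
qed

lemma dw_to_supp:
  assumes "x \<in> pts" "a \<in> supp x"
  shows "dw w x (pt a) = (1 - x a) * w (supp x)"
  using assms(1)
proof (cases rule: pts_cases)
  case (edge p q s)
  note pq = edge_verts[OF edge(1)]
  have s: "supp x = {p, q}" using supp_mix[of p q s] edge pq by auto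
  then consider "a = p" | "a = q" using assms by auto
  then show ?thesis
  proof cases
    case 1
    then show ?thesis using dw_mix[OF edge(1), of s 0 w] edge s by (simp add: mix_0)
  next
    case 2
    then show ?thesis using dw_mix[OF edge(1), of s 1 w] edge s pq by (simp add: mix_1)
  qed
qed (use assms in auto)

end

text \<open>Each pair of ends gives the length of a path, at least the distance by the triangle
  inequality; the gates of the two supports attain the minimum.\<close>

lemma point_dist_dw:
  fixes T :: "('g, 'v) metric_gtree"
  assumes tree: "simplicial_tree (verts T) (edges T)" and len: "\<And>e. e \<in> edges T \<Longrightarrow> 0 \<le> len T e"
    and P: "x \<in> points T" "y \<in> points T"
  shows "point_dist T x y = simp_tree.dw (verts T) (edges T) (len T) x y"
proof -
  interpret simp_tree "verts T" "edges T" by unfold_locales (rule tree)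
  have P: "x \<in> pts" "y \<in> pts" using P points_pts[OF tree] by auto
  have vd: "vertex_dist T a b = dw (len T) (pt a) (pt b)" if "a \<in> verts T" "b \<in> verts T" for a b
    using path_length_sum[OF tp_props(5)[OF that]] dw_pt[OF that] unfolding vertex_dist_def tp_def geo_def by auto
  show ?thesis
  proof (cases "supp x = supp y")
    case True
    have "len T (supp x) * ((\<Sum>v\<in>supp x. \<bar>x v - y v\<bar>) / 2) = dw (len T) x y"
      using P(1)
    proof (cases rule: pts_cases)
      case (vertex v)
      then have "y = pt v" using P(2) True by (auto elim!: pts_cases simp: supp_mix dest: edge_verts)
      then show ?thesis using vertex by auto
    next
      case (edge a b s)
      note ab = edge_verts[OF edge(1)]
      have s: "supp x = {a, b}" "supp y = {a, b}" using True supp_mix[of a b s] edge ab by auto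
      obtain s' where "0 < s'" "s' < 1" "y = mix a b s'" using mix_cases[OF P(2) s(2) ab(3)] .
      then show ?thesis using s ab edge dw_mix[OF edge(1), of s s' "len T"] by auto
    qed
    then show ?thesis using True unfolding point_dist_def by auto
  next
    case False
    let ?M = "{(1 - x a) * len T (supp x) + vertex_dist T a b + (1 - y b) * len T (supp y)
                | a b. a \<in> supp x \<and> b \<in> supp y}"
    have M: "?M = (\<lambda>(a, b). dw (len T) x (pt a) + dw (len T) (pt a) (pt b) + dw (len T) (pt b) y) ` (supp x \<times> supp y)"
    proof -
      have "(1 - x a) * len T (supp x) + vertex_dist T a b + (1 - y b) * len T (supp y)
          = dw (len T) x (pt a) + dw (len T) (pt a) (pt b) + dw (len T) (pt b) y"
        if "a \<in> supp x" "b \<in> supp y" for a b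
      proof -
        have "a \<in> verts T" "b \<in> verts T" using that supp_pts(2)[OF P(1)] supp_pts(2)[OF P(2)] by auto
        then show ?thesis using vd dw_to_supp[OF P(1) that(1)] dw_to_supp[OF P(2) that(2)]
          dw_sym[of "len T" "pt b" y] by simp
      qed
      then show ?thesis unfolding image_def by (auto; metis)
    qed
    have "Min ?M = dw (len T) x y"
    proof (rule Min_eqI)
      show "finite ?M" unfolding M using supp_pts(1)[OF P(1)] supp_pts(1)[OF P(2)] by auto
      fix z assume "z \<in> ?M"
      then obtain a b where ab: "a \<in> supp x" "b \<in> supp y"
        "z = dw (len T) x (pt a) + dw (len T) (pt a) (pt b) + dw (len T) (pt b) y" unfolding M by auto
      have V: "pt a \<in> pts" "pt b \<in> pts" using ab supp_pts(2)[OF P(1)] supp_pts(2)[OF P(2)] by auto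
      show "dw (len T) x y \<le> z"
        using dw_tri[of "len T" x "pt a" y] dw_tri[of "len T" "pt a" "pt b" y] len P V ab(3) by auto
    next
      obtain a where a: "a \<in> supp x" "B x (pt a) y" using gate[OF P False] by auto
      have V: "pt a \<in> pts" using a supp_pts(2)[OF P(1)] by auto
      obtain b where b: "b \<in> supp y" "B y (pt b) (pt a)"
      proof (cases "supp y = {a}")
        case True
        then show ?thesis using that[of a] B_triv by auto
      next
        case False
        then show ?thesis using gate[OF P(2) V] that by auto
      qed
      have Vb: "pt b \<in> pts" using b supp_pts(2)[OF P(2)] by auto
      have "dw (len T) x y = dw (len T) x (pt a) + dw (len T) (pt a) (pt b) + dw (len T) (pt b) y"
        using dw_B[of "len T" x "pt a" y] dw_B[of "len T" "pt a" "pt b" y] B_sym[OF b(2)] len P V Vb a by auto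
      then show "dw (len T) x y \<in> ?M" unfolding M using a b by (auto intro!: image_eqI[of _ _ "(a, b)"])
    qed
    then show ?thesis using False unfolding point_dist_def by auto
  qed
qed

section \<open>Group actions on trees\<close>

locale gtr =
  fixes G :: "('g, 'b) monoid_scheme" and T :: "('g, 'v, 'c) gtree_scheme"
  assumes gt: "is_gtree G T"

sublocale gtr \<subseteq> simp_tree "verts T" "edges T"
  by unfold_locales (use gt in \<open>simp add: is_gtree_def\<close>)

sublocale gtr \<subseteq> action: group_action G "verts T" "act T"
  using gt by (simp add: is_gtree_def)

sublocale gtr \<subseteq> group G
  using action.group_hom by (simp add: group_hom_def)

context gtr
begin

abbreviation pact :: "'g \<Rightarrow> ('v \<Rightarrow> real) \<Rightarrow> 'v \<Rightarrow> real" where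
  "pact \<equiv> point_act G T"

lemma act_in [simp]: "g \<in> carrier G \<Longrightarrow> v \<in> verts T \<Longrightarrow> act T g v \<in> verts T"
  using action.element_image by blast

lemma act_mult: "g \<in> carrier G \<Longrightarrow> h \<in> carrier G \<Longrightarrow> v \<in> verts T \<Longrightarrow> act T (g \<otimes>\<^bsub>G\<^esub> h) v = act T g (act T h v)"
  using action.composition_rule by auto

lemma act_one [simp]: "v \<in> verts T \<Longrightarrow> act T \<one>\<^bsub>G\<^esub> v = v"
  using action.id_eq_one by (metis restrict_apply')

lemma act_inv [simp]: "g \<in> carrier G \<Longrightarrow> v \<in> verts T \<Longrightarrow> act T (inv\<^bsub>G\<^esub> g) (act T g v) = v"
  using act_mult[of "inv\<^bsub>G\<^esub> g" g v] by simp

lemma act_inv' [simp]: "g \<in> carrier G \<Longrightarrow> v \<in> verts T \<Longrightarrow> act T g (act T (inv\<^bsub>G\<^esub> g) v) = v"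
  using act_mult[of g "inv\<^bsub>G\<^esub> g" v] by simp

lemma act_eq_iff [simp]: "g \<in> carrier G \<Longrightarrow> u \<in> verts T \<Longrightarrow> v \<in> verts T \<Longrightarrow> act T g u = act T g v \<longleftrightarrow> u = v"
  by (metis act_inv)

lemma edge_sub: "e \<in> edges T \<Longrightarrow> e \<subseteq> verts T"
  using edge_ends[of e] by auto

lemma act_edge [simp]: "g \<in> carrier G \<Longrightarrow> e \<in> edges T \<Longrightarrow> act T g ` e \<in> edges T"
  using gt by (simp add: is_gtree_def)

lemma act_edge2: "g \<in> carrier G \<Longrightarrow> {a, b} \<in> edges T \<Longrightarrow> {act T g a, act T g b} \<in> edges T"
  using act_edge[of g "{a, b}"] by simp

lemma act_edge_mult:
  "g \<in> carrier G \<Longrightarrow> h \<in> carrier G \<Longrightarrow> e \<in> edges T \<Longrightarrow> act T (g \<otimes>\<^bsub>G\<^esub> h) ` e = act T g ` act T h ` e"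
  using edge_sub[of e] by (auto simp: image_image act_mult subset_iff cong: image_cong_simp)

lemma act_edge_one [simp]: "e \<in> edges T \<Longrightarrow> act T \<one>\<^bsub>G\<^esub> ` e = e"
  using edge_sub[of e] by (force simp: subset_iff)

lemma act_edge_inv [simp]: "g \<in> carrier G \<Longrightarrow> e \<in> edges T \<Longrightarrow> act T (inv\<^bsub>G\<^esub> g) ` act T g ` e = e"
  using act_edge_mult[of "inv\<^bsub>G\<^esub> g" g e] by simp

lemma act_edge_inv' [simp]: "g \<in> carrier G \<Longrightarrow> e \<in> edges T \<Longrightarrow> act T g ` act T (inv\<^bsub>G\<^esub> g) ` e = e"
  using act_edge_mult[of g "inv\<^bsub>G\<^esub> g" e] by simp

lemma act_edge_eq_iff: "g \<in> carrier G \<Longrightarrow> e \<in> edges T \<Longrightarrow> f \<in> edges T \<Longrightarrow> act T g ` e = act T g ` f \<longleftrightarrow> e = f"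
  by (metis act_edge_inv)

lemma no_inversion: "g \<in> carrier G \<Longrightarrow> {a, b} \<in> edges T \<Longrightarrow> \<not> (act T g a = b \<and> act T g b = a)"
proof -
  have "\<forall>g\<in>carrier G. \<forall>a b. {a, b} \<in> edges T \<longrightarrow> \<not> (act T g a = b \<and> act T g b = a)"
    using gt unfolding is_gtree_def by (elim conjE)
  then show "g \<in> carrier G \<Longrightarrow> {a, b} \<in> edges T \<Longrightarrow> \<not> (act T g a = b \<and> act T g b = a)" by blast
qed

lemma edge_fixed:
  assumes "g \<in> carrier G" "e \<in> edges T" "act T g ` e = e" "v \<in> e"
  shows "act T g v = v"
proof -
  obtain a b where ab: "e = {a, b}" "a \<noteq> b" using edge_ends[OF assms(2)] by auto
  then show ?thesis using no_inversion[of g a b] assms by (auto simp: doubleton_eq_iff)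
qed

lemma geo_act:
  assumes g: "g \<in> carrier G" and V: "u \<in> verts T" "v \<in> verts T" and "e \<in> edges T"
  shows "act T g ` e \<in> geo (act T g u) (act T g v) \<longleftrightarrow> e \<in> geo u v"
proof -
  have "\<forall>e\<in>edges T. act T g ` e \<in> geo (act T g u) (act T g v) \<longleftrightarrow> e \<in> geo u v"
  proof (rule conn_induct[OF V, where P = "\<lambda>v. \<forall>e\<in>edges T. act T g ` e \<in> geo (act T g u) (act T g v) \<longleftrightarrow> e \<in> geo u v"])
    show "\<forall>e\<in>edges T. act T g ` e \<in> geo (act T g u) (act T g u) \<longleftrightarrow> e \<in> geo u u"
      using geo_self g V by auto
  next
    fix m w assume *: "m \<in> verts T" "{m, w} \<in> edges T"
      "\<forall>e\<in>edges T. act T g ` e \<in> geo (act T g u) (act T g m) \<longleftrightarrow> e \<in> geo u m"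
    show "\<forall>e\<in>edges T. act T g ` e \<in> geo (act T g u) (act T g w) \<longleftrightarrow> e \<in> geo u w"
    proof
      fix e assume e: "e \<in> edges T"
      have "act T g ` e = {act T g m, act T g w} \<longleftrightarrow> e = {m, w}"
        using act_edge_eq_iff[OF g e *(2)] by simp
      then show "act T g ` e \<in> geo (act T g u) (act T g w) \<longleftrightarrow> e \<in> geo u w"
        using geo_step[OF act_in[OF g V(1)] act_edge2[OF g *(2)]] geo_step[OF V(1) *(2)] *(3) e
        by simp
    qed
  qed
  then show ?thesis using assms(4) by blast
qed

lemma geo_act_image:
  assumes g: "g \<in> carrier G" and V: "u \<in> verts T" "v \<in> verts T"
  shows "geo (act T g u) (act T g v) = (\<lambda>e. act T g ` e) ` geo u v"
proof (intro equalityI subsetI)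
  fix e assume e: "e \<in> geo (act T g u) (act T g v)"
  then have E: "e \<in> edges T" using geo_in_E[of "act T g u" "act T g v"] g V by auto
  have "act T (inv\<^bsub>G\<^esub> g) ` e \<in> geo u v"
    using geo_act[OF g V, of "act T (inv\<^bsub>G\<^esub> g) ` e"] e E g by simp
  then show "e \<in> (\<lambda>e. act T g ` e) ` geo u v" using E g by (intro image_eqI[of _ _ "act T (inv\<^bsub>G\<^esub> g) ` e"]) auto
qed (use geo_act[OF g V] geo_in_E[OF V] in auto)

lemma pact_pt [simp]: "g \<in> carrier G \<Longrightarrow> v \<in> verts T \<Longrightarrow> pact g (pt v) = pt (act T g v)"
  unfolding point_act_def pt_def by (auto simp: fun_eq_iff)

lemma pact_mix:
  "g \<in> carrier G \<Longrightarrow> a \<in> verts T \<Longrightarrow> b \<in> verts T \<Longrightarrow> pact g (mix a b s) = mix (act T g a) (act T g b) s"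
  unfolding point_act_def mix_def by (auto simp: fun_eq_iff)

lemma pact_in [simp]: "g \<in> carrier G \<Longrightarrow> x \<in> pts \<Longrightarrow> pact g x \<in> pts"
  by (erule pts_cases) (use edge_verts in \<open>auto simp: pact_mix intro!: mix_in act_edge2\<close>)

lemma pact_mult: "g \<in> carrier G \<Longrightarrow> h \<in> carrier G \<Longrightarrow> x \<in> pts \<Longrightarrow> pact (g \<otimes>\<^bsub>G\<^esub> h) x = pact g (pact h x)"
  by (erule pts_cases) (use edge_verts in \<open>auto simp: pact_mix act_mult\<close>)

lemma pact_one [simp]: "x \<in> pts \<Longrightarrow> pact \<one>\<^bsub>G\<^esub> x = x"
  by (erule pts_cases) (use edge_verts in \<open>auto simp: pact_mix\<close>)

lemma pact_inv [simp]: "g \<in> carrier G \<Longrightarrow> x \<in> pts \<Longrightarrow> pact (inv\<^bsub>G\<^esub> g) (pact g x) = x"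
  using pact_mult[of "inv\<^bsub>G\<^esub> g" g x] by simp

lemma pact_inv' [simp]: "g \<in> carrier G \<Longrightarrow> x \<in> pts \<Longrightarrow> pact g (pact (inv\<^bsub>G\<^esub> g) x) = x"
  using pact_mult[of g "inv\<^bsub>G\<^esub> g" x] by simp

lemma supp_pact: "g \<in> carrier G \<Longrightarrow> x \<in> pts \<Longrightarrow> supp (pact g x) = act T g ` supp x"
proof (erule pts_cases)
  fix a b s assume *: "g \<in> carrier G" "{a, b} \<in> edges T" "0 < s" "s < 1" "x = mix a b s"
  note ab = edge_verts[OF *(2)]
  show "supp (pact g x) = act T g ` supp x"
    using supp_mix[of a b s] supp_mix[of "act T g a" "act T g b" s] * ab by (simp add: pact_mix)
qed auto

lemma side_act:
  assumes "g \<in> carrier G" "v \<in> verts T" "e \<in> edges T"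
  shows "act T g ` e \<in> geo root (act T g v) \<longleftrightarrow> (act T g ` e \<in> geo root (act T g root)) \<noteq> (e \<in> geo root v)"
  using geo_cocycle[of root "act T g root" "act T g v" "act T g ` e"] geo_act[of g root v e] assms by auto

text \<open>Coordinates count from the root, which \<open>g\<close> need not fix: at the image of
  \<open>e\<close> the two sides are exchanged exactly when this edge separates the root from its
  translate.\<close>

lemma cc_act:
  assumes g: "g \<in> carrier G" and x: "x \<in> pts" and e: "e \<in> edges T"
  shows "cc (act T g ` e) (pact g x) =
    (if act T g ` e \<in> geo root (act T g root) then 1 - cc e x else cc e x)"
  using x
proof (cases rule: pts_cases)
  case (vertex v)
  then show ?thesis using side_act[OF g vertex(1) e] g by simp
next
  case (edge a b s)
  note ab = edge_verts[OF edge(1)]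
  have "act T g a \<noteq> act T g b" using ab g by simp
  then show ?thesis using side_act[OF g ab(1) e] side_act[OF g ab(2) e] ab g edge(4)
    by (simp add: pact_mix cc_mix algebra_simps)
qed

definition inv_weight :: "('v set \<Rightarrow> real) \<Rightarrow> bool" where
  "inv_weight w \<longleftrightarrow> (\<forall>e\<in>edges T. 0 \<le> w e) \<and> (\<forall>g\<in>carrier G. \<forall>e\<in>edges T. w (act T g ` e) = w e)"

lemma inv_weight_one: "inv_weight (\<lambda>_. 1)" unfolding inv_weight_def by auto

lemma inv_weight_nonneg: "inv_weight w \<Longrightarrow> e \<in> edges T \<Longrightarrow> 0 \<le> w e" unfolding inv_weight_def by auto

lemma dw_act:
  assumes w: "inv_weight w" and g: "g \<in> carrier G" and P: "x \<in> pts" "y \<in> pts"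
  shows "dw w (pact g x) (pact g y) = dw w x y"
proof -
  have c: "\<bar>cc (act T g ` e) (pact g x) - cc (act T g ` e) (pact g y)\<bar> = \<bar>cc e x - cc e y\<bar>"
    if "e \<in> edges T" for e
    using cc_act[OF g P(1) that] cc_act[OF g P(2) that] by auto
  have c': "\<bar>cc e (pact g x) - cc e (pact g y)\<bar> = \<bar>cc (act T (inv\<^bsub>G\<^esub> g) ` e) x - cc (act T (inv\<^bsub>G\<^esub> g) ` e) y\<bar>"
    if "e \<in> edges T" for e
    using c[of "act T (inv\<^bsub>G\<^esub> g) ` e"] that g by simp
  show ?thesis unfolding dw_def
  proof (rule sum.reindex_bij_witness[of _ "\<lambda>e. act T g ` e" "\<lambda>e. act T (inv\<^bsub>G\<^esub> g) ` e"])
    fix e assume e: "e \<in> {e \<in> edges T. cc e (pact g x) \<noteq> cc e (pact g y)}"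
    then show "act T (inv\<^bsub>G\<^esub> g) ` e \<in> {e \<in> edges T. cc e x \<noteq> cc e y}" using c'[of e] g by auto
    have "w (act T (inv\<^bsub>G\<^esub> g) ` e) = w e" using e g w unfolding inv_weight_def by auto
    then show "w (act T (inv\<^bsub>G\<^esub> g) ` e) * \<bar>cc (act T (inv\<^bsub>G\<^esub> g) ` e) x - cc (act T (inv\<^bsub>G\<^esub> g) ` e) y\<bar>
        = w e * \<bar>cc e (pact g x) - cc e (pact g y)\<bar>" using c'[of e] e by simp
  next
    fix e assume e: "e \<in> {e \<in> edges T. cc e x \<noteq> cc e y}"
    then show "act T g ` e \<in> {e \<in> edges T. cc e (pact g x) \<noteq> cc e (pact g y)}" using c[of e] g by auto
  qed (use g in auto)
qed

lemma B_act:
  assumes g: "g \<in> carrier G" and P: "x \<in> pts" "y \<in> pts" "z \<in> pts" and "B x y z"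
  shows "B (pact g x) (pact g y) (pact g z)"
  using dw_act[OF inv_weight_one g] dw_additive_iff[of "\<lambda>_. 1", OF _ P] assms
    dw_additive_iff[of "\<lambda>_. 1", of "pact g x" "pact g y" "pact g z"] unfolding B_one by simp

lemma isometry_pact:
  assumes w: "inv_weight w" and g: "g \<in> carrier G"
  shows "ptree_isometry pts (dw w) (pact g) (pact (inv\<^bsub>G\<^esub> g))"
proof -
  interpret ptree pts "dw w" by (rule ptree_pts) (rule inv_weight_nonneg[OF w])
  show ?thesis by unfold_locales (use g dw_act[OF w g] in auto)
qed

end

section \<open>Minimal trees\<close>

context simp_tree
begin

lemma dw_eq_0:
  assumes w: "\<And>e. e \<in> E \<Longrightarrow> 0 < w e" and P: "x \<in> pts" "y \<in> pts"
  shows "dw w x y = 0 \<longleftrightarrow> x = y"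
proof
  assume 0: "dw w x y = 0"
  have "\<forall>e\<in>{e\<in>E. cc e x \<noteq> cc e y}. w e * \<bar>cc e x - cc e y\<bar> = 0"
    using 0 unfolding dw_def
    by (subst (asm) sum_nonneg_eq_0_iff) (use w cc_diff_finite[OF P] in \<open>auto intro!: mult_nonneg_nonneg less_imp_le\<close>)
  then show "x = y" using w by (intro cc_eq P) fastforce
qed auto

lemma dw_one_pos: "x \<in> pts \<Longrightarrow> y \<in> pts \<Longrightarrow> x \<noteq> y \<Longrightarrow> 0 < dw (\<lambda>_. 1) x y"
  using dw_eq_0[of "\<lambda>_. 1" x y] dw_nonneg[of "\<lambda>_. 1" x y] by auto

lemma bt_B: "x \<in> pts \<Longrightarrow> y \<in> pts \<Longrightarrow> z \<in> pts \<Longrightarrow> ptree.bt (dw (\<lambda>_. 1)) x y z \<longleftrightarrow> B x y z"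
  unfolding B_one by (rule bt_cb) auto

lemma B_local:
  assumes P: "a \<in> pts" "b \<in> pts" "c \<in> pts" "e \<in> pts" and B: "B a b c" "B b c e" "b \<noteq> c"
  shows "B a b e" "B a c e"
proof -
  interpret ptree pts "dw (\<lambda>_. 1)" by (rule ptree_pts) auto
  show "B a b e" "B a c e"
    using bt_local[OF P] B bt_B P dw_one_pos by auto
qed

lemma geo_disjoint:
  assumes "a \<in> V" "m \<in> V" "b \<in> V" "B (pt a) (pt m) (pt b)" "e \<in> geo a m"
  shows "e \<notin> geo m b"
  using assms B_geo[of a b m] geo_cocycle[of a m b e] by auto

lemma card_geo_dw: "u \<in> V \<Longrightarrow> v \<in> V \<Longrightarrow> dw (\<lambda>_. 1) (pt u) (pt v) = card (geo u v)"
  using dw_pt[of u v "\<lambda>_. 1"] by simp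

lemma geo_first_edge:
  assumes "u \<in> V" "z \<in> V" "{u, m} \<in> E" "{u, m} \<in> geo u z"
  shows "B (pt u) (pt m) (pt z)"
  using B_geo[of u z m] geo_edge[OF assms(3)] assms edge_verts(2)[OF assms(3)] by simp

text \<open>Two applications of \<open>B_local\<close>, gluing along the edge to \<open>u1\<close>
  and then along the edge to \<open>u2\<close>; each edge is an overlap of positive length.\<close>

lemma B_different_branches:
  assumes V: "u \<in> V" "z1 \<in> V" "z2 \<in> V" and k: "{u, u1} \<in> E" "{u, u2} \<in> E" "u1 \<noteq> u2"
    and z: "{u, u1} \<in> geo u z1" "{u, u2} \<in> geo u z2"
  shows "B (pt z1) (pt u) (pt z2)"
proof -
  note e1 = edge_verts[OF k(1)] and e2 = edge_verts[OF k(2)]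
  have 1: "B (pt z1) (pt u1) (pt u)" "B (pt u) (pt u2) (pt z2)"
    using geo_first_edge[OF V(1,2) k(1) z(1)] geo_first_edge[OF V(1,3) k(2) z(2)] B_sym by auto
  have "{u, u1} \<noteq> {u, u2}" using k(3) by (auto simp: doubleton_eq_iff)
  then have "geo u1 u \<subseteq> geo u1 u2"
    using geo_cocycle[of u1 u u2] geo_edge[OF k(1)] geo_edge[OF k(2)] geo_sym[of u1 u] e1 e2 by auto
  then have 2: "B (pt u1) (pt u) (pt u2)" using B_geo e1 e2 by simp
  have 3: "B (pt z1) (pt u) (pt u2)" by (rule B_local(2)[OF _ _ _ _ 1(1) 2]) (use V e1 e2 in auto)
  show ?thesis by (rule B_local(1)[OF _ _ _ _ 3 1(2)]) (use V e1 e2 in auto)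
qed

lemma B_path:
  assumes V: "u \<in> V" "v \<in> V" and y: "y \<in> pts" "\<And>a. a \<in> supp y \<Longrightarrow> geo u a \<subseteq> geo u v"
  shows "B (pt u) y (pt v)"
  unfolding B_def
proof
  fix e assume e: "e \<in> E"
  show "between (cc e (pt u)) (cc e y) (cc e (pt v))"
  proof (cases "e \<in> geo u v")
    case True
    then show ?thesis using geo_cocycle[of root u v e] V cc_range[OF y(1), of e] by (auto simp: between_iff)
  next
    case False
    have eq: "e \<in> geo root a \<longleftrightarrow> e \<in> geo root u" if "a \<in> supp y" for a
      using geo_cocycle[of root u a e] V y(2)[OF that] False that supp_pts(2)[OF y(1)] by auto
    have "cc e y = (\<Sum>a\<in>supp y. y a * of_bool (e \<in> geo root u))"
      unfolding cc_def by (rule sum.cong) (use eq in auto)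
    also have "\<dots> = cc e (pt u)" using supp_pts(4)[OF y(1)] by (simp add: sum_distrib_right[symmetric])
    finally show ?thesis by (simp add: between_def)
  qed
qed

text \<open>If an edge off the segment separated \<open>u\<close> from \<open>a\<close>, the
  coordinate of \<open>y\<close> at this edge would have to agree with that of \<open>u\<close>; but
  \<open>a\<close> carries positive weight in \<open>y\<close>, which pulls the coordinate to the
  other side.\<close>

lemma B_supp:
  assumes V: "u \<in> V" "v \<in> V" and y: "y \<in> pts" "B (pt u) y (pt v)" and a: "a \<in> supp y"
  shows "geo u a \<subseteq> geo u v"
proof
  fix e assume e: "e \<in> geo u a"
  have aV: "a \<in> V" using a supp_pts(2)[OF y(1)] by auto
  have E: "e \<in> E" using geo_in_E[OF V(1) aV e] .
  show "e \<in> geo u v"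
  proof (rule ccontr)
    assume n: "e \<notin> geo u v"
    have c: "cc e y = of_bool (e \<in> geo root u)"
    proof -
      have "between (of_bool (e \<in> geo root u)) (cc e y) (of_bool (e \<in> geo root v))"
        using y(2) E unfolding B_def by auto
      moreover have "e \<in> geo root v \<longleftrightarrow> e \<in> geo root u" using n geo_cocycle[of root u v e] V by auto
      ultimately show ?thesis by (cases "e \<in> geo root u") (auto simp: between_iff)
    qed
    have ra: "(e \<in> geo root a) \<noteq> (e \<in> geo root u)" using e geo_cocycle[of root u a e] V aV by auto
    show False
      using y(1)
    proof (cases rule: pts_cases)
      case (vertex b)
      then show ?thesis using c ra a by auto
    next
      case (edge p q s)
      have pq: "p \<noteq> q" "a = p \<or> a = q" using a edge_verts(3)[OF edge(1)] supp_mix_subset[of p q s] edge(4) by auto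
      have "(e \<in> geo root p) = (e \<in> geo root u) \<and> (e \<in> geo root q) = (e \<in> geo root u)"
        using c edge(2,3) pq(1) unfolding edge(4)
        by (cases "e \<in> geo root p"; cases "e \<in> geo root q"; cases "e \<in> geo root u") (simp_all add: cc_mix)
      then show ?thesis using ra pq(2) by auto
    qed
  qed
qed

end

context gtr
begin

lemma minimality:
  assumes "W \<subseteq> verts T" "F \<subseteq> edges T" "simplicial_tree W F"
    "\<And>g. g \<in> carrier G \<Longrightarrow> act T g ` W \<subseteq> W" "\<And>g e. g \<in> carrier G \<Longrightarrow> e \<in> F \<Longrightarrow> act T g ` e \<in> F"
  shows "W = verts T" "F = edges T"
proof -
  have "\<forall>W F. W \<subseteq> verts T \<and> F \<subseteq> edges T \<and> simplicial_tree W F \<and>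
      (\<forall>g\<in>carrier G. act T g ` W \<subseteq> W \<and> (\<forall>e\<in>F. act T g ` e \<in> F)) \<longrightarrow>
      W = verts T \<and> F = edges T"
    using gt unfolding is_gtree_def by (elim conjE)
  from this[rule_format, of W F] have "W = verts T \<and> F = edges T" using assms by simp
  then show "W = verts T" "F = edges T" by auto
qed

lemma nonredundant:
  assumes "v \<in> verts T" "e \<noteq> f" "{d \<in> edges T. v \<in> d} = {e, f}"
  shows "\<exists>g\<in>carrier G. act T g v = v \<and> act T g ` e = f"
proof -
  have "\<forall>v\<in>verts T. \<forall>e f. e \<noteq> f \<and> {d \<in> edges T. v \<in> d} = {e, f} \<longrightarrow>
        (\<exists>g\<in>carrier G. act T g v = v \<and> act T g ` e = f \<and> act T g ` f = e)"
    using gt unfolding is_gtree_def by (elim conjE)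
  from this[rule_format, of v e f] show ?thesis using assms by auto
qed

text \<open>The vertices reached from \<open>u\<close> along edges of \<open>F\<close> span a convex
  set of vertices. It is invariant because the way from \<open>u\<close> to each of its translates
  stays in \<open>F\<close>. Minimality then leaves no further edge.\<close>

lemma minimal_edges:
  assumes u: "u \<in> verts T" and F: "F \<subseteq> edges T" "\<And>g e. g \<in> carrier G \<Longrightarrow> e \<in> F \<Longrightarrow> act T g ` e \<in> F"
    and orb: "\<And>k. k \<in> carrier G \<Longrightarrow> geo u (act T k u) \<subseteq> F"
  shows "F = edges T"
proof -
  define W where "W = {a \<in> verts T. geo u a \<subseteq> F}"
  define F0 where "F0 = {e \<in> F. e \<subseteq> W}"
  have WV: "W \<subseteq> verts T" "u \<in> W" unfolding W_def using u geo_self by auto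
  have tree: "simplicial_tree W F0"
  proof (rule subtree)
    fix a b assume ab: "a \<in> W" "b \<in> W"
    then have V: "a \<in> verts T" "b \<in> verts T" using WV by auto
    have sub: "geo a b \<subseteq> F" using geo_sub_Un[OF V(1) u V(2)] geo_sym[OF V(1) u] ab unfolding W_def by auto
    show "geo a b \<subseteq> F0"
    proof
      fix e assume e: "e \<in> geo a b"
      have "c \<in> W" if c: "c \<in> e" for c
      proof -
        have cV: "c \<in> verts T" using c edge_sub geo_in_E[OF V e] by auto
        have "geo a c \<subseteq> F" using geo_end_subset[OF V e c] sub by auto
        then show ?thesis using geo_sub_Un[OF u V(1) cV] ab cV unfolding W_def by auto
      qed
      then show "e \<in> F0" using e sub unfolding F0_def by auto
    qed
  qed (use WV F in \<open>auto simp: F0_def\<close>)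
  have inv: "act T g ` W \<subseteq> W" if g: "g \<in> carrier G" for g
  proof
    fix b assume "b \<in> act T g ` W"
    then obtain a where a: "a \<in> W" "b = act T g a" by auto
    then have aV: "a \<in> verts T" "geo u a \<subseteq> F" unfolding W_def by auto
    have "geo (act T g u) b \<subseteq> F" using geo_act_image[OF g u aV(1)] a(2) aV(2) F(2)[OF g] by auto
    then show "b \<in> W" using geo_sub_Un[of u "act T g u" b] orb[OF g] a aV g u unfolding W_def by auto
  qed
  have "F0 = edges T"
  proof (rule minimality(2)[OF WV(1) _ tree inv])
    show "F0 \<subseteq> edges T" using F unfolding F0_def by auto
    fix g e assume g: "g \<in> carrier G" and "e \<in> F0"
    then have e: "e \<in> F" "e \<subseteq> W" unfolding F0_def by auto
    have "act T g ` e \<subseteq> W" by (rule subset_trans[OF image_mono[OF e(2)] inv[OF g]])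
    then show "act T g ` e \<in> F0" using F(2)[OF g e(1)] unfolding F0_def by auto
  qed
  then show ?thesis using F unfolding F0_def by auto
qed

text \<open>The edges on segments between points of the orbit form an invariant set containing the
  way from \<open>v\<close> to each of its translates, so \<open>minimal_edges\<close>
  applies.\<close>

lemma hull_edge:
  assumes v: "v \<in> verts T" and e: "e \<in> edges T"
  shows "\<exists>h\<in>carrier G. \<exists>k\<in>carrier G. e \<in> geo (act T h v) (act T k v)"
proof -
  let ?F = "{e \<in> edges T. \<exists>h\<in>carrier G. \<exists>k\<in>carrier G. e \<in> geo (act T h v) (act T k v)}"
  have "?F = edges T"
  proof (rule minimal_edges[OF v])
    fix g e assume g: "g \<in> carrier G" and "e \<in> ?F"
    then obtain h k where hk: "h \<in> carrier G" "k \<in> carrier G" "e \<in> edges T" "e \<in> geo (act T h v) (act T k v)" by auto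
    have "act T g ` e \<in> geo (act T (g \<otimes>\<^bsub>G\<^esub> h) v) (act T (g \<otimes>\<^bsub>G\<^esub> k) v)"
      using geo_act[OF g, of "act T h v" "act T k v" e] hk v g by (simp add: act_mult)
    moreover have "g \<otimes>\<^bsub>G\<^esub> h \<in> carrier G" "g \<otimes>\<^bsub>G\<^esub> k \<in> carrier G" "act T g ` e \<in> edges T" using g hk by auto
    ultimately show "act T g ` e \<in> ?F" by blast
  next
    fix k assume k: "k \<in> carrier G"
    show "geo v (act T k v) \<subseteq> ?F"
    proof
      fix e assume e: "e \<in> geo v (act T k v)"
      have "e \<in> geo (act T \<one>\<^bsub>G\<^esub> v) (act T k v)" using e v by simp
      then show "e \<in> ?F" using k geo_in_E[OF v act_in[OF k v] e] by blast
    qed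
  qed auto
  then show ?thesis using e by blast
qed

lemma hull_point:
  assumes v: "v \<in> verts T" and y: "y \<in> pts"
  shows "\<exists>h\<in>carrier G. \<exists>k\<in>carrier G. B (pt (act T h v)) y (pt (act T k v))"
proof -
  have "\<exists>h\<in>carrier G. \<exists>k\<in>carrier G. \<forall>a\<in>supp y. geo (act T h v) a \<subseteq> geo (act T h v) (act T k v)"
  proof -
    have *: ?thesis if e: "e \<in> edges T" "supp y \<subseteq> e" for e
    proof -
      obtain h k where "h \<in> carrier G" "k \<in> carrier G" "e \<in> geo (act T h v) (act T k v)"
        using hull_edge[OF v e(1)] by auto
      then have "\<forall>a\<in>supp y. geo (act T h v) a \<subseteq> geo (act T h v) (act T k v)" "h \<in> carrier G" "k \<in> carrier G"
        using geo_end_subset[of "act T h v" "act T k v" e] e(2) v by auto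
      then show ?thesis by blast
    qed
    show ?thesis
      using y
    proof (cases rule: pts_cases)
      case (vertex b)
      show ?thesis
      proof (cases "b = v")
        case True
        then show ?thesis using vertex geo_self v
          by (intro bexI[of _ "\<one>\<^bsub>G\<^esub>"] bexI[of _ "\<one>\<^bsub>G\<^esub>"]) auto
      next
        case False
        obtain m where "{m, b} \<in> edges T" using geo_last[OF v vertex(1)] False by auto
        then show ?thesis using *[of "{m, b}"] vertex by auto
      qed
    next
      case (edge a b s)
      then show ?thesis using *[OF edge(1)] supp_mix_subset[of a b s] by simp
    qed
  qed
  then show ?thesis using B_path[of "act T h v" "act T k v" y for h k] y v act_in by meson
qed

text \<open>Reading a group element as a word cuts the way from \<open>u\<close> to its translate
  into translates of the segments \<open>geo u (act T a u)\<close> for letters \<open>a\<close>. In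
  this way displacements by finitely many elements control all edges.\<close>

lemma generators_edge:
  assumes S: "S \<subseteq> carrier G" "generate G S = carrier G" and u: "u \<in> verts T" and e: "e \<in> edges T"
  shows "\<exists>a\<in>S. \<exists>k\<in>carrier G. act T k ` e \<in> geo u (act T a u)"
proof -
  let ?F = "{e \<in> edges T. \<exists>a\<in>S. \<exists>k\<in>carrier G. act T k ` e \<in> geo u (act T a u)}"
  have inv: "act T g ` e \<in> ?F" if g: "g \<in> carrier G" "e \<in> ?F" for g e
  proof -
    obtain a k where ak: "a \<in> S" "k \<in> carrier G" "e \<in> edges T" "act T k ` e \<in> geo u (act T a u)" using g by auto
    have "act T (k \<otimes>\<^bsub>G\<^esub> inv\<^bsub>G\<^esub> g) ` act T g ` e = act T k ` e"
      using act_edge_mult[of k "inv\<^bsub>G\<^esub> g" "act T g ` e"] ak g by simp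
    moreover have "k \<otimes>\<^bsub>G\<^esub> inv\<^bsub>G\<^esub> g \<in> carrier G" "act T g ` e \<in> edges T" using ak g by auto
    ultimately have "act T g ` e \<in> edges T" "k \<otimes>\<^bsub>G\<^esub> inv\<^bsub>G\<^esub> g \<in> carrier G"
      "act T (k \<otimes>\<^bsub>G\<^esub> inv\<^bsub>G\<^esub> g) ` act T g ` e \<in> geo u (act T a u)" using ak by auto
    then show ?thesis using ak(1) by blast
  qed
  have gen: "geo u (act T k u) \<subseteq> ?F" if "k \<in> generate G S" for k
    using that
  proof (induction rule: generate.induct)
    case one
    then show ?case using geo_self u by auto
  next
    case (incl h)
    show ?case
    proof
      fix e assume e: "e \<in> geo u (act T h u)"
      have hc: "h \<in> carrier G" using incl S by auto
      have E: "e \<in> edges T" using geo_in_E[OF u act_in[OF hc u] e] .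
      have "act T \<one>\<^bsub>G\<^esub> ` e \<in> geo u (act T h u)" using e E by simp
      then show "e \<in> ?F" using incl E one_closed by blast
    qed
  next
    case (inv h)
    show ?case
    proof
      fix e assume e: "e \<in> geo u (act T (inv\<^bsub>G\<^esub> h) u)"
      have hc: "h \<in> carrier G" using inv S by auto
      have E: "e \<in> edges T" using geo_in_E[OF u _ e] hc u by simp
      have "act T h ` e \<in> geo (act T h u) (act T h (act T (inv\<^bsub>G\<^esub> h) u))"
        using geo_act[OF hc u, of "act T (inv\<^bsub>G\<^esub> h) u" e] E e hc u by simp
      then have "act T h ` e \<in> geo u (act T h u)" using geo_sym hc u by simp
      then show "e \<in> ?F" using inv E hc by blast
    qed
  next
    case (eng h1 h2)
    have c: "h1 \<in> carrier G" "h2 \<in> carrier G" using eng S by auto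
    have "geo (act T h1 u) (act T (h1 \<otimes>\<^bsub>G\<^esub> h2) u) \<subseteq> ?F"
    proof
      fix e assume "e \<in> geo (act T h1 u) (act T (h1 \<otimes>\<^bsub>G\<^esub> h2) u)"
      then obtain e' where e': "e' \<in> geo u (act T h2 u)" "e = act T h1 ` e'"
        using geo_act_image[OF c(1) u act_in[OF c(2) u]] c u by (auto simp: act_mult)
      have "e' \<in> ?F" using e'(1) eng.IH(2) by (rule rev_subsetD)
      then show "e \<in> ?F" unfolding e'(2) by (rule inv[OF c(1)])
    qed
    then show ?case
      using geo_sub_Un[of u "act T h1 u" "act T (h1 \<otimes>\<^bsub>G\<^esub> h2) u"] eng.IH(1) c u by auto
  qed
  have "?F = edges T" by (rule minimal_edges[OF u _ inv]) (use gen S in auto)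
  then show ?thesis using e by blast
qed

text \<open>Some translate \<open>f\<close> of \<open>e\<close> separates a vertex \<open>u\<close>
  from \<open>act T a u\<close>. The factor \<open>2\<close> pays for \<open>p\<close> being inside
  an edge: \<open>u\<close> is chosen as the nearer end, whose coordinates differ from those of
  \<open>p\<close> by at most one half, and only at the edge carrying \<open>p\<close>.\<close>

lemma weight_bound:
  assumes S: "finite S" "S \<subseteq> carrier G" "generate G S = carrier G" and w: "inv_weight w"
    and p: "p \<in> pts" and e: "e \<in> edges T"
  shows "w e \<le> 2 * (\<Sum>a\<in>S. dw w p (pact a p))"
proof -
  obtain u where u: "u \<in> verts T" "u \<in> supp p"
    "\<And>f. f \<noteq> supp p \<Longrightarrow> cc f p = cc f (pt u)" "\<And>f. \<bar>cc f p - cc f (pt u)\<bar> \<le> 1 / 2"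
    using p
  proof (cases rule: pts_cases)
    case (vertex v)
    then show ?thesis using that[of v] by auto
  next
    case (edge a b s)
    note ab = edge_verts[OF edge(1)] and obt = that
    have *: thesis if x: "{a, b} \<in> edges T" "a \<noteq> b" "0 < s" "s \<le> 1 / 2" "p = mix a b s" for a b s
    proof -
      have "cc f p = cc f (pt a)" if "f \<noteq> {a, b}" for f
        using side_edge[OF x(1), of f] x that by (simp add: cc_mix algebra_simps)
      moreover have "\<bar>cc f p - cc f (pt a)\<bar> \<le> 1 / 2" for f
        using side_edge[OF x(1), of f] x by (auto simp: cc_mix)
      ultimately show thesis using obt[of a] x edge_verts[OF x(1)] supp_mix[of a b s] by auto
    qed
    show thesis
    proof (cases "s \<le> 1 / 2")
      case True
      then show ?thesis using *[of a b s] edge ab by auto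
    next
      case False
      then show ?thesis using *[of b a "1 - s"] edge ab mix_swap[of a b s] by (auto simp: insert_commute)
    qed
  qed
  obtain a k where ak: "a \<in> S" "k \<in> carrier G" "act T k ` e \<in> geo u (act T a u)"
    using generators_edge[OF S(2,3) u(1) e] by auto
  define f where "f = act T k ` e"
  have a: "a \<in> carrier G" using ak S by auto
  have f: "f \<in> edges T" "w f = w e" using w ak e unfolding f_def inv_weight_def by auto
  have 1: "\<bar>cc f (pt u) - cc f (pt (act T a u))\<bar> = 1"
    using geo_cocycle[of root u "act T a u" f] ak(3) a u(1) unfolding f_def by auto
  have sa: "supp (pact a p) = act T a ` supp p" using supp_pact a p by auto
  have 2: "\<bar>cc f (pact a p) - cc f (pt (act T a u))\<bar> \<le> 1 / 2 \<and>
      (f \<noteq> act T a ` supp p \<longrightarrow> cc f (pact a p) = cc f (pt (act T a u)))"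
  proof -
    define f' where "f' = act T (inv\<^bsub>G\<^esub> a) ` f"
    have f': "f' \<in> edges T" "f = act T a ` f'" using f a unfolding f'_def by auto
    have "\<bar>cc f (pact a p) - cc f (pact a (pt u))\<bar> = \<bar>cc f' p - cc f' (pt u)\<bar>"
      unfolding f'(2) using cc_act[OF a p f'(1)] cc_act[OF a _ f'(1), of "pt u"] u by auto
    then have eq: "\<bar>cc f (pact a p) - cc f (pt (act T a u))\<bar> = \<bar>cc f' p - cc f' (pt u)\<bar>" using a u(1) by simp
    show ?thesis
    proof (intro conjI impI)
      show "\<bar>cc f (pact a p) - cc f (pt (act T a u))\<bar> \<le> 1 / 2" using eq u(4)[of f'] by linarith
      assume "f \<noteq> act T a ` supp p"
      then have "f' \<noteq> supp p" using f' by auto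
      then show "cc f (pact a p) = cc f (pt (act T a u))" using eq u(3)[of f'] by linarith
    qed
  qed
  \<comment> \<open>Only one of the two roundings can concern \<open>f\<close>: otherwise
    \<open>a\<close> would preserve \<open>f\<close> and, there being no inversions, fix its end
    \<open>u\<close>.\<close>
  have 3: "\<not> (f = supp p \<and> f = act T a ` supp p)"
  proof
    assume "f = supp p \<and> f = act T a ` supp p"
    then have "act T a u = u" using edge_fixed[OF a f(1)] u by auto
    then show False using ak(3) geo_self u by auto
  qed
  have "\<bar>cc f p - cc f (pact a p)\<bar> \<ge> 1 / 2" using 1 2 3 u(3)[of f] u(4)[of f] by linarith
  then have "w f * (1 / 2) \<le> w f * \<bar>cc f p - cc f (pact a p)\<bar>"
    by (rule mult_left_mono) (use w f in \<open>auto simp: inv_weight_def\<close>)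
  also have "\<dots> \<le> dw w p (pact a p)"
  proof (cases "cc f p = cc f (pact a p)")
    case True
    then show ?thesis using dw_nonneg[of w p "pact a p"] inv_weight_nonneg[OF w] by auto
  next
    case False
    show ?thesis unfolding dw_def
      by (rule member_le_sum) (use False f cc_diff_finite[OF p, of "pact a p"] a p inv_weight_nonneg[OF w] in auto)
  qed
  also have "\<dots> \<le> (\<Sum>a\<in>S. dw w p (pact a p))"
    by (rule member_le_sum) (use ak S dw_nonneg[of w] inv_weight_nonneg[OF w] in auto)
  finally show ?thesis using f by auto
qed

text \<open>A vertex \<open>v\<close> of least displacement will do: if the path from
  \<open>v\<close> to its second image backtracked at \<open>act T g v\<close>, the next vertex
  \<open>v1\<close> on the way would be moved by two edges less. When the displacement is a single
  edge, backtracking is instead an inversion.\<close>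

lemma axis_vertex:
  assumes g: "g \<in> carrier G" and free: "\<And>v. v \<in> verts T \<Longrightarrow> act T g v \<noteq> v"
  shows "\<exists>v\<in>verts T. B (pt v) (pt (act T g v)) (pt (act T g (act T g v)))"
proof -
  define m where "m v = card (geo v (act T g v))" for v
  obtain v where v: "v \<in> verts T" "\<And>u. u \<in> verts T \<Longrightarrow> m v \<le> m u"
    using exists_least_iff[of "\<lambda>n. \<exists>v\<in>verts T. m v = n"] V_nonempty by (metis ex_in_conv linorder_not_less)
  let ?gv = "act T g v" and ?ggv = "act T g (act T g v)"
  have gv: "?gv \<in> verts T" "?ggv \<in> verts T" using v g by auto
  have ne: "?gv \<noteq> v" using free v by auto
  obtain z where z: "{z, ?gv} \<in> edges T" "{z, ?gv} \<in> geo v ?gv" "geo v z = geo v ?gv - {{z, ?gv}}"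
    using geo_last[OF v(1) gv(1)] ne by auto
  have zV: "z \<in> verts T" "z \<noteq> ?gv" using edge_verts[OF z(1)] by auto
  obtain v1 where v1: "{v1, v} \<in> edges T" "{v1, v} \<in> geo ?gv v"
    using geo_last[OF gv(1) v(1)] ne by auto
  have v1V: "v1 \<in> verts T" "v1 \<noteq> v" using edge_verts[OF v1(1)] by auto
  have v1': "{v, v1} \<in> edges T" "{v, v1} \<in> geo v ?gv" using v1 geo_sym[OF gv(1) v(1)] by (auto simp: insert_commute)
  have Bz: "B (pt v) (pt z) (pt ?gv)" using B_geo v gv zV z(3) by auto
  have Bv1: "B (pt v) (pt v1) (pt ?gv)" using geo_first_edge[OF v(1) gv(1) v1'] .
  have "B (pt v) (pt ?gv) (pt ?ggv)"
  proof (cases "z = act T g v1")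
    case False
    have "{?gv, act T g v1} \<in> edges T" "{?gv, act T g v1} \<in> geo ?gv ?ggv"
      using act_edge2[OF g v1'(1)] geo_act[OF g v(1) gv(1) v1'(1)] v1'(2) by auto
    moreover have "{?gv, z} \<in> edges T" "{?gv, z} \<in> geo ?gv v"
      using z geo_sym[OF gv(1) v(1)] by (auto simp: insert_commute)
    ultimately show ?thesis using B_different_branches[OF gv(1) v(1) gv(2)] False by auto
  next
    case True
    let ?d = "\<lambda>x y. dw (\<lambda>_. 1) (pt x) (pt y)"
    interpret ptree pts "dw (\<lambda>_. 1)" by (rule ptree_pts) auto
    have gv1: "act T g v1 \<in> verts T" using g v1V by auto
    have d1: "?d v v1 = 1" "?d z ?gv = 1" using dw_edge[OF v1'(1)] dw_edge[OF z(1)] by auto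
    have dz: "?d v z = real (m v) - 1"
      using dw_B[of "\<lambda>_. 1" "pt v" "pt z" "pt ?gv"] Bz d1 card_geo_dw[OF v(1) gv(1)] v gv zV unfolding m_def by auto
    have "m v1 \<ge> m v" using v v1V by auto
    moreover have "real (m v1) = ?d v1 z" using card_geo_dw[OF v1V(1) gv1] True unfolding m_def by auto
    ultimately have big: "?d v1 z \<ge> m v" by auto
    show ?thesis
    proof (cases "?d v v1 \<le> ?d v z")
      case le: True
      have "bt (pt v) (pt v1) (pt z)"
        by (rule bt_segment(1)[of "pt v" "pt ?gv"]) (use v gv v1V zV le Bv1 Bz bt_B in auto)
      then have "?d v1 z = ?d v z - ?d v v1" unfolding bt_def by auto
      then show ?thesis using big dz d1 by auto
    next
      case False
      then have "card (geo v z) = 0" using d1 card_geo_dw[OF v(1) zV(1)] by simp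
      then have "geo v z = {}" using finite_geo[of v z] by simp
      then have "z = v" using geo_empty v zV by auto
      then have "act T g v1 = v" using True by auto
      moreover have "?gv = v1"
      proof -
        have "{v, v1} \<in> {{v, ?gv}}" using v1'(2) geo_edge[of v ?gv] z(1) \<open>z = v\<close> by auto
        then show ?thesis using v1V ne by (auto simp: doubleton_eq_iff)
      qed
      ultimately show ?thesis using no_inversion[OF g v1'(1)] by auto
    qed
  qed
  then show ?thesis using v by auto
qed

lemma axis_line:
  assumes w: "inv_weight w" and g: "g \<in> carrier G" and x: "x \<in> pts"
    and bt: "dw w x (pact g x) + dw w (pact g x) (pact g (pact g x)) = dw w x (pact g (pact g x))"
    and pos: "0 < dw w x (pact g x)"
  shows "ptree_line pts (dw w) (\<lambda>i. pact (g [^]\<^bsub>G\<^esub> (i :: int)) x) (dw w x (pact g x))"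
proof -
  interpret ptree pts "dw w" by (rule ptree_pts) (rule inv_weight_nonneg[OF w])
  have 1: "pact (g [^]\<^bsub>G\<^esub> (i + 1)) x = pact (g [^]\<^bsub>G\<^esub> i) (pact g x)" for i :: int
    using int_pow_mult[OF g, of i 1] int_pow_1[OF g] pact_mult[of "g [^]\<^bsub>G\<^esub> i" g x] g x by simp
  have 2: "pact (g [^]\<^bsub>G\<^esub> (i + 2)) x = pact (g [^]\<^bsub>G\<^esub> i) (pact g (pact g x))" for i :: int
  proof -
    have "pact (g [^]\<^bsub>G\<^esub> (i + 2)) x = pact (g [^]\<^bsub>G\<^esub> (i + 1)) (pact g x)"
      using int_pow_mult[OF g, of "i + 1" 1] int_pow_1[OF g] pact_mult[of "g [^]\<^bsub>G\<^esub> (i + 1)" g x] g x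
      by (simp add: algebra_simps)
    also have "\<dots> = pact (g [^]\<^bsub>G\<^esub> i) (pact g (pact g x))"
      using int_pow_mult[OF g, of i 1] int_pow_1[OF g] pact_mult[of "g [^]\<^bsub>G\<^esub> i" g "pact g x"] g x by simp
    finally show ?thesis .
  qed
  show ?thesis
    by unfold_locales (use g x bt pos dw_act[OF w] in \<open>simp_all add: 1 2 bt_def\<close>)
qed

text \<open>Each side of an edge contains two vertices at positive distance, namely two consecutive
  points of a translate of the axis of \<open>g\<close>.\<close>

lemma branch_vertices:
  assumes w: "inv_weight w" and g: "g \<in> carrier G" and v: "v \<in> verts T"
    and ax: "B (pt v) (pt (act T g v)) (pt (act T g (act T g v)))" and pos: "0 < dw w (pt v) (pt (act T g v))"
    and k: "{u, u'} \<in> edges T"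
  shows "\<exists>z\<in>verts T. \<exists>z'\<in>verts T. {u, u'} \<in> geo u z \<and> {u, u'} \<in> geo u z' \<and> 0 < dw w (pt z) (pt z')"
proof -
  note uV = edge_verts[OF k]
  obtain h1 h2 where h: "h1 \<in> carrier G" "h2 \<in> carrier G" "{u, u'} \<in> geo (act T h1 v) (act T h2 v)"
    using hull_edge[OF v k] by auto
  obtain m where m: "m \<in> carrier G" "{u, u'} \<in> geo u (act T m v)"
    using h geo_cocycle[of u "act T h1 v" "act T h2 v" "{u, u'}"] v uV by auto
  let ?g' = "inv\<^bsub>G\<^esub> g"
  let ?b = "act T m v" and ?a = "act T m (act T ?g' v)" and ?c = "act T m (act T g v)"
  have V: "?a \<in> verts T" "?b \<in> verts T" "?c \<in> verts T" using m g v by auto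
  have "B (pact ?g' (pt v)) (pact ?g' (pt (act T g v))) (pact ?g' (pt (act T g (act T g v))))"
    by (rule B_act) (use g v ax in auto)
  then have "B (pt (act T ?g' v)) (pt v) (pt (act T g v))" using g v by simp
  then have "B (pact m (pt (act T ?g' v))) (pact m (pt v)) (pact m (pt (act T g v)))"
    by (rule B_act[rotated -1]) (use g v m in auto)
  then have B: "B (pt ?a) (pt ?b) (pt ?c)" using m g v by simp
  have dc: "dw w (pt ?b) (pt ?c) = dw w (pt v) (pt (act T g v))"
    using dw_act[OF w m(1), of "pt v" "pt (act T g v)"] m g v by simp
  have "dw w (pt ?b) (pt ?a) = dw w (pt v) (pt (act T ?g' v))"
    using dw_act[OF w m(1), of "pt v" "pt (act T ?g' v)"] m g v by simp
  also have "\<dots> = dw w (pt (act T g v)) (pt v)"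
    using dw_act[OF w g, of "pt v" "pt (act T ?g' v)"] g v by simp
  finally have da: "dw w (pt ?b) (pt ?a) = dw w (pt v) (pt (act T g v))" using dw_sym by metis
  have "{u, u'} \<in> geo u ?a \<or> {u, u'} \<in> geo u ?c"
    using geo_disjoint[OF V B, of "{u, u'}"] m(2) geo_cocycle[of u ?a ?b "{u, u'}"]
      geo_cocycle[of u ?b ?c "{u, u'}"] V uV by auto
  then show ?thesis
  proof
    assume "{u, u'} \<in> geo u ?a"
    then show ?thesis using m(2) V da pos by (intro bexI[of _ ?b] bexI[of _ ?a]) auto
  next
    assume "{u, u'} \<in> geo u ?c"
    then show ?thesis using m(2) V dc pos by (intro bexI[of _ ?b] bexI[of _ ?c]) auto
  qed
qed

text \<open>At a nonredundant vertex the tree cannot look like the interior of an edge, on which \<open>\<sigma>\<close>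
  is a coordinate.\<close>

lemma not_two_sided:
  assumes u: "u \<in> verts T" and ex: "\<exists>u'. {u, u'} \<in> edges T"
    and two: "\<And>a b. {a, b} \<in> edges T \<Longrightarrow>
      \<exists>z\<in>verts T. \<exists>z'\<in>verts T. {a, b} \<in> geo a z \<and> {a, b} \<in> geo a z' \<and> z \<noteq> z'"
    and br: "\<And>u'. {u, u'} \<in> edges T \<Longrightarrow> \<exists>z\<in>verts T. {u, u'} \<in> geo u z \<and> \<sigma> z \<noteq> (\<sigma> u :: real)"
    and mono: "\<And>z1 z2. z1 \<in> verts T \<Longrightarrow> z2 \<in> verts T \<Longrightarrow> B (pt z1) (pt u) (pt z2) \<Longrightarrow>
      between (\<sigma> z1) (\<sigma> u) (\<sigma> z2)"
    and equi: "\<And>g z. g \<in> carrier G \<Longrightarrow> act T g u = u \<Longrightarrow> z \<in> verts T \<Longrightarrow> \<sigma> (act T g z) = \<sigma> z"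
  shows False
proof -
  obtain u1 where u1: "{u, u1} \<in> edges T" using ex by auto
  obtain u2 where u2: "{u, u2} \<in> edges T" "u2 \<noteq> u1"
  proof -
    \<comment> \<open>Seen from \<open>u1\<close>, there is a vertex beyond \<open>u\<close>, hence
      a second edge at \<open>u\<close>.\<close>
    have u1': "{u1, u} \<in> edges T" using u1 by (simp add: insert_commute)
    from two[OF u1'] obtain z where z: "z \<in> verts T" "{u1, u} \<in> geo u1 z" "z \<noteq> u" by metis
    have "{u1, u} \<notin> geo u z"
      using geo_cocycle[of u u1 z "{u1, u}"] geo_edge[OF u1] edge_verts[OF u1] z u by (auto simp: insert_commute)
    moreover obtain m where m: "{m, u} \<in> edges T" "{m, u} \<in> geo z u" using geo_last[OF z(1) u] z(3) by auto
    ultimately have "m \<noteq> u1" using geo_sym[OF z(1) u] by auto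
    then show ?thesis using that[of m] m(1) by (simp add: insert_commute)
  qed
  obtain z1 where z1: "z1 \<in> verts T" "{u, u1} \<in> geo u z1" "\<sigma> z1 \<noteq> \<sigma> u" using br[OF u1] by auto
  obtain z2 where z2: "z2 \<in> verts T" "{u, u2} \<in> geo u z2" "\<sigma> z2 \<noteq> \<sigma> u" using br[OF u2(1)] by auto
  have "{d \<in> edges T. u \<in> d} = {{u, u1}, {u, u2}}"
  proof (intro equalityI subsetI)
    fix d assume "d \<in> {d \<in> edges T. u \<in> d}"
    then have d: "d \<in> edges T" "u \<in> d" by auto
    obtain a b where "d = {a, b}" using edge_ends[OF d(1)] by auto
    then obtain u3 where u3: "d = {u, u3}" "{u, u3} \<in> edges T" using d by (metis insert_commute insert_iff singletonD)
    obtain z3 where z3: "z3 \<in> verts T" "{u, u3} \<in> geo u z3" "\<sigma> z3 \<noteq> \<sigma> u" using br[OF u3(2)] by auto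
    have "u3 = u1 \<or> u3 = u2"
    proof (rule ccontr)
      assume n: "\<not> ?thesis"
      \<comment> \<open>On the real line two of the three values lie on the same side of
        \<open>\<sigma> u\<close>, whereas \<open>u\<close> is between any two of the three
        vertices.\<close>
      have "between (\<sigma> z1) (\<sigma> u) (\<sigma> z2)"
        using mono B_different_branches[OF u z1(1) z2(1) u1 u2(1) _ z1(2) z2(2)] z1 z2 u2 by auto
      moreover have "between (\<sigma> z1) (\<sigma> u) (\<sigma> z3)"
        using mono B_different_branches[OF u z1(1) z3(1) u1 u3(2) _ z1(2) z3(2)] z1 z3 n by auto
      moreover have "between (\<sigma> z2) (\<sigma> u) (\<sigma> z3)"
        using mono B_different_branches[OF u z2(1) z3(1) u2(1) u3(2) _ z2(2) z3(2)] z2 z3 n by auto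
      ultimately show False using z1(3) z2(3) z3(3) unfolding between_iff by auto
    qed
    then show "d \<in> {{u, u1}, {u, u2}}" using u3 by auto
  qed (use u1 u2 in auto)
  moreover have "{u, u1} \<noteq> {u, u2}" using u2(2) by (auto simp: doubleton_eq_iff)
  ultimately obtain g where g: "g \<in> carrier G" "act T g u = u" "act T g ` {u, u1} = {u, u2}"
    using nonredundant[OF u] by metis
  \<comment> \<open>The element \<open>g\<close> carries the first branch to the second and
    preserves \<open>\<sigma>\<close>, so that a single value would lie on both sides of
    \<open>\<sigma> u\<close>.\<close>
  have "{u, u2} \<in> geo u (act T g z1)" using geo_act[OF g(1) u z1(1) u1] g z1(2) by auto
  then have "B (pt z1) (pt u) (pt (act T g z1))"
    using B_different_branches[OF u z1(1) _ u1 u2(1) _ z1(2)] g z1 u2 by auto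
  then have "between (\<sigma> z1) (\<sigma> u) (\<sigma> z1)" using mono[OF z1(1) act_in[OF g(1) z1(1)]] equi[OF g(1,2) z1(1)] by auto
  then show False using z1(3) unfolding between_iff by auto
qed

end

section \<open>Confining almost minimally displaced points\<close>

context ptree_line
begin

lemma compatible_line:
  fixes \<epsilon> :: real
  assumes e: "compatible e" and step: "\<And>i. e (q i) (q (i + 1)) = \<epsilon>" and ij: "i \<le> j"
  shows "e (q i) (q j) = (j - i) * \<epsilon>"
  using ij
proof (induction j rule: int_ge_induct)
  case base
  have "bt (q i) (q i) (q (i + 1))" using bt_triv q_in by auto
  then have "e (q i) (q i) + e (q i) (q (i + 1)) = e (q i) (q (i + 1))"
    using e q_in unfolding compatible_def by simp
  then show ?case by simp
next
  case (step j)
  have "e (q i) (q j) + e (q j) (q (j + 1)) = e (q i) (q (j + 1))"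
    using e q_in q_bt[of i j "j + 1"] step(1) unfolding compatible_def by simp
  then show ?case using step assms(2)[of j] by (simp add: algebra_simps)
qed

lemma bt_widen:
  assumes "r \<in> M" "bt (q (- N)) r (q N)" "0 \<le> N" "N \<le> N'"
  shows "bt (q (- N')) r (q N')"
proof -
  have "bt (q N) r (q (- N))" "bt (q N) (q (- N)) (q (- N'))"
    using bt_sym[of "q (- N)" r "q N"] bt_sym[OF q_in q_in q_in q_bt[of "- N'" "- N" N]] q_in assms by auto
  then have "bt (q N) r (q (- N'))" using bt_trans(1)[of "q N" "q (- N)" r "q (- N')"] q_in assms(1) by auto
  then have "bt (q (- N')) r (q N)" using bt_sym[of "q N" r "q (- N')"] q_in assms(1) by auto
  then show ?thesis
    using bt_trans(1)[of "q (- N')" "q N" r "q N'"] q_bt[of "- N'" N N'] q_in assms by auto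
qed

end

context ptree_line_isometry
begin

text \<open>From \<open>q K\<close> on, the ray either moves away from the characteristic set of \<open>h\<close> or stays in it.\<close>

definition ray_type :: "int \<Rightarrow> bool" where
  "ray_type K \<longleftrightarrow> (\<forall>r\<in>M. \<forall>j\<ge>K. bt (q K) r (q j) \<longrightarrow> good r (q K) \<and> \<not> ch (q K)) \<or>
       (\<forall>r\<in>M. \<forall>j\<ge>K. bt (q K) r (q j) \<longrightarrow> ch r)"

text \<open>Beyond \<open>q K1\<close>, the point \<open>r\<close> has \<open>e\<close>-distance at
  least \<open>(K1 - K) * \<epsilon>\<close> from \<open>q K\<close>. If the ray recedes from the
  characteristic set, the displacement is at least twice that and exceeds \<open>C\<close>; if the
  ray stays in the set, the displacement by the square of \<open>h\<close> is twice that by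
  \<open>h\<close>, against \<open>pos\<close>.\<close>

lemma ray_trap:
  fixes C \<epsilon> :: real
  assumes K: "ray_type K" and e: "compatible e"
    and inv: "\<And>x y. x \<in> M \<Longrightarrow> y \<in> M \<Longrightarrow> e (h x) (h y) = e x y"
    and step: "\<And>i. e (q i) (q (i + 1)) = \<epsilon>"
    and r: "r \<in> M" "K \<le> K1" "K1 \<le> j" "bt (q K1) r (q j)"
    and C: "e r (h r) \<le> C" "C < 2 * (K1 - K) * \<epsilon>" and pos: "e r (h (h r)) < 2 * e r (h r)"
  shows False
proof -
  have add: "\<And>x y z. x \<in> M \<Longrightarrow> y \<in> M \<Longrightarrow> z \<in> M \<Longrightarrow> bt x y z \<Longrightarrow> e x y + e y z = e x z"
    and s: "\<And>x y. x \<in> M \<Longrightarrow> y \<in> M \<Longrightarrow> e x y = e y x" and n: "\<And>x y. x \<in> M \<Longrightarrow> y \<in> M \<Longrightarrow> 0 \<le> e x y"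
    using e unfolding compatible_def by auto
  have b: "bt (q j) (q K1) (q K)" "bt (q j) r (q K1)"
    using bt_sym[OF q_in q_in q_in q_bt[of K K1 j]] bt_sym[OF q_in r(1) q_in r(4)] r by auto
  have 1: "bt (q j) r (q K)" "bt r (q K1) (q K)"
    using bt_trans[OF q_in q_in r(1) q_in b] by auto
  then have bK: "bt (q K) r (q j)" using bt_sym[OF q_in r(1) q_in] by auto
  have Kj: "K \<le> j" using r by auto
  from K[unfolded ray_type_def] show False
  proof
    assume "\<forall>r\<in>M. \<forall>j\<ge>K. bt (q K) r (q j) \<longrightarrow> good r (q K) \<and> \<not> ch (q K)"
    then have g: "good r (q K)" "\<not> ch (q K)" using r(1) Kj bK by auto
    have "e r (h r) = e (q K) (h (q K)) + 2 * e r (q K)"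
      using good_displacement[OF q_in r(1) g(2,1) e inv] .
    moreover have "e r (q K) = e r (q K1) + e (q K1) (q K)" using add[OF r(1) q_in q_in 1(2)] by simp
    moreover have "e (q K1) (q K) = (K1 - K) * \<epsilon>"
      using compatible_line[OF e step r(2)] s[OF q_in q_in] by simp
    moreover have "0 \<le> e (q K) (h (q K))" "0 \<le> e r (q K1)" using n q_in h_in r by auto
    ultimately show False using C by auto
  next
    assume "\<forall>r\<in>M. \<forall>j\<ge>K. bt (q K) r (q j) \<longrightarrow> ch r"
    then have "ch r" using r(1) Kj bK by auto
    then have "e (h' r) r + e r (h r) = e (h' r) (h r)" using add[OF h'_in r(1) h_in] r unfolding ch_def by auto
    moreover have "e (h' r) r = e r (h r)" using inv[of "h' r" r] r h'_in hh' by auto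
    moreover have "e (h' r) (h r) = e r (h (h r))" using inv[of "h' r" "h r"] r h'_in h_in hh' by auto
    ultimately show False using pos by auto
  qed
qed

end

context gtr
begin

lemma compatible_dw: "inv_weight w \<Longrightarrow> ptree.compatible pts (dw (\<lambda>_. 1)) (dw w)"
proof -
  assume w: "inv_weight w"
  interpret ptree pts "dw (\<lambda>_. 1)" by (rule ptree_pts) auto
  note nn = inv_weight_nonneg[OF w]
  show ?thesis unfolding compatible_def
    using dw_nonneg[of w] dw_sym[of w] dw_tri[of w] dw_B[of w] nn bt_B by auto
qed

text \<open>The number \<open>Dg\<close> is twice the distance of \<open>p\<close> from the axis of \<open>g\<close>, on which \<open>q\<close> lies, and \<open>Dh > 0\<close>
  means that \<open>p\<close> is outside the characteristic set of \<open>h\<close>. Far out on the axis, such a point near the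
  axis would be moved by \<open>h\<close> by more than \<open>C\<close>.\<close>

lemma axis_trap:
  assumes g: "g \<in> carrier G" and h: "h \<in> carrier G" and q: "q \<in> verts T"
    and ax: "B (pt q) (pt (act T g q)) (pt (act T g (act T g q)))" and ne: "act T g q \<noteq> q" and \<mu>: "0 < \<mu>"
  shows "\<exists>F. finite F \<and> F \<subseteq> verts T \<and>
    (\<forall>w p. inv_weight w \<longrightarrow> p \<in> pts \<longrightarrow>
      (let Dg = 2 * dw w p (pact g p) - dw w p (pact g (pact g p));
           Dh = 2 * dw w p (pact h p) - dw w p (pact h (pact h p)) in
       \<mu> \<le> dw w p (pact g p) - Dg \<and> dw w p (pact h p) + Dg \<le> C \<and> 3 * Dg < Dh \<longrightarrow>
       (\<exists>r\<in>pts. supp r \<subseteq> F \<and> 2 * dw w p r = Dg)))"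
proof -
  define Q where "Q i = pact (g [^]\<^bsub>G\<^esub> (i :: int)) (pt q)" for i
  let ?d = "dw (\<lambda>_. 1 :: real)"
  have gq: "act T g q \<in> verts T" "act T g (act T g q) \<in> verts T" using g q by auto
  interpret L: ptree_line pts ?d Q "?d (pt q) (pact g (pt q))"
    unfolding Q_def
  proof (rule axis_line[OF inv_weight_one g])
    show "?d (pt q) (pact g (pt q)) + ?d (pact g (pt q)) (pact g (pact g (pt q))) = ?d (pt q) (pact g (pact g (pt q)))"
      using dw_B[of "\<lambda>_. 1", OF _ _ _ _ ax] g q by simp
    show "0 < ?d (pt q) (pact g (pt q))" using dw_one_pos[of "pt q" "pt (act T g q)"] ne g q by auto
  qed (use q in auto)
  interpret Ig: ptree_isometry pts ?d "pact g" "pact (inv\<^bsub>G\<^esub> g)" by (rule isometry_pact[OF inv_weight_one g])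
  interpret Ih: ptree_isometry pts ?d "pact h" "pact (inv\<^bsub>G\<^esub> h)" by (rule isometry_pact[OF inv_weight_one h])
  interpret Lh: ptree_line_isometry pts ?d "pact h" "pact (inv\<^bsub>G\<^esub> h)" Q "?d (pt q) (pact g (pt q))" ..
  interpret R: ptree_line pts ?d "\<lambda>i. Q (- i)" "?d (pt q) (pact g (pt q))" by (rule L.reverse_line)
  interpret Rh: ptree_line_isometry pts ?d "pact h" "pact (inv\<^bsub>G\<^esub> h)" "\<lambda>i. Q (- i)" "?d (pt q) (pact g (pt q))" ..
  obtain K where K: "Lh.ray_type K" using Lh.ray_dichotomy unfolding Lh.ray_type_def by auto
  obtain K' where K': "Rh.ray_type K'" using Rh.ray_dichotomy unfolding Rh.ray_type_def by auto
  \<comment> \<open>More than \<open>\<bar>C\<bar> / \<mu>\<close> steps beyond both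
    \<open>K\<close> and \<open>K'\<close>. Steps turn out to have length at least
    \<open>\<mu>\<close>, so the bound in \<open>ray_trap\<close> is exceeded on both rays.\<close>
  define K1 where "K1 = max \<bar>K\<bar> \<bar>K'\<bar> + \<lceil>\<bar>C\<bar> / \<mu>\<rceil> + 1"
  have CK: "C < 2 * (K1 - K) * \<epsilon>" "C < 2 * (K1 - K') * \<epsilon>" if "\<mu> \<le> \<epsilon>" for \<epsilon> :: real
  proof -
    have *: "C < 2 * (K1 - k) * \<epsilon>" if k: "real_of_int k \<le> max \<bar>K\<bar> \<bar>K'\<bar>" for k :: int
    proof -
      have "real_of_int K1 = max \<bar>K\<bar> \<bar>K'\<bar> + \<lceil>\<bar>C\<bar> / \<mu>\<rceil> + 1" unfolding K1_def by simp
      then have a: "K1 - k > \<bar>C\<bar> / \<mu>" using le_of_int_ceiling[of "\<bar>C\<bar> / \<mu>"] k by linarith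
      then have "\<bar>C\<bar> < (K1 - k) * \<mu>" using \<mu> by (simp add: field_simps)
      also have "\<dots> \<le> (K1 - k) * \<epsilon>"
      proof (rule mult_left_mono)
        have "0 \<le> \<bar>C\<bar> / \<mu>" using \<mu> by simp
        then show "0 \<le> real_of_int (K1 - k)" using a by linarith
      qed (rule \<open>\<mu> \<le> \<epsilon>\<close>)
      finally have "\<bar>C\<bar> < (K1 - k) * \<epsilon>" .
      moreover have "2 * (K1 - k) * \<epsilon> = 2 * ((K1 - k) * \<epsilon>)" by simp
      ultimately show ?thesis by linarith
    qed
    show "C < 2 * (K1 - K) * \<epsilon>" "C < 2 * (K1 - K') * \<epsilon>" by (rule *; simp)+
  qed
  have "0 \<le> \<bar>C\<bar> / \<mu>" using \<mu> by simp
  then have "0 \<le> \<lceil>\<bar>C\<bar> / \<mu>\<rceil>" by (metis ceiling_mono ceiling_zero)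
  then have K1: "K \<le> K1" "K' \<le> K1" "0 \<le> K1" unfolding K1_def by linarith+
  define v where "v i = act T (g [^]\<^bsub>G\<^esub> (i :: int)) q" for i
  have v: "v i \<in> verts T" "Q i = pt (v i)" for i unfolding v_def Q_def using g q by auto
  \<comment> \<open>The vertices of the segment from \<open>v (- K1)\<close> to \<open>v K1\<close>.
    They depend on the combinatorial tree, on \<open>g\<close>, \<open>h\<close>, \<open>q\<close>
    and on \<open>\<mu>\<close>, \<open>C\<close>, but neither on the lengths nor on
    \<open>p\<close>.\<close>
  define F where "F = insert (v (- K1)) (\<Union>(geo (v (- K1)) (v K1)))"
  have F: "finite F" "F \<subseteq> verts T"
  proof -
    have "finite e \<and> e \<subseteq> verts T" if "e \<in> geo (v (- K1)) (v K1)" for e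
      using edge_ends[OF geo_in_E[OF v(1) v(1) that]] by auto
    then show "finite F" "F \<subseteq> verts T" unfolding F_def using finite_geo v(1) by auto
  qed
  have main: "\<exists>r\<in>pts. supp r \<subseteq> F \<and> 2 * dw w p r = Dg"
    if w: "inv_weight w" and p: "p \<in> pts"
      and Dg: "Dg = 2 * dw w p (pact g p) - dw w p (pact g (pact g p))"
      and Dh: "Dh = 2 * dw w p (pact h p) - dw w p (pact h (pact h p))"
      and asm: "\<mu> \<le> dw w p (pact g p) - Dg" "dw w p (pact h p) + Dg \<le> C" "3 * Dg < Dh" for w p Dg Dh
  proof -
    let ?e = "dw w"
    have e: "L.compatible ?e" by (rule compatible_dw[OF w])
    have add: "\<And>x y z. x \<in> pts \<Longrightarrow> y \<in> pts \<Longrightarrow> z \<in> pts \<Longrightarrow> L.bt x y z \<Longrightarrow> ?e x y + ?e y z = ?e x z"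
      and s: "\<And>x y. x \<in> pts \<Longrightarrow> y \<in> pts \<Longrightarrow> ?e x y = ?e y x"
      and tr: "\<And>x y z. x \<in> pts \<Longrightarrow> y \<in> pts \<Longrightarrow> z \<in> pts \<Longrightarrow> ?e x z \<le> ?e x y + ?e y z"
      using e unfolding L.compatible_def by auto
    obtain r N where r: "r \<in> pts" "L.bt p r (Q (- N))" "L.bt p r (Q N)" "L.bt (Q (- N)) r (Q N)"
      "?d r (Q N) > 0" "?d r (Q (- N)) > 0" "N \<ge> 1"
      using Lh.projection_exists[OF p] by auto
    have Qshift: "pact g (Q i) = Q (i + 1)" "pact (g \<otimes>\<^bsub>G\<^esub> g) (Q i) = Q (i + 2)" for i
    proof -
      have 1: "pact g (Q i) = Q (i + 1)" for i
        unfolding Q_def using int_pow_mult[OF g, of 1 i] int_pow_1[OF g] pact_mult[of g "g [^]\<^bsub>G\<^esub> i" "pt q"] g q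
        by (simp add: add.commute)
      then show "pact g (Q i) = Q (i + 1)" .
      show "pact (g \<otimes>\<^bsub>G\<^esub> g) (Q i) = Q (i + 2)" using pact_mult[OF g g L.q_in, of i] 1 by (simp add: add.assoc)
    qed
    have gg: "g \<otimes>\<^bsub>G\<^esub> g \<in> carrier G" using g by auto
    interpret Lg: ptree_line_isometry pts ?d "pact g" "pact (inv\<^bsub>G\<^esub> g)" Q "?d (pt q) (pact g (pt q))" ..
    interpret Igg: ptree_isometry pts ?d "pact (g \<otimes>\<^bsub>G\<^esub> g)" "pact (inv\<^bsub>G\<^esub> (g \<otimes>\<^bsub>G\<^esub> g))"
      by (rule isometry_pact[OF inv_weight_one gg])
    interpret Lgg: ptree_line_isometry pts ?d "pact (g \<otimes>\<^bsub>G\<^esub> g)" "pact (inv\<^bsub>G\<^esub> (g \<otimes>\<^bsub>G\<^esub> g))" Q "?d (pt q) (pact g (pt q))" ..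
    have N: "0 \<le> N" using r(7) by auto
    note s1 = Lg.shift_projection_step[OF Qshift(1) _ p r(1-6) N]
    note s2 = Lgg.shift_projection_step[OF Qshift(2) _ p r(1-6) N]
    have P: "pact g p \<in> pts" "pact g r \<in> pts" "pact (g \<otimes>\<^bsub>G\<^esub> g) p \<in> pts" "pact (g \<otimes>\<^bsub>G\<^esub> g) r \<in> pts"
      using g gg p r by auto
    have displ: "?e p (pact k p) = 2 * ?e p r + ?e r (pact k r)"
      if k: "k \<in> carrier G" "L.bt p r (pact k p)" "L.bt p (pact k r) (pact k p)" "L.bt p r (pact k r)" for k
    proof -
      have "?e (pact k r) (pact k p) = ?e p r" using dw_act[OF w k(1) r(1) p] s[OF p r(1)] by simp
      then show ?thesis
        using add[OF p _ _ k(3)] add[OF p r(1) _ k(4)] k(1) p r(1) by auto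
    qed
    have e1: "?e p (pact g p) = 2 * ?e p r + ?e r (pact g r)" by (rule displ[OF g]; rule s1; simp)
    have e2: "?e p (pact (g \<otimes>\<^bsub>G\<^esub> g) p) = 2 * ?e p r + ?e r (pact (g \<otimes>\<^bsub>G\<^esub> g) r)"
      by (rule displ[OF gg]; rule s2; simp)
    have "?d r (pact g r) = ?d (pt q) (pact g (pt q))" using s1(4) by simp
    moreover have "?d r (pact (g \<otimes>\<^bsub>G\<^esub> g) r) = 2 * ?d (pt q) (pact g (pt q))" using s2(4) by simp
    moreover have "?d (pact g r) (pact (g \<otimes>\<^bsub>G\<^esub> g) r) = ?d r (pact g r)"
      using pact_mult[OF g g r(1)] dw_act[OF inv_weight_one g r(1) P(2)] by simp
    ultimately have "L.bt r (pact g r) (pact (g \<otimes>\<^bsub>G\<^esub> g) r)" unfolding L.bt_def by auto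
    then have "?e r (pact (g \<otimes>\<^bsub>G\<^esub> g) r) = 2 * ?e r (pact g r)"
      using add[OF r(1) P(2,4)] pact_mult[OF g g r(1)] dw_act[OF w g r(1) P(2)] by simp
    \<comment> \<open>The displacement of \<open>p\<close> by \<open>g\<close> is
      \<open>2 * ?e p r + ?e r (pact g r)\<close>; for the square of \<open>g\<close> the second
      term is doubled. Twice the first displacement minus the second leaves
      \<open>2 * ?e p r\<close>.\<close>
    then have pr: "2 * ?e p r = Dg" using e1 e2 Dg pact_mult[OF g g p] by simp
    define \<epsilon> where "\<epsilon> = ?e (pt q) (pact g (pt q))"
    have st: "?e (Q i) (Q (i + 1)) = \<epsilon>" for i
    proof -
      have "Q (i + 1) = pact (g [^]\<^bsub>G\<^esub> i) (pact g (pt q))"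
        unfolding Q_def using int_pow_mult[OF g, of i 1] int_pow_1[OF g] pact_mult[of "g [^]\<^bsub>G\<^esub> i" g "pt q"] g q by simp
      then show ?thesis unfolding \<epsilon>_def Q_def using dw_act[OF w, of "g [^]\<^bsub>G\<^esub> i" "pt q" "pact g (pt q)"] g q by simp
    qed
    \<comment> \<open>The projection \<open>r\<close> is moved by at most the length
      \<open>\<epsilon>\<close> of one step of the axis, and its displacement is that of
      \<open>p\<close> minus \<open>Dg\<close>.\<close>
    have "\<mu> \<le> \<epsilon>"
    proof -
      have "?e (Q (- N)) r + ?e r (pact g r) = ?e (Q (- N)) (pact g r)"
        by (rule add[OF L.q_in r(1) P(2)]) (rule s1, simp)
      also have "\<dots> \<le> ?e (Q (- N)) (Q (- N + 1)) + ?e (Q (- N + 1)) (pact g r)"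
        using tr L.q_in P(2) by blast
      also have "?e (Q (- N + 1)) (pact g r) = ?e (Q (- N)) r"
        using dw_act[OF w g L.q_in r(1), of "- N"] Qshift(1) by simp
      finally have "?e r (pact g r) \<le> \<epsilon>" using st[of "- N"] by linarith
      then show ?thesis using asm(1) e1 pr by simp
    qed
    note CK = CK[OF this, unfolded of_int_mult of_int_diff of_int_numeral]
    have Hr: "pact h r \<in> pts" "pact h (pact h r) \<in> pts" "pact h p \<in> pts" "pact h (pact h p) \<in> pts" using h r p by auto
    have hC: "?e r (pact h r) \<le> C"
      using tr[OF r(1) p Hr(1)] tr[OF p Hr(3,1)] dw_act[OF w h p r(1)] s[OF r(1) p] pr asm(2) by linarith
    \<comment> \<open>Passing from \<open>p\<close> to \<open>r\<close> changes each displacement by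
      at most \<open>Dg\<close>. This is incurred once for the square of \<open>h\<close> and twice
      for \<open>h\<close>, whence the factor \<open>3\<close> in the hypothesis.\<close>
    have hpos: "?e r (pact h (pact h r)) < 2 * ?e r (pact h r)"
    proof -
      have "?e (pact h (pact h p)) (pact h (pact h r)) = ?e p r"
        using dw_act[OF w h Hr(3,1)] dw_act[OF w h p r(1)] by simp
      then have "?e r (pact h (pact h r)) \<le> ?e p (pact h (pact h p)) + 2 * ?e p r"
        using tr[OF r(1) p Hr(2)] tr[OF p Hr(4,2)] s[OF r(1) p] by linarith
      moreover have "?e p (pact h p) \<le> ?e r (pact h r) + 2 * ?e p r"
        using tr[OF p r(1) Hr(3)] tr[OF r(1) Hr(1,3)] dw_act[OF w h r(1) p] s[OF r(1) p] by linarith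
      ultimately show ?thesis using asm(3) Dh pr by linarith
    qed
    define N' where "N' = max N K1"
    have wide: "L.bt (Q (- N')) r (Q N')" by (rule L.bt_widen[OF r(1,4) N]) (simp add: N'_def)
    have NK: "K1 \<le> N'" unfolding N'_def by auto
    have no: "\<not> L.bt (Q K1) r (Q N')"
      using Lh.ray_trap[OF K e dw_act[OF w h] st r(1) K1(1) NK _ hC CK(1) hpos] by auto
    have no': "\<not> L.bt (Q (- K1)) r (Q (- N'))"
    proof -
      have "?e (Q (- i)) (Q (- (i + 1))) = \<epsilon>" for i using st[of "- i - 1"] s[OF L.q_in L.q_in] by simp
      then show ?thesis
        using Rh.ray_trap[OF K' e dw_act[OF w h] _ r(1) K1(2) NK _ hC CK(2) hpos] by auto
    qed
    have Bm: "L.bt (Q (- N')) (Q (- K1)) (Q N')" "L.bt (Q (- N')) (Q K1) (Q N')"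
      using L.q_bt[of "- N'" "- K1" N'] L.q_bt[of "- N'" K1 N'] NK K1(3) by auto
    have 1: "L.bt (Q (- N')) (Q (- K1)) r"
    proof (cases "?d (Q (- N')) (Q (- K1)) \<le> ?d (Q (- N')) r")
      case True
      then show ?thesis using L.bt_segment(1)[OF L.q_in L.q_in L.q_in r(1) Bm(1) wide] by auto
    next
      case False
      then have "L.bt (Q (- N')) r (Q (- K1))" using L.bt_segment(1)[OF L.q_in L.q_in r(1) L.q_in wide Bm(1)] by auto
      then show ?thesis using no' L.bt_sym[OF L.q_in r(1) L.q_in] by auto
    qed
    have 2: "L.bt (Q (- N')) r (Q K1)"
    proof (cases "?d (Q (- N')) r \<le> ?d (Q (- N')) (Q K1)")
      case True
      then show ?thesis using L.bt_segment(1)[OF L.q_in L.q_in r(1) L.q_in wide Bm(2)] by auto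
    next
      case False
      then have "L.bt (Q K1) r (Q N')" using L.bt_segment(2)[OF L.q_in L.q_in L.q_in r(1) Bm(2) wide] by auto
      then show ?thesis using no by auto
    qed
    have "L.bt (Q (- K1)) r (Q K1)" using L.bt_trans(2)[OF L.q_in r(1) L.q_in L.q_in 2 1] .
    then have B: "B (pt (v (- K1))) r (pt (v K1))" using bt_B[OF L.q_in r(1) L.q_in] v by auto
    have "a \<in> F" if a: "a \<in> supp r" for a
    proof (cases "a = v (- K1)")
      case False
      have aV: "a \<in> verts T" using a supp_pts(2)[OF r(1)] by auto
      have "geo (v (- K1)) a \<subseteq> geo (v (- K1)) (v K1)" using B_supp[OF v(1) v(1) r(1) B a] .
      moreover obtain m where "{m, a} \<in> geo (v (- K1)) a" using geo_last[OF v(1)[of "- K1"] aV] False by auto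
      ultimately show ?thesis unfolding F_def by auto
    qed (simp add: F_def)
    then show ?thesis using r(1) pr by auto
  qed
  show ?thesis unfolding Let_def using F main by (intro exI[of _ F]) blast
qed

end

section \<open>Trees with the same orbit metric\<close>

text \<open>A point of \<open>M1\<close> lies on a segment between two points of the family
  \<open>x\<close>, and \<open>\<theta>\<close> sends it to the same place on the corresponding
  segment in \<open>M2\<close>. By \<open>bt_max\<close>, all distances to the family and between
  images are then forced, whichever segments are chosen.\<close>

lemma orbit_map:
  assumes "ptree M1 d1" "ptree M2 d2"
    and x: "\<And>i. i \<in> I \<Longrightarrow> x i \<in> M1" and p: "\<And>i. i \<in> I \<Longrightarrow> p i \<in> M2"
    and eq: "\<And>i j. i \<in> I \<Longrightarrow> j \<in> I \<Longrightarrow> d1 (x i) (x j) = d2 (p i) (p j)"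
    and hull: "\<And>y. y \<in> M1 \<Longrightarrow> \<exists>i\<in>I. \<exists>j\<in>I. d1 (x i) y + d1 y (x j) = d1 (x i) (x j)"
  shows "\<exists>\<theta>. (\<forall>y\<in>M1. \<theta> y \<in> M2) \<and> (\<forall>y\<in>M1. \<forall>z\<in>M1. d2 (\<theta> y) (\<theta> z) = d1 y z) \<and>
    (\<forall>y\<in>M1. \<forall>i\<in>I. d2 (p i) (\<theta> y) = d1 (x i) y)"
proof -
  interpret A: ptree M1 d1 by fact
  interpret B: ptree M2 d2 by fact
  define ok where "ok y m \<longleftrightarrow> m \<in> M2 \<and> (\<exists>i\<in>I. \<exists>j\<in>I. A.bt (x i) y (x j) \<and> B.bt (p i) m (p j) \<and>
    d2 (p i) m = d1 (x i) y \<and> d2 (p j) m = d1 (x j) y)" for y m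
  have "\<exists>m. ok y m" if y: "y \<in> M1" for y
  proof -
    obtain i j where ij: "i \<in> I" "j \<in> I" "d1 (x i) y + d1 y (x j) = d1 (x i) (x j)" using hull[OF y] by auto
    have "0 \<le> d1 (x i) y" "d1 (x i) y \<le> d2 (p i) (p j)"
      using A.nonneg[OF x y] A.nonneg[OF y x] ij eq[OF ij(1,2)] by (auto, smt (verit))
    then obtain m where m: "m \<in> M2" "d2 (p i) m = d1 (x i) y" "d2 m (p j) = d2 (p i) (p j) - d1 (x i) y"
      using B.geod[OF p[OF ij(1)] p[OF ij(2)]] by blast
    have "d2 (p j) m = d1 (x j) y"
      using m ij eq[OF ij(1,2)] B.sym[OF m(1) p[OF ij(2)]] A.sym[OF y x[OF ij(2)]] by auto
    then have "A.bt (x i) y (x j) \<and> B.bt (p i) m (p j) \<and> d2 (p i) m = d1 (x i) y \<and> d2 (p j) m = d1 (x j) y"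
      using m ij unfolding A.bt_def B.bt_def by auto
    then show ?thesis using m(1) ij(1,2) unfolding ok_def by blast
  qed
  then obtain \<theta> where \<theta>: "\<And>y. y \<in> M1 \<Longrightarrow> ok y (\<theta> y)" by metis
  have 1: "d2 (p k) (\<theta> y) = d1 (x k) y" if y: "y \<in> M1" and k: "k \<in> I" for y k
  proof -
    obtain i j where ij: "i \<in> I" "j \<in> I" "A.bt (x i) y (x j)" "B.bt (p i) (\<theta> y) (p j)"
      "d2 (p i) (\<theta> y) = d1 (x i) y" "d2 (p j) (\<theta> y) = d1 (x j) y" and m: "\<theta> y \<in> M2"
      using \<theta>[OF y] unfolding ok_def by auto
    show ?thesis
      using B.bt_max[OF p[OF ij(1)] p[OF ij(2)] m p[OF k] ij(4)] A.bt_max[OF x[OF ij(1)] x[OF ij(2)] y x[OF k] ij(3)]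
        eq ij k B.sym[OF m p[OF k]] A.sym[OF y x[OF k]] by auto
  qed
  have "d2 (\<theta> y) (\<theta> z) = d1 y z" if y: "y \<in> M1" and z: "z \<in> M1" for y z
  proof -
    obtain i j where ij: "i \<in> I" "j \<in> I" "A.bt (x i) y (x j)" "B.bt (p i) (\<theta> y) (p j)"
      "d2 (p i) (\<theta> y) = d1 (x i) y" "d2 (p j) (\<theta> y) = d1 (x j) y" and m: "\<theta> y \<in> M2"
      using \<theta>[OF y] unfolding ok_def by auto
    have "\<theta> z \<in> M2" using \<theta>[OF z] unfolding ok_def by auto
    then show ?thesis
      using B.bt_max[OF p[OF ij(1)] p[OF ij(2)] m _ ij(4)] A.bt_max[OF x[OF ij(1)] x[OF ij(2)] y z ij(3)]
        1[OF z] ij by auto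
  qed
  then show ?thesis using 1 \<theta> unfolding ok_def by blast
qed

locale mtr = gtr G T for G :: "('g, 'b) monoid_scheme" and T :: "('g, 'v) metric_gtree" +
  assumes metric: "is_metric_gtree G T"
begin

lemma len_pos: "e \<in> edges T \<Longrightarrow> 0 < len T e" using metric unfolding is_metric_gtree_def by auto

lemma inv_weight_len: "inv_weight (len T)"
  using metric unfolding is_metric_gtree_def inv_weight_def by (auto intro: less_imp_le)

abbreviation td :: "('v \<Rightarrow> real) \<Rightarrow> ('v \<Rightarrow> real) \<Rightarrow> real" where "td \<equiv> dw (len T)"

lemma points_eq: "points T = pts" by (rule points_pts[OF tree])

lemma point_dist_eq: "x \<in> pts \<Longrightarrow> y \<in> pts \<Longrightarrow> point_dist T x y = td x y"
  using point_dist_dw[OF tree] len_pos points_eq by (metis less_imp_le)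

lemma td_eq_0: "x \<in> pts \<Longrightarrow> y \<in> pts \<Longrightarrow> td x y = 0 \<longleftrightarrow> x = y"
  by (rule dw_eq_0[OF len_pos])

lemma td_B: "x \<in> pts \<Longrightarrow> y \<in> pts \<Longrightarrow> z \<in> pts \<Longrightarrow> td x y + td y z = td x z \<longleftrightarrow> B x y z"
  using dw_additive_iff[of "len T" x y z] len_pos unfolding cb_def B_def by (force intro: less_imp_le)

end

lemma mtr_I: "is_metric_gtree G T \<Longrightarrow> mtr G T"
  by unfold_locales (auto simp: is_metric_gtree_def)

text \<open>The weights \<open>w\<close> on \<open>S\<close> may vanish on some edges.\<close>

locale weighted_pair = S: gtr G S + T: mtr G T
  for G :: "('g, 'b) monoid_scheme" and S :: "('g, 's, 'c) gtree_scheme" and T :: "('g, 'v) metric_gtree" +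
  fixes w :: "'s set \<Rightarrow> real"
  assumes w: "S.inv_weight w"
begin

sublocale SP: ptree S.pts "S.dw w" by (rule S.ptree_pts) (rule S.inv_weight_nonneg[OF w])
sublocale TP: ptree T.pts T.td by (rule T.ptree_pts) (rule T.inv_weight_nonneg[OF T.inv_weight_len])

text \<open>The collapse as a map of points: the lengths \<open>w\<close> give only a pseudo-metric
  on \<open>S\<close>, and \<open>\<psi>\<close> identifies exactly the points at distance
  zero.\<close>

definition surjection :: "(('s \<Rightarrow> real) \<Rightarrow> ('v \<Rightarrow> real)) \<Rightarrow> bool" where
  "surjection \<psi> \<longleftrightarrow> \<psi> ` S.pts = T.pts \<and> (\<forall>a\<in>S.pts. \<forall>b\<in>S.pts. T.td (\<psi> a) (\<psi> b) = S.dw w a b) \<and>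
     (\<forall>k\<in>carrier G. \<forall>a\<in>S.pts. \<psi> (S.pact k a) = T.pact k (\<psi> a))"

text \<open>\<open>orbit_map\<close> is used from \<open>T\<close> to \<open>S\<close>, because
  \<open>x\<close> is a vertex and its orbit has all of \<open>T\<close> as hull, while
  \<open>p\<close> may be inside an edge. The resulting \<open>\<theta>\<close> is equivariant up to
  distance zero, and \<open>\<psi>\<close> inverts it up to distance zero; this needs every point of
  \<open>S\<close> to be at distance zero from the image of \<open>\<theta>\<close>.\<close>

lemma same_orbit_metric_surjection:
  assumes x: "x \<in> verts T" and p: "p \<in> S.pts"
    and eq: "\<And>k. k \<in> carrier G \<Longrightarrow> T.td (pt x) (T.pact k (pt x)) = S.dw w p (S.pact k p)"
    and g: "g \<in> carrier G" "S.dw w p (S.pact g p) > 0"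
  shows "\<exists>\<psi>. surjection \<psi>"
proof -
  let ?e = "S.dw w"
  have eq2: "T.td (T.pact i (pt x)) (T.pact j (pt x)) = ?e (S.pact i p) (S.pact j p)"
    if ij: "i \<in> carrier G" "j \<in> carrier G" for i j
  proof -
    let ?k = "inv\<^bsub>G\<^esub> i \<otimes>\<^bsub>G\<^esub> j"
    have k: "?k \<in> carrier G" "i \<otimes>\<^bsub>G\<^esub> ?k = j" using ij by (auto simp: S.m_assoc[symmetric])
    have "T.td (T.pact i (pt x)) (T.pact i (T.pact ?k (pt x))) = T.td (pt x) (T.pact ?k (pt x))"
      by (rule T.dw_act[OF T.inv_weight_len ij(1)]) (use x k in auto)
    moreover have "?e (S.pact i p) (S.pact i (S.pact ?k p)) = ?e p (S.pact ?k p)"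
      by (rule S.dw_act[OF w ij(1)]) (use p k in auto)
    ultimately show ?thesis using eq[OF k(1)] T.pact_mult[OF ij(1) k(1), of "pt x"] S.pact_mult[OF ij(1) k(1) p] x k(2)
      by simp
  qed
  have "\<exists>\<theta>. (\<forall>y\<in>T.pts. \<theta> y \<in> S.pts) \<and> (\<forall>y\<in>T.pts. \<forall>z\<in>T.pts. ?e (\<theta> y) (\<theta> z) = T.td y z) \<and>
    (\<forall>y\<in>T.pts. \<forall>i\<in>carrier G. ?e (S.pact i p) (\<theta> y) = T.td (T.pact i (pt x)) y)"
  proof (rule orbit_map[where I = "carrier G" and x = "\<lambda>k. T.pact k (pt x)" and p = "\<lambda>k. S.pact k p",
        OF TP.ptree_axioms SP.ptree_axioms _ _ eq2])
    fix y assume y: "y \<in> T.pts"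
    from T.hull_point[OF x y] obtain h k where hk: "h \<in> carrier G" "k \<in> carrier G"
      "T.B (pt (act T h x)) y (pt (act T k x))" by auto
    then have "T.B (T.pact h (pt x)) y (T.pact k (pt x))" using x by simp
    then have "T.td (T.pact h (pt x)) y + T.td y (T.pact k (pt x)) = T.td (T.pact h (pt x)) (T.pact k (pt x))"
      using T.td_B[of "T.pact h (pt x)" y "T.pact k (pt x)"] y hk x by simp
    then show "\<exists>i\<in>carrier G. \<exists>j\<in>carrier G. T.td (T.pact i (pt x)) y + T.td y (T.pact j (pt x)) =
        T.td (T.pact i (pt x)) (T.pact j (pt x))" using hk by blast
  qed (use x p in auto)
  then obtain \<theta> where \<theta>: "\<And>y. y \<in> T.pts \<Longrightarrow> \<theta> y \<in> S.pts"
    "\<And>y z. y \<in> T.pts \<Longrightarrow> z \<in> T.pts \<Longrightarrow> ?e (\<theta> y) (\<theta> z) = T.td y z"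
    "\<And>y i. y \<in> T.pts \<Longrightarrow> i \<in> carrier G \<Longrightarrow> ?e (S.pact i p) (\<theta> y) = T.td (T.pact i (pt x)) y" by blast
  have px: "T.pact k (pt x) \<in> T.pts" if "k \<in> carrier G" for k using that x by simp
  have pp: "S.pact k p \<in> S.pts" if "k \<in> carrier G" for k using that p by simp
  \<comment> \<open>Both points have the same distances from the orbit of \<open>p\<close> and lie
    between the same two points of it, so \<open>bt_unique\<close> applies.\<close>
  have \<theta>eq: "?e (\<theta> (T.pact k y)) (S.pact k (\<theta> y)) = 0" if k: "k \<in> carrier G" and y: "y \<in> T.pts" for k y
  proof -
    let ?a = "\<theta> (T.pact k y)" and ?b = "S.pact k (\<theta> y)"
    have ky: "T.pact k y \<in> T.pts" using k y by simp
    have P: "?a \<in> S.pts" "?b \<in> S.pts" using \<theta>(1) k y ky by auto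
    have d: "?e (S.pact i p) ?a = ?e (S.pact i p) ?b" if i: "i \<in> carrier G" for i
    proof -
      let ?j = "inv\<^bsub>G\<^esub> k \<otimes>\<^bsub>G\<^esub> i"
      have j: "?j \<in> carrier G" "k \<otimes>\<^bsub>G\<^esub> ?j = i" using i k by (auto simp: S.m_assoc[symmetric])
      have "?e (S.pact i p) ?a = T.td (T.pact i (pt x)) (T.pact k y)" using \<theta>(3)[OF ky i] .
      also have "\<dots> = T.td (T.pact k (T.pact ?j (pt x))) (T.pact k y)" using T.pact_mult[OF k j(1), of "pt x"] x j(2) by simp
      also have "\<dots> = T.td (T.pact ?j (pt x)) y" using T.dw_act[OF T.inv_weight_len k px[OF j(1)] y] .
      also have "\<dots> = ?e (S.pact ?j p) (\<theta> y)" using \<theta>(3)[OF y j(1)] by simp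
      also have "\<dots> = ?e (S.pact k (S.pact ?j p)) ?b" using S.dw_act[OF w k pp[OF j(1)] \<theta>(1)[OF y]] by simp
      also have "\<dots> = ?e (S.pact i p) ?b" using S.pact_mult[OF k j(1) p] j(2) by simp
      finally show ?thesis .
    qed
    from T.hull_point[OF x ky] obtain i j where ij: "i \<in> carrier G" "j \<in> carrier G"
      "T.B (pt (act T i x)) (T.pact k y) (pt (act T j x))" by auto
    then have "T.td (T.pact i (pt x)) (T.pact k y) + T.td (T.pact k y) (T.pact j (pt x)) = T.td (T.pact i (pt x)) (T.pact j (pt x))"
      using T.td_B[OF px[OF ij(1)] ky px[OF ij(2)]] x by simp
    then have bt: "SP.bt (S.pact i p) ?a (S.pact j p)"
      unfolding SP.bt_def using \<theta>(3)[OF ky ij(1)] \<theta>(3)[OF ky ij(2)] eq2[OF ij(1,2)]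
        SP.sym[OF P(1) pp[OF ij(2)]] TP.sym[OF ky px[OF ij(2)]] by simp
    then have "SP.bt (S.pact i p) ?b (S.pact j p)"
      unfolding SP.bt_def using d[OF ij(1)] d[OF ij(2)] SP.sym[OF P(1) pp[OF ij(2)]] SP.sym[OF P(2) pp[OF ij(2)]] by simp
    then show ?thesis using SP.bt_unique[OF pp[OF ij(1)] pp[OF ij(2)] P bt] d[OF ij(1)] by simp
  qed
  \<comment> \<open>The points at distance zero from the image of \<open>\<theta>\<close>. This set
    turns out to be convex and invariant, so that by minimality one vertex in it suffices.\<close>
  define A where "A = {z \<in> S.pts. \<exists>y\<in>T.pts. ?e (\<theta> y) z = 0}"
  have A_bt: "z \<in> A" if z: "z1 \<in> A" "z2 \<in> A" "z \<in> S.pts" "S.B z1 z z2" for z1 z2 z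
  proof -
    obtain y1 y2 where y: "y1 \<in> T.pts" "y2 \<in> T.pts" "?e (\<theta> y1) z1 = 0" "?e (\<theta> y2) z2 = 0"
      using z unfolding A_def by auto
    have P: "z1 \<in> S.pts" "z2 \<in> S.pts" using z unfolding A_def by auto
    have add: "?e z1 z + ?e z z2 = ?e z1 z2" using S.dw_B[of w z1 z z2] S.inv_weight_nonneg[OF w] z P by auto
    have d1: "?e (\<theta> y1) u = ?e z1 u" if "u \<in> S.pts" for u
      using SP.tri[OF \<theta>(1)[OF y(1)] P(1) that] SP.tri[OF P(1) \<theta>(1)[OF y(1)] that] SP.sym[OF P(1) \<theta>(1)[OF y(1)]] y(3) by auto
    have d2: "?e u (\<theta> y2) = ?e u z2" if "u \<in> S.pts" for u
      using SP.tri[OF that \<theta>(1)[OF y(2)] P(2)] SP.tri[OF that P(2) \<theta>(1)[OF y(2)]] SP.sym[OF P(2) \<theta>(1)[OF y(2)]] y(4) by auto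
    have btz: "SP.bt (\<theta> y1) z (\<theta> y2)"
      unfolding SP.bt_def using d1[OF z(3)] d2[OF z(3)] d1[OF \<theta>(1)[OF y(2)]] d2[OF P(1)] add by simp
    then have "?e (\<theta> y1) z \<le> T.td y1 y2" "0 \<le> ?e (\<theta> y1) z"
      using \<theta>(2)[OF y(1,2)] SP.nonneg[OF z(3) \<theta>(1)[OF y(2)]] SP.nonneg[OF \<theta>(1)[OF y(1)] z(3)] unfolding SP.bt_def by auto
    then obtain y where yy: "y \<in> T.pts" "T.td y1 y = ?e (\<theta> y1) z" "T.td y y2 = T.td y1 y2 - ?e (\<theta> y1) z"
      using TP.geod[OF y(1,2)] by blast
    have "SP.bt (\<theta> y1) (\<theta> y) (\<theta> y2)" unfolding SP.bt_def using \<theta>(2) y yy by auto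
    then have "?e (\<theta> y) z = 0"
      using SP.bt_unique[OF \<theta>(1)[OF y(1)] \<theta>(1)[OF y(2)] \<theta>(1)[OF yy(1)] z(3) _ btz] \<theta>(2)[OF y(1) yy(1)] yy by auto
    then show ?thesis unfolding A_def using yy z by auto
  qed
  have A_act: "S.pact k z \<in> A" if k: "k \<in> carrier G" and z: "z \<in> A" for k z
  proof -
    obtain y where y: "y \<in> T.pts" "?e (\<theta> y) z = 0" and zP: "z \<in> S.pts" using z unfolding A_def by auto
    have ky: "T.pact k y \<in> T.pts" "S.pact k z \<in> S.pts" "S.pact k (\<theta> y) \<in> S.pts" using k y zP \<theta>(1) by auto
    have "?e (S.pact k (\<theta> y)) (S.pact k z) = 0" using S.dw_act[OF w k \<theta>(1)[OF y(1)] zP] y by simp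
    then have "?e (\<theta> (T.pact k y)) (S.pact k z) = 0"
      using \<theta>eq[OF k y(1)] SP.tri[OF \<theta>(1)[OF ky(1)] ky(3,2)] SP.nonneg[OF \<theta>(1)[OF ky(1)] ky(2)] by simp
    then show ?thesis unfolding A_def using ky by auto
  qed
  have pA: "p \<in> A"
  proof -
    have "?e (S.pact \<one>\<^bsub>G\<^esub> p) (\<theta> (pt x)) = T.td (T.pact \<one>\<^bsub>G\<^esub> (pt x)) (pt x)" by (rule \<theta>(3)) (use x in auto)
    then have "?e p (\<theta> (pt x)) = 0" using p x by simp
    then have "?e (\<theta> (pt x)) p = 0" using SP.sym[OF p \<theta>(1)[of "pt x"]] x by simp
    then show ?thesis unfolding A_def using p x by auto
  qed
  \<comment> \<open>The segment from \<open>p\<close> to its translate by \<open>g\<close> contains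
    a vertex unless both points are inside the same edge; in that case \<open>g\<close> would fix
    this edge pointwise and not move \<open>p\<close>.\<close>
  obtain v where v: "v \<in> verts S" "pt v \<in> A"
  proof (cases "supp p = supp (S.pact g p)")
    case False
    obtain a where a: "a \<in> supp p" "S.B p (pt a) (S.pact g p)" using S.gate[OF p pp[OF g(1)] False] by auto
    have aV: "a \<in> verts S" using a S.supp_pts(2)[OF p] by auto
    then show ?thesis using that[OF aV] A_bt[OF pA A_act[OF g(1) pA] _ a(2)] by simp
  next
    case True
    show ?thesis
      using p
    proof (cases rule: S.pts_cases)
      case (vertex v)
      then show ?thesis using that[of v] pA by simp
    next
      case (edge a b s)
      note ab = S.edge_verts[OF edge(1)]
      have s: "supp p = {a, b}" using edge ab supp_mix[of a b s] by auto
      have "supp (S.pact g p) = act S g ` {a, b}" using S.supp_pact[OF g(1) p] unfolding s .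
      then have "act S g ` {a, b} = {a, b}" unfolding True[symmetric] s by (rule sym)
      from S.edge_fixed[OF g(1) edge(1) this] have "act S g a = a" "act S g b = b" by simp_all
      then have "S.pact g p = p" using edge(4) S.pact_mix[OF g(1) ab(1,2)] by simp
      then show ?thesis using g(2) by simp
    qed
  qed
  have A_all: "z \<in> A" if z: "z \<in> S.pts" for z
  proof -
    from S.hull_point[OF v(1) z] obtain h k where hk: "h \<in> carrier G" "k \<in> carrier G"
      "S.B (pt (act S h v)) z (pt (act S k v))" by auto
    have "pt (act S h v) \<in> A" "pt (act S k v) \<in> A" using A_act[OF hk(1) v(2)] A_act[OF hk(2) v(2)] hk v by auto
    then show ?thesis using A_bt z hk(3) by blast
  qed
  then obtain \<psi> where \<psi>: "\<And>z. z \<in> S.pts \<Longrightarrow> \<psi> z \<in> T.pts \<and> ?e (\<theta> (\<psi> z)) z = 0" unfolding A_def by (auto, metis)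
  have \<psi>P: "\<psi> z \<in> T.pts" "\<theta> (\<psi> z) \<in> S.pts" "?e (\<theta> (\<psi> z)) z = 0" if "z \<in> S.pts" for z using \<psi>[OF that] \<theta>(1) by auto
  have iso: "T.td (\<psi> a) (\<psi> b) = ?e a b" if a: "a \<in> S.pts" and b: "b \<in> S.pts" for a b
  proof -
    have "T.td (\<psi> a) (\<psi> b) = ?e (\<theta> (\<psi> a)) (\<theta> (\<psi> b))" using \<theta>(2)[OF \<psi>P(1)[OF a] \<psi>P(1)[OF b]] by simp
    also have "\<dots> = ?e a (\<theta> (\<psi> b))"
      using SP.tri[OF \<psi>P(2)[OF a] a \<psi>P(2)[OF b]] SP.tri[OF a \<psi>P(2)[OF a] \<psi>P(2)[OF b]]
        SP.sym[OF a \<psi>P(2)[OF a]] \<psi>P(3)[OF a] by simp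
    also have "\<dots> = ?e a b"
      using SP.tri[OF a b \<psi>P(2)[OF b]] SP.tri[OF a \<psi>P(2)[OF b] b]
        SP.sym[OF b \<psi>P(2)[OF b]] \<psi>P(3)[OF b] by simp
    finally show ?thesis .
  qed
  have equi: "\<psi> (S.pact k a) = T.pact k (\<psi> a)" if k: "k \<in> carrier G" and a: "a \<in> S.pts" for k a
  proof -
    have ka: "S.pact k a \<in> S.pts" and kp: "T.pact k (\<psi> a) \<in> T.pts" "S.pact k (\<theta> (\<psi> a)) \<in> S.pts"
      using k a \<psi>P by auto
    have "?e (S.pact k (\<theta> (\<psi> a))) (S.pact k a) = 0" using S.dw_act[OF w k \<psi>P(2)[OF a] a] \<psi>P(3)[OF a] by simp
    then have "?e (\<theta> (T.pact k (\<psi> a))) (S.pact k a) = 0"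
      using \<theta>eq[OF k \<psi>P(1)[OF a]] SP.tri[OF \<theta>(1)[OF kp(1)] kp(2) ka] SP.nonneg[OF \<theta>(1)[OF kp(1)] ka] by simp
    then have "?e (\<theta> (\<psi> (S.pact k a))) (\<theta> (T.pact k (\<psi> a))) = 0"
      using \<psi>P(3)[OF ka] SP.tri[OF \<psi>P(2)[OF ka] ka \<theta>(1)[OF kp(1)]] SP.sym[OF ka \<theta>(1)[OF kp(1)]]
        SP.nonneg[OF \<psi>P(2)[OF ka] \<theta>(1)[OF kp(1)]] by simp
    then have "T.td (\<psi> (S.pact k a)) (T.pact k (\<psi> a)) = 0" using \<theta>(2)[OF \<psi>P(1)[OF ka] kp(1)] by simp
    then show ?thesis using T.td_eq_0[OF \<psi>P(1)[OF ka] kp(1)] by simp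
  qed
  have "y \<in> \<psi> ` S.pts" if y: "y \<in> T.pts" for y
  proof -
    have "T.td (\<psi> (\<theta> y)) y = 0" using \<theta>(2)[OF \<psi>P(1)[OF \<theta>(1)[OF y]] y] \<psi>P(3)[OF \<theta>(1)[OF y]] by simp
    then have "\<psi> (\<theta> y) = y" using T.td_eq_0[OF \<psi>P(1)[OF \<theta>(1)[OF y]] y] by simp
    then show ?thesis using \<theta>(1)[OF y] by force
  qed
  then have "surjection \<psi>" unfolding surjection_def using \<psi>P(1) iso equi by blast
  then show ?thesis by blast
qed

end

section \<open>Recognizing a collapse\<close>

context simp_tree
begin

text \<open>A fractional coordinate places both points inside the edge \<open>e\<close>, where this
  coordinate determines the point.\<close>

lemma cc_frac_eq:
  assumes P: "x \<in> pts" "y \<in> pts" and eq: "cc e x = cc e y" and fr: "cc e x \<noteq> 0" "cc e x \<noteq> 1"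
  shows "x = y"
proof (rule cc_eq[OF P])
  have s: "supp x = e" "supp y = e" "e \<in> E" using cc_frac[OF P(1)] cc_frac[OF P(2)] eq fr by auto
  obtain a b where ab: "e = {a, b}" "a \<noteq> b" using edge_ends[OF s(3)] by auto
  obtain s1 where s1: "x = mix a b s1" using mix_cases[OF P(1)] s(1) ab by metis
  obtain s2 where s2: "y = mix a b s2" using mix_cases[OF P(2)] s(2) ab by metis
  fix f assume "f \<in> E"
  show "cc f x = cc f y"
    using eq side_edge[of a b f] side_edge[of a b e] s(3) ab
    unfolding s1 s2 by (cases "f = e") (auto simp: cc_mix algebra_simps)
qed

lemma dw_lower:
  assumes w: "\<And>e. e \<in> E \<Longrightarrow> 0 \<le> w e" and P: "x \<in> pts" "y \<in> pts" and e: "e \<in> E"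
  shows "w e * \<bar>cc e x - cc e y\<bar> \<le> dw w x y"
proof (cases "cc e x = cc e y")
  case False
  show ?thesis unfolding dw_def
    by (rule member_le_sum) (use False e w cc_diff_finite[OF P] in auto)
qed (use dw_nonneg[OF w] in auto)

lemma dw_zero_cc:
  assumes w: "\<And>e. e \<in> E \<Longrightarrow> 0 \<le> w e" and P: "x \<in> pts" "y \<in> pts" and e: "e \<in> E" "w e \<noteq> 0" and 0: "dw w x y = 0"
  shows "cc e x = cc e y"
proof -
  have "w e * \<bar>cc e x - cc e y\<bar> \<le> dw w x y" by (rule dw_lower[OF w P e(1)])
  then show ?thesis using w[OF e(1)] e(2) 0 by (auto simp: mult_le_0_iff)
qed

lemma dw_pt_zero_iff:
  assumes w: "\<And>e. e \<in> E \<Longrightarrow> 0 \<le> w e" and V: "u \<in> V" "v \<in> V"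
  shows "dw w (pt u) (pt v) = 0 \<longleftrightarrow> (\<forall>e\<in>geo u v. w e = 0)"
  unfolding dw_pt[OF V] by (rule sum_nonneg_eq_0_iff[OF finite_geo]) (use w geo_in_E[OF V] in auto)

lemma zero_path_iff:
  assumes V: "u \<in> V" "v \<in> V"
  shows "(\<exists>p. is_path V {e \<in> E. w e = 0} p u v) \<longleftrightarrow> (\<forall>e\<in>geo u v. w e = (0 :: real))"
proof
  assume "\<exists>p. is_path V {e \<in> E. w e = 0} p u v"
  then obtain p where p: "is_path V {e \<in> E. w e = 0} p u v" ..
  then have "is_path V E p u v" unfolding is_path_iff by auto
  then have "tp u v = p" by (rule tp_eq)
  then show "\<forall>e\<in>geo u v. w e = 0" using p unfolding geo_def is_path_iff by auto
next
  assume "\<forall>e\<in>geo u v. w e = 0"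
  then have "is_path V {e \<in> E. w e = 0} (tp u v) u v"
    using tp_props[OF V] unfolding is_path_iff geo_def by auto
  then show "\<exists>p. is_path V {e \<in> E. w e = 0} p u v" ..
qed

lemma edge_at: "u \<in> V \<Longrightarrow> v \<in> V \<Longrightarrow> u \<noteq> v \<Longrightarrow> \<exists>z. {u, z} \<in> E"
  using geo_last[of v u] by (auto simp: insert_commute)

end

context gtr
begin

lemma cc_fixed_edge:
  assumes g: "g \<in> carrier G" and e: "e \<in> edges T" "act T g ` e = e" and x: "x \<in> pts"
  shows "cc e (pact g x) = cc e x"
proof -
  obtain a b where ab: "e = {a, b}" "a \<in> verts T" using edge_ends[OF e(1)] by auto
  have "act T g a = a" using edge_fixed[OF g e, of a] ab by auto
  then have "e \<notin> geo root (act T g root)" using side_act[OF g ab(2) e(1)] e(2) by auto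
  then show ?thesis using cc_act[OF g x e(1)] e(2) by simp
qed

end

context weighted_pair
begin

lemma surjection_pts: "surjection \<psi> \<Longrightarrow> a \<in> S.pts \<Longrightarrow> \<psi> a \<in> T.pts"
  and surjection_dist: "surjection \<psi> \<Longrightarrow> a \<in> S.pts \<Longrightarrow> b \<in> S.pts \<Longrightarrow> T.td (\<psi> a) (\<psi> b) = S.dw w a b"
  and surjection_act: "surjection \<psi> \<Longrightarrow> k \<in> carrier G \<Longrightarrow> a \<in> S.pts \<Longrightarrow> \<psi> (S.pact k a) = T.pact k (\<psi> a)"
  unfolding surjection_def by auto

lemma surjection_onto: "surjection \<psi> \<Longrightarrow> y \<in> T.pts \<Longrightarrow> \<exists>a\<in>S.pts. \<psi> a = y"
  unfolding surjection_def by (metis imageE)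

lemma surjection_B:
  assumes \<psi>: "surjection \<psi>" and P: "a \<in> S.pts" "b \<in> S.pts" "c \<in> S.pts"
  shows "T.B (\<psi> a) (\<psi> b) (\<psi> c) \<longleftrightarrow> S.cb w a b c"
  using T.td_B[OF surjection_pts[OF \<psi> P(1)] surjection_pts[OF \<psi> P(2)] surjection_pts[OF \<psi> P(3)]]
    S.dw_additive_iff[OF S.inv_weight_nonneg[OF w] P] surjection_dist[OF \<psi>] P by simp

context
  fixes \<psi> g q q'
  assumes \<psi>: "surjection \<psi>" and g: "g \<in> carrier G"
    and q: "q \<in> verts S" "S.B (pt q) (pt (act S g q)) (pt (act S g (act S g q)))" "0 < S.dw w (pt q) (pt (act S g q))"
    and q': "q' \<in> verts T" "T.B (pt q') (pt (act T g q')) (pt (act T g (act T g q')))" "act T g q' \<noteq> q'"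
begin

text \<open>If the image of \<open>v\<close> were inside an edge, the coordinate along this edge
  would be a function as excluded by \<open>not_two_sided\<close>. Every branch at \<open>v\<close>
  has a vertex with another value, because it contains two vertices with distinct images; elements
  fixing \<open>v\<close> fix the edge pointwise and so preserve the coordinate.\<close>

lemma vertex_to_vertex:
  assumes v: "v \<in> verts S"
  shows "\<exists>u\<in>verts T. \<psi> (pt v) = pt u"
proof (rule ccontr)
  assume n: "\<not> ?thesis"
  have y: "\<psi> (pt v) \<in> T.pts" using surjection_pts[OF \<psi>] v by simp
  from y obtain a b s where e: "{a, b} \<in> edges T" "0 < s" "s < 1" "\<psi> (pt v) = mix a b s"
    by (cases rule: T.pts_cases) (use n in auto)
  let ?e = "{a, b}"
  have fr: "T.cc ?e (\<psi> (pt v)) \<noteq> 0" "T.cc ?e (\<psi> (pt v)) \<noteq> 1"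
    using T.cc_frac_mix[OF e(1-3)] e(4) by auto
  have sup: "supp (\<psi> (pt v)) = ?e" using T.cc_frac(1)[OF y fr] .
  have zP: "\<psi> (pt z) \<in> T.pts" if "z \<in> verts S" for z using surjection_pts[OF \<psi>] that by simp
  show False
  proof (rule S.not_two_sided[OF v, of "\<lambda>z. T.cc ?e (\<psi> (pt z))"])
    have "act S g q \<noteq> q" using q(3) by auto
    then show "\<exists>u'. {v, u'} \<in> edges S"
      using S.edge_at[OF v, of q] S.edge_at[OF v, of "act S g q"] q(1) g by (cases "v = q") auto
  next
    fix c d assume cd: "{c, d} \<in> edges S"
    show "\<exists>z\<in>verts S. \<exists>z'\<in>verts S. {c, d} \<in> S.geo c z \<and> {c, d} \<in> S.geo c z' \<and> z \<noteq> z'"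
      using S.branch_vertices[OF w g q cd] by (metis S.dw_self less_irrefl)
  next
    fix u' assume cd: "{v, u'} \<in> edges S"
    obtain z z' where z: "z \<in> verts S" "z' \<in> verts S" "{v, u'} \<in> S.geo v z" "{v, u'} \<in> S.geo v z'" "0 < S.dw w (pt z) (pt z')"
      using S.branch_vertices[OF w g q cd] by blast
    show "\<exists>z\<in>verts S. {v, u'} \<in> S.geo v z \<and> T.cc ?e (\<psi> (pt z)) \<noteq> T.cc ?e (\<psi> (pt v))"
    proof (rule ccontr)
      assume "\<not> ?thesis"
      then have "T.cc ?e (\<psi> (pt v)) = T.cc ?e (\<psi> (pt z))" "T.cc ?e (\<psi> (pt v)) = T.cc ?e (\<psi> (pt z'))" using z by auto
      then have "\<psi> (pt v) = \<psi> (pt z)" "\<psi> (pt v) = \<psi> (pt z')"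
        using T.cc_frac_eq[OF y zP[OF z(1)] _ fr] T.cc_frac_eq[OF y zP[OF z(2)] _ fr] by auto
      then show False using surjection_dist[OF \<psi>, of "pt z" "pt z'"] z by simp
    qed
  next
    fix z1 z2 assume z: "z1 \<in> verts S" "z2 \<in> verts S" "S.B (pt z1) (pt v) (pt z2)"
    have "T.B (\<psi> (pt z1)) (\<psi> (pt v)) (\<psi> (pt z2))"
      using surjection_B[OF \<psi>, of "pt z1" "pt v" "pt z2"] S.B_cb[OF z(3)] z v by simp
    then show "between (T.cc ?e (\<psi> (pt z1))) (T.cc ?e (\<psi> (pt v))) (T.cc ?e (\<psi> (pt z2)))"
      using e(1) unfolding T.B_def by blast
  next
    fix k z assume k: "k \<in> carrier G" "act S k v = v" and z: "z \<in> verts S"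
    have "T.pact k (\<psi> (pt v)) = \<psi> (pt v)" using surjection_act[OF \<psi> k(1), of "pt v"] k v by simp
    then have "act T k ` ?e = ?e" using T.supp_pact[OF k(1) y] unfolding sup by (simp only: sup)
    then have "T.cc ?e (T.pact k (\<psi> (pt z))) = T.cc ?e (\<psi> (pt z))"
      by (rule T.cc_fixed_edge[OF k(1) e(1) _ zP[OF z]])
    then show "T.cc ?e (\<psi> (pt (act S k z))) = T.cc ?e (\<psi> (pt z))"
      using surjection_act[OF \<psi> k(1), of "pt z"] k z by simp
  qed
qed

text \<open>The argument of \<open>vertex_to_vertex\<close> in the other direction: if
  \<open>b\<close> had a preimage inside an edge \<open>?f\<close> only, the coordinate at
  \<open>?f\<close> of chosen preimages would be a function on \<open>T\<close> excluded by
  \<open>not_two_sided\<close>. An edge \<open>?f\<close> of weight zero would have an end mapped to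
  \<open>b\<close> as well.\<close>

lemma vertex_from_vertex:
  assumes b: "b \<in> verts T"
  shows "\<exists>v\<in>verts S. \<psi> (pt v) = pt b"
proof (rule ccontr)
  assume n: "\<not> ?thesis"
  obtain a where a: "a \<in> S.pts" "\<psi> a = pt b" using surjection_onto[OF \<psi>, of "pt b"] b by auto
  from a(1) obtain c c' s where f: "{c, c'} \<in> edges S" "0 < s" "s < 1" "a = mix c c' s"
    by (cases rule: S.pts_cases) (use n a in auto)
  let ?f = "{c, c'}"
  note cV = S.edge_verts[OF f(1)]
  have nn: "\<And>e. e \<in> edges S \<Longrightarrow> 0 \<le> w e" by (rule S.inv_weight_nonneg[OF w])
  have wf: "w ?f \<noteq> 0"
  proof
    assume "w ?f = 0"
    then have "S.dw w a (pt c) = 0" using S.dw_mix[OF f(1), of s 0 w] f by (simp add: mix_0)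
    then have "T.td (\<psi> a) (\<psi> (pt c)) = 0" using surjection_dist[OF \<psi> a(1), of "pt c"] cV by simp
    then have "\<psi> (pt c) = pt b"
      using T.td_eq_0[of "\<psi> a" "\<psi> (pt c)"] surjection_pts[OF \<psi> a(1)] surjection_pts[OF \<psi>, of "pt c"] a(2) cV by simp
    then show False using n cV by auto
  qed
  \<comment> \<open>The choice of preimages is harmless: two of the same point are at distance zero
    and hence have equal coordinates at \<open>?f\<close>, whose weight is not zero.\<close>
  have "\<exists>\<xi>. \<forall>z\<in>verts T. \<xi> z \<in> S.pts \<and> \<psi> (\<xi> z) = pt z"
    using surjection_onto[OF \<psi>] by (intro bchoice) (metis T.pt_in)
  then obtain \<xi> where \<xi>: "\<And>z. z \<in> verts T \<Longrightarrow> \<xi> z \<in> S.pts" "\<And>z. z \<in> verts T \<Longrightarrow> \<psi> (\<xi> z) = pt z" by blast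
  have same: "S.cc ?f x = S.cc ?f y" if "x \<in> S.pts" "y \<in> S.pts" "\<psi> x = \<psi> y" for x y
    by (rule S.dw_zero_cc[where w = w, OF nn that(1,2) f(1) wf]) (use surjection_dist[OF \<psi> that(1,2)] that(3) in simp_all)
  have "S.cc ?f (\<xi> b) = S.cc ?f a" by (rule same) (use \<xi> a b in auto)
  then have fr: "S.cc ?f (\<xi> b) \<noteq> 0" "S.cc ?f (\<xi> b) \<noteq> 1" using S.cc_frac_mix[OF f(1-3)] f(4) by auto
  have sup: "supp (\<xi> b) = ?f" using S.cc_frac(1)[OF \<xi>(1)[OF b] fr] .
  have posT: "0 < T.td (pt q') (pt (act T g q'))"
    using T.td_eq_0[of "pt q'" "pt (act T g q')"] TP.nonneg[of "pt q'" "pt (act T g q')"] q' g by auto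
  show False
  proof (rule T.not_two_sided[OF b, of "\<lambda>z. S.cc ?f (\<xi> z)"])
    show "\<exists>u'. {b, u'} \<in> edges T"
      using T.edge_at[OF b, of q'] T.edge_at[OF b, of "act T g q'"] q' g by (cases "b = q'") auto
  next
    fix c d assume cd: "{c, d} \<in> edges T"
    show "\<exists>z\<in>verts T. \<exists>z'\<in>verts T. {c, d} \<in> T.geo c z \<and> {c, d} \<in> T.geo c z' \<and> z \<noteq> z'"
      using T.branch_vertices[OF T.inv_weight_len g q'(1,2) posT cd] by (metis T.dw_self less_irrefl)
  next
    fix u' assume cd: "{b, u'} \<in> edges T"
    obtain z z' where z: "z \<in> verts T" "z' \<in> verts T" "{b, u'} \<in> T.geo b z" "{b, u'} \<in> T.geo b z'" "0 < T.td (pt z) (pt z')"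
      using T.branch_vertices[OF T.inv_weight_len g q'(1,2) posT cd] by blast
    show "\<exists>z\<in>verts T. {b, u'} \<in> T.geo b z \<and> S.cc ?f (\<xi> z) \<noteq> S.cc ?f (\<xi> b)"
    proof (rule ccontr)
      assume "\<not> ?thesis"
      then have "S.cc ?f (\<xi> b) = S.cc ?f (\<xi> z)" "S.cc ?f (\<xi> b) = S.cc ?f (\<xi> z')" using z by auto
      then have "\<xi> b = \<xi> z" "\<xi> b = \<xi> z'"
        using S.cc_frac_eq[OF \<xi>(1)[OF b] \<xi>(1)[OF z(1)] _ fr] S.cc_frac_eq[OF \<xi>(1)[OF b] \<xi>(1)[OF z(2)] _ fr] by auto
      then have "pt z = pt z'" using \<xi>(2)[OF z(1)] \<xi>(2)[OF z(2)] by simp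
      then show False using z by simp
    qed
  next
    fix z1 z2 assume z: "z1 \<in> verts T" "z2 \<in> verts T" "T.B (pt z1) (pt b) (pt z2)"
    have "S.cb w (\<xi> z1) (\<xi> b) (\<xi> z2)"
      using surjection_B[OF \<psi> \<xi>(1)[OF z(1)] \<xi>(1)[OF b] \<xi>(1)[OF z(2)]] \<xi>(2) z b by simp
    then show "between (S.cc ?f (\<xi> z1)) (S.cc ?f (\<xi> b)) (S.cc ?f (\<xi> z2))"
      using f(1) wf unfolding S.cb_def by blast
  next
    fix k z assume k: "k \<in> carrier G" "act T k b = b" and z: "z \<in> verts T"
    have "\<psi> (S.pact k (\<xi> b)) = \<psi> (\<xi> b)" using surjection_act[OF \<psi> k(1) \<xi>(1)[OF b]] \<xi>(2)[OF b] k b by simp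
    then have "S.cc ?f (\<xi> b) = S.cc ?f (S.pact k (\<xi> b))" using same[of "\<xi> b" "S.pact k (\<xi> b)"] \<xi>(1)[OF b] k by simp
    from S.cc_frac_eq[OF \<xi>(1)[OF b] S.pact_in[OF k(1) \<xi>(1)[OF b]] this fr]
    have "S.pact k (\<xi> b) = \<xi> b" by (rule sym)
    then have fx: "act S k ` ?f = ?f" using S.supp_pact[OF k(1) \<xi>(1)[OF b]] unfolding sup by (simp only: sup)
    have "S.cc ?f (\<xi> (act T k z)) = S.cc ?f (S.pact k (\<xi> z))"
      by (rule same) (use \<xi> k z surjection_act[OF \<psi> k(1) \<xi>(1)[OF z]] in auto)
    then show "S.cc ?f (\<xi> (act T k z)) = S.cc ?f (\<xi> z)"
      using S.cc_fixed_edge[OF k(1) f(1) fx \<xi>(1)[OF z]] by simp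
  qed
qed

lemma surjection_collapse:
  "\<exists>f. f ` verts S = verts T \<and>
     (\<forall>u\<in>verts S. \<forall>v\<in>verts S. f u = f v \<longleftrightarrow> (\<exists>p. is_path (verts S) {e \<in> edges S. w e = 0} p u v)) \<and>
     (\<forall>g\<in>carrier G. \<forall>v\<in>verts S. f (act S g v) = act T g (f v)) \<and>
     edges T = (`) f ` {e \<in> edges S. w e \<noteq> 0} \<and>
     (\<forall>e\<in>edges S. w e \<noteq> 0 \<longrightarrow> len T (f ` e) = w e)"
proof -
  obtain f where f: "\<And>v. v \<in> verts S \<Longrightarrow> f v \<in> verts T" "\<And>v. v \<in> verts S \<Longrightarrow> \<psi> (pt v) = pt (f v)"
    using vertex_to_vertex by metis
  have nn: "\<And>e. e \<in> edges S \<Longrightarrow> 0 \<le> w e" by (rule S.inv_weight_nonneg[OF w])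
  have onto: "\<exists>v\<in>verts S. f v = b" if "b \<in> verts T" for b
    using vertex_from_vertex[OF that] f(2) by fastforce
  have d: "T.td (pt (f u)) (pt (f v)) = S.dw w (pt u) (pt v)" if "u \<in> verts S" "v \<in> verts S" for u v
    using surjection_dist[OF \<psi>, of "pt u" "pt v"] f(2) that by simp
  have eq0: "f u = f v \<longleftrightarrow> S.dw w (pt u) (pt v) = 0" if "u \<in> verts S" "v \<in> verts S" for u v
    using T.td_eq_0[of "pt (f u)" "pt (f v)"] d[OF that] f(1) that by simp
  have edge: "{f u, f v} \<in> edges T \<and> len T {f u, f v} = w {u, v}" if e: "{u, v} \<in> edges S" "w {u, v} \<noteq> 0" for u v
  proof -
    note uv = S.edge_verts[OF e(1)]
    have duv: "S.dw w (pt u) (pt v) = w {u, v}" by (rule S.dw_edge[OF e(1)])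
    then have ne: "f u \<noteq> f v" using eq0[OF uv(1,2)] e by simp
    obtain m where m: "{m, f v} \<in> edges T" "T.geo (f u) m = T.geo (f u) (f v) - {{m, f v}}"
      using T.geo_last[OF f(1)[OF uv(1)] f(1)[OF uv(2)] ne] by auto
    note mV = T.edge_verts[OF m(1)]
    \<comment> \<open>A vertex over \<open>m\<close>, the last vertex before \<open>f v\<close>.
      Being a vertex, \<open>z\<close> lies on one side of \<open>{u, v}\<close>, so one of its
      distances to \<open>u\<close> and \<open>v\<close> is already the whole weight and the other
      is zero. Since \<open>m\<close> differs from \<open>f v\<close>, the distance to
      \<open>u\<close> is zero and \<open>f u = m\<close>.\<close>
    obtain z where z: "z \<in> verts S" "f z = m" using onto[OF mV(1)] by auto
    have "T.B (pt (f u)) (pt (f z)) (pt (f v))" using T.B_geo[of "f u" "f v" m] f(1) uv z m mV by auto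
    then have add: "S.dw w (pt u) (pt z) + S.dw w (pt z) (pt v) = w {u, v}"
      using T.td_B[of "pt (f u)" "pt (f z)" "pt (f v)"] d[OF uv(1) z(1)] d[OF z(1) uv(2)] d[OF uv(1,2)]
        f(1)[OF uv(1)] f(1)[OF uv(2)] f(1)[OF z(1)] duv by simp
    have lower: "w {u, v} * \<bar>S.cc {u, v} (pt a) - S.cc {u, v} (pt b)\<bar> \<le> S.dw w (pt a) (pt b)"
      if "a \<in> verts S" "b \<in> verts S" for a b
      by (rule S.dw_lower[OF nn _ _ e(1)]) (use that in auto)
    have nonneg: "0 \<le> S.dw w a b" for a b by (rule S.dw_nonneg[OF nn])
    have "S.dw w (pt z) (pt v) \<noteq> 0" using eq0[OF z(1) uv(2)] z mV by simp
    then have "S.dw w (pt u) (pt z) = 0"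
      using lower[OF uv(1) z(1)] lower[OF z(1) uv(2)] S.side_edge[OF e(1), of "{u, v}"] add
        nonneg[of "pt u" "pt z"] nonneg[of "pt z" "pt v"]
      by (auto split: if_splits simp: of_bool_def)
    then have "f u = m" using eq0[OF uv(1) z(1)] z by simp
    then show ?thesis using m(1) T.dw_edge[of "f u" "f v" "len T"] d[OF uv(1,2)] duv by simp
  qed
  have im: "f ` {u, v} = {f u, f v}" for u v by auto
  have edges: "edges T = (`) f ` {e \<in> edges S. w e \<noteq> 0}"
  proof (intro equalityI subsetI)
    fix e assume e: "e \<in> edges T"
    obtain a b where ab: "e = {a, b}" using T.edge_ends[OF e] by auto
    have E: "{a, b} \<in> edges T" using e ab by simp
    note abV = T.edge_verts[OF E]
    obtain u v where uv: "u \<in> verts S" "v \<in> verts S" "f u = a" "f v = b" using onto abV by metis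
    have "S.dw w (pt u) (pt v) \<noteq> 0" using eq0[OF uv(1,2)] uv abV by simp
    \<comment> \<open>An edge of nonzero weight on the segment from \<open>u\<close> to
      \<open>v\<close>. Its ends are mapped to two distinct vertices between \<open>a\<close> and
      \<open>b\<close>, so to \<open>a\<close> and \<open>b\<close> themselves.\<close>
    then obtain k where k: "k \<in> S.geo u v" "w k \<noteq> 0" using S.dw_pt_zero_iff[OF nn uv(1,2)] by auto
    have kE: "k \<in> edges S" using S.geo_in_E[OF uv(1,2) k(1)] .
    obtain c c' where c: "k = {c, c'}" using S.edge_ends[OF kE] by auto
    have cE: "{c, c'} \<in> edges S" using kE c by simp
    note cV = S.edge_verts[OF cE]
    have in_ab: "f x \<in> {a, b}" if x: "x \<in> k" "x \<in> verts S" for x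
    proof -
      have "S.B (pt u) (pt x) (pt v)" using S.B_geo[OF uv(1,2) x(2)] S.geo_end_subset[OF uv(1,2) k(1) x(1)] by simp
      then have "T.B (\<psi> (pt u)) (\<psi> (pt x)) (\<psi> (pt v))"
        using surjection_B[OF \<psi>, of "pt u" "pt x" "pt v"] S.B_cb uv x by simp
      then have "T.B (pt a) (pt (f x)) (pt b)" using f(2) uv x by simp
      then have "T.geo a (f x) \<subseteq> {{a, b}}" using T.B_geo[of a b "f x"] abV f(1) x T.geo_edge[OF E] by simp
      then consider "T.geo a (f x) = {}" | "T.geo a (f x) = T.geo a b" using T.geo_edge[OF E] by auto
      then show ?thesis
      proof cases
        case 1
        then show ?thesis using T.geo_empty[of a "f x"] abV f(1) x by auto
      next
        case 2
        then have "T.geo b (f x) = {}" using T.geo_cocycle[of b a "f x"] T.geo_sym[of a b] abV f(1) x by auto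
        then show ?thesis using T.geo_empty[of b "f x"] abV f(1) x by auto
      qed
    qed
    have "f c \<noteq> f c'" using edge[OF cE] k(2) c T.edge_verts(3)[of "f c" "f c'"] by auto
    then have "f ` k = {a, b}" using in_ab[of c] in_ab[of c'] c cV by auto
    then show "e \<in> (`) f ` {e \<in> edges S. w e \<noteq> 0}" using kE k(2) ab by blast
  next
    fix e assume "e \<in> (`) f ` {e \<in> edges S. w e \<noteq> 0}"
    then obtain k where k: "k \<in> edges S" "w k \<noteq> 0" "e = f ` k" by auto
    obtain c c' where c: "k = {c, c'}" using S.edge_ends[OF k(1)] by auto
    show "e \<in> edges T" using edge[of c c'] k c im[of c c'] by simp
  qed
  have lens: "len T (f ` e) = w e" if e: "e \<in> edges S" "w e \<noteq> 0" for e
  proof -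
    obtain c c' where c: "e = {c, c'}" using S.edge_ends[OF e(1)] by auto
    show ?thesis using edge[of c c'] e c im[of c c'] by simp
  qed
  have fibre: "f u = f v \<longleftrightarrow> (\<exists>p. is_path (verts S) {e \<in> edges S. w e = 0} p u v)"
    if "u \<in> verts S" "v \<in> verts S" for u v
    using eq0[OF that] S.dw_pt_zero_iff[OF nn that] S.zero_path_iff[OF that, of w] by simp
  have equi: "f (act S k v) = act T k (f v)" if k: "k \<in> carrier G" and v: "v \<in> verts S" for k v
    using surjection_act[OF \<psi> k, of "pt v"] f k v by simp
  have verts: "f ` verts S = verts T" using f(1) onto by blast
  show ?thesis
    by (intro exI[of _ f] conjI ballI impI verts edges lens equi fibre)
qed

end

end

section \<open>Collapse maps and equivariant isometries\<close>

context weighted_pair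
begin

text \<open>Barycentric coordinates are pushed forward along \<open>f\<close>. An edge of nonzero
  weight separates two vertices exactly when its image separates their images, so the coordinates
  correspond up to an exchange of sides, while edges of weight zero contribute nothing to
  \<open>S.dw w\<close>.\<close>

lemma collapse_surjection:
  assumes f: "f ` verts S = verts T"
    and fibre: "\<And>u v. u \<in> verts S \<Longrightarrow> v \<in> verts S \<Longrightarrow>
      f u = f v \<longleftrightarrow> (\<exists>p. is_path (verts S) {e \<in> edges S. w e = 0} p u v)"
    and equi: "\<And>g v. g \<in> carrier G \<Longrightarrow> v \<in> verts S \<Longrightarrow> f (act S g v) = act T g (f v)"
    and edg: "edges T = (`) f ` {e \<in> edges S. w e \<noteq> 0}"
    and lens: "\<And>e. e \<in> edges S \<Longrightarrow> w e \<noteq> 0 \<Longrightarrow> len T (f ` e) = w e"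
  shows "\<exists>\<kappa>. surjection \<kappa>"
proof -
  define N where "N = {e \<in> edges S. w e \<noteq> 0}"
  define \<kappa> where "\<kappa> x = (\<lambda>u. \<Sum>v\<in>supp x. if f v = u then x v else 0)" for x :: "'s \<Rightarrow> real"
  have fv: "f v \<in> verts T" if "v \<in> verts S" for v using f that by auto
  have fib: "f u = f v \<longleftrightarrow> (\<forall>e\<in>S.geo u v. w e = 0)" if "u \<in> verts S" "v \<in> verts S" for u v
    using fibre[OF that] S.zero_path_iff[OF that, of w] by simp
  have fedge: "f a = f b \<longleftrightarrow> w {a, b} = 0" if "{a, b} \<in> edges S" for a b
    using fib[OF S.edge_verts(1,2)[OF that]] S.geo_edge[OF that] by simp
  have fE: "{f a, f b} \<in> edges T" if ab: "{a, b} \<in> edges S" "f a \<noteq> f b" for a b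
  proof -
    have "{a, b} \<in> {e \<in> edges S. w e \<noteq> 0}" using fedge[OF ab(1)] ab by simp
    then have "f ` {a, b} \<in> edges T" unfolding edg by (rule imageI)
    then show ?thesis by simp
  qed
  \<comment> \<open>The ends of two edges with the same image are joined in pairs by paths of weight
    zero, which avoid \<open>e\<close>; so \<open>e\<close> lies on the segment between the ends of
    \<open>k\<close>.\<close>
  have inj: "e = k" if ek: "e \<in> N" "k \<in> N" "f ` e = f ` k" for e k
  proof -
    obtain a b where ab: "e = {a, b}" "{a, b} \<in> edges S" using S.edge_ends[of e] ek unfolding N_def by auto
    obtain c0 d0 where cd0: "k = {c0, d0}" using S.edge_ends[of k] ek unfolding N_def by auto
    have "{f a, f b} = {f c0, f d0}" using ek(3) ab cd0 by simp
    then obtain c d where cd: "k = {c, d}" "f a = f c" "f b = f d"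
      using cd0 by (auto simp: doubleton_eq_iff insert_commute)
    have kE: "{c, d} \<in> edges S" "w k \<noteq> 0" "w e \<noteq> 0" using ek cd unfolding N_def by auto
    note V = S.edge_verts[OF ab(2)] S.edge_verts[OF kE(1)]
    have "e \<notin> S.geo a c" "e \<notin> S.geo b d" using fib[of a c] fib[of b d] cd V kE by auto
    then have "e \<in> S.geo c d"
      using S.geo_cocycle[of a c d e] S.geo_cocycle[of a b d e] S.geo_edge[OF ab(2)] ab(1) V by auto
    then show ?thesis using S.geo_edge[OF kE(1)] cd(1) by simp
  qed
  have claim: "f ` e \<in> T.geo (f u) (f v) \<longleftrightarrow> e \<in> S.geo u v"
    if u: "u \<in> verts S" and v: "v \<in> verts S" and e: "e \<in> N" for u v e
  proof (rule S.conn_induct[OF u v, where P = "\<lambda>v. f ` e \<in> T.geo (f u) (f v) \<longleftrightarrow> e \<in> S.geo u v"])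
    show "f ` e \<in> T.geo (f u) (f u) \<longleftrightarrow> e \<in> S.geo u u" using T.geo_self[OF fv[OF u]] S.geo_self[OF u] by simp
    fix m z assume m: "m \<in> verts S" "{m, z} \<in> edges S" "f ` e \<in> T.geo (f u) (f m) \<longleftrightarrow> e \<in> S.geo u m"
    show "f ` e \<in> T.geo (f u) (f z) \<longleftrightarrow> e \<in> S.geo u z"
    proof (cases "f m = f z")
      case True
      then have "e \<noteq> {m, z}" using fedge[OF m(2)] e unfolding N_def by auto
      then show ?thesis using S.geo_step[OF u m(2), of e] m(3) True by simp
    next
      case False
      have mzN: "{m, z} \<in> N" using m(2) fedge[OF m(2)] False unfolding N_def by simp
      have "f ` e = {f m, f z} \<longleftrightarrow> e = {m, z}" using inj[OF e mzN] by auto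
      then show ?thesis using S.geo_step[OF u m(2), of e] T.geo_step[OF fv[OF u] fE[OF m(2) False], of "f ` e"] m(3) by simp
    qed
  qed
  have \<kappa>_pt: "\<kappa> (pt v) = pt (f v)" for v
    unfolding \<kappa>_def supp_pt by (auto simp: pt_def fun_eq_iff)
  have \<kappa>_mix: "\<kappa> (mix a b s) = (if f a = f b then pt (f a) else mix (f a) (f b) s)"
    if "a \<noteq> b" "0 < s" "s < 1" for a b s
    unfolding \<kappa>_def supp_mix[OF that] using that by (auto simp: pt_def fun_eq_iff) (auto simp: mix_def)
  have \<kappa>P: "\<kappa> x \<in> T.pts" if "x \<in> S.pts" for x
    using that
  proof (cases rule: S.pts_cases)
    case (edge a b s)
    then show ?thesis using \<kappa>_mix[of a b s] S.edge_verts[OF edge(1)] fv[of a] fE[OF edge(1)] T.mix_in[of "f a" "f b" s] by auto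
  qed (use \<kappa>_pt fv in auto)
  have cc: "T.cc (f ` e) (\<kappa> x) = (if f ` e \<in> T.geo T.root (f S.root) then 1 - S.cc e x else S.cc e x)"
    if e: "e \<in> N" and x: "x \<in> S.pts" for e x
  proof -
    have side: "f ` e \<in> T.geo T.root (f v) \<longleftrightarrow> (f ` e \<in> T.geo T.root (f S.root)) \<noteq> (e \<in> S.geo S.root v)"
      if v: "v \<in> verts S" for v
      using T.geo_cocycle[of T.root "f S.root" "f v" "f ` e"] claim[OF S.root_in v e] fv[OF S.root_in] fv[OF v] by simp
    show ?thesis
      using x
    proof (cases rule: S.pts_cases)
      case (vertex v)
      then show ?thesis using side[OF vertex(1)] \<kappa>_pt by auto
    next
      case (edge a b s)
      note ab = S.edge_verts[OF edge(1)]
      have "T.cc (f ` e) (\<kappa> x) = (1 - s) * of_bool (f ` e \<in> T.geo T.root (f a)) + s * of_bool (f ` e \<in> T.geo T.root (f b))"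
        unfolding edge(4) using \<kappa>_mix[OF ab(3) edge(2,3)] by (simp add: T.cc_mix algebra_simps)
      moreover have "S.cc e x = (1 - s) * of_bool (e \<in> S.geo S.root a) + s * of_bool (e \<in> S.geo S.root b)"
        unfolding edge(4) using ab(3) by (simp add: S.cc_mix)
      ultimately show ?thesis using side[OF ab(1)] side[OF ab(2)]
        by (cases "e \<in> S.geo S.root a"; cases "e \<in> S.geo S.root b"; cases "f ` e \<in> T.geo T.root (f S.root)")
           (simp_all add: algebra_simps)
    qed
  qed
  have dist: "T.td (\<kappa> x) (\<kappa> y) = S.dw w x y" if x: "x \<in> S.pts" and y: "y \<in> S.pts" for x y
  proof -
    let ?D = "{e \<in> N. S.cc e x \<noteq> S.cc e y}"
    have "S.dw w x y = (\<Sum>e\<in>?D. w e * \<bar>S.cc e x - S.cc e y\<bar>)"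
      unfolding S.dw_def by (rule sum.mono_neutral_right) (use S.cc_diff_finite[OF x y] in \<open>auto simp: N_def\<close>)
    also have "\<dots> = (\<Sum>e\<in>?D. len T (f ` e) * \<bar>T.cc (f ` e) (\<kappa> x) - T.cc (f ` e) (\<kappa> y)\<bar>)"
      by (rule sum.cong) (use cc x y lens in \<open>auto simp: N_def\<close>)
    also have "\<dots> = (\<Sum>e\<in>(`) f ` ?D. len T e * \<bar>T.cc e (\<kappa> x) - T.cc e (\<kappa> y)\<bar>)"
      by (rule sum.reindex[symmetric, unfolded o_def]) (use inj in \<open>auto simp: inj_on_def\<close>)
    also have "(`) f ` ?D = {e \<in> edges T. T.cc e (\<kappa> x) \<noteq> T.cc e (\<kappa> y)}"
    proof -
      have *: "T.cc (f ` e) (\<kappa> x) \<noteq> T.cc (f ` e) (\<kappa> y) \<longleftrightarrow> S.cc e x \<noteq> S.cc e y" if "e \<in> N" for e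
        using cc[OF that x] cc[OF that y] by simp
      have EN: "edges T = (`) f ` N" using edg unfolding N_def .
      show ?thesis
      proof (intro equalityI subsetI)
        fix e assume "e \<in> (`) f ` ?D"
        then obtain k where kD: "e = f ` k" "k \<in> ?D" by (rule imageE)
        then have k: "k \<in> N" "S.cc k x \<noteq> S.cc k y" "e = f ` k" by simp_all
        have "e \<in> edges T" unfolding EN k(3) using k(1) by (rule imageI)
        then show "e \<in> {e \<in> edges T. T.cc e (\<kappa> x) \<noteq> T.cc e (\<kappa> y)}" using *[OF k(1)] k(2,3) by simp
      next
        fix e assume "e \<in> {e \<in> edges T. T.cc e (\<kappa> x) \<noteq> T.cc e (\<kappa> y)}"
        then have e: "e \<in> edges T" "T.cc e (\<kappa> x) \<noteq> T.cc e (\<kappa> y)" by simp_all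
        have "e \<in> (`) f ` N" using e(1) unfolding EN .
        then obtain k where k: "e = f ` k" "k \<in> N" by (rule imageE)
        have "k \<in> ?D" using *[OF k(2)] e(2) k by simp
        then show "e \<in> (`) f ` ?D" unfolding k(1) by (rule imageI)
      qed
    qed
    finally show ?thesis unfolding T.dw_def by simp
  qed
  have act: "\<kappa> (S.pact k x) = T.pact k (\<kappa> x)" if k: "k \<in> carrier G" and x: "x \<in> S.pts" for k x
    using x
  proof (cases rule: S.pts_cases)
    case (vertex v)
    then show ?thesis using \<kappa>_pt k fv equi by simp
  next
    case (edge a b s)
    note ab = S.edge_verts[OF edge(1)]
    have ne: "act S k a \<noteq> act S k b" using ab k by simp
    have "\<kappa> (S.pact k x) = \<kappa> (mix (act S k a) (act S k b) s)" using edge(4) S.pact_mix[OF k ab(1,2)] by simp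
    also have "\<dots> = (if f a = f b then pt (act T k (f a)) else mix (act T k (f a)) (act T k (f b)) s)"
      using \<kappa>_mix[OF ne edge(2,3)] equi[OF k] ab T.act_eq_iff[OF k fv[OF ab(1)] fv[OF ab(2)]] by simp
    also have "\<dots> = T.pact k (\<kappa> x)"
      unfolding edge(4) using \<kappa>_mix[OF ab(3) edge(2,3)] T.pact_mix[OF k fv[OF ab(1)] fv[OF ab(2)]] fv[OF ab(1)] fv[OF ab(2)] k by simp
    finally show ?thesis .
  qed
  have "y \<in> \<kappa> ` S.pts" if y: "y \<in> T.pts" for y
    using y
  proof (cases rule: T.pts_cases)
    case (vertex u)
    then have "u \<in> f ` verts S" using f by simp
    then obtain v where "u = f v" "v \<in> verts S" by (rule imageE)
    then show ?thesis using \<kappa>_pt[of v] vertex by (intro image_eqI[of _ _ "pt v"]) auto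
  next
    case (edge a' b' s)
    obtain e where e: "e \<in> N" "{a', b'} = f ` e" using edge(1) unfolding edg N_def by auto
    obtain a b where ab: "e = {a, b}" "{a, b} \<in> edges S" using S.edge_ends[of e] e unfolding N_def by auto
    note V = S.edge_verts[OF ab(2)]
    have fne: "f a \<noteq> f b" using fedge[OF ab(2)] e ab unfolding N_def by simp
    have "a' = f a \<and> b' = f b \<or> a' = f b \<and> b' = f a" using e(2) ab(1) by (auto simp: doubleton_eq_iff)
    then show ?thesis
    proof
      assume "a' = f a \<and> b' = f b"
      then have "y = \<kappa> (mix a b s)" using \<kappa>_mix[OF V(3) edge(2,3)] edge(4) fne by simp
      moreover have "mix a b s \<in> S.pts" using S.mix_in[OF ab(2)] edge by simp
      ultimately show ?thesis by (rule image_eqI)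
    next
      assume "a' = f b \<and> b' = f a"
      then have "y = \<kappa> (mix a b (1 - s))" using \<kappa>_mix[OF V(3), of "1 - s"] edge fne mix_swap[of "f b" "f a" s] by simp
      moreover have "mix a b (1 - s) \<in> S.pts" using S.mix_in[OF ab(2)] edge by simp
      ultimately show ?thesis by (rule image_eqI)
    qed
  qed
  then have "surjection \<kappa>" unfolding surjection_def using \<kappa>P dist act by blast
  then show ?thesis by blast
qed

end

text \<open>Both trees are the quotient of \<open>S\<close> by the relation of having distance zero.
  This yields the uniqueness of collapses and, when \<open>w\<close> is the length function of a
  metric tree, symmetry and transitivity of equivariant isometry.\<close>

lemma surjections_isometric:
  assumes "weighted_pair G S T1 w" "weighted_pair G S T2 w"
    and s1: "weighted_pair.surjection G S T1 w \<psi>1" and s2: "weighted_pair.surjection G S T2 w \<psi>2"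
  shows "equivariantly_isometric G T1 T2"
proof -
  interpret A: weighted_pair G S T1 w by fact
  interpret B: weighted_pair G S T2 w by fact
  define r where "r y = (SOME a. a \<in> A.S.pts \<and> \<psi>1 a = y)" for y
  have r: "r y \<in> A.S.pts" "\<psi>1 (r y) = y" if "y \<in> A.T.pts" for y
    using someI_ex[of "\<lambda>a. a \<in> A.S.pts \<and> \<psi>1 a = y"] A.surjection_onto[OF s1 that] unfolding r_def by auto
  define F where "F y = \<psi>2 (r y)" for y
  have FP: "F y \<in> B.T.pts" if "y \<in> A.T.pts" for y
    unfolding F_def using B.surjection_pts[OF s2] r[OF that] by simp
  have dist: "B.T.td (F x) (F y) = A.T.td x y" if "x \<in> A.T.pts" "y \<in> A.T.pts" for x y
    unfolding F_def using A.surjection_dist[OF s1 r(1)[OF that(1)] r(1)[OF that(2)]]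
      B.surjection_dist[OF s2 r(1)[OF that(1)] r(1)[OF that(2)]] r(2) that by simp
  have Feq: "F (\<psi>1 a) = \<psi>2 a" if a: "a \<in> A.S.pts" for a
  proof -
    have y: "\<psi>1 a \<in> A.T.pts" using A.surjection_pts[OF s1 a] .
    have "A.S.dw w (r (\<psi>1 a)) a = A.T.td (\<psi>1 a) (\<psi>1 a)" using A.surjection_dist[OF s1 r(1)[OF y] a] r(2)[OF y] by simp
    then have "B.T.td (\<psi>2 (r (\<psi>1 a))) (\<psi>2 a) = 0" using B.surjection_dist[OF s2 r(1)[OF y] a] by simp
    then show ?thesis
      unfolding F_def using B.T.td_eq_0 B.surjection_pts[OF s2 r(1)[OF y]] B.surjection_pts[OF s2 a] by simp
  qed
  have "inj_on F A.T.pts"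
  proof (rule inj_onI)
    fix x y assume xy: "x \<in> A.T.pts" "y \<in> A.T.pts" "F x = F y"
    then have "A.T.td x y = 0" using dist[OF xy(1,2)] by simp
    then show "x = y" using A.T.td_eq_0[OF xy(1,2)] by simp
  qed
  moreover have "F ` A.T.pts = B.T.pts"
  proof (intro equalityI subsetI)
    fix y assume "y \<in> B.T.pts"
    then obtain a where a: "a \<in> A.S.pts" "\<psi>2 a = y" using B.surjection_onto[OF s2] by blast
    then have "y = F (\<psi>1 a)" using Feq[OF a(1)] by simp
    then show "y \<in> F ` A.T.pts" using A.surjection_pts[OF s1 a(1)] by (rule image_eqI)
  qed (use FP in auto)
  ultimately have bij: "bij_betw F A.T.pts B.T.pts" unfolding bij_betw_def by simp
  have equi: "F (A.T.pact k x) = B.T.pact k (F x)" if k: "k \<in> carrier G" and x: "x \<in> A.T.pts" for k x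
  proof -
    have "A.T.pact k x = \<psi>1 (A.S.pact k (r x))" using A.surjection_act[OF s1 k r(1)[OF x]] r(2)[OF x] by simp
    then have "F (A.T.pact k x) = \<psi>2 (A.S.pact k (r x))" using Feq r(1)[OF x] k by simp
    then show ?thesis using B.surjection_act[OF s2 k r(1)[OF x]] unfolding F_def by simp
  qed
  show ?thesis
    unfolding equivariantly_isometric_def A.T.points_eq B.T.points_eq
    using bij dist equi A.T.point_dist_eq B.T.point_dist_eq FP by (intro exI[of _ F]) auto
qed

lemma weighted_pair_metric: "is_metric_gtree G T \<Longrightarrow> is_metric_gtree G T' \<Longrightarrow> weighted_pair G T T' (len T)"
proof -
  assume T: "is_metric_gtree G T" "is_metric_gtree G T'"
  interpret A: mtr G T by (rule mtr_I[OF T(1)])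
  interpret B: mtr G T' by (rule mtr_I[OF T(2)])
  show ?thesis by unfold_locales (rule A.inv_weight_len)
qed

lemma isometric_surjection:
  assumes "is_metric_gtree G T" "is_metric_gtree G T'" "equivariantly_isometric G T T'"
  shows "\<exists>F. weighted_pair.surjection G T T' (len T) F"
proof -
  interpret weighted_pair G T T' "len T" by (rule weighted_pair_metric[OF assms(1,2)])
  interpret A: mtr G T by (rule mtr_I[OF assms(1)])
  obtain F where F: "bij_betw F S.pts T.pts"
    "\<forall>x\<in>S.pts. \<forall>y\<in>S.pts. point_dist T' (F x) (F y) = point_dist T x y"
    "\<forall>g\<in>carrier G. \<forall>x\<in>S.pts. F (point_act G T g x) = point_act G T' g (F x)"
    using assms(3) unfolding equivariantly_isometric_def A.points_eq T.points_eq by blast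
  have im: "F ` S.pts = T.pts" using F(1) unfolding bij_betw_def by simp
  then have FP: "F x \<in> T.pts" if "x \<in> S.pts" for x using that by auto
  have "surjection F" unfolding surjection_def
    using im F(2,3) FP A.point_dist_eq T.point_dist_eq by simp
  then show ?thesis by blast
qed

lemma surjection_trans:
  assumes "weighted_pair G S T w" and s: "weighted_pair.surjection G S T w \<psi>"
    and m: "is_metric_gtree G T'" and iso: "equivariantly_isometric G T T'"
  shows "weighted_pair G S T' w \<and> (\<exists>\<psi>'. weighted_pair.surjection G S T' w \<psi>')"
proof -
  interpret A: weighted_pair G S T w by fact
  interpret B: weighted_pair G T T' "len T" by (rule weighted_pair_metric[OF A.T.metric m])
  obtain F where F: "B.surjection F" using isometric_surjection[OF A.T.metric m iso] by auto
  interpret C: weighted_pair G S T' w by unfold_locales (rule A.w)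
  have "F ` \<psi> ` A.S.pts = B.T.pts" using s F unfolding A.surjection_def B.surjection_def by simp
  then have "C.surjection (F \<circ> \<psi>)"
    unfolding C.surjection_def
    using A.surjection_pts[OF s] A.surjection_dist[OF s] A.surjection_act[OF s] B.surjection_dist[OF F] B.surjection_act[OF F]
    by (simp add: image_comp)
  then show ?thesis using C.weighted_pair_axioms by blast
qed

lemma isometric_refl: "is_metric_gtree G T \<Longrightarrow> equivariantly_isometric G T T"
  unfolding equivariantly_isometric_def by (intro exI[of _ id]) auto

text \<open>Both trees receive a surjection from \<open>T\<close>, and in
  \<open>surjections_isometric\<close> the two targets may be exchanged.\<close>

lemma isometric_sym:
  assumes "is_metric_gtree G T" "is_metric_gtree G T'" "equivariantly_isometric G T T'"
  shows "equivariantly_isometric G T' T"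
  using surjections_isometric[OF weighted_pair_metric[OF assms(1,2)] weighted_pair_metric[OF assms(1,1)]]
    isometric_surjection[OF assms] isometric_surjection[OF assms(1,1) isometric_refl[OF assms(1)]] by blast

lemma isometric_trans:
  assumes "is_metric_gtree G T" "is_metric_gtree G T'" "is_metric_gtree G T''"
    "equivariantly_isometric G T T'" "equivariantly_isometric G T' T''"
  shows "equivariantly_isometric G T T''"
proof -
  obtain F where F: "weighted_pair.surjection G T T' (len T) F" using isometric_surjection[OF assms(1,2,4)] by auto
  obtain F' where F': "weighted_pair.surjection G T T'' (len T) F'"
    using surjection_trans[OF weighted_pair_metric[OF assms(1,2)] F assms(3,5)] by auto
  obtain I where "weighted_pair.surjection G T T (len T) I"
    using isometric_surjection[OF assms(1,1) isometric_refl[OF assms(1)]] by auto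
  then show ?thesis
    using surjections_isometric[OF weighted_pair_metric[OF assms(1,1)] weighted_pair_metric[OF assms(1,3)] _ F'] by blast
qed

lemma class_self: "is_metric_gtree G T \<Longrightarrow> T \<in> isometry_class G T"
  unfolding isometry_class_def using isometric_refl by auto

lemma class_eqI:
  assumes "is_metric_gtree G T" "is_metric_gtree G T'" "equivariantly_isometric G T T'"
  shows "isometry_class G T' = isometry_class G T"
  unfolding isometry_class_def using isometric_sym[OF assms] isometric_trans assms by blast

section \<open>Points of cones\<close>

context gtr
begin

lemma orbit_act: "g \<in> carrier G \<Longrightarrow> e \<in> edges T \<Longrightarrow> orbit G (edge_act T) (act T g ` e) = orbit G (edge_act T) e"
proof -
  assume g: "g \<in> carrier G" and e: "e \<in> edges T"
  show ?thesis
  proof (intro equalityI subsetI)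
    fix x assume "x \<in> orbit G (edge_act T) (act T g ` e)"
    then obtain h where h: "h \<in> carrier G" "x = act T h ` act T g ` e" unfolding orbit_def by auto
    then have "x = act T (h \<otimes>\<^bsub>G\<^esub> g) ` e" using act_edge_mult[OF h(1) g e] by simp
    then show "x \<in> orbit G (edge_act T) e" unfolding orbit_def using h g by blast
  next
    fix x assume "x \<in> orbit G (edge_act T) e"
    then obtain h where h: "h \<in> carrier G" "x = act T h ` e" unfolding orbit_def by auto
    then have "x = act T (h \<otimes>\<^bsub>G\<^esub> inv\<^bsub>G\<^esub> g) ` act T g ` e"
      using act_edge_mult[of h "inv\<^bsub>G\<^esub> g" "act T g ` e"] g e by simp
    moreover have "h \<otimes>\<^bsub>G\<^esub> inv\<^bsub>G\<^esub> g \<in> carrier G" using h g by simp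
    ultimately show "x \<in> orbit G (edge_act T) (act T g ` e)" unfolding orbit_def by blast
  qed
qed

lemma inv_weight_edge_weight:
  "(\<And>c. c \<in> edge_orbits G T \<Longrightarrow> 0 \<le> \<omega> c) \<Longrightarrow> inv_weight (edge_weight G T \<omega>)"
  unfolding inv_weight_def edge_weight_def edge_orbits_def orbits_def using orbit_act by auto

end

lemma collapse_pair:
  assumes S: "is_gtree G S" and \<omega>: "\<And>c. c \<in> edge_orbits G S \<Longrightarrow> 0 \<le> \<omega> c"
    and T: "is_metric_gtree G T"
  shows "weighted_pair G S T (edge_weight G S \<omega>)"
proof -
  interpret S: gtr G S by unfold_locales (rule S)
  interpret T: mtr G T by (rule mtr_I[OF T])
  show ?thesis by unfold_locales (rule S.inv_weight_edge_weight[OF \<omega>])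
qed

lemma collapse_to_surjection:
  assumes S: "is_gtree G S" and \<omega>: "\<And>c. c \<in> edge_orbits G S \<Longrightarrow> 0 \<le> \<omega> c"
    and T: "is_metric_gtree G T" and c: "collapses_to G S \<omega> T"
  shows "\<exists>\<kappa>. weighted_pair.surjection G S T (edge_weight G S \<omega>) \<kappa>"
proof -
  interpret weighted_pair G S T "edge_weight G S \<omega>" by (rule collapse_pair[OF S \<omega> T])
  from c obtain f where f: "f ` verts S = verts T"
    "\<forall>u\<in>verts S. \<forall>v\<in>verts S.
       f u = f v \<longleftrightarrow> (\<exists>p. is_path (verts S) {e \<in> edges S. edge_weight G S \<omega> e = 0} p u v)"
    "\<forall>g\<in>carrier G. \<forall>v\<in>verts S. f (act S g v) = act T g (f v)"
    "edges T = (`) f ` {e \<in> edges S. edge_weight G S \<omega> e \<noteq> 0}"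
    "\<forall>e\<in>edges S. edge_weight G S \<omega> e \<noteq> 0 \<longrightarrow> len T (f ` e) = edge_weight G S \<omega> e"
    unfolding collapses_to_def by (elim exE conjE)
  show ?thesis
    by (rule collapse_surjection[of f]) (use f in auto)
qed

text \<open>\<open>cone_point\<close> is a union over all trees realizing the collapse. These are
  equivariantly isometric, as \<open>S\<close> with the lengths \<open>\<omega>\<close> determines
  the target, so the union is a single class.\<close>

lemma cone_point_eq:
  assumes S: "is_gtree G S" and \<omega>: "\<And>c. c \<in> edge_orbits G S \<Longrightarrow> 0 \<le> \<omega> c"
    and T: "is_metric_gtree G T" and c: "collapses_to G S \<omega> T"
  shows "cone_point G S \<omega> = isometry_class G T"
proof -
  have "isometry_class G T' = isometry_class G T" if T': "is_metric_gtree G T'" "collapses_to G S \<omega> T'" for T'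
  proof -
    note P = collapse_pair[where \<omega> = \<omega>, OF S \<omega> T] collapse_pair[where \<omega> = \<omega>, OF S \<omega> T'(1)]
    obtain \<kappa> where \<kappa>: "weighted_pair.surjection G S T (edge_weight G S \<omega>) \<kappa>"
      using collapse_to_surjection[where \<omega> = \<omega>, OF S \<omega> T c] by auto
    obtain \<kappa>' where \<kappa>': "weighted_pair.surjection G S T' (edge_weight G S \<omega>) \<kappa>'"
      using collapse_to_surjection[where \<omega> = \<omega>, OF S \<omega> T'] by auto
    show ?thesis by (rule class_eqI[OF T T'(1) surjections_isometric[OF P \<kappa> \<kappa>']])
  qed
  note * = this
  have "cone_point G S \<omega> \<subseteq> isometry_class G T"
  proof
    fix X assume "X \<in> cone_point G S \<omega>"
    then obtain T' where T': "is_metric_gtree G T'" "collapses_to G S \<omega> T'" "X \<in> isometry_class G T'"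
      unfolding cone_point_def by (elim UnionE imageE CollectE conjE) simp
    show "X \<in> isometry_class G T" using T'(3) unfolding *[OF T'(1,2)] .
  qed
  moreover have "isometry_class G T \<subseteq> cone_point G S \<omega>"
    unfolding cone_point_def by (rule Union_upper) (intro imageI CollectI conjI T c)
  ultimately show ?thesis by (rule equalityI)
qed

section \<open>Limits of approximating length vectors\<close>

context simp_tree
begin

text \<open>Bounded parts of a tree need not be compact when vertices have infinitely many edges;
  with finitely many vertices allowed, the set is a finite union of vertices and closed edges. The
  topology is that of pointwise convergence of barycentric coordinates.\<close>

lemma compact_supported:
  assumes F: "finite F" "F \<subseteq> V"
  shows "compact {r \<in> pts. supp r \<subseteq> F}"
proof -
  have cont: "continuous_on {0..1} (mix a b)" for a b :: 'v
  proof (rule continuous_on_coordinatewise_then_product)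
    fix v :: 'v
    consider "v = a" | "v \<noteq> a" "v = b" | "v \<noteq> a" "v \<noteq> b" by auto
    then show "continuous_on {0..1} (\<lambda>s. mix a b s v)"
      unfolding mix_def by cases (auto intro!: continuous_intros)
  qed
  let ?I = "{(a, b) \<in> F \<times> F. {a, b} \<in> E}"
  have fI: "finite ?I" by (rule finite_subset[of _ "F \<times> F"]) (use F in auto)
  have "{r \<in> pts. supp r \<subseteq> F} = pt ` F \<union> (\<Union>(a, b)\<in>?I. mix a b ` {0..1})"
  proof (intro equalityI subsetI)
    fix r assume "r \<in> {r \<in> pts. supp r \<subseteq> F}"
    then have r: "r \<in> pts" "supp r \<subseteq> F" by auto
    show "r \<in> pt ` F \<union> (\<Union>(a, b)\<in>?I. mix a b ` {0..1})"
      using r(1)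
    proof (cases rule: pts_cases)
      case (edge a b s)
      have "{a, b} \<subseteq> F" using r(2) edge supp_mix[of a b s] edge_verts[OF edge(1)] by auto
      then have "(a, b) \<in> ?I" using edge by auto
      moreover have "r \<in> mix a b ` {0..1}" using edge by auto
      ultimately show ?thesis by blast
    qed (use r in auto)
  next
    fix r assume "r \<in> pt ` F \<union> (\<Union>(a, b)\<in>?I. mix a b ` {0..1})"
    then show "r \<in> {r \<in> pts. supp r \<subseteq> F}"
    proof
      assume "r \<in> (\<Union>(a, b)\<in>?I. mix a b ` {0..1})"
      then obtain a b s where "a \<in> F" "b \<in> F" "{a, b} \<in> E" "0 \<le> s" "s \<le> 1" "r = mix a b s" by auto
      then show ?thesis using mix_in[of a b s] supp_mix_subset[of a b s] by auto
    qed (use F in auto)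
  qed
  moreover have 1: "compact (pt ` F)" using F by (intro finite_imp_compact) auto
  moreover have 2: "compact (\<Union>(a, b)\<in>?I. mix a b ` {0..1})"
    by (rule compact_UN[OF fI]) (auto intro!: compact_continuous_image cont)
  ultimately show ?thesis using compact_Un[OF 1 2] by simp
qed

end

context gtr
begin

lemma cc_pact_sum:
  assumes k: "k \<in> carrier G" and r: "r \<in> pts" "supp r \<subseteq> F" and F: "finite F" "F \<subseteq> verts T"
  shows "cc e (pact k r) = (\<Sum>v\<in>F. r v * of_bool (e \<in> geo root (act T k v)))"
proof -
  have V: "supp r \<subseteq> verts T" using supp_pts(2)[OF r(1)] .
  have "cc e (pact k r) = (\<Sum>u\<in>act T k ` supp r. pact k r u * of_bool (e \<in> geo root u))"
    unfolding cc_def supp_pact[OF k r(1)] ..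
  also have "\<dots> = (\<Sum>v\<in>supp r. pact k r (act T k v) * of_bool (e \<in> geo root (act T k v)))"
    by (rule sum.reindex[unfolded o_def]) (use V k in \<open>auto simp: inj_on_def subset_iff\<close>)
  also have "\<dots> = (\<Sum>v\<in>supp r. r v * of_bool (e \<in> geo root (act T k v)))"
    by (rule sum.cong) (use V k in \<open>auto simp: point_act_def subset_iff\<close>)
  also have "\<dots> = (\<Sum>v\<in>F. r v * of_bool (e \<in> geo root (act T k v)))"
    by (rule sum.mono_neutral_left) (use F r in \<open>auto simp: supp_def\<close>)
  finally show ?thesis .
qed

text \<open>One finite set of edges serves all points supported in \<open>F\<close> and all lengths,
  which makes the displacement by \<open>k\<close> jointly continuous in lengths and point.\<close>

lemma displacement_formula:
  assumes k: "k \<in> carrier G" and F: "finite F" "F \<subseteq> verts T"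
  obtains E0 where "finite E0" "E0 \<subseteq> edges T"
    "\<And>w r. r \<in> pts \<Longrightarrow> supp r \<subseteq> F \<Longrightarrow> dw w r (pact k r) =
      (\<Sum>e\<in>E0. w e * \<bar>(\<Sum>v\<in>F. r v * of_bool (e \<in> geo root v)) - (\<Sum>v\<in>F. r v * of_bool (e \<in> geo root (act T k v)))\<bar>)"
proof -
  let ?E0 = "{e \<in> edges T. e \<subseteq> F} \<union> {e \<in> edges T. e \<subseteq> act T k ` F} \<union> (\<Union>a\<in>F. \<Union>b\<in>F. geo a (act T k b))"
  have fin: "finite ?E0"
  proof -
    have "finite {e \<in> edges T. e \<subseteq> F}" by (rule finite_subset[of _ "Pow F"]) (use F in auto)
    moreover have "finite {e \<in> edges T. e \<subseteq> act T k ` F}" by (rule finite_subset[of _ "Pow (act T k ` F)"]) (use F in auto)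
    ultimately show ?thesis using F finite_geo by auto
  qed
  have sub: "?E0 \<subseteq> edges T"
  proof -
    have "geo a (act T k b) \<subseteq> edges T" if "a \<in> F" "b \<in> F" for a b
    proof -
      have "a \<in> verts T" "act T k b \<in> verts T" using that F k by auto
      then show ?thesis using geo_in_E by blast
    qed
    then show ?thesis by blast
  qed
  have "dw w r (pact k r) = (\<Sum>e\<in>?E0. w e * \<bar>(\<Sum>v\<in>F. r v * of_bool (e \<in> geo root v)) - (\<Sum>v\<in>F. r v * of_bool (e \<in> geo root (act T k v)))\<bar>)"
    if r: "r \<in> pts" "supp r \<subseteq> F" for w r
  proof -
    have kr: "pact k r \<in> pts" using k r by simp
    have sk: "supp (pact k r) \<subseteq> act T k ` F" using supp_pact[OF k r(1)] r(2) by auto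
    obtain a where a: "a \<in> supp r" using supp_pts(3)[OF r(1)] by auto
    then have ka: "act T k a \<in> supp (pact k r)" using supp_pact[OF k r(1)] by auto
    have "{e \<in> edges T. cc e r \<noteq> cc e (pact k r)} \<subseteq> ?E0"
    proof
      fix e assume "e \<in> {e \<in> edges T. cc e r \<noteq> cc e (pact k r)}"
      then have e: "e \<in> edges T" "cc e r \<noteq> cc e (pact k r)" by auto
      from cc_diff_subset[OF r(1) kr a ka e(2)] show "e \<in> ?E0"
        using e(1) r(2) sk a by blast
    qed
    from dw_superset[OF fin this sub] show ?thesis
      unfolding cc_superset[OF F(1) r(2)] cc_pact_sum[OF k r F] .
  qed
  then show ?thesis using that[OF fin sub] by blast
qed

end

lemma (in mtr) td_nonneg: "0 \<le> td x y"
  by (rule dw_nonneg) (rule less_imp_le[OF len_pos])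

locale gtr_pair = S: gtr G S + T: mtr G T
  for G :: "('g, 'b) monoid_scheme" and S T :: "('g, 'v) metric_gtree"
begin

abbreviation sw :: "('v set set \<Rightarrow> real) \<Rightarrow> 'v set \<Rightarrow> real" where "sw \<equiv> edge_weight G S"

lemma sw_inv: "\<omega> \<in> edge_orbits G S \<rightarrow>\<^sub>E {0..} \<Longrightarrow> S.inv_weight (sw \<omega>)"
  by (rule S.inv_weight_edge_weight) auto

text \<open>Each approximating point is replaced by its projection to the axis of \<open>g\<close>
  in \<open>S\<close>, which \<open>axis_trap\<close> confines to a fixed finite set; the
  displacements change by at most twice the distance moved. Displacements by generators bound the
  lengths through \<open>weight_bound\<close>.\<close>

lemma approximations_bounded:
  assumes A0: "finite A0" "A0 \<subseteq> carrier G" "generate G A0 = carrier G"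
    and x: "x \<in> verts T" and g: "g \<in> carrier G" and h: "h \<in> carrier G"
    and ax: "T.B (pt x) (pt (act T g x)) (pt (act T g (act T g x)))" and gx: "act T g x \<noteq> x"
    and hx: "T.td (pt x) (pt (act T h (act T h x))) < 2 * T.td (pt x) (pt (act T h x))"
    and free: "\<And>v. v \<in> verts S \<Longrightarrow> act S g v \<noteq> v"
    and Q: "Q \<subseteq> edge_orbits G S \<rightarrow>\<^sub>E {0..}"
    and approx: "\<And>A \<epsilon>. finite A \<Longrightarrow> A \<subseteq> carrier G \<Longrightarrow> 0 < \<epsilon> \<Longrightarrow> \<exists>\<omega>\<in>Q. \<exists>p\<in>S.pts. \<forall>k\<in>A.
      \<bar>T.td (pt x) (T.pact k (pt x)) - S.dw (sw \<omega>) p (S.pact k p)\<bar> < \<epsilon>"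
  obtains F R where "finite F" "F \<subseteq> verts S"
    "\<And>A \<epsilon>. finite A \<Longrightarrow> A \<subseteq> carrier G \<Longrightarrow> 0 < \<epsilon> \<Longrightarrow> \<exists>\<omega>\<in>Q. (\<forall>c\<in>edge_orbits G S. \<omega> c \<le> R) \<and>
      (\<exists>p\<in>S.pts. supp p \<subseteq> F \<and> (\<forall>k\<in>A.
      \<bar>T.td (pt x) (T.pact k (pt x)) - S.dw (sw \<omega>) p (S.pact k p)\<bar> < \<epsilon>))"
proof -
  let ?\<tau> = "\<lambda>k. T.td (pt x) (T.pact k (pt x))"
  define a where "a = ?\<tau> g"
  define dh where "dh = 2 * ?\<tau> h - T.td (pt x) (T.pact h (T.pact h (pt x)))"
  have gxV: "act T g x \<in> verts T" "act T g (act T g x) \<in> verts T" using g x by auto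
  have a: "0 < a" unfolding a_def
    using T.td_eq_0[of "pt x" "pt (act T g x)"] T.td_nonneg[of "pt x" "pt (act T g x)"] gx x g
    by (auto simp: order_less_le)
  have dh: "0 < dh" unfolding dh_def using hx x h by simp
  have gg: "?\<tau> (g \<otimes>\<^bsub>G\<^esub> g) = 2 * a"
  proof -
    have "T.td (pt x) (pt (act T g x)) + T.td (pt (act T g x)) (pt (act T g (act T g x))) = T.td (pt x) (pt (act T g (act T g x)))"
      using T.td_B[of "pt x" "pt (act T g x)" "pt (act T g (act T g x))"] ax gxV x by simp
    moreover have "T.td (pt (act T g x)) (pt (act T g (act T g x))) = T.td (pt x) (pt (act T g x))"
      using T.dw_act[OF T.inv_weight_len g, of "pt x" "pt (act T g x)"] g x by simp
    ultimately show ?thesis unfolding a_def using T.pact_mult[OF g g, of "pt x"] g x by simp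
  qed
  have hh: "?\<tau> (h \<otimes>\<^bsub>G\<^esub> h) = 2 * ?\<tau> h - dh" unfolding dh_def using T.pact_mult[OF h h, of "pt x"] x by simp
  obtain q where q: "q \<in> verts S" "S.B (pt q) (pt (act S g q)) (pt (act S g (act S g q)))"
    using S.axis_vertex[OF g free] by auto
  obtain F where F: "finite F" "F \<subseteq> verts S" and trap: "\<And>w p. S.inv_weight w \<Longrightarrow> p \<in> S.pts \<Longrightarrow>
      (let Dg = 2 * S.dw w p (S.pact g p) - S.dw w p (S.pact g (S.pact g p));
           Dh = 2 * S.dw w p (S.pact h p) - S.dw w p (S.pact h (S.pact h p)) in
       a / 2 \<le> S.dw w p (S.pact g p) - Dg \<and> S.dw w p (S.pact h p) + Dg \<le> ?\<tau> h + 2 \<and> 3 * Dg < Dh \<longrightarrow>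
       (\<exists>r\<in>S.pts. supp r \<subseteq> F \<and> 2 * S.dw w p r = Dg))"
    using S.axis_trap[OF g h q free[OF q(1)], of "a / 2" "?\<tau> h + 2"] a by auto
  define R where "R = 2 * (\<Sum>b\<in>A0. ?\<tau> b + 1)"
  have "\<exists>\<omega>\<in>Q. (\<forall>c\<in>edge_orbits G S. \<omega> c \<le> R) \<and> (\<exists>p\<in>S.pts. supp p \<subseteq> F \<and> (\<forall>k\<in>A.
      \<bar>?\<tau> k - S.dw (sw \<omega>) p (S.pact k p)\<bar> < \<epsilon>))"
    if A: "finite A" "A \<subseteq> carrier G" "0 < \<epsilon>" for A \<epsilon>
  proof -
    \<comment> \<open>The approximation gives \<open>Dg < 3 * \<delta>\<close> and
      \<open>dh - 3 * \<delta> < Dh\<close>, the exact values for \<open>x\<close> being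
      \<open>0\<close> and \<open>dh\<close>. The conditions of \<open>axis_trap\<close> need
      \<open>4 * \<delta>\<close> at most \<open>a / 2\<close> and \<open>12 * \<delta>\<close> at
      most \<open>dh\<close>; moving from \<open>p\<close> to \<open>r\<close> adds
      \<open>Dg\<close> to the error \<open>\<delta>\<close>, whence
      \<open>4 * \<delta> \<le> \<epsilon>\<close>.\<close>
    define \<delta> where "\<delta> = min (\<epsilon> / 4) (min (1 / 4) (min (a / 16) (dh / 16)))"
    have \<delta>: "0 < \<delta>" "4 * \<delta> \<le> \<epsilon>" "\<delta> \<le> 1 / 4" "16 * \<delta> \<le> a" "16 * \<delta> \<le> dh"
      unfolding \<delta>_def using A a dh by auto
    let ?A = "A \<union> A0 \<union> {g, h, g \<otimes>\<^bsub>G\<^esub> g, h \<otimes>\<^bsub>G\<^esub> h}"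
    have "finite ?A" "?A \<subseteq> carrier G" using A A0 g h by auto
    from approx[OF this \<delta>(1)] obtain \<omega> p where \<omega>: "\<omega> \<in> Q" and p: "p \<in> S.pts"
      and ap: "\<And>k. k \<in> ?A \<Longrightarrow> \<bar>?\<tau> k - S.dw (sw \<omega>) p (S.pact k p)\<bar> < \<delta>" by blast
    let ?e = "S.dw (sw \<omega>)"
    have w: "S.inv_weight (sw \<omega>)" by (rule sw_inv) (use \<omega> Q in auto)
    have tr: "?e a c \<le> ?e a b + ?e b c" if "a \<in> S.pts" "b \<in> S.pts" "c \<in> S.pts" for a b c
      by (rule S.dw_tri[OF S.inv_weight_nonneg[OF w] that])
    have R: "\<omega> c \<le> R" if "c \<in> edge_orbits G S" for c
    proof -
      obtain e where e: "e \<in> edges S" "c = orbit G (edge_act S) e" using \<open>c \<in> _\<close> unfolding edge_orbits_def orbits_def by auto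
      have "\<omega> c = sw \<omega> e" unfolding edge_weight_def e(2) ..
      also have "\<dots> \<le> 2 * (\<Sum>b\<in>A0. ?e p (S.pact b p))" by (rule S.weight_bound[OF A0 w p e(1)])
      also have "(\<Sum>b\<in>A0. ?e p (S.pact b p)) \<le> (\<Sum>b\<in>A0. ?\<tau> b + 1)"
      proof (rule sum_mono)
        fix b assume "b \<in> A0"
        then show "?e p (S.pact b p) \<le> ?\<tau> b + 1" using ap[of b] \<delta>(3) by auto
      qed
      finally show ?thesis unfolding R_def by simp
    qed
    define Dg where "Dg = 2 * ?e p (S.pact g p) - ?e p (S.pact g (S.pact g p))"
    define Dh where "Dh = 2 * ?e p (S.pact h p) - ?e p (S.pact h (S.pact h p))"
    have apg: "\<bar>a - ?e p (S.pact g p)\<bar> < \<delta>" "\<bar>2 * a - ?e p (S.pact g (S.pact g p))\<bar> < \<delta>"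
      using ap[of g] ap[of "g \<otimes>\<^bsub>G\<^esub> g"] gg S.pact_mult[OF g g p] unfolding a_def by auto
    have aph: "\<bar>?\<tau> h - ?e p (S.pact h p)\<bar> < \<delta>" "\<bar>2 * ?\<tau> h - dh - ?e p (S.pact h (S.pact h p))\<bar> < \<delta>"
      using ap[of h] ap[of "h \<otimes>\<^bsub>G\<^esub> h"] hh S.pact_mult[OF h h p] by auto
    have D: "Dg < 3 * \<delta>" "dh - 3 * \<delta> < Dh" unfolding Dg_def Dh_def using apg aph by linarith+
    have "a / 2 \<le> ?e p (S.pact g p) - Dg" using apg(1) D(1) \<delta>(1,4) by linarith
    moreover have "?e p (S.pact h p) + Dg \<le> ?\<tau> h + 2" using aph(1) D(1) \<delta>(3) by linarith
    moreover have "3 * Dg < Dh" using D \<delta>(1,5) by linarith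
    ultimately obtain r where r: "r \<in> S.pts" "supp r \<subseteq> F" "2 * ?e p r = Dg"
      using trap[OF w p] unfolding Let_def Dg_def Dh_def by blast
    have "\<bar>?\<tau> k - ?e r (S.pact k r)\<bar> < \<epsilon>" if k: "k \<in> A" for k
    proof -
      have kc: "k \<in> carrier G" using k A by auto
      have P: "S.pact k p \<in> S.pts" "S.pact k r \<in> S.pts" using kc p r by auto
      have e: "?e (S.pact k p) (S.pact k r) = ?e p r" "?e r p = ?e p r" "?e (S.pact k r) (S.pact k p) = ?e p r"
        using S.dw_act[OF w kc p r(1)] S.dw_sym[of "sw \<omega>"] by auto
      have "?e r (S.pact k r) \<le> ?e p (S.pact k p) + 2 * ?e p r"
        using tr[OF r(1) p P(2)] tr[OF p P(1,2)] e by auto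
      moreover have "?e p (S.pact k p) \<le> ?e r (S.pact k r) + 2 * ?e p r"
        using tr[OF p r(1) P(1)] tr[OF r(1) P(2,1)] e by auto
      moreover have "\<bar>?\<tau> k - ?e p (S.pact k p)\<bar> < \<delta>" using ap[of k] k by auto
      ultimately show ?thesis using r(3) D(1) \<delta>(2) by linarith
    qed
    then show ?thesis using \<omega> R r by blast
  qed
  then show ?thesis using that[OF F] by blast
qed

text \<open>Approximations are indexed by finite sets of group elements and tolerances, so the limit
  is taken by the finite intersection property in a compact set of pairs of lengths and points. The
  limit pair has exactly the displacements of \<open>x\<close>, to which
  \<open>same_orbit_metric_surjection\<close> applies.\<close>

lemma limit_tree:
  assumes A0: "finite A0" "A0 \<subseteq> carrier G" "generate G A0 = carrier G"
    and x: "x \<in> verts T" and g: "g \<in> carrier G" and h: "h \<in> carrier G"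
    and ax: "T.B (pt x) (pt (act T g x)) (pt (act T g (act T g x)))" and gx: "act T g x \<noteq> x"
    and hx: "T.td (pt x) (pt (act T h (act T h x))) < 2 * T.td (pt x) (pt (act T h x))"
    and free: "\<And>v. v \<in> verts S \<Longrightarrow> act S g v \<noteq> v"
    and freeT: "\<And>y. y \<in> T.pts \<Longrightarrow> T.pact g y \<noteq> y"
    and Q: "Q \<subseteq> edge_orbits G S \<rightarrow>\<^sub>E {0..}"
    and approx: "\<And>A \<epsilon>. finite A \<Longrightarrow> A \<subseteq> carrier G \<Longrightarrow> 0 < \<epsilon> \<Longrightarrow> \<exists>\<omega>\<in>Q. \<exists>p\<in>S.pts. \<forall>k\<in>A.
      \<bar>T.td (pt x) (T.pact k (pt x)) - S.dw (sw \<omega>) p (S.pact k p)\<bar> < \<epsilon>"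
  shows "\<exists>\<omega>\<in>closure Q. \<omega> \<in> edge_orbits G S \<rightarrow>\<^sub>E {0..} \<and> (\<exists>c\<in>edge_orbits G S. \<omega> c \<noteq> 0) \<and> collapses_to G S \<omega> T"
proof -
  let ?\<tau> = "\<lambda>k. T.td (pt x) (T.pact k (pt x))" and ?I = "edge_orbits G S"
  obtain F R where F: "finite F" "F \<subseteq> verts S" and
    N: "\<And>A \<epsilon>. finite A \<Longrightarrow> A \<subseteq> carrier G \<Longrightarrow> 0 < \<epsilon> \<Longrightarrow> \<exists>\<omega>\<in>Q. (\<forall>c\<in>?I. \<omega> c \<le> R) \<and>
      (\<exists>p\<in>S.pts. supp p \<subseteq> F \<and> (\<forall>k\<in>A. \<bar>?\<tau> k - S.dw (sw \<omega>) p (S.pact k p)\<bar> < \<epsilon>))"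
    by (rule approximations_bounded[OF A0 x g h ax gx hx free Q approx]) (assumption | rule that)+
  define K1 where "K1 = ?I \<rightarrow>\<^sub>E {0..R}"
  define K2 where "K2 = {r \<in> S.pts. supp r \<subseteq> F}"
  \<comment> \<open>Extensional functions as a full product: outside \<open>?I\<close> the only
    value is \<open>undefined\<close>, so the remaining factors are one-point sets and compactness
    of products applies.\<close>
  have K1_alt: "K1 = PiE UNIV (\<lambda>c. if c \<in> ?I then {0..R} else {undefined})"
    unfolding K1_def by (auto simp: PiE_def Pi_def extensional_def split: if_splits)
  have "compactin (product_topology (\<lambda>_. euclidean) UNIV) K1"
    unfolding K1_alt compactin_PiE by auto
  then have "compact K1" unfolding euclidean_product_topology by simp
  moreover have "compact K2" unfolding K2_def by (rule S.compact_supported[OF F])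
  ultimately have comp: "compact (K1 \<times> K2)" by (rule compact_Times)
  \<comment> \<open>The approximations within \<open>\<epsilon>\<close> on \<open>A\<close>.
    Enlarging \<open>A\<close> and lowering \<open>\<epsilon>\<close> shrinks the set, so any
    finitely many of these sets contain a common nonempty one.\<close>
  define P where "P A \<epsilon> = {(\<omega>, r). \<omega> \<in> Q \<inter> K1 \<and> r \<in> K2 \<and> (\<forall>k\<in>A. \<bar>?\<tau> k - S.dw (sw \<omega>) r (S.pact k r)\<bar> < \<epsilon>)}" for A \<epsilon>
  define PP where "PP = {closure (P A \<epsilon>) | A \<epsilon>. finite A \<and> A \<subseteq> carrier G \<and> 0 < (\<epsilon>::real)}"
  have ne: "P A \<epsilon> \<noteq> {}" if A: "finite A" "A \<subseteq> carrier G" "0 < \<epsilon>" for A \<epsilon>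
  proof -
    obtain \<omega> p where \<omega>: "\<omega> \<in> Q" "\<forall>c\<in>?I. \<omega> c \<le> R" "p \<in> S.pts" "supp p \<subseteq> F"
      "\<forall>k\<in>A. \<bar>?\<tau> k - S.dw (sw \<omega>) p (S.pact k p)\<bar> < \<epsilon>" using N[OF A] by blast
    moreover have "\<omega> \<in> K1" using \<omega>(1,2) Q unfolding K1_def by (auto simp: PiE_iff)
    ultimately have "(\<omega>, p) \<in> P A \<epsilon>" unfolding P_def K2_def by auto
    then show ?thesis by auto
  qed
  have sub: "P A \<epsilon> \<subseteq> K1 \<times> K2" for A \<epsilon> unfolding P_def by auto
  have fip: "\<exists>A \<epsilon>. finite A \<and> A \<subseteq> carrier G \<and> 0 < \<epsilon> \<and> P A \<epsilon> \<subseteq> \<Inter>B" if "finite B" "B \<subseteq> PP" for B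
    using that
  proof (induction B rule: finite_induct)
    case empty
    show ?case by (rule exI[of _ "{}"], rule exI[of _ 1]) simp
  next
    case (insert b B)
    then obtain A \<epsilon> where A: "finite A" "A \<subseteq> carrier G" "0 < \<epsilon>" "P A \<epsilon> \<subseteq> \<Inter>B" by auto
    obtain A' \<epsilon>' where A': "finite A'" "A' \<subseteq> carrier G" "0 < \<epsilon>'" "b = closure (P A' \<epsilon>')"
      using insert.prems unfolding PP_def by auto
    have m1: "P (A \<union> A') (min \<epsilon> \<epsilon>') \<subseteq> P A \<epsilon>" and m2: "P (A \<union> A') (min \<epsilon> \<epsilon>') \<subseteq> P A' \<epsilon>'" unfolding P_def by auto
    have "P (A \<union> A') (min \<epsilon> \<epsilon>') \<subseteq> b" using m2 A'(4) closure_subset by blast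
    then have "P (A \<union> A') (min \<epsilon> \<epsilon>') \<subseteq> \<Inter>(insert b B)" using m1 A(4) by auto
    then show ?case using A A' by (intro exI[of _ "A \<union> A'"] exI[of _ "min \<epsilon> \<epsilon>'"]) auto
  qed
  have "(K1 \<times> K2) \<inter> \<Inter>PP \<noteq> {}"
  proof (rule compact_imp_fip[OF comp])
    fix b assume "b \<in> PP" then show "closed b" unfolding PP_def by auto
  next
    fix B assume B: "finite B" "B \<subseteq> PP"
    from fip[OF B] obtain A \<epsilon> where A: "finite A" "A \<subseteq> carrier G" "0 < \<epsilon>" "P A \<epsilon> \<subseteq> \<Inter>B" by (elim exE conjE)
    then show "(K1 \<times> K2) \<inter> \<Inter>B \<noteq> {}" using ne[OF A(1-3)] sub[of A \<epsilon>] by blast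
  qed
  then obtain z where z: "z \<in> K1 \<times> K2" "z \<in> \<Inter>PP" by blast
  obtain \<omega> r where zr: "z = (\<omega>, r)" by (cases z)
  have \<omega>r: "\<omega> \<in> K1" "r \<in> K2" using z(1) zr by auto
  have cl: "(\<omega>, r) \<in> closure (P A \<epsilon>)" if "finite A" "A \<subseteq> carrier G" "0 < \<epsilon>" for A \<epsilon>
  proof -
    have "closure (P A \<epsilon>) \<in> PP" unfolding PP_def using that by (intro CollectI exI conjI) (rule refl)
    then show ?thesis using z(2) unfolding zr by (rule InterD[rotated])
  qed
  have r: "r \<in> S.pts" "supp r \<subseteq> F" using \<omega>r unfolding K2_def by auto
  have \<omega>: "\<omega> \<in> ?I \<rightarrow>\<^sub>E {0..}" using \<omega>r(1) unfolding K1_def by (auto simp: PiE_iff)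
  have \<omega>Q: "\<omega> \<in> closure Q"
  proof -
    have "(\<omega>, r) \<in> closure (P {} 1)" by (rule cl) auto
    also have "closure (P {} 1) \<subseteq> closure (Q \<times> UNIV)" by (rule closure_mono) (auto simp: P_def)
    finally show ?thesis by (simp add: closure_Times)
  qed
  have eq: "?\<tau> k = S.dw (sw \<omega>) r (S.pact k r)" if k: "k \<in> carrier G" for k
  proof -
    obtain E0 where E0: "finite E0" "E0 \<subseteq> edges S" "\<And>w r. r \<in> S.pts \<Longrightarrow> supp r \<subseteq> F \<Longrightarrow> S.dw w r (S.pact k r) =
      (\<Sum>e\<in>E0. w e * \<bar>(\<Sum>v\<in>F. r v * of_bool (e \<in> S.geo S.root v)) - (\<Sum>v\<in>F. r v * of_bool (e \<in> S.geo S.root (act S k v)))\<bar>)"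
      using S.displacement_formula[OF k F] by blast
    \<comment> \<open>The displacement formula extended to all pairs of functions, where its
      continuity is evident; for points supported in \<open>F\<close> it is the displacement by
      \<open>k\<close>.\<close>
    define \<Phi> where "\<Phi> z = (\<Sum>e\<in>E0. fst z (orbit G (edge_act S) e) *
      \<bar>(\<Sum>v\<in>F. snd z v * of_bool (e \<in> S.geo S.root v)) - (\<Sum>v\<in>F. snd z v * of_bool (e \<in> S.geo S.root (act S k v)))\<bar>)"
      for z :: "('v set set \<Rightarrow> real) \<times> ('v \<Rightarrow> real)"
    have c1: "continuous_on UNIV (\<lambda>z :: ('v set set \<Rightarrow> real) \<times> ('v \<Rightarrow> real). fst z c)" for c
      by (rule continuous_on_product_then_coordinatewise) (intro continuous_intros)
    have c2: "continuous_on UNIV (\<lambda>z :: ('v set set \<Rightarrow> real) \<times> ('v \<Rightarrow> real). snd z v)" for v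
      by (rule continuous_on_product_then_coordinatewise) (intro continuous_intros)
    have "continuous_on UNIV \<Phi>" unfolding \<Phi>_def by (intro continuous_intros c1 c2)
    then have cont: "continuous_on UNIV (\<lambda>z. \<bar>?\<tau> k - \<Phi> z\<bar>)" by (intro continuous_intros)
    have \<Phi>: "\<Phi> (\<omega>', r') = S.dw (sw \<omega>') r' (S.pact k r')" if "r' \<in> K2" for \<omega>' r'
      using E0(3)[of r' "sw \<omega>'"] that unfolding \<Phi>_def K2_def edge_weight_def by simp
    have "\<bar>?\<tau> k - \<Phi> (\<omega>, r)\<bar> \<le> \<epsilon>" if \<epsilon>: "0 < \<epsilon>" for \<epsilon>
    proof -
      have "closed {z. \<bar>?\<tau> k - \<Phi> z\<bar> \<le> \<epsilon>}" by (rule closed_Collect_le[OF cont]) (intro continuous_intros)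
      moreover have "P {k} \<epsilon> \<subseteq> {z. \<bar>?\<tau> k - \<Phi> z\<bar> \<le> \<epsilon>}" unfolding P_def using \<Phi> by auto
      ultimately have "closure (P {k} \<epsilon>) \<subseteq> {z. \<bar>?\<tau> k - \<Phi> z\<bar> \<le> \<epsilon>}" by (rule closure_minimal[rotated])
      then show ?thesis using cl[of "{k}" \<epsilon>] k \<epsilon> by auto
    qed
    then have "\<bar>?\<tau> k - \<Phi> (\<omega>, r)\<bar> \<le> 0" by (rule field_le_epsilon) simp
    then show ?thesis using \<Phi>[OF \<omega>r(2)] by simp
  qed
  have w: "S.inv_weight (sw \<omega>)" by (rule sw_inv[OF \<omega>])
  interpret W: weighted_pair G S T "sw \<omega>" by unfold_locales (rule w)
  have pos: "0 < ?\<tau> g"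
    using T.td_eq_0[of "pt x" "pt (act T g x)"] T.td_nonneg[of "pt x" "pt (act T g x)"] gx x g
    by (auto simp: order_less_le)
  obtain \<psi> where \<psi>: "W.surjection \<psi>"
    using W.same_orbit_metric_surjection[OF x r(1) eq g] pos eq[OF g] by auto
  obtain q where q: "q \<in> verts S" "S.B (pt q) (pt (act S g q)) (pt (act S g (act S g q)))"
    using S.axis_vertex[OF g free] by auto
  \<comment> \<open>Although the limit lengths may vanish on some edges, the axis of
    \<open>g\<close> in \<open>S\<close> keeps positive length: the image of \<open>q\<close> is
    moved by \<open>g\<close>, which has no fixed point in \<open>T\<close>.\<close>
  have qpos: "0 < S.dw (sw \<omega>) (pt q) (pt (act S g q))"
  proof -
    have "\<psi> (pt q) \<in> T.pts" using W.surjection_pts[OF \<psi>] q by simp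
    then have "T.td (\<psi> (pt q)) (T.pact g (\<psi> (pt q))) \<noteq> 0" using T.td_eq_0 freeT g by (metis T.pact_in)
    then have "S.dw (sw \<omega>) (pt q) (pt (act S g q)) \<noteq> 0"
      using W.surjection_dist[OF \<psi>, of "pt q" "pt (act S g q)"] W.surjection_act[OF \<psi> g, of "pt q"] q g by simp
    then show ?thesis using S.dw_nonneg[of "sw \<omega>" "pt q" "pt (act S g q)"] S.inv_weight_nonneg[OF w] by auto
  qed
  have "collapses_to G S \<omega> T"
    unfolding collapses_to_def by (rule W.surjection_collapse[OF \<psi> g q qpos x ax gx])
  moreover have "\<exists>c\<in>?I. \<omega> c \<noteq> 0"
  proof (rule ccontr)
    assume "\<not> ?thesis"
    then have "sw \<omega> e = 0" if "e \<in> edges S" for e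
      using that unfolding edge_weight_def edge_orbits_def orbits_def by auto
    then have "S.dw (sw \<omega>) (pt q) (pt (act S g q)) = 0" unfolding S.dw_def by simp
    then show False using qpos by simp
  qed
  ultimately show ?thesis using \<omega> \<omega>Q by blast
qed

end

section \<open>Irreducible and genuine abelian trees\<close>

context ptree_line_isometry
begin

text \<open>With \<open>r\<close> the projection of \<open>p\<close>, the displacements by
  \<open>h\<close> and by its square are \<open>2 * d p r + c\<close> and
  \<open>2 * d p r + 2 * c\<close>; the hypothesis then leaves \<open>d p r = 0\<close>.\<close>

lemma ch_on_line:
  assumes shift: "\<And>i. h (q i) = q (i + 1)" and p: "p \<in> M" and ch: "d p (h (h p)) = 2 * d p (h p)"
  shows "\<exists>r\<in>M. \<exists>N\<ge>1. bt (q (- N)) r (q N) \<and> d p r = 0"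
proof -
  obtain r N where r: "r \<in> M" "bt p r (q (- N))" "bt p r (q N)" "bt (q (- N)) r (q N)"
    "d r (q N) > 0" "d r (q (- N)) > 0" "N \<ge> 1"
    using projection_exists[OF p] by blast
  have N: "0 \<le> N" using r(7) by auto
  interpret I2: ptree_isometry M d "h \<circ> h" "h' \<circ> h'"
    by unfold_locales (auto simp: h_in h'_in hh' h'h h_iso)
  interpret H2: ptree_line_isometry M d "h \<circ> h" "h' \<circ> h'" q c ..
  have shift2: "(h \<circ> h) (q i) = q (i + 2)" for i by (simp add: shift add.assoc)
  note s1 = shift_projection_step[OF shift _ p r(1-6) N, simplified]
  note s2 = H2.shift_projection_step[OF shift2 _ p r(1-6) N, simplified]
  have H: "h p \<in> M" "h r \<in> M" "h (h p) \<in> M" "h (h r) \<in> M" using p r(1) h_in by auto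
  have "d (h r) (h p) = d p r" "d (h (h r)) (h (h p)) = d p r" using h_iso p r(1) H sym by auto
  then have "d p (h p) = 2 * d p r + c" "d p (h (h p)) = 2 * d p r + 2 * c"
    using s1(2-4) s2(2-4) unfolding bt_def by auto
  then have "d p r = 0" using ch by auto
  then show ?thesis using r by blast
qed

end

context mtr
begin

lemma td_line:
  assumes g: "g \<in> carrier G" and x: "x \<in> pts" and bt: "td x (pact g (pact g x)) = 2 * td x (pact g x)" and ne: "pact g x \<noteq> x"
  shows "ptree_line_isometry pts td (pact g) (pact (inv\<^bsub>G\<^esub> g)) (\<lambda>i. pact (g [^]\<^bsub>G\<^esub> (i :: int)) x) (td x (pact g x))"
proof -
  have d: "td (pact g x) (pact g (pact g x)) = td x (pact g x)" using dw_act[OF inv_weight_len g x] g x by simp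
  have pos: "0 < td x (pact g x)" using td_eq_0[of x "pact g x"] td_nonneg[of x "pact g x"] g x ne by auto
  interpret ptree_line pts td "\<lambda>i. pact (g [^]\<^bsub>G\<^esub> (i :: int)) x" "td x (pact g x)"
    by (rule axis_line[OF inv_weight_len g x _ pos]) (use bt d in simp)
  interpret ptree_isometry pts td "pact g" "pact (inv\<^bsub>G\<^esub> g)" by (rule isometry_pact[OF inv_weight_len g])
  show ?thesis ..
qed

lemma pow_shift: "g \<in> carrier G \<Longrightarrow> x \<in> pts \<Longrightarrow> pact g (pact (g [^]\<^bsub>G\<^esub> (i :: int)) x) = pact (g [^]\<^bsub>G\<^esub> (i + 1)) x"
  using int_pow_mult[of g 1 i] int_pow_1[of g] pact_mult[of g "g [^]\<^bsub>G\<^esub> i" x] by (simp add: add.commute)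

text \<open>A fixed point \<open>y\<close> would bound the displacements of \<open>x\<close> by all
  powers of \<open>g\<close> by \<open>2 * td x y\<close>, but along the axis these grow
  linearly.\<close>

lemma translation_no_fixpoint:
  assumes g: "g \<in> carrier G" and x: "x \<in> pts" and bt: "td x (pact g (pact g x)) = 2 * td x (pact g x)" and ne: "pact g x \<noteq> x"
    and y: "y \<in> pts"
  shows "pact g y \<noteq> y"
proof
  assume fx: "pact g y = y"
  interpret L: ptree_line_isometry pts td "pact g" "pact (inv\<^bsub>G\<^esub> g)" "\<lambda>i. pact (g [^]\<^bsub>G\<^esub> (i :: int)) x" "td x (pact g x)"
    by (rule td_line[OF g x bt ne])
  have fp: "pact (g [^]\<^bsub>G\<^esub> (int n)) y = y" for n
  proof (induction n)
    case (Suc n)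
    have "pact (g [^]\<^bsub>G\<^esub> (int n + 1)) y = pact g (pact (g [^]\<^bsub>G\<^esub> (int n)) y)" using pow_shift[OF g y, of "int n"] by simp
    then show ?case using Suc fx by (simp add: add.commute)
  qed (use y in simp)
  have "n * td x (pact g x) \<le> 2 * td x y" for n :: nat
  proof -
    have gn: "g [^]\<^bsub>G\<^esub> (int n) \<in> carrier G" using g by simp
    have "n * td x (pact g x) = td x (pact (g [^]\<^bsub>G\<^esub> (int n)) x)" using L.q_dist[of 0 "int n"] x by simp
    also have "\<dots> \<le> td x y + td y (pact (g [^]\<^bsub>G\<^esub> (int n)) x)" using L.tri[OF x y] gn x by simp
    also have "td y (pact (g [^]\<^bsub>G\<^esub> (int n)) x) = td y x"
      using dw_act[OF inv_weight_len gn y x] fp[of n] by simp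
    finally show ?thesis using dw_sym[of "len T" y x] by simp
  qed
  moreover obtain n :: nat where "2 * td x y < n * td x (pact g x)" using reals_Archimedean3[OF L.c_pos] by auto
  ultimately show False by (simp add: not_le[symmetric])
qed

lemma B_td: "x \<in> verts T \<Longrightarrow> g \<in> carrier G \<Longrightarrow> B (pt x) (pt (act T g x)) (pt (act T g (act T g x))) \<longleftrightarrow>
    td (pt x) (pt (act T g (act T g x))) = 2 * td (pt x) (pt (act T g x))"
  using td_B[of "pt x" "pt (act T g x)" "pt (act T g (act T g x))"] dw_act[OF inv_weight_len, of g "pt x" "pt (act T g x)"]
  by auto

lemma elliptic_iff: "elliptic G T H \<longleftrightarrow> (\<exists>y\<in>pts. \<forall>h\<in>H. pact h y = y)"
  unfolding elliptic_def points_eq ..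

text \<open>A vertex on the axis of \<open>g\<close> that is not in the characteristic set of \<open>h\<close>.\<close>

definition axis_data :: "'g \<Rightarrow> 'v \<Rightarrow> 'g \<Rightarrow> bool" where
  "axis_data g x h \<longleftrightarrow> g \<in> carrier G \<and> h \<in> carrier G \<and> x \<in> verts T \<and>
     B (pt x) (pt (act T g x)) (pt (act T g (act T g x))) \<and> act T g x \<noteq> x \<and>
     td (pt x) (pt (act T h (act T h x))) < 2 * td (pt x) (pt (act T h x))"

lemma not_ch_less:
  assumes "x \<in> verts T" "h \<in> carrier G" "td (pt x) (pt (act T h (act T h x))) \<noteq> 2 * td (pt x) (pt (act T h x))"
  shows "td (pt x) (pt (act T h (act T h x))) < 2 * td (pt x) (pt (act T h x))"
proof -
  have V: "act T h x \<in> verts T" "act T h (act T h x) \<in> verts T" using assms by auto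
  have nn: "\<And>e. e \<in> edges T \<Longrightarrow> 0 \<le> len T e" using len_pos by (auto intro: less_imp_le)
  have "td (pt x) (pt (act T h (act T h x))) \<le> td (pt x) (pt (act T h x)) + td (pt (act T h x)) (pt (act T h (act T h x)))"
    by (rule dw_tri[OF nn]) (use assms V in auto)
  then show ?thesis using dw_act[OF inv_weight_len assms(2), of "pt x" "pt (act T h x)"] assms V by simp
qed

text \<open>The real line parametrizing the axis is sampled at multiples of the translation length
  \<open>l\<close>, which gives a line indexed by integers. By \<open>ch_on_line\<close>,
  \<open>p\<close> is at distance zero from a point between two samples, and such a point lies on
  the axis by \<open>bt_unique\<close>.\<close>

lemma in_axis:
  assumes ax: "is_axis G T g L" and g: "g \<in> carrier G" and p: "p \<in> pts" and ch: "td p (pact g (pact g p)) = 2 * td p (pact g p)"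
  shows "p \<in> L"
proof -
  obtain \<gamma> :: "real \<Rightarrow> 'v \<Rightarrow> real" and l where \<gamma>: "0 < l" "range \<gamma> = L" "L \<subseteq> points T"
    "\<forall>s t. point_dist T (\<gamma> s) (\<gamma> t) = \<bar>s - t\<bar>" "\<forall>t. pact g (\<gamma> t) = \<gamma> (t + l)"
    using ax unfolding is_axis_def by blast
  have \<gamma>P: "\<gamma> t \<in> pts" for t using \<gamma>(2,3) unfolding points_eq by auto
  have \<gamma>d: "td (\<gamma> s) (\<gamma> t) = \<bar>s - t\<bar>" for s t using \<gamma>(4) point_dist_eq[OF \<gamma>P \<gamma>P] by simp
  interpret I: ptree_isometry pts td "pact g" "pact (inv\<^bsub>G\<^esub> g)" by (rule isometry_pact[OF inv_weight_len g])
  interpret L: ptree_line_isometry pts td "pact g" "pact (inv\<^bsub>G\<^esub> g)" "\<lambda>i. \<gamma> (of_int i * l)" l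
    by unfold_locales (use \<gamma>P \<gamma>(1) in \<open>auto simp: I.bt_def \<gamma>d algebra_simps\<close>)
  obtain r N where r: "r \<in> pts" "N \<ge> 1" "I.bt (\<gamma> (of_int (- N) * l)) r (\<gamma> (of_int N * l))" "td p r = 0"
    using L.ch_on_line[OF _ p ch] \<gamma>(5) by (auto simp: algebra_simps)
  \<comment> \<open>The parameter at which the axis has the same distance as \<open>r\<close> from
    the sample with index \<open>- N\<close>.\<close>
  define s where "s = of_int (- N) * l + td (\<gamma> (of_int (- N) * l)) r"
  have le: "td (\<gamma> (of_int (- N) * l)) r \<le> 2 * (N * l)"
    using r(3) td_nonneg[of r "\<gamma> (of_int N * l)"] \<gamma>(1) r(2) unfolding I.bt_def \<gamma>d by (auto simp: algebra_simps)
  have "I.bt (\<gamma> (of_int (- N) * l)) (\<gamma> s) (\<gamma> (of_int N * l))"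
  proof -
    have "of_int (- N) * l = - (of_int N * l)" by simp
    then show ?thesis unfolding I.bt_def \<gamma>d using le td_nonneg[of "\<gamma> (of_int (- N) * l)" r] s_def by linarith
  qed
  then have "td r (\<gamma> s) = 0"
    by (rule I.bt_unique[OF \<gamma>P \<gamma>P r(1) \<gamma>P r(3)]) (use td_nonneg[of "\<gamma> (of_int (- N) * l)" r] in \<open>simp add: \<gamma>d s_def\<close>)
  then have "r = \<gamma> s" "p = r" using td_eq_0 r \<gamma>P p by auto
  then show ?thesis using \<gamma>(2) by auto
qed

lemma irreducible_axis_data:
  assumes "irreducible_tree G T"
  shows "\<exists>g x h. axis_data g x h"
proof -
  obtain g h L M where gh: "hyperbolic G T g" "hyperbolic G T h" "is_axis G T g L" "is_axis G T h M" "L \<inter> M = {}"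
    using assms unfolding irreducible_tree_def by blast
  have c: "g \<in> carrier G" "h \<in> carrier G" using gh unfolding hyperbolic_def by auto
  have free: "act T g v \<noteq> v" if v: "v \<in> verts T" for v
  proof
    assume "act T g v = v"
    then have "elliptic G T {g}" unfolding elliptic_iff using v c by (intro bexI[of _ "pt v"]) auto
    then show False using gh unfolding hyperbolic_def by auto
  qed
  obtain x where x: "x \<in> verts T" "B (pt x) (pt (act T g x)) (pt (act T g (act T g x)))"
    using axis_vertex[OF c(1) free] by auto
  have "pt x \<in> L" using in_axis[OF gh(3) c(1), of "pt x"] x B_td[OF x(1) c(1)] c by simp
  then have "pt x \<notin> M" using gh(5) by auto
  then have "td (pt x) (pt (act T h (act T h x))) \<noteq> 2 * td (pt x) (pt (act T h x))"
    using in_axis[OF gh(4) c(2), of "pt x"] x c by auto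
  then show ?thesis unfolding axis_data_def using c x free not_ch_less[OF x(1) c(2)] by blast
qed

section \<open>Trees with a fixed end\<close>

lemma ray_B:
  assumes r: "is_ray T r" and ij: "i \<le> j" "j \<le> k"
  shows "B (pt (r i)) (pt (r j)) (pt (r k))"
proof -
  have V: "r n \<in> verts T" "{r n, r (Suc n)} \<in> edges T" for n using r unfolding is_ray_def by auto
  have inj: "r m = r n \<longleftrightarrow> m = n" for m n using r unfolding is_ray_def inj_def by auto
  have 1: "B (pt (r i)) (pt (r (i + n))) (pt (r (Suc (i + n))))" for i n
  proof (induction n)
    case (Suc n)
    let ?u = "r (Suc (i + n))"
    have e: "{?u, r (i + n)} \<in> edges T" "{?u, r (Suc (Suc (i + n)))} \<in> edges T"
      using V(2)[of "i + n"] V(2)[of "Suc (i + n)"] by (auto simp: insert_commute)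
    have "B (pt (r (i + n))) (pt ?u) (pt (r (Suc (Suc (i + n)))))"
      by (rule B_different_branches[OF V(1) V(1) V(1) e]) (use inj geo_edge[OF e(1)] geo_edge[OF e(2)] in auto)
    from B_local(2)[OF _ _ _ _ Suc this] have "B (pt (r i)) (pt ?u) (pt (r (Suc (Suc (i + n)))))"
      using V inj by simp
    then show ?case by simp
  qed (use B_triv in auto)
  obtain m where m: "j = i + m" using ij(1) le_Suc_ex by blast
  show ?thesis
    using ij(2)
  proof (induction k rule: dec_induct)
    case base
    show ?case by (rule B_triv)
  next
    case (step k)
    have "B (pt (r i)) (pt (r k)) (pt (r (Suc k)))" using 1[of i "k - i"] step(1) ij(1) by simp
    then show ?case using B_trans step(3) by blast
  qed
qed

text \<open>Otherwise each generator, shifting the ray in neither direction, fixes a tail of it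
  pointwise. Finitely many generators have a common fixed vertex \<open>r N\<close>, which is then
  fixed by the whole group and forms a proper invariant subtree.\<close>

lemma end_translation:
  assumes A0: "finite A0" "A0 \<subseteq> carrier G" "generate G A0 = carrier G"
    and r: "is_ray T r" and fixes_end: "\<And>g. g \<in> carrier G \<Longrightarrow> same_end (act T g \<circ> r) r"
  shows "\<exists>g\<in>carrier G. \<exists>m n. m < n \<and> (\<forall>k. act T g (r (m + k)) = r (n + k))"
proof (rule ccontr)
  assume no: "\<not> ?thesis"
  have V: "r n \<in> verts T" for n using r unfolding is_ray_def by auto
  have inj: "r m = r n \<longleftrightarrow> m = n" for m n using r unfolding is_ray_def inj_def by auto
  have "\<exists>m. \<forall>k\<ge>m. act T a (r k) = r k" if a: "a \<in> A0" for a
  proof -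
    have ac: "a \<in> carrier G" using a A0 by auto
    obtain m n where mn: "\<forall>k. act T a (r (m + k)) = r (n + k)"
      using fixes_end[OF ac] unfolding same_end_def by auto
    have "\<not> m < n" using no ac mn by blast
    moreover have "\<not> n < m"
    proof
      assume "n < m"
      moreover have "\<forall>k. act T (inv\<^bsub>G\<^esub> a) (r (n + k)) = r (m + k)" using mn act_inv[OF ac V] by metis
      ultimately show False using no ac by blast
    qed
    ultimately have "m = n" by auto
    then have "act T a (r k) = r k" if "m \<le> k" for k using mn that le_Suc_ex by metis
    then show ?thesis by auto
  qed
  then obtain f where f: "\<And>a k. a \<in> A0 \<Longrightarrow> f a \<le> k \<Longrightarrow> act T a (r k) = r k" by metis
  obtain N where N: "\<And>a. a \<in> A0 \<Longrightarrow> f a \<le> N" using A0(1) by (metis finite_imageI finite_nat_set_iff_bounded_le imageI)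
  have gen: "act T k (r N) = r N" if "k \<in> generate G A0" for k
    using that
  proof (induction rule: generate.induct)
    case (inv h)
    then show ?case using f[OF inv N[OF inv]] act_inv[of h "r N"] V A0 by (metis subsetD)
  next
    case (eng h1 h2)
    then show ?case using act_mult[of h1 h2 "r N"] V A0 by auto
  qed (use V f N in auto)
  have "simplicial_tree {r N} {}"
  proof (rule subtree)
    fix a b assume "a \<in> {r N}" "b \<in> {r N}"
    then show "geo a b \<subseteq> {}" using geo_self V by auto
  qed (use V in auto)
  then have "{r N} = verts T" by (rule minimality(1)[rotated 2]) (use V gen A0 in auto)
  then show False using V[of "Suc N"] inj[of "Suc N" N] by auto
qed

text \<open>The integer coordinate \<open>s\<close> is the combinatorial distance from a point far
  out on the negative side, minus that point's distance from the base point: a Busemann function of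
  the axis. Distances of vertices are differences of \<open>s\<close>, and all integers are
  attained.\<close>

lemma line_if_axis:
  assumes g: "g \<in> carrier G" and x: "x \<in> verts T"
    and ax: "B (pt x) (pt (act T g x)) (pt (act T g (act T g x)))" and ne: "act T g x \<noteq> x"
    and cover: "\<And>v. v \<in> verts T \<Longrightarrow> \<exists>N\<ge>0. B (pt (act T (g [^]\<^bsub>G\<^esub> (- N :: int)) x)) (pt v) (pt (act T (g [^]\<^bsub>G\<^esub> N) x))"
  shows "is_line T"
proof -
  let ?d = "dw (\<lambda>_. 1 :: real)"
  define q where "q i = act T (g [^]\<^bsub>G\<^esub> (i :: int)) x" for i
  have qV: "q i \<in> verts T" for i unfolding q_def using g x by simp
  define Q where "Q i = pact (g [^]\<^bsub>G\<^esub> (i :: int)) (pt x)" for i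
  have Qq: "Q i = pt (q i)" for i unfolding Q_def q_def using g x by simp
  define n where "n = card (geo x (act T g x))"
  have gx: "act T g x \<in> verts T" "act T g (act T g x) \<in> verts T" using g x by auto
  have dn: "?d (pt x) (pact g (pt x)) = n" unfolding n_def using card_geo_dw[OF x gx(1)] g x by simp
  have "n \<noteq> 0" unfolding n_def using geo_empty[OF x gx(1)] finite_geo ne by auto
  then have n: "1 \<le> n" by simp
  have "ptree_line pts ?d Q (?d (pt x) (pact g (pt x)))"
    unfolding Q_def
  proof (rule axis_line[OF inv_weight_one g])
    show "?d (pt x) (pact g (pt x)) + ?d (pact g (pt x)) (pact g (pact g (pt x))) = ?d (pt x) (pact g (pact g (pt x)))"
      using dw_B[of "\<lambda>_. 1", OF _ _ _ _ ax] gx x g by simp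
    show "0 < ?d (pt x) (pact g (pt x))" using dn n by simp
  qed (use x in simp)
  then interpret L: ptree_line pts ?d Q n unfolding dn .
  have cov: "\<exists>N\<ge>0. L.bt (Q (- N)) (pt v) (Q N)" if v: "v \<in> verts T" for v
    using cover[OF v] bt_B[of "pt (q i)" "pt v" "pt (q j)" for i j] qV v unfolding Qq q_def by auto
  have "\<exists>N\<ge>0. \<exists>s::int. \<forall>N'\<ge>N. ?d (Q (- N')) (pt v) = of_int s + of_int N' * real n \<and> L.bt (Q (- N')) (pt v) (Q N')" if v: "v \<in> verts T" for v
  proof -
    have vp: "pt v \<in> pts" using v by simp
    obtain N where N: "N \<ge> 0" "L.bt (Q (- N)) (pt v) (Q N)" using cov[OF v] by auto
    define s where "s = int (card (geo (q (- N)) v)) - N * int n"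
    have "?d (Q (- N')) (pt v) = of_int s + of_int N' * real n \<and> L.bt (Q (- N')) (pt v) (Q N')" if N': "N' \<ge> N" for N'
    proof
      show "L.bt (Q (- N')) (pt v) (Q N')" by (rule L.bt_widen[OF vp N(2,1) N'])
      have "L.bt (Q N) (Q (- N)) (Q (- N'))"
        by (rule L.bt_sym[OF L.q_in L.q_in L.q_in]) (rule L.q_bt, use N N' in auto)
      moreover have "L.bt (Q N) (pt v) (Q (- N))" by (rule L.bt_sym[OF L.q_in vp L.q_in N(2)])
      ultimately have "L.bt (pt v) (Q (- N)) (Q (- N'))" by (rule L.bt_trans(2)[OF L.q_in L.q_in vp L.q_in])
      then have "?d (pt v) (Q (- N)) + ?d (Q (- N)) (Q (- N')) = ?d (pt v) (Q (- N'))" unfolding L.bt_def .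
      moreover have "?d (pt v) (Q (- N)) = card (geo (q (- N)) v)"
        using card_geo_dw[OF qV v, of "- N"] dw_sym[of "\<lambda>_. 1" "pt v"] Qq by simp
      moreover have "?d (Q (- N)) (Q (- N')) = (N' - N) * n"
        using L.q_dist[of "- N'" "- N"] dw_sym[of "\<lambda>_. 1" "Q (- N)"] N' by simp
      ultimately show "?d (Q (- N')) (pt v) = of_int s + of_int N' * real n"
        unfolding s_def using dw_sym[of "\<lambda>_. 1" "pt v"] by (simp add: algebra_simps)
    qed
    then show ?thesis using N(1) by blast
  qed
  then obtain N0 s where s: "\<And>v N'. v \<in> verts T \<Longrightarrow> N0 v \<le> N' \<Longrightarrow>
      ?d (Q (- N')) (pt v) = of_int (s v) + of_int N' * real n \<and> L.bt (Q (- N')) (pt v) (Q N')"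
    by metis
  have dist: "real (card (geo u v)) = \<bar>real_of_int (s u) - s v\<bar>" if u: "u \<in> verts T" and v: "v \<in> verts T" for u v
  proof -
    define N where "N = max (N0 u) (N0 v)"
    have us: "?d (Q (- N)) (pt u) = of_int (s u) + of_int N * real n" "L.bt (Q (- N)) (pt u) (Q N)" using s[OF u, of N] unfolding N_def by auto
    have vs: "?d (Q (- N)) (pt v) = of_int (s v) + of_int N * real n" "L.bt (Q (- N)) (pt v) (Q N)" using s[OF v, of N] unfolding N_def by auto
    have P: "pt u \<in> pts" "pt v \<in> pts" using u v by auto
    have "?d (pt u) (pt v) = \<bar>real_of_int (s u) - s v\<bar>"
    proof (cases "?d (Q (- N)) (pt u) \<le> ?d (Q (- N)) (pt v)")
      case True
      have "L.bt (Q (- N)) (pt u) (pt v)" by (rule L.bt_segment(1)[OF L.q_in L.q_in P us(2) vs(2) True])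
      then show ?thesis using us vs True unfolding L.bt_def by auto
    next
      case False
      have "L.bt (Q (- N)) (pt v) (pt u)"
        by (rule L.bt_segment(1)[OF L.q_in L.q_in P(2,1) vs(2) us(2)]) (use False in auto)
      then show ?thesis using us vs False dw_sym[of "\<lambda>_. 1" "pt u"] unfolding L.bt_def by auto
    qed
    then show ?thesis using card_geo_dw[OF u v] by simp
  qed
  have inj: "inj_on s (verts T)"
  proof (rule inj_onI)
    fix u v assume uv: "u \<in> verts T" "v \<in> verts T" "s u = s v"
    then have "card (geo u v) = 0" using dist[OF uv(1,2)] by simp
    then show "u = v" using geo_empty[OF uv(1,2)] finite_geo by auto
  qed
  have surj: "\<exists>v\<in>verts T. s v = i" for i
  proof -
    define N where "N = \<bar>i\<bar>"
    have bound: "\<bar>i\<bar> \<le> N * int n" unfolding N_def using n by (metis abs_ge_zero mult.right_neutral mult_left_mono of_nat_1 of_nat_mono)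
    have "real (card (geo (q (- N)) (q N))) = (N - (- N)) * n"
      using card_geo_dw[OF qV qV, of "- N" N] L.q_dist[of "- N" N] Qq unfolding N_def by simp
    then have cardq: "int (card (geo (q (- N)) (q N))) = 2 * (N * int n)" by (simp add: algebra_simps flip: of_int_eq_iff[where 'a = real])
    \<comment> \<open>The position counted from the left end \<open>q (- N)\<close>, whose
      coordinate is \<open>- N * int n\<close>; the segment has \<open>2 * (N * int n)\<close>
      edges.\<close>
    define j where "j = nat (i + N * int n)"
    have "j \<le> card (geo (q (- N)) (q N))" unfolding j_def using cardq bound by linarith
    then obtain v where v: "v \<in> verts T" "geo (q (- N)) v \<subseteq> geo (q (- N)) (q N)" "card (geo (q (- N)) v) = j"
      using geo_prefix_card[OF qV qV] by blast
    have Bv: "L.bt (Q (- N)) (pt v) (Q N)"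
      using B_geo[OF qV qV v(1), of "- N" N] bt_B[of "Q (- N)" "pt v" "Q N"] v Qq qV by simp
    define N' where "N' = max N (N0 v)"
    have sv: "?d (Q (- N')) (pt v) = of_int (s v) + of_int N' * real n" using s[OF v(1), of N'] unfolding N'_def by auto
    have N': "N \<le> N'" "0 \<le> N" unfolding N'_def N_def by auto
    have vp: "pt v \<in> pts" using v by simp
    have "L.bt (Q N) (Q (- N)) (Q (- N'))"
      by (rule L.bt_sym[OF L.q_in L.q_in L.q_in]) (rule L.q_bt, use N' in auto)
    moreover have "L.bt (Q N) (pt v) (Q (- N))" by (rule L.bt_sym[OF L.q_in vp L.q_in Bv])
    ultimately have "L.bt (pt v) (Q (- N)) (Q (- N'))" by (rule L.bt_trans(2)[OF L.q_in L.q_in vp L.q_in])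
    then have "?d (pt v) (Q (- N)) + ?d (Q (- N)) (Q (- N')) = ?d (pt v) (Q (- N'))" unfolding L.bt_def .
    moreover have "?d (pt v) (Q (- N)) = j"
      using card_geo_dw[OF qV v(1), of "- N"] dw_sym[of "\<lambda>_. 1" "pt v"] Qq v(3) by simp
    moreover have "?d (Q (- N)) (Q (- N')) = (N' - N) * n"
      using L.q_dist[of "- N'" "- N"] dw_sym[of "\<lambda>_. 1" "Q (- N)"] N' by simp
    moreover have "real j = i + N * int n" unfolding j_def using bound by (simp add: of_nat_nat)
    ultimately have "real_of_int (s v) = i" using sv dw_sym[of "\<lambda>_. 1" "pt v"] by (simp add: algebra_simps)
    then show ?thesis using v(1) by auto
  qed
  define f where "f = inv_into (verts T) s"
  have bij: "bij_betw s (verts T) UNIV" unfolding bij_betw_def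
  proof
    have "i \<in> s ` verts T" for i using surj[of i] by auto
    then show "s ` verts T = UNIV" by auto
  qed (rule inj)
  then have fb: "bij_betw f UNIV (verts T)" unfolding f_def by (rule bij_betw_inv_into)
  have sf: "f i \<in> verts T" "s (f i) = i" for i
    using bij_betw_apply[OF fb] bij_betw_inv_into_right[OF bij] unfolding f_def by auto
  have fs: "f (s v) = v" if "v \<in> verts T" for v unfolding f_def using inv_into_f_f[OF inj that] .
  have edge_iff: "{u, v} \<in> edges T \<longleftrightarrow> \<bar>s u - s v\<bar> = 1" if uv: "u \<in> verts T" "v \<in> verts T" for u v
  proof
    assume "{u, v} \<in> edges T"
    then have "card (geo u v) = 1" using geo_edge by simp
    then show "\<bar>s u - s v\<bar> = 1" using dist[OF uv] by linarith
  next
    assume "\<bar>s u - s v\<bar> = 1"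
    then have c1: "card (geo u v) = 1" using dist[OF uv] by linarith
    then have "u \<noteq> v" using geo_self uv by auto
    then obtain m where m: "{m, v} \<in> edges T" "{m, v} \<in> geo u v" "geo u m = geo u v - {{m, v}}" using geo_last[OF uv] by auto
    have "card (geo u m) = 0" unfolding m(3) using card_Diff_singleton[OF m(2)] c1 by simp
    then have "geo u m = {}" using finite_geo[of u m] by simp
    then show "{u, v} \<in> edges T" using geo_empty[OF uv(1) edge_verts(1)[OF m(1)]] m(1) by simp
  qed
  have "edges T = {{f i, f (i + 1)} | i. True}"
  proof (intro equalityI subsetI)
    fix e assume e: "e \<in> edges T"
    obtain u v where uv: "e = {u, v}" "u \<in> verts T" "v \<in> verts T" using edge_ends[OF e] by auto
    then have "s v = s u + 1 \<or> s u = s v + 1" using edge_iff[OF uv(2,3)] e by auto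
    then show "e \<in> {{f i, f (i + 1)} | i. True}"
    proof
      assume "s v = s u + 1"
      then have "e = {f (s u), f (s u + 1)}" using uv(1) fs[OF uv(2)] fs[OF uv(3)] by metis
      then show ?thesis by (intro CollectI exI[of _ "s u"] conjI TrueI)
    next
      assume "s u = s v + 1"
      then have "e = {f (s v), f (s v + 1)}" using uv(1) fs[OF uv(2)] fs[OF uv(3)] by (metis insert_commute)
      then show ?thesis by (intro CollectI exI[of _ "s v"] conjI TrueI)
    qed
  next
    fix e assume "e \<in> {{f i, f (i + 1)} | i. True}"
    then obtain i where "e = {f i, f (i + 1)}" by auto
    then show "e \<in> edges T" using edge_iff[of "f i" "f (i + 1)"] sf by simp
  qed
  then show ?thesis unfolding is_line_def using fb by blast
qed

text \<open>If \<open>x\<close> lay in the characteristic set of every element, then applying this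
  to the conjugates of \<open>g\<close> would put every translate of \<open>x\<close> on the axis of
  \<open>g\<close>. The hull of the orbit is the whole tree, which would be a line.\<close>

lemma genuine_abelian_axis_data:
  assumes A0: "finite A0" "A0 \<subseteq> carrier G" "generate G A0 = carrier G" and ab: "genuine_abelian_tree G T"
  shows "\<exists>g x h. axis_data g x h"
proof -
  obtain r where r: "is_ray T r" "\<And>g. g \<in> carrier G \<Longrightarrow> same_end (act T g \<circ> r) r"
    using ab unfolding genuine_abelian_tree_def fixes_end_def by blast
  obtain g m n where g: "g \<in> carrier G" "m < n" "\<And>k. act T g (r (m + k)) = r (n + k)"
    using end_translation[OF A0 r] by blast
  define x where "x = r m"
  have x: "x \<in> verts T" using r unfolding is_ray_def x_def by auto
  have gx: "act T g x = r n" "act T g (act T g x) = r (n + (n - m))" using g(3)[of 0] g(3)[of "n - m"] g(2) unfolding x_def by auto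
  have ax: "B (pt x) (pt (act T g x)) (pt (act T g (act T g x)))"
    unfolding gx(2) unfolding gx(1) unfolding x_def by (rule ray_B[OF r(1)]) (use g(2) in auto)
  have ne: "act T g x \<noteq> x" unfolding gx unfolding x_def using r(1) g(2) unfolding is_ray_def inj_def by auto
  show ?thesis
  proof (rule ccontr)
    assume no: "\<not> ?thesis"
    have all: "td (pt x) (pact h (pact h (pt x))) = 2 * td (pt x) (pact h (pt x))" if h: "h \<in> carrier G" for h
      using no not_ch_less[OF x h] h g x ax ne unfolding axis_data_def by auto
    have td2: "td (pt x) (pact g (pact g (pt x))) = 2 * td (pt x) (pact g (pt x))" by (rule all[OF g(1)])
    have ne': "pact g (pt x) \<noteq> pt x" using ne g x by simp
    interpret L: ptree_line_isometry pts td "pact g" "pact (inv\<^bsub>G\<^esub> g)" "\<lambda>i. pact (g [^]\<^bsub>G\<^esub> (i :: int)) (pt x)" "td (pt x) (pact g (pt x))"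
      by (rule td_line[OF g(1) _ td2 ne']) (use x in simp)
    let ?q = "\<lambda>i. act T (g [^]\<^bsub>G\<^esub> (i :: int)) x"
    have qV: "?q i \<in> verts T" for i using g x by simp
    have on: "\<exists>N\<ge>0. \<forall>N'\<ge>N. B (pt (?q (- N'))) (pt (act T k x)) (pt (?q N'))" if k: "k \<in> carrier G" for k
    proof -
      \<comment> \<open>The element \<open>g\<close> moves \<open>act T k x\<close> as the conjugate
        \<open>?h\<close> moves \<open>x\<close>, up to applying \<open>k\<close>.\<close>
      let ?p = "pt (act T k x)" and ?h = "inv\<^bsub>G\<^esub> k \<otimes>\<^bsub>G\<^esub> g \<otimes>\<^bsub>G\<^esub> k"
      have kx: "?p \<in> pts" using k x by simp
      have h: "?h \<in> carrier G" using k g by simp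
      have a1: "pact k (pact ?h (pt x)) = pact g ?p"
        using k g x by (simp add: act_mult m_assoc)
      have a2: "pact k (pact ?h (pact ?h (pt x))) = pact g (pact g ?p)"
        using k g x by (simp add: act_mult m_assoc)
      have "td ?p (pact g (pact g ?p)) = 2 * td ?p (pact g ?p)"
        using all[OF h] dw_act[OF inv_weight_len k, of "pt x" "pact ?h (pact ?h (pt x))"]
          dw_act[OF inv_weight_len k, of "pt x" "pact ?h (pt x)"] a1 a2 k x h by simp
      from L.ch_on_line[OF _ kx this] obtain s and N :: int where s: "s \<in> pts" "N \<ge> 1"
        "L.bt (pact (g [^]\<^bsub>G\<^esub> (- N)) (pt x)) s (pact (g [^]\<^bsub>G\<^esub> N) (pt x))" "td ?p s = 0"
        using pow_shift[OF g(1), of "pt x"] x by auto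
      have "?p = s" using td_eq_0[OF kx s(1)] s(4) by simp
      then have b: "L.bt (pact (g [^]\<^bsub>G\<^esub> (- N)) (pt x)) ?p (pact (g [^]\<^bsub>G\<^esub> N) (pt x))" using s(3) by simp
      have "B (pt (?q (- N'))) ?p (pt (?q N'))" if N': "N' \<ge> N" for N'
        using L.bt_widen[OF kx b _ N'] s(2) td_B[of "pt (?q (- N'))" ?p "pt (?q N')"] qV kx g x unfolding L.bt_def by simp
      then show ?thesis using s(2) by (intro exI[of _ N]) auto
    qed
    have "is_line T"
    proof (rule line_if_axis[OF g(1) x ax ne])
      fix v assume v: "v \<in> verts T"
      obtain h k where hk: "h \<in> carrier G" "k \<in> carrier G" "B (pt (act T h x)) (pt v) (pt (act T k x))"
        using hull_point[OF x, of "pt v"] v by auto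
      obtain N1 where N1: "\<And>N'. N' \<ge> N1 \<Longrightarrow> B (pt (?q (- N'))) (pt (act T h x)) (pt (?q N'))" "0 \<le> N1" using on[OF hk(1)] by auto
      obtain N2 where N2: "\<And>N'. N' \<ge> N2 \<Longrightarrow> B (pt (?q (- N'))) (pt (act T k x)) (pt (?q N'))" using on[OF hk(2)] by auto
      define N where "N = max N1 N2"
      have bN: "B (pt (?q (- N))) (pt (act T h x)) (pt (?q N))" "B (pt (?q (- N))) (pt (act T k x)) (pt (?q N))"
        using N1(1)[of N] N2[of N] unfolding N_def by auto
      have "between (cc e (pt (?q (- N)))) (cc e (pt v)) (cc e (pt (?q N)))" if e: "e \<in> edges T" for e
      proof -
        have "between (cc e (pt (act T h x))) (cc e (pt v)) (cc e (pt (act T k x)))"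
          "between (cc e (pt (?q (- N)))) (cc e (pt (act T h x))) (cc e (pt (?q N)))"
          "between (cc e (pt (?q (- N)))) (cc e (pt (act T k x))) (cc e (pt (?q N)))"
          using bN hk(3) e unfolding B_def by blast+
        then show ?thesis unfolding between_iff by linarith
      qed
      then have "B (pt (?q (- N))) (pt v) (pt (?q N))" unfolding B_def by blast
      then show "\<exists>N\<ge>0. B (pt (?q (- N))) (pt v) (pt (?q N))" using N1(2) unfolding N_def by (intro exI[of _ "max N1 N2"]) auto
    qed
    then show False using ab unfolding genuine_abelian_tree_def by auto
  qed
qed

end

section \<open>Rescaling\<close>

lemma rescale_simps [simp]:
  "verts (rescale t T) = verts T" "edges (rescale t T) = edges T" "act (rescale t T) = act T"
  "len (rescale t T) = (\<lambda>e. t * len T e)" "points (rescale t T) = points T"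
  "point_act G (rescale t T) = point_act G T" "rescale s (rescale t T) = rescale (s * t) T" "rescale 1 T = T"
  by (simp_all add: rescale_def points_def point_act_def fun_eq_iff mult.assoc)

lemma is_gtree_len: "is_gtree G (T\<lparr>len := l\<rparr>) \<longleftrightarrow> is_gtree G (T :: ('g, 'v) metric_gtree)"
  unfolding is_gtree_def by simp

lemma metric_rescale: "is_metric_gtree G T \<Longrightarrow> 0 < t \<Longrightarrow> is_metric_gtree G (rescale t T)"
  unfolding is_metric_gtree_def by (simp add: rescale_def is_gtree_len)

lemma point_dist_rescale:
  assumes T: "is_metric_gtree G T" and t: "0 < t" and P: "x \<in> points T" "y \<in> points T"
  shows "point_dist (rescale t T) x y = t * point_dist T x y"
proof -
  interpret A: mtr G T by (rule mtr_I[OF T])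
  interpret B: mtr G "rescale t T" by (rule mtr_I[OF metric_rescale[OF T t]])
  have "x \<in> A.pts" "y \<in> A.pts" "x \<in> B.pts" "y \<in> B.pts" using P A.points_eq B.points_eq by auto
  then show ?thesis using A.point_dist_eq B.point_dist_eq A.dw_scale[of t "len T" x y] by simp
qed

lemma point_act_points:
  assumes T: "is_metric_gtree G T" and "x \<in> points T" "g \<in> carrier G"
  shows "point_act G T g x \<in> points T"
proof -
  interpret A: mtr G T by (rule mtr_I[OF T])
  show ?thesis using assms A.points_eq by simp
qed

lemma isometric_rescale:
  assumes T: "is_metric_gtree G T" "is_metric_gtree G T'" and t: "0 < t" and iso: "equivariantly_isometric G T T'"
  shows "equivariantly_isometric G (rescale t T) (rescale t T')"
proof -
  obtain f where f: "bij_betw f (points T) (points T')"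
    "\<forall>x\<in>points T. \<forall>y\<in>points T. point_dist T' (f x) (f y) = point_dist T x y"
    "\<forall>g\<in>carrier G. \<forall>x\<in>points T. f (point_act G T g x) = point_act G T' g (f x)"
    using iso unfolding equivariantly_isometric_def by (elim exE conjE)
  have "f x \<in> points T'" if "x \<in> points T" for x using bij_betw_apply[OF f(1) that] .
  then show ?thesis
    unfolding equivariantly_isometric_def
    using f point_dist_rescale[OF T(1) t] point_dist_rescale[OF T(2) t] by (intro exI[of _ f]) simp
qed

lemma class_rescale:
  assumes T: "is_metric_gtree G T" and t: "0 < t"
  shows "rescale t ` isometry_class G T = isometry_class G (rescale t T)"
proof (intro equalityI subsetI)
  fix X assume "X \<in> rescale t ` isometry_class G T"
  then obtain T' where "X = rescale t T'" "is_metric_gtree G T'" "equivariantly_isometric G T T'"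
    unfolding isometry_class_def by auto
  then show "X \<in> isometry_class G (rescale t T)"
    unfolding isometry_class_def using metric_rescale t isometric_rescale[OF T _ t] by auto
next
  fix X assume "X \<in> isometry_class G (rescale t T)"
  then have X: "is_metric_gtree G X" "equivariantly_isometric G (rescale t T) X" unfolding isometry_class_def by auto
  have t': "0 < 1 / t" using t by simp
  have "equivariantly_isometric G (rescale (1 / t) (rescale t T)) (rescale (1 / t) X)"
    by (rule isometric_rescale[OF metric_rescale[OF T t] X(1) t' X(2)])
  then have "rescale (1 / t) X \<in> isometry_class G T"
    unfolding isometry_class_def using metric_rescale[OF X(1) t'] t by simp
  moreover have "X = rescale t (rescale (1 / t) X)" using t by simp
  ultimately show "X \<in> rescale t ` isometry_class G T" by (rule rev_image_eqI)
qed

lemma rescale_image: "rescale s ` rescale t ` c = rescale (s * t) ` c" "rescale 1 ` c = c"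
  by (simp_all add: image_image)

lemma projection_self: "c \<in> projection c"
  unfolding projection_def using rescale_image(2)[of c] by (metis (mono_tags, lifting) mem_Collect_eq zero_less_one)

lemma projection_eqD: "projection c = projection c' \<Longrightarrow> \<exists>t>0. c = rescale t ` c'"
  using projection_self[of c] unfolding projection_def by auto

lemma projection_rescale:
  assumes t: "0 < t"
  shows "projection (rescale t ` c) = projection c"
proof (intro equalityI subsetI)
  fix z assume "z \<in> projection (rescale t ` c)"
  then obtain s where s: "0 < s" "z = rescale s ` rescale t ` c" unfolding projection_def by auto
  then have "z = rescale (s * t) ` c" "0 < s * t" using t by (simp_all add: image_image)
  then show "z \<in> projection c" unfolding projection_def by blast
next
  fix z assume "z \<in> projection c"
  then obtain s where s: "0 < s" "z = rescale s ` c" unfolding projection_def by auto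
  then have "z = rescale (s / t) ` rescale t ` c" "0 < s / t" using t by (simp_all add: image_image)
  then show "z \<in> projection (rescale t ` c)" unfolding projection_def by blast
qed

lemma collapses_to_rescale:
  assumes t: "0 < t" and c: "collapses_to G S \<omega> T"
  shows "collapses_to G S (\<lambda>c\<in>edge_orbits G S. t * \<omega> c) (rescale t T)"
proof -
  have w: "edge_weight G S (\<lambda>c\<in>edge_orbits G S. t * \<omega> c) e = t * edge_weight G S \<omega> e" if "e \<in> edges S" for e
    using that unfolding edge_weight_def edge_orbits_def orbits_def by auto
  have z: "{e \<in> edges S. edge_weight G S (\<lambda>c\<in>edge_orbits G S. t * \<omega> c) e = 0} = {e \<in> edges S. edge_weight G S \<omega> e = 0}"
    "{e \<in> edges S. edge_weight G S (\<lambda>c\<in>edge_orbits G S. t * \<omega> c) e \<noteq> 0} = {e \<in> edges S. edge_weight G S \<omega> e \<noteq> 0}"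
    using w t by auto
  obtain f where f: "f ` verts S = verts T"
    "\<forall>u\<in>verts S. \<forall>v\<in>verts S.
       f u = f v \<longleftrightarrow> (\<exists>p. is_path (verts S) {e \<in> edges S. edge_weight G S \<omega> e = 0} p u v)"
    "\<forall>g\<in>carrier G. \<forall>v\<in>verts S. f (act S g v) = act T g (f v)"
    "edges T = (`) f ` {e \<in> edges S. edge_weight G S \<omega> e \<noteq> 0}"
    "\<forall>e\<in>edges S. edge_weight G S \<omega> e \<noteq> 0 \<longrightarrow> len T (f ` e) = edge_weight G S \<omega> e"
    using c unfolding collapses_to_def by (elim exE conjE)
  have l: "\<forall>e\<in>edges S. edge_weight G S (\<lambda>c\<in>edge_orbits G S. t * \<omega> c) e \<noteq> 0 \<longrightarrow>
      len (rescale t T) (f ` e) = edge_weight G S (\<lambda>c\<in>edge_orbits G S. t * \<omega> c) e"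
    using f(5) w t by simp
  show ?thesis unfolding collapses_to_def z rescale_simps(1-3)
    by (rule exI[of _ f]) (intro conjI f(1-4) l)
qed

section \<open>Deformation spaces\<close>

lemma isometric_elliptic:
  assumes T: "is_metric_gtree G T" "is_metric_gtree G T'" and iso: "equivariantly_isometric G T T'"
    and H: "H \<subseteq> carrier G" and ell: "elliptic G T H"
  shows "elliptic G T' H"
proof -
  interpret weighted_pair G T T' "len T" by (rule weighted_pair_metric[OF T])
  interpret A: mtr G T by (rule mtr_I[OF T(1)])
  obtain F where F: "surjection F" using isometric_surjection[OF T iso] by auto
  obtain y where y: "y \<in> S.pts" "\<forall>h\<in>H. S.pact h y = y" using ell unfolding A.elliptic_iff by auto
  have "T.pact h (F y) = F y" if "h \<in> H" for h
    using surjection_act[OF F _ y(1), of h] y(2) that H by (metis subsetD)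
  then show ?thesis unfolding T.elliptic_iff using surjection_pts[OF F y(1)] by blast
qed

text \<open>Restricted and unrestricted spaces are treated at once: in either case the trees share
  their elliptic subgroups and the space is stable under rescaling.\<close>

locale def_space =
  fixes G :: "('g, 'b) monoid_scheme" and T\<^sub>0 :: "('g, 'v) metric_gtree" and D :: "('g, 'v) metric_gtree set set"
  assumes fg: "finitely_generated_group G"
    and D: "D = deformation_space G T\<^sub>0 \<or>
      (\<exists>\<A>. subgroup_family G \<A> \<and> D = restricted_deformation_space G T\<^sub>0 \<A>)"
    and types: "irreducible_space G D \<or> genuine_abelian_space G D"
begin

lemma D_rep:
  assumes "c \<in> D"
  shows "\<exists>T. is_metric_gtree G T \<and> c = isometry_class G T \<and> (\<forall>H. subgroup H G \<longrightarrow> elliptic G T H = elliptic G T\<^sub>0 H)"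
proof -
  have "c \<in> deformation_space G T\<^sub>0" using D assms unfolding restricted_deformation_space_def by auto
  then show ?thesis unfolding deformation_space_def by auto
qed

lemma D_mem:
  assumes c: "c \<in> D" and T: "T \<in> c"
  shows "is_metric_gtree G T" "c = isometry_class G T" "subgroup H G \<Longrightarrow> elliptic G T H = elliptic G T\<^sub>0 H"
proof -
  obtain T1 where T1: "is_metric_gtree G T1" "c = isometry_class G T1"
    "\<forall>H. subgroup H G \<longrightarrow> elliptic G T1 H = elliptic G T\<^sub>0 H" using D_rep[OF c] by auto
  have i: "is_metric_gtree G T" "equivariantly_isometric G T1 T" using T T1 unfolding isometry_class_def by auto
  show "is_metric_gtree G T" by (rule i)
  show "c = isometry_class G T" using class_eqI[OF T1(1) i] T1(2) by simp
  assume H: "subgroup H G"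
  have "H \<subseteq> carrier G" using H by (rule subgroup.subset)
  then have "elliptic G T1 H = elliptic G T H"
    using isometric_elliptic[OF T1(1) i] isometric_elliptic[OF i(1) T1(1) isometric_sym[OF T1(1) i]] by auto
  then show "elliptic G T H = elliptic G T\<^sub>0 H" using T1(3) H by auto
qed

lemma D_self: "c \<in> D \<Longrightarrow> \<exists>T\<in>c. is_metric_gtree G T \<and> c = isometry_class G T"
  using D_rep[of c] class_self by blast

lemma D_rescale:
  assumes c: "c \<in> D" and t: "0 < t"
  shows "rescale t ` c \<in> D"
proof -
  have 1: "rescale t ` c \<in> deformation_space G T\<^sub>0"
  proof -
    obtain T where T: "is_metric_gtree G T" "c = isometry_class G T" "\<forall>H. subgroup H G \<longrightarrow> elliptic G T H = elliptic G T\<^sub>0 H"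
      using D_rep[OF c] by auto
    have "elliptic G (rescale t T) H = elliptic G T H" for H unfolding elliptic_def by simp
    then show ?thesis
      unfolding deformation_space_def T(2) class_rescale[OF T(1) t] using metric_rescale[OF T(1) t] T(3)
      by (intro imageI CollectI) simp
  qed
  show ?thesis
  proof (cases "D = deformation_space G T\<^sub>0")
    case False
    then obtain \<A> where A: "D = restricted_deformation_space G T\<^sub>0 \<A>" using D by auto
    have "\<forall>T\<in>c. \<forall>e\<in>edges T. stabilizer G (edge_act T) e \<in> \<A>"
      using c unfolding A restricted_deformation_space_def by auto
    then have "\<forall>T\<in>rescale t ` c. \<forall>e\<in>edges T. stabilizer G (edge_act T) e \<in> \<A>" by simp
    then show ?thesis using 1 unfolding A restricted_deformation_space_def by simp
  qed (use 1 in simp)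
qed

lemma generators: "\<exists>A0. finite A0 \<and> A0 \<subseteq> carrier G \<and> generate G A0 = carrier G"
  using fg unfolding finitely_generated_group_def by auto

lemma axis_data_exists:
  assumes T: "T \<in> \<Union>D"
  shows "\<exists>g x h. mtr.axis_data G T g x h"
proof -
  have m: "is_metric_gtree G T" using T D_mem(1) by auto
  interpret mtr G T by (rule mtr_I[OF m])
  obtain A0 where A0: "finite A0" "A0 \<subseteq> carrier G" "generate G A0 = carrier G" using generators by auto
  have "irreducible_tree G T \<or> genuine_abelian_tree G T"
    using types T unfolding irreducible_space_def genuine_abelian_space_def by auto
  then show ?thesis using irreducible_axis_data genuine_abelian_axis_data[OF A0] by auto
qed

text \<open>A deformation space compares subgroups, so \<open>g\<close> is replaced by the cyclic
  group it generates: a vertex of \<open>S\<close> fixed by \<open>g\<close> makes this group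
  elliptic in \<open>S\<close>, hence in \<open>T\<close>.\<close>

lemma free_transfer:
  assumes T: "T \<in> \<Union>D" and S: "S \<in> \<Union>D" and g: "g \<in> carrier G"
    and free: "\<And>y. y \<in> points T \<Longrightarrow> point_act G T g y \<noteq> y" and v: "v \<in> verts S"
  shows "act S g v \<noteq> v"
proof
  assume fx: "act S g v = v"
  have mS: "is_metric_gtree G S" and mT: "is_metric_gtree G T" using S T D_mem(1) by auto
  interpret S: mtr G S by (rule mtr_I[OF mS])
  interpret T: mtr G T by (rule mtr_I[OF mT])
  have sub: "subgroup (generate G {g}) G" by (rule S.generate_is_subgroup) (use g in simp)
  have "act S k v = v" if "k \<in> generate G {g}" for k
    using that
  proof (induction rule: generate.induct)
    case (inv h)
    then show ?case using S.act_inv[OF g v] fx by simp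
  next
    case (eng h1 h2)
    have "h1 \<in> carrier G" "h2 \<in> carrier G" using eng subgroup.subset[OF sub] by auto
    then show ?case using S.act_mult eng v by simp
  qed (use fx v in auto)
  then have "elliptic G S (generate G {g})"
    unfolding S.elliptic_iff using v subgroup.subset[OF sub] by (intro bexI[of _ "pt v"]) auto
  then have "elliptic G T (generate G {g})" using S T D_mem(3)[OF _ _ sub] by auto
  moreover have "g \<in> generate G {g}" by (rule generate.incl) simp
  ultimately show False using free unfolding elliptic_def by blast
qed

lemma params_tree:
  assumes S: "S \<in> \<Union>D" and \<omega>: "\<omega> \<in> closed_cone_params G D S"
  obtains T where "is_metric_gtree G T" "collapses_to G S \<omega> T" "cone_point G S \<omega> = isometry_class G T"
proof -
  have mS: "is_metric_gtree G S" using S D_mem(1) by auto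
  then have gS: "is_gtree G S" unfolding is_metric_gtree_def by auto
  have c: "cone_point G S \<omega> \<in> D" and nn: "\<And>c. c \<in> edge_orbits G S \<Longrightarrow> 0 \<le> \<omega> c"
    using \<omega> unfolding closed_cone_params_def by (auto simp: PiE_iff)
  obtain T1 where "T1 \<in> cone_point G S \<omega>" using D_self[OF c] by auto
  then obtain T where T: "is_metric_gtree G T" "collapses_to G S \<omega> T" unfolding cone_point_def by auto
  show ?thesis by (rule that[OF T cone_point_eq[OF gS nn T]])
qed

text \<open>Here \<open>T\<close> is an arbitrary representative of the class; the collapse onto one
  tree of the class is followed by an equivariant isometry.\<close>

lemma params_surjection:
  assumes S: "S \<in> \<Union>D" and \<omega>: "\<omega> \<in> closed_cone_params G D S" and T: "T \<in> cone_point G S \<omega>"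
  shows "weighted_pair G S T (edge_weight G S \<omega>)" "\<exists>\<kappa>. weighted_pair.surjection G S T (edge_weight G S \<omega>) \<kappa>"
proof -
  have gS: "is_gtree G S" using S D_mem(1) unfolding is_metric_gtree_def by auto
  have nn: "\<And>c. c \<in> edge_orbits G S \<Longrightarrow> 0 \<le> \<omega> c"
    using \<omega> unfolding closed_cone_params_def by (auto simp: PiE_iff)
  obtain T' where T': "is_metric_gtree G T'" "collapses_to G S \<omega> T'" "cone_point G S \<omega> = isometry_class G T'"
    using params_tree[OF S \<omega>] .
  have i: "is_metric_gtree G T" "equivariantly_isometric G T' T" using T unfolding T'(3) isometry_class_def by auto
  obtain \<kappa> where \<kappa>: "weighted_pair.surjection G S T' (edge_weight G S \<omega>) \<kappa>"
    using collapse_to_surjection[where \<omega> = \<omega>, OF gS nn T'(1,2)] by auto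
  have "weighted_pair G S T (edge_weight G S \<omega>) \<and> (\<exists>\<kappa>. weighted_pair.surjection G S T (edge_weight G S \<omega>) \<kappa>)"
    by (rule surjection_trans[OF collapse_pair[where \<omega> = \<omega>, OF gS nn T'(1)] \<kappa> i])
  then show "weighted_pair G S T (edge_weight G S \<omega>)" "\<exists>\<kappa>. weighted_pair.surjection G S T (edge_weight G S \<omega>) \<kappa>" by auto
qed

section \<open>Comparison of the two topologies\<close>

lemma topspace_weak: "topspace (weak_topology G D) = D"
proof -
  have "weakly_closed G D {}" unfolding weakly_closed_def by simp
  then have "openin (weak_topology G D) D" unfolding openin_weak_topology by simp
  then show ?thesis using openin_subset[of "weak_topology G D"] openin_weak_topology[of G D "topspace (weak_topology G D)"]
    by (metis openin_topspace subset_antisym)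
qed

lemma topspace_gromov: "topspace (gromov_topology G D) = D"
proof -
  have "gromov_open G D D" unfolding gromov_open_def
    by (intro conjI ballI exI[of _ "{}"] exI[of _ 1]) auto
  then have "openin (gromov_topology G D) D" unfolding openin_gromov_topology .
  moreover have "gromov_open G D (topspace (gromov_topology G D))" unfolding openin_gromov_topology[symmetric] by simp
  then have "topspace (gromov_topology G D) \<subseteq> D" unfolding gromov_open_def by (rule conjunct1)
  ultimately show ?thesis using openin_subset by (metis subset_antisym)
qed

lemma topspace_cone_space:
  "topspace (subtopology (powertop_real (edge_orbits G S)) (closed_cone_params G D S)) = closed_cone_params G D S"
  unfolding topspace_subtopology topspace_product_topology closed_cone_params_def by force

lemma gromov_openD:
  assumes "gromov_open G D U" "T \<in> \<Union>U"
  shows "\<exists>X A \<epsilon>. finite X \<and> X \<subseteq> points T \<and> finite A \<and> A \<subseteq> carrier G \<and> 0 < \<epsilon> \<and>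
    {c \<in> D. c \<inter> gromov_nhd G T X A \<epsilon> \<noteq> {}} \<subseteq> U"
  using assms unfolding gromov_open_def by (elim conjE) (rule bspec)

text \<open>The finite set \<open>X\<close> is lifted to points of \<open>S\<close>. The images of
  the same lifts under the collapses for nearby lengths show that the nearby trees lie in the given
  neighborhood, because distances between fixed points of \<open>S\<close> are continuous in the
  lengths.\<close>

lemma gromov_open_is_weakly_open:
  assumes U: "openin (gromov_topology G D) U"
  shows "openin (weak_topology G D) U"
proof -
  have go: "gromov_open G D U" using U unfolding openin_gromov_topology .
  then have UD: "U \<subseteq> D" unfolding gromov_open_def by (rule conjunct1)
  have "closedin (closed_cone_topology G D S) ((D - U) \<inter> closed_cone G D S)" if S: "S \<in> \<Union>D" for S
  proof -
    let ?I = "edge_orbits G S" and ?P = "closed_cone_params G D S" and ?K = "closed_cone G D S"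
    let ?X = "subtopology (powertop_real ?I) ?P"
    have mS: "is_metric_gtree G S" using S D_mem(1) by auto
    interpret S: mtr G S by (rule mtr_I[OF mS])
    have "openin ?X {\<omega> \<in> ?P. cone_point G S \<omega> \<in> U}"
      unfolding openin_subopen[of ?X "{\<omega> \<in> ?P. cone_point G S \<omega> \<in> U}"]
    proof
      fix \<omega>0 assume "\<omega>0 \<in> {\<omega> \<in> ?P. cone_point G S \<omega> \<in> U}"
      then have \<omega>0: "\<omega>0 \<in> ?P" "cone_point G S \<omega>0 \<in> U" by auto
      obtain T where T: "is_metric_gtree G T" "collapses_to G S \<omega>0 T" "cone_point G S \<omega>0 = isometry_class G T"
        using params_tree[OF S \<omega>0(1)] .
      have Tc: "T \<in> cone_point G S \<omega>0" unfolding T(3) by (rule class_self[OF T(1)])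
      then have "T \<in> \<Union>U" using \<omega>0(2) by blast
      from gromov_openD[OF go this] obtain X A \<epsilon> where X: "finite X" "X \<subseteq> points T" "finite A" "A \<subseteq> carrier G" "0 < \<epsilon>"
        and nhd: "{c \<in> D. c \<inter> gromov_nhd G T X A \<epsilon> \<noteq> {}} \<subseteq> U"
        by (elim exE conjE)
      interpret W0: weighted_pair G S T "edge_weight G S \<omega>0" by (rule params_surjection(1)[OF S \<omega>0(1) Tc])
      obtain \<kappa>0 where \<kappa>0: "W0.surjection \<kappa>0" using params_surjection(2)[OF S \<omega>0(1) Tc] by auto
      have "\<forall>x\<in>X. \<exists>a\<in>S.pts. \<kappa>0 a = x" using W0.surjection_onto[OF \<kappa>0] X(2) W0.T.points_eq by auto
      then obtain l where l: "\<And>x. x \<in> X \<Longrightarrow> l x \<in> S.pts" "\<And>x. x \<in> X \<Longrightarrow> \<kappa>0 (l x) = x" by metis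
      define F where "F t \<omega> = S.dw (edge_weight G S \<omega>) (l (fst t)) (S.pact (snd (snd t)) (l (fst (snd t))))" for t \<omega>
      let ?J = "X \<times> X \<times> A"
      have FJ: "continuous_map (powertop_real ?I) euclideanreal (F t)" for t
      proof -
        have proj: "continuous_map (powertop_real ?I) euclideanreal (\<lambda>\<omega>. edge_weight G S \<omega> e)" if "e \<in> edges S" for e
          unfolding edge_weight_def
          by (rule continuous_map_product_projection) (use that in \<open>auto simp: edge_orbits_def orbits_def\<close>)
        show ?thesis
        proof (cases "finite {e \<in> edges S. S.cc e (l (fst t)) \<noteq> S.cc e (S.pact (snd (snd t)) (l (fst (snd t))))}")
          case True
          then show ?thesis unfolding F_def S.dw_def
            by (intro continuous_map_sum continuous_map_real_mult proj continuous_map_const[THEN iffD2]) auto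
        next
          \<comment> \<open>Outside \<open>?J\<close> the values of \<open>l\<close> are arbitrary.
            A sum over an infinite set is \<open>0\<close> by convention, so the function is still
            continuous.\<close>
          case False
          then show ?thesis unfolding F_def S.dw_def by simp
        qed
      qed
      define V where "V = (\<Inter>t\<in>?J. {\<omega> \<in> topspace (powertop_real ?I). F t \<omega> \<in> ball (F t \<omega>0) \<epsilon>}) \<inter> topspace (powertop_real ?I)"
      have oV: "openin (powertop_real ?I) V"
        unfolding V_def
      proof (rule openin_INT)
        show "finite ?J" using X by simp
        fix t assume "t \<in> ?J"
        show "openin (powertop_real ?I) {\<omega> \<in> topspace (powertop_real ?I). F t \<omega> \<in> ball (F t \<omega>0) \<epsilon>}"
          by (rule openin_continuous_map_preimage[OF FJ]) (simp only: open_openin[symmetric] open_ball)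
      qed
      have top: "\<omega>0 \<in> topspace (powertop_real ?I)" using \<omega>0(1) unfolding closed_cone_params_def by (auto simp: PiE_iff)
      have "\<omega>0 \<in> V \<inter> ?P" unfolding V_def using top \<omega>0 X(5) by auto
      moreover have "V \<inter> ?P \<subseteq> {\<omega> \<in> ?P. cone_point G S \<omega> \<in> U}"
      proof
        fix \<omega> assume "\<omega> \<in> V \<inter> ?P"
        then have \<omega>: "\<omega> \<in> V" "\<omega> \<in> ?P" by auto
        obtain T' where T': "is_metric_gtree G T'" "collapses_to G S \<omega> T'" "cone_point G S \<omega> = isometry_class G T'"
          using params_tree[OF S \<omega>(2)] .
        have Tc': "T' \<in> cone_point G S \<omega>" unfolding T'(3) by (rule class_self[OF T'(1)])
        interpret W: weighted_pair G S T' "edge_weight G S \<omega>" by (rule params_surjection(1)[OF S \<omega>(2) Tc'])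
        obtain \<kappa> where \<kappa>: "W.surjection \<kappa>" using params_surjection(2)[OF S \<omega>(2) Tc'] by auto
        have "T' \<in> gromov_nhd G T X A \<epsilon>"
          unfolding gromov_nhd_def
        proof (intro CollectI exI[of _ "\<lambda>x. \<kappa> (l x)"] conjI ballI)
          show "(\<lambda>x. \<kappa> (l x)) ` X \<subseteq> points T'" using W.surjection_pts[OF \<kappa>] l(1) W.T.points_eq by auto
          fix x y k assume xyk: "x \<in> X" "y \<in> X" "k \<in> A"
          have k: "k \<in> carrier G" using xyk X by auto
          have P: "l x \<in> S.pts" "l y \<in> S.pts" "S.pact k (l y) \<in> S.pts" using l xyk k by auto
          have "point_dist T x (point_act G T k y) = F (x, y, k) \<omega>0"
            using W0.T.point_dist_eq[OF W0.surjection_pts[OF \<kappa>0 P(1)] W0.surjection_pts[OF \<kappa>0 P(3)]]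
              W0.surjection_dist[OF \<kappa>0 P(1,3)] W0.surjection_act[OF \<kappa>0 k P(2)] l(2)[OF xyk(1)] l(2)[OF xyk(2)]
            unfolding F_def by simp
          moreover have "point_dist T' (\<kappa> (l x)) (point_act G T' k (\<kappa> (l y))) = F (x, y, k) \<omega>"
            using W.T.point_dist_eq[OF W.surjection_pts[OF \<kappa> P(1)] W.surjection_pts[OF \<kappa> P(3)]]
              W.surjection_dist[OF \<kappa> P(1,3)] W.surjection_act[OF \<kappa> k P(2)]
            unfolding F_def by simp
          moreover have "F (x, y, k) \<omega> \<in> ball (F (x, y, k) \<omega>0) \<epsilon>" using \<omega>(1) xyk unfolding V_def by blast
          ultimately show "\<bar>point_dist T x (point_act G T k y) - point_dist T' (\<kappa> (l x)) (point_act G T' k (\<kappa> (l y)))\<bar> < \<epsilon>"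
            by (simp add: dist_real_def)
        qed
        moreover have "cone_point G S \<omega> \<in> D" using \<omega>(2) unfolding closed_cone_params_def by auto
        ultimately have "cone_point G S \<omega> \<in> U" using nhd Tc' by blast
        then show "\<omega> \<in> {\<omega> \<in> ?P. cone_point G S \<omega> \<in> U}" using \<omega>(2) by simp
      qed
      moreover have "openin ?X (V \<inter> ?P)" using oV by (rule openin_subtopology_Int)
      ultimately show "\<exists>V. openin ?X V \<and> \<omega>0 \<in> V \<and> V \<subseteq> {\<omega> \<in> ?P. cone_point G S \<omega> \<in> U}" by blast
    qed
    then have "openin (closed_cone_topology G D S) (U \<inter> ?K)"
      unfolding closed_cone_topology_def openin_quotient_topology topspace_cone_space
      by (auto simp: closed_cone_def elim: back_subst[of "openin ?X"])
    moreover have "?K - (D - U) \<inter> ?K = U \<inter> ?K" using closed_cone_subset[of G D S] by blast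
    ultimately show ?thesis
      unfolding closedin_def topspace_closed_cone_topology by simp
  qed
  then have "weakly_closed G D (D - U)" unfolding weakly_closed_def by blast
  then show ?thesis unfolding openin_weak_topology using UD by blast
qed

text \<open>If no Gromov neighborhood of \<open>T\<close> avoided the set, already those given by
  the single point \<open>pt x\<close> would supply all approximations asked for by
  \<open>limit_tree\<close>. The approximating trees are pulled back to \<open>S\<close> along their
  collapse maps.\<close>

lemma weakly_closed_in_cone:
  assumes S: "S \<in> \<Union>D" and W: "closedin (closed_cone_topology G D S) (W \<inter> closed_cone G D S)"
  shows "openin (gromov_topology G D) (D - W \<inter> closed_cone G D S)"
proof -
  let ?I = "edge_orbits G S" and ?P = "closed_cone_params G D S" and ?K = "closed_cone G D S"
  let ?X = "subtopology (powertop_real ?I) ?P"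
  define Q where "Q = {\<omega> \<in> ?P. cone_point G S \<omega> \<in> W}"
  have mS: "is_metric_gtree G S" using S D_mem(1) by auto
  have gS: "is_gtree G S" using mS unfolding is_metric_gtree_def by auto
  have Qsub: "Q \<subseteq> ?I \<rightarrow>\<^sub>E {0..}" unfolding Q_def closed_cone_params_def by auto
  have "openin (closed_cone_topology G D S) (?K - W \<inter> ?K)" using W unfolding closedin_def topspace_closed_cone_topology by auto
  then have "openin ?X {\<omega> \<in> ?P. cone_point G S \<omega> \<in> ?K - W \<inter> ?K}"
    unfolding closed_cone_topology_def openin_quotient_topology topspace_cone_space by auto
  moreover have "{\<omega> \<in> ?P. cone_point G S \<omega> \<in> ?K - W \<inter> ?K} = ?P - Q" unfolding Q_def closed_cone_def by blast
  ultimately obtain V where V: "openin (powertop_real ?I) V" "?P - Q = V \<inter> ?P" unfolding openin_subtopology by auto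
  \<comment> \<open>\<open>closure\<close> refers to the space of all functions, whereas
    \<open>?P\<close> is topologized by \<open>powertop_real\<close>. Restriction to
    \<open>?I\<close> is continuous from the one to the other and is the identity on
    \<open>?P\<close>.\<close>
  have clQ: "\<omega> \<in> Q" if \<omega>: "\<omega> \<in> ?P" "\<omega> \<in> closure Q" for \<omega>
  proof (rule ccontr)
    assume "\<omega> \<notin> Q"
    then have "\<omega> \<in> V" using \<omega>(1) V(2) by auto
    have "continuous_map euclidean (powertop_real ?I) (\<lambda>f. restrict f ?I)"
      unfolding continuous_map_componentwise
      by (auto intro!: continuous_map_iff_continuous2[THEN iffD2])
    from openin_continuous_map_preimage[OF this V(1)] have "open {f. restrict f ?I \<in> V}" by simp
    moreover have ext: "restrict f ?I = f" if "f \<in> ?P" for f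
      using that unfolding closed_cone_params_def by (auto simp: PiE_iff extensional_restrict)
    moreover have "\<omega> \<in> {f. restrict f ?I \<in> V}" using \<open>\<omega> \<in> V\<close> ext[OF \<omega>(1)] by simp
    ultimately obtain f where f: "f \<in> Q" "restrict f ?I \<in> V" using \<omega>(2) unfolding closure_iff_nhds_not_empty by blast
    then have "f \<in> ?P" "f \<in> V" using ext unfolding Q_def by auto
    then show False using V(2) f by auto
  qed
  have "gromov_open G D (D - W \<inter> ?K)"
    unfolding gromov_open_def
  proof (intro conjI ballI)
    fix T assume "T \<in> \<Union>(D - W \<inter> ?K)"
    then obtain c where c: "c \<in> D" "c \<notin> W \<inter> ?K" "T \<in> c" by auto
    have TD: "T \<in> \<Union>D" using c by auto
    note mT = D_mem(1,2)[OF c(1,3)]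
    interpret gtr_pair G S T
    proof -
      interpret A: mtr G S by (rule mtr_I[OF mS])
      interpret B: mtr G T by (rule mtr_I[OF mT(1)])
      show "gtr_pair G S T" ..
    qed
    obtain g x h where "T.axis_data g x h" using axis_data_exists[OF TD] by auto
    then have ad: "g \<in> carrier G" "h \<in> carrier G" "x \<in> verts T"
      "T.B (pt x) (pt (act T g x)) (pt (act T g (act T g x)))" "act T g x \<noteq> x"
      "T.td (pt x) (pt (act T h (act T h x))) < 2 * T.td (pt x) (pt (act T h x))" unfolding T.axis_data_def by auto
    have freeT: "T.pact g y \<noteq> y" if "y \<in> T.pts" for y
      by (rule T.translation_no_fixpoint[of g "pt x" y]) (use ad that T.B_td[OF ad(3,1)] in auto)
    have free: "act S g v \<noteq> v" if "v \<in> verts S" for v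
      by (rule free_transfer[OF TD S ad(1) _ that]) (use freeT T.points_eq in auto)
    obtain A0 where A0: "finite A0" "A0 \<subseteq> carrier G" "generate G A0 = carrier G" using generators by auto
    show "\<exists>X A \<epsilon>. finite X \<and> X \<subseteq> points T \<and> finite A \<and> A \<subseteq> carrier G \<and> 0 < \<epsilon> \<and>
        {c \<in> D. c \<inter> gromov_nhd G T X A \<epsilon> \<noteq> {}} \<subseteq> D - W \<inter> ?K"
    proof (rule ccontr)
      assume no: "\<not> ?thesis"
      have approx: "\<exists>\<omega>\<in>Q. \<exists>p\<in>S.pts. \<forall>k\<in>A. \<bar>T.td (pt x) (T.pact k (pt x)) - S.dw (sw \<omega>) p (S.pact k p)\<bar> < \<epsilon>"
        if A: "finite A" "A \<subseteq> carrier G" "0 < \<epsilon>" for A \<epsilon>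
      proof -
        have "{pt x} \<subseteq> points T" using T.points_eq ad(3) by simp
        have "\<not> {c \<in> D. c \<inter> gromov_nhd G T {pt x} A \<epsilon> \<noteq> {}} \<subseteq> D - W \<inter> ?K"
        proof
          assume sub: "{c \<in> D. c \<inter> gromov_nhd G T {pt x} A \<epsilon> \<noteq> {}} \<subseteq> D - W \<inter> ?K"
          show False
            by (rule notE[OF no], rule exI[of _ "{pt x}"], rule exI[of _ A], rule exI[of _ \<epsilon>],
                intro conjI finite.intros A sub \<open>{pt x} \<subseteq> points T\<close>)
        qed
        then obtain c' where c0: "c' \<in> D" "c' \<inter> gromov_nhd G T {pt x} A \<epsilon> \<noteq> {}" "c' \<notin> D - W \<inter> ?K"
          unfolding subset_iff mem_Collect_eq not_all not_imp by (elim exE conjE)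
        from c0(2) obtain T' where "T' \<in> c' \<inter> gromov_nhd G T {pt x} A \<epsilon>" unfolding ex_in_conv[symmetric] by (elim exE)
        then have c': "c' \<in> W" "c' \<in> ?K" "T' \<in> c'" "T' \<in> gromov_nhd G T {pt x} A \<epsilon>" using c0(1,3) by simp_all
        obtain \<omega> where \<omega>: "\<omega> \<in> ?P" "c' = cone_point G S \<omega>" using c'(2) unfolding closed_cone_def by auto
        have T'c: "T' \<in> cone_point G S \<omega>" using c'(3) \<omega>(2) by simp
        interpret W: weighted_pair G S T' "sw \<omega>" by (rule params_surjection(1)[OF S \<omega>(1) T'c])
        obtain \<kappa> where \<kappa>: "W.surjection \<kappa>" using params_surjection(2)[OF S \<omega>(1) T'c] by auto
        obtain f where f: "f ` {pt x} \<subseteq> points T'" "\<forall>k\<in>A.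
          \<bar>point_dist T (pt x) (point_act G T k (pt x)) - point_dist T' (f (pt x)) (point_act G T' k (f (pt x)))\<bar> < \<epsilon>"
          using c'(4) unfolding gromov_nhd_def by auto
        obtain p where p: "p \<in> S.pts" "\<kappa> p = f (pt x)"
          using W.surjection_onto[OF \<kappa>, of "f (pt x)"] f(1) W.T.points_eq by auto
        have "\<bar>T.td (pt x) (T.pact k (pt x)) - S.dw (sw \<omega>) p (S.pact k p)\<bar> < \<epsilon>" if k: "k \<in> A" for k
        proof -
          have kc: "k \<in> carrier G" using k A by auto
          have P: "S.pact k p \<in> S.pts" using kc p by simp
          have e1: "point_dist T' (f (pt x)) (point_act G T' k (f (pt x))) = S.dw (sw \<omega>) p (S.pact k p)"
            using W.T.point_dist_eq[OF W.surjection_pts[OF \<kappa> p(1)] W.surjection_pts[OF \<kappa> P]]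
              W.surjection_dist[OF \<kappa> p(1) P] W.surjection_act[OF \<kappa> kc p(1)] p(2) by simp
          have e2: "point_dist T (pt x) (point_act G T k (pt x)) = T.td (pt x) (T.pact k (pt x))"
            by (rule T.point_dist_eq) (use ad kc in simp_all)
          show ?thesis using bspec[OF f(2) k] unfolding e1 e2 .
        qed
        moreover have "\<omega> \<in> Q" unfolding Q_def using \<omega> c'(1) by simp
        ultimately show ?thesis using p(1) by blast
      qed
      obtain \<omega> where \<omega>: "\<omega> \<in> closure Q" "\<omega> \<in> ?I \<rightarrow>\<^sub>E {0..}" "\<exists>c\<in>?I. \<omega> c \<noteq> 0" "collapses_to G S \<omega> T"
        using limit_tree[OF A0 ad(3,1,2,4,5,6) free freeT Qsub approx] by blast
      have "cone_point G S \<omega> = isometry_class G T"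
        by (rule cone_point_eq[OF gS _ mT(1) \<omega>(4)]) (use \<omega>(2) in \<open>auto simp: PiE_iff\<close>)
      then have cp: "cone_point G S \<omega> = c" using mT(2) by simp
      \<comment> \<open>The limit of the lengths has not left the closed cone: its collapse is
        \<open>T\<close>, whose class \<open>c\<close> belongs to \<open>D\<close>.\<close>
      then have "\<omega> \<in> ?P" unfolding closed_cone_params_def using \<omega>(2,3) c(1) by simp
      moreover from this have "\<omega> \<in> Q" using clQ \<omega>(1) by simp
      ultimately have "c \<in> W \<inter> ?K" using cp unfolding Q_def closed_cone_def by auto
      then show False using c(2) by simp
    qed
  qed auto
  then show ?thesis unfolding openin_gromov_topology .
qed

text \<open>On \<open>Y\<close>, the set \<open>U\<close> is obtained by removing the pieces
  \<open>(D - U) \<inter> closed_cone G D S\<close>. Each is Gromov closed, and finiteness of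
  \<open>F\<close> keeps the remaining set open.\<close>

lemma agree_on_cones:
  assumes F: "finite F" "F \<subseteq> \<Union>D" and Y: "Y \<inter> D \<subseteq> (\<Union>S\<in>F. closed_cone G D S)" and U: "openin (weak_topology G D) U"
  shows "\<exists>V. openin (gromov_topology G D) V \<and> V \<inter> Y = U \<inter> Y"
proof -
  have UD: "U \<subseteq> D" "weakly_closed G D (D - U)" using U unfolding openin_weak_topology by auto
  define V where "V = (\<Inter>S\<in>F. D - (D - U) \<inter> closed_cone G D S) \<inter> topspace (gromov_topology G D)"
  have "openin (gromov_topology G D) V"
    unfolding V_def
  proof (rule openin_INT[OF F(1)])
    fix S assume "S \<in> F"
    then have S: "S \<in> \<Union>D" using F(2) by auto
    show "openin (gromov_topology G D) (D - (D - U) \<inter> closed_cone G D S)"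
      by (rule weakly_closed_in_cone[OF S]) (use UD(2)[unfolded weakly_closed_def, THEN conjunct2] S in \<open>rule bspec\<close>)
  qed
  moreover have "V \<inter> Y = U \<inter> Y"
  proof (intro equalityI subsetI)
    fix c assume c: "c \<in> V \<inter> Y"
    then have "c \<in> D" unfolding V_def topspace_gromov by simp
    then obtain S where S: "S \<in> F" "c \<in> closed_cone G D S" using Y c by auto
    have "c \<in> (\<Inter>S\<in>F. D - (D - U) \<inter> closed_cone G D S)" using c unfolding V_def by (elim IntE)
    from INT_D[OF this S(1)] show "c \<in> U \<inter> Y" using c S(2) by simp
  next
    fix c assume c: "c \<in> U \<inter> Y"
    then show "c \<in> V \<inter> Y" unfolding V_def topspace_gromov using UD(1) by auto
  qed
  ultimately show ?thesis by blast
qed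

text \<open>For positive lengths nothing is collapsed, so the tree with the new lengths realizes its
  own cone point, with the identity as collapse map.\<close>

lemma cone_in_closed_cone:
  assumes C: "C \<in> cones G D"
  shows "\<exists>S\<in>\<Union>D. C \<inter> D \<subseteq> closed_cone G D S"
proof -
  consider S where "S \<in> \<Union>D" "C = closed_cone G D S" | S where "S \<in> \<Union>D" "C = open_cone G S"
    using C unfolding cones_def by blast
  then show ?thesis
  proof cases
    case 1
    then show ?thesis by (intro bexI[of _ S]) auto
  next
    case 2
    have mS: "is_metric_gtree G S" using 2 D_mem(1) by auto
    then have gS: "is_gtree G S" unfolding is_metric_gtree_def by auto
    interpret S: mtr G S by (rule mtr_I[OF mS])
    obtain g x h where "S.axis_data g x h" using axis_data_exists[OF 2(1)] by auto
    then have x: "x \<in> verts S" "act S g x \<in> verts S" "act S g x \<noteq> x" unfolding S.axis_data_def by auto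
    \<comment> \<open>The length vector has to be nonzero, for which an edge must exist; a vertex
      moved by \<open>g\<close> provides one.\<close>
    then obtain e where e: "e \<in> edges S" using S.edge_at[OF x(1,2)] by auto
    have "C \<inter> D \<subseteq> closed_cone G D S"
    proof
      fix c assume c: "c \<in> C \<inter> D"
      then obtain w where w: "w \<in> edge_orbits G S \<rightarrow>\<^sub>E {0<..}" "c = isometry_class G (S\<lparr>len := edge_weight G S w\<rparr>)"
        using 2(2) unfolding open_cone_def by auto
      let ?T = "S\<lparr>len := edge_weight G S w\<rparr>"
      have pos: "0 < edge_weight G S w e" if "e \<in> edges S" for e
        using w(1) that unfolding edge_weight_def edge_orbits_def orbits_def by (auto simp: PiE_iff)
      have nn: "0 \<le> w c" if "c \<in> edge_orbits G S" for c using w(1) that by (auto simp: PiE_iff intro: less_imp_le)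
      have "S.inv_weight (edge_weight G S w)" by (rule S.inv_weight_edge_weight[OF nn])
      then have mT: "is_metric_gtree G ?T"
        unfolding is_metric_gtree_def is_gtree_len S.inv_weight_def using gS pos by simp
      have zero: "{e \<in> edges S. edge_weight G S w e \<noteq> 0} = edges S" using pos by fastforce
      have col: "collapses_to G S w ?T"
        unfolding collapses_to_def zero
      proof (intro exI[of _ id] conjI ballI)
        fix u v assume uv: "u \<in> verts S" "v \<in> verts S"
        have "(\<forall>e\<in>S.geo u v. edge_weight G S w e = 0) \<longleftrightarrow> S.geo u v = {}"
          using pos S.geo_in_E[OF uv] by force
        then show "id u = id v \<longleftrightarrow> (\<exists>p. is_path (verts S) {e \<in> edges S. edge_weight G S w e = 0} p u v)"
          using S.zero_path_iff[OF uv, of "edge_weight G S w"] S.geo_empty[OF uv] by simp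
      qed simp_all
      have cp: "cone_point G S w = c" unfolding w(2) by (rule cone_point_eq[where \<omega> = w, OF gS nn mT col])
      have "\<exists>c\<in>edge_orbits G S. w c \<noteq> 0"
        using pos[OF e] e unfolding edge_weight_def edge_orbits_def orbits_def by (intro bexI[of _ "orbit G (edge_act S) e"]) auto
      then have "w \<in> closed_cone_params G D S"
        unfolding closed_cone_params_def using w(1) cp c by (auto simp: PiE_iff intro: less_imp_le)
      then show "c \<in> closed_cone G D S" unfolding closed_cone_def using cp by blast
    qed
    then show ?thesis using 2(1) by blast
  qed
qed

section \<open>Rescaling and the passage to simplices\<close>

lemma closed_cone_rescale:
  assumes S: "S \<in> \<Union>D" and c: "c \<in> closed_cone G D S" and t: "0 < t"
  shows "rescale t ` c \<in> closed_cone G D S"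
proof -
  obtain \<omega> where \<omega>: "\<omega> \<in> closed_cone_params G D S" "c = cone_point G S \<omega>" using c unfolding closed_cone_def by auto
  obtain T where T: "is_metric_gtree G T" "collapses_to G S \<omega> T" "cone_point G S \<omega> = isometry_class G T"
    using params_tree[OF S \<omega>(1)] .
  have gS: "is_gtree G S" using S D_mem(1) unfolding is_metric_gtree_def by auto
  let ?\<omega> = "\<lambda>c\<in>edge_orbits G S. t * \<omega> c"
  have \<omega>': "\<omega> \<in> edge_orbits G S \<rightarrow>\<^sub>E {0..}" "\<exists>c\<in>edge_orbits G S. \<omega> c \<noteq> 0" using \<omega>(1) unfolding closed_cone_params_def by auto
  have nn: "0 \<le> ?\<omega> c" if "c \<in> edge_orbits G S" for c using \<omega>'(1) that t by (auto simp: PiE_iff)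
  have "cone_point G S ?\<omega> = isometry_class G (rescale t T)"
    by (rule cone_point_eq[OF gS nn metric_rescale[OF T(1) t] collapses_to_rescale[OF t T(2)]])
  then have cp: "cone_point G S ?\<omega> = rescale t ` c" unfolding \<omega>(2) T(3) class_rescale[OF T(1) t] .
  have "c \<in> D" using c closed_cone_subset[of G D S] by auto
  then have "?\<omega> \<in> closed_cone_params G D S"
    unfolding closed_cone_params_def using \<omega>' nn t cp D_rescale by (auto simp: PiE_iff)
  then show ?thesis unfolding closed_cone_def using cp by (metis image_eqI)
qed

text \<open>Rescaling by \<open>t\<close> multiplies all distances by \<open>t\<close>, so it
  carries a neighborhood with tolerance \<open>\<epsilon>\<close> to one with tolerance
  \<open>t * \<epsilon>\<close>, for the same \<open>X\<close> and \<open>A\<close>.\<close>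

lemma gromov_saturation:
  assumes V: "openin (gromov_topology G D) V"
  shows "openin (gromov_topology G D) {rescale t ` c | t c. 0 < t \<and> c \<in> V}"
proof -
  let ?W = "{rescale t ` c | t c. 0 < t \<and> c \<in> V}"
  have go: "gromov_open G D V" using V unfolding openin_gromov_topology .
  have VD: "V \<subseteq> D" using go unfolding gromov_open_def by (rule conjunct1)
  have "gromov_open G D ?W"
    unfolding gromov_open_def
  proof (intro conjI ballI)
    show "?W \<subseteq> D" using VD D_rescale by blast
    fix T' assume "T' \<in> \<Union>?W"
    then obtain t c T where t: "0 < t" "c \<in> V" "T \<in> c" "T' = rescale t T" by auto
    have mT: "is_metric_gtree G T" using D_mem(1) t VD by blast
    have "T \<in> \<Union>V" using t by blast
    from gromov_openD[OF go this] obtain X A \<epsilon> where X: "finite X" "X \<subseteq> points T" "finite A" "A \<subseteq> carrier G" "0 < \<epsilon>"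
      and nhd: "{c \<in> D. c \<inter> gromov_nhd G T X A \<epsilon> \<noteq> {}} \<subseteq> V"
      by (elim exE conjE)
    have "{c \<in> D. c \<inter> gromov_nhd G T' X A (t * \<epsilon>) \<noteq> {}} \<subseteq> ?W"
    proof
      fix c' assume "c' \<in> {c \<in> D. c \<inter> gromov_nhd G T' X A (t * \<epsilon>) \<noteq> {}}"
      then obtain T2 where c': "c' \<in> D" "T2 \<in> c'" "T2 \<in> gromov_nhd G T' X A (t * \<epsilon>)" by auto
      have m2: "is_metric_gtree G T2" using D_mem(1) c' by blast
      have t': "0 < 1 / t" using t by simp
      obtain f where f: "f ` X \<subseteq> points T2" "\<forall>x\<in>X. \<forall>y\<in>X. \<forall>g\<in>A.
          \<bar>point_dist T' x (point_act G T' g y) - point_dist T2 (f x) (point_act G T2 g (f y))\<bar> < t * \<epsilon>"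
        using c'(3) unfolding gromov_nhd_def by auto
      have "rescale (1 / t) T2 \<in> gromov_nhd G T X A \<epsilon>"
        unfolding gromov_nhd_def
      proof (intro CollectI exI[of _ f] conjI ballI)
        show "f ` X \<subseteq> points (rescale (1 / t) T2)" using f(1) by simp
        fix x y g assume xyg: "x \<in> X" "y \<in> X" "g \<in> A"
        have P: "x \<in> points T" "point_act G T g y \<in> points T" "f x \<in> points T2" "point_act G T2 g (f y) \<in> points T2"
          by (rule subsetD[OF X(2) xyg(1)], rule point_act_points[OF mT subsetD[OF X(2) xyg(2)] subsetD[OF X(4) xyg(3)]],
              rule subsetD[OF f(1) imageI[OF xyg(1)]],
              rule point_act_points[OF m2 subsetD[OF f(1) imageI[OF xyg(2)]] subsetD[OF X(4) xyg(3)]])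
        have 1: "point_dist T' x (point_act G T' g y) = t * point_dist T x (point_act G T g y)"
          unfolding t(4) using point_dist_rescale[OF mT t(1) P(1,2)] by simp
        have 2: "point_dist (rescale (1 / t) T2) (f x) (point_act G (rescale (1 / t) T2) g (f y)) =
            (1 / t) * point_dist T2 (f x) (point_act G T2 g (f y))"
          using point_dist_rescale[OF m2 t' P(3,4)] by simp
        let ?a = "point_dist T x (point_act G T g y)" and ?b = "point_dist T2 (f x) (point_act G T2 g (f y))"
        have "\<bar>t * ?a - ?b\<bar> < t * \<epsilon>" using f(2)[rule_format, OF xyg] unfolding 1 .
        moreover have "t * ?a - ?b = t * (?a - (1 / t) * ?b)" using t(1) by (simp add: field_simps)
        ultimately have "t * \<bar>?a - (1 / t) * ?b\<bar> < t * \<epsilon>" using t(1) by (simp add: abs_mult)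
        then show "\<bar>?a - point_dist (rescale (1 / t) T2) (f x) (point_act G (rescale (1 / t) T2) g (f y))\<bar> < \<epsilon>"
          unfolding 2 using t(1) by simp
      qed
      moreover have "rescale (1 / t) ` c' \<in> D" by (rule D_rescale[OF c'(1) t'])
      ultimately have "rescale (1 / t) ` c' \<in> V" using nhd c'(2) by blast
      moreover have "c' = rescale t ` rescale (1 / t) ` c'" using t(1) by (simp add: image_image)
      ultimately show "c' \<in> ?W" using t(1) by blast
    qed
    then show "\<exists>X A \<epsilon>. finite X \<and> X \<subseteq> points T' \<and> finite A \<and> A \<subseteq> carrier G \<and> 0 < \<epsilon> \<and>
        {c \<in> D. c \<inter> gromov_nhd G T' X A \<epsilon> \<noteq> {}} \<subseteq> ?W"
      using X t(1,4) by (intro exI[of _ X] exI[of _ A] exI[of _ "t * \<epsilon>"]) simp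
  qed
  then show ?thesis unfolding openin_gromov_topology .
qed

lemma cones_covered:
  assumes C: "finite \<C>" "\<C> \<subseteq> cones G D"
  shows "\<exists>F. finite F \<and> F \<subseteq> \<Union>D \<and> \<Union>\<C> \<inter> D \<subseteq> (\<Union>S\<in>F. closed_cone G D S)"
proof -
  define s where "s C = (SOME S. S \<in> \<Union>D \<and> C \<inter> D \<subseteq> closed_cone G D S)" for C
  have s: "s C \<in> \<Union>D \<and> C \<inter> D \<subseteq> closed_cone G D (s C)" if "C \<in> \<C>" for C
    unfolding s_def by (rule someI_ex) (rule cone_in_closed_cone[OF subsetD[OF C(2) that], unfolded Bex_def])
  show ?thesis
  proof (intro exI[of _ "s ` \<C>"] conjI subsetI)
    show "finite (s ` \<C>)" using C(1) by simp
    show "S \<in> \<Union>D" if "S \<in> s ` \<C>" for S using that s by (elim imageE) simp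
    show "c \<in> (\<Union>S\<in>s ` \<C>. closed_cone G D S)" if c: "c \<in> \<Union>\<C> \<inter> D" for c
    proof -
      obtain C where "C \<in> \<C>" "c \<in> C" "c \<in> D" using c by auto
      then show ?thesis using s[of C] by (intro UN_I[of "s C"]) (simp, rule subsetD[of "C \<inter> D"], simp_all)
    qed
  qed
qed

lemma cones_topology:
  assumes C: "finite \<C>" "\<C> \<subseteq> cones G D"
  shows "subtopology (gromov_topology G D) (\<Union>\<C>) = subtopology (weak_topology G D) (\<Union>\<C>)"
proof -
  obtain F where F: "finite F" "F \<subseteq> \<Union>D" "\<Union>\<C> \<inter> D \<subseteq> (\<Union>S\<in>F. closed_cone G D S)" using cones_covered[OF C] by auto
  have "openin (subtopology (gromov_topology G D) (\<Union>\<C>)) Z \<longleftrightarrow> openin (subtopology (weak_topology G D) (\<Union>\<C>)) Z" for Z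
  proof
    assume "openin (subtopology (gromov_topology G D) (\<Union>\<C>)) Z"
    then obtain U where "openin (gromov_topology G D) U" "Z = U \<inter> \<Union>\<C>" unfolding openin_subtopology by auto
    then show "openin (subtopology (weak_topology G D) (\<Union>\<C>)) Z"
      unfolding openin_subtopology using gromov_open_is_weakly_open by blast
  next
    assume "openin (subtopology (weak_topology G D) (\<Union>\<C>)) Z"
    then obtain U where U: "openin (weak_topology G D) U" "Z = U \<inter> \<Union>\<C>" unfolding openin_subtopology by auto
    then obtain V where "openin (gromov_topology G D) V" "V \<inter> \<Union>\<C> = U \<inter> \<Union>\<C>" using agree_on_cones[OF F U(1)] by auto
    then show "openin (subtopology (gromov_topology G D) (\<Union>\<C>)) Z" unfolding openin_subtopology using U(2) by blast
  qed
  then show ?thesis unfolding topology_eq by simp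
qed

lemma simplices_topology:
  assumes \<S>: "finite \<S>" "\<S> \<subseteq> simplices G D"
  shows "subtopology (projective_gromov_topology G D) (\<Union>\<S>) = subtopology (projective_weak_topology G D) (\<Union>\<S>)"
proof -
  obtain \<C> where \<C>: "\<C> \<subseteq> cones G D" "finite \<C>" "\<S> = (`) projection ` \<C>"
    using finite_subset_image[OF \<S>(1) \<S>(2)[unfolded simplices_def]] by (elim exE conjE)
  obtain F where F: "finite F" "F \<subseteq> \<Union>D" "\<Union>\<C> \<inter> D \<subseteq> (\<Union>S\<in>F. closed_cone G D S)" using cones_covered[OF \<C>(2,1)] by auto
  \<comment> \<open>The full preimage of the simplices. It is covered by the same closed cones,
    because these are stable under rescaling, so \<open>agree_on_cones\<close> applies to
    it.\<close>
  define Y where "Y = {c \<in> D. projection c \<in> \<Union>\<S>}"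
  have YF: "Y \<inter> D \<subseteq> (\<Union>S\<in>F. closed_cone G D S)"
  proof
    fix c assume "c \<in> Y \<inter> D"
    then have c: "c \<in> D" "projection c \<in> \<Union>\<S>" unfolding Y_def by auto
    then obtain c' where c': "c' \<in> \<Union>\<C>" "projection c = projection c'" unfolding \<C>(3) by auto
    then obtain t where t: "0 < t" "c = rescale t ` c'" using projection_eqD by blast
    have "c' = rescale (1 / t) ` c" unfolding t(2) using t(1) by (simp add: image_image)
    then have "c' \<in> D" using D_rescale[OF c(1), of "1 / t"] t(1) by simp
    then obtain S where S: "S \<in> F" "c' \<in> closed_cone G D S" using F(3) c'(1) by blast
    then have "c \<in> closed_cone G D S" unfolding t(2) using closed_cone_rescale[OF _ S(2) t(1)] F(2) by blast
    then show "c \<in> (\<Union>S\<in>F. closed_cone G D S)" using S(1) by blast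
  qed
  have "openin (subtopology (projective_gromov_topology G D) (\<Union>\<S>)) Z \<longleftrightarrow>
      openin (subtopology (projective_weak_topology G D) (\<Union>\<S>)) Z" for Z
  proof
    assume "openin (subtopology (projective_gromov_topology G D) (\<Union>\<S>)) Z"
    then obtain U where "openin (projective_gromov_topology G D) U" "Z = U \<inter> \<Union>\<S>" unfolding openin_subtopology by auto
    moreover from this have "openin (projective_weak_topology G D) U"
      unfolding projective_gromov_topology_def projective_weak_topology_def openin_quotient_topology topspace_gromov topspace_weak
      using gromov_open_is_weakly_open by blast
    ultimately show "openin (subtopology (projective_weak_topology G D) (\<Union>\<S>)) Z" unfolding openin_subtopology by blast
  next
    assume "openin (subtopology (projective_weak_topology G D) (\<Union>\<S>)) Z"
    then obtain U where U: "openin (projective_weak_topology G D) U" "Z = U \<inter> \<Union>\<S>" unfolding openin_subtopology by auto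
    define U' where "U' = {c \<in> D. projection c \<in> U}"
    have U': "U \<subseteq> projection ` D" "openin (weak_topology G D) U'"
      using U(1) unfolding projective_weak_topology_def openin_quotient_topology topspace_weak U'_def by auto
    obtain V where V: "openin (gromov_topology G D) V" "V \<inter> Y = U' \<inter> Y" using agree_on_cones[OF F(1,2) YF U'(2)] by auto
    \<comment> \<open>\<open>V\<close> need not be saturated, and then it is not the preimage of a
      set in the quotient. Its saturation is still Gromov open, and on \<open>Y\<close> it agrees
      with \<open>U'\<close> because \<open>U'\<close> and \<open>Y\<close> are saturated.\<close>
    define W where "W = {rescale t ` c | t c. 0 < t \<and> c \<in> V}"
    have oW: "openin (gromov_topology G D) W" unfolding W_def by (rule gromov_saturation[OF V(1)])
    have VD: "V \<subseteq> D" "W \<subseteq> D" using openin_subset[OF V(1)] openin_subset[OF oW] unfolding topspace_gromov by auto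
    have VW: "V \<subseteq> W" unfolding W_def using rescale_image(2) by (metis (mono_tags, lifting) mem_Collect_eq subsetI zero_less_one)
    have sat: "c \<in> W" if c: "c \<in> D" "projection c \<in> projection ` W" for c
    proof -
      obtain c' where c': "c' \<in> W" "projection c = projection c'" using c by auto
      then obtain t where t: "0 < t" "c = rescale t ` c'" using projection_eqD by blast
      obtain s d where s: "0 < s" "d \<in> V" "c' = rescale s ` d" using c'(1) unfolding W_def by auto
      have "c = rescale (t * s) ` d" unfolding t(2) s(3) by (simp add: image_image)
      then show ?thesis unfolding W_def using t(1) s by (intro CollectI exI[of _ "t * s"] exI[of _ d]) simp
    qed
    have "{c \<in> D. projection c \<in> projection ` W} = W" using sat VD(2) by blast
    then have oP: "openin (projective_gromov_topology G D) (projection ` W)"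
      unfolding projective_gromov_topology_def openin_quotient_topology topspace_gromov using oW VD(2) by auto
    have "projection ` W \<inter> \<Union>\<S> = Z"
      unfolding U(2)
    proof (intro equalityI subsetI)
      fix z assume z: "z \<in> projection ` W \<inter> \<Union>\<S>"
      then obtain t d where td: "0 < t" "d \<in> V" "z = projection (rescale t ` d)" unfolding W_def by auto
      have zd: "z = projection d" using projection_rescale[OF td(1)] td(3) by simp
      then have "d \<in> Y" unfolding Y_def using VD(1) td(2) z by auto
      then have "d \<in> U'" using V(2) td(2) by blast
      then show "z \<in> U \<inter> \<Union>\<S>" unfolding U'_def using zd z by simp
    next
      fix z assume z: "z \<in> U \<inter> \<Union>\<S>"
      then obtain c where c: "c \<in> D" "z = projection c" using U'(1) by auto
      then have "c \<in> U' \<inter> Y" unfolding U'_def Y_def using z by simp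
      then have "c \<in> W" using V(2) VW by blast
      then show "z \<in> projection ` W \<inter> \<Union>\<S>" using c z by blast
    qed
    then show "openin (subtopology (projective_gromov_topology G D) (\<Union>\<S>)) Z"
      unfolding openin_subtopology using oP by blast
  qed
  then show ?thesis unfolding topology_eq by simp
qed

end

theorem proposition5p2:
  fixes G :: "('g, 'b) monoid_scheme"
    and T\<^sub>0 :: "('g, 'v) metric_gtree"
    and D :: "('g, 'v) metric_gtree set set"
  assumes "finitely_generated_group G"
    and "is_metric_gtree G T\<^sub>0"
    and "D = deformation_space G T\<^sub>0 \<or>
      (\<exists>\<A>. subgroup_family G \<A> \<and> D = restricted_deformation_space G T\<^sub>0 \<A>)"
    and "irreducible_space G D \<or> genuine_abelian_space G D"
  shows "(\<forall>\<C>. finite \<C> \<and> \<C> \<subseteq> cones G D \<longrightarrow>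
            subtopology (gromov_topology G D) (\<Union>\<C>) = subtopology (weak_topology G D) (\<Union>\<C>)) \<and>
         (\<forall>\<S>. finite \<S> \<and> \<S> \<subseteq> simplices G D \<longrightarrow>
            subtopology (projective_gromov_topology G D) (\<Union>\<S>) =
            subtopology (projective_weak_topology G D) (\<Union>\<S>))"
proof -
  interpret def_space G T\<^sub>0 D
    by unfold_locales (rule assms(1), rule assms(3), rule assms(4))
  show ?thesis
    by (intro conjI allI impI) (erule conjE, rule cones_topology simplices_topology, assumption+)+
qed

end
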